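(* There is a cubical $4$-polytope $P_{72}$ with $f$-vector $f(P_{72})=(72,196,186,62)$, one of whose dual manifolds is an immersed Klein bottle with $f$-vector $(80,160,80)$.
   Context: A polytope is cubical if each of its proper $k$-faces is combinatorially equivalent to the $k$-dimensional cube. The derivative complex of the boundary complex of a cubical $4$-polytope is the abstract cubical $2$-dimensional complex whose vertices are the midpoints of the edges of the polytope and whose facets correspond to pairs $(F,[e])$, where $F$ is a facet ($3$-cube) and $[e]$ is one of the three parallel classes of edges of $F$ (the facet being the square in $F$ through the four midpoints of the edges in $[e]$). Its connected components are the dual manifolds; each is a closed surface coming with a canonical normal crossing immersion into the boundary of the polytope. *)

theory Defs
  imports "HOL-Analysis.Analysis"
begin

section \<open>Cubical polytopes\<close>

definition combinatorially_equivalent ::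
    "'a::real_vector set \<Rightarrow> 'b::real_vector set \<Rightarrow> bool" where
  "combinatorially_equivalent P Q \<longleftrightarrow>
     (\<exists>\<phi>. bij_betw \<phi> {F. F face_of P} {G. G face_of Q} \<and>
          (\<forall>F F'. F face_of P \<longrightarrow> F' face_of P \<longrightarrow> (F \<subseteq> F' \<longleftrightarrow> \<phi> F \<subseteq> \<phi> F')))"

text \<open>
  For \<open>B\<close> a set of \<open>k\<close> basis vectors, \<open>cbox 0 (\<Sum>B)\<close> is the unit \<open>k\<close>-cube in the coordinate
  subspace spanned by \<open>B\<close>.
\<close>

definition combinatorial_cube :: "nat \<Rightarrow> 'a::euclidean_space set \<Rightarrow> bool" where
  "combinatorial_cube k F \<longleftrightarrow>
     (\<exists>B::'a set. B \<subseteq> Basis \<and> card B = k \<and> combinatorially_equivalent F (cbox 0 (\<Sum>B)))"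

definition cubical_polytope :: "'a::euclidean_space set \<Rightarrow> bool" where
  "cubical_polytope P \<longleftrightarrow>
     polytope P \<and>
     (\<forall>F k. F face_of P \<longrightarrow> F \<noteq> P \<longrightarrow> aff_dim F = int k \<longrightarrow> combinatorial_cube k F)"

definition polytope_f_vector :: "'a::euclidean_space set \<Rightarrow> nat list" where
  "polytope_f_vector P =
     map (\<lambda>k. card {F. F face_of P \<and> aff_dim F = int k}) [0..<nat (aff_dim P)]"


section \<open>The derivative complex and the dual manifolds\<close>

definition generated_equivalence :: "('a \<times> 'a) set \<Rightarrow> ('a \<times> 'a) set" where
  "generated_equivalence r = (r \<union> r\<inverse>)\<^sup>*"

text \<open>
  Two edges of a combinatorial cube are parallel iff they are connected by a chain of edges in
  which consecutive edges are opposite, i.e. disjoint, edges of a common 2-face.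
\<close>

definition opposite_edges :: "'a::euclidean_space set \<Rightarrow> ('a set \<times> 'a set) set" where
  "opposite_edges F =
     {(e, e'). \<exists>S. S face_of F \<and> aff_dim S = 2 \<and> e edge_of S \<and> e' edge_of S \<and> e \<inter> e' = {}}"

definition parallel_classes :: "'a::euclidean_space set \<Rightarrow> 'a set set set" where
  "parallel_classes F = {e. e edge_of F} // generated_equivalence (opposite_edges F)"

text \<open>
  The derivative complex is encoded by its nonempty cells, ordered by inclusion.  The pair
  \<open>(F, C)\<close> of a proper face \<open>F\<close> and a parallel class \<open>C\<close> of edges of \<open>F\<close> stands for the cell whose
  vertices are the midpoints of the edges in \<open>C\<close>.  For a cubical 4-polytope, \<open>(e, {e})\<close> with \<open>e\<close> an
  edge is thus the vertex at the midpoint of \<open>e\<close>; for \<open>S\<close> a 2-face, \<open>(S, C)\<close> is the 1-cell joining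
  the midpoints of two opposite edges of \<open>S\<close>; and for \<open>F\<close> a facet, \<open>(F, C)\<close> is the square spanned by
  the midpoints of the four edges in \<open>C\<close>.
\<close>

type_synonym 'a derivative_cell = "'a set \<times> 'a set set"

definition derivative_complex :: "'a::euclidean_space set \<Rightarrow> 'a derivative_cell set" where
  "derivative_complex P = {(F, C). F face_of P \<and> F \<noteq> P \<and> C \<in> parallel_classes F}"

definition cell_le :: "'a derivative_cell \<Rightarrow> 'a derivative_cell \<Rightarrow> bool" where
  "cell_le c d \<longleftrightarrow> fst c \<subseteq> fst d \<and> snd c \<subseteq> snd d"

definition cell_dim :: "'a::euclidean_space derivative_cell \<Rightarrow> int" where
  "cell_dim c = aff_dim (fst c) - 1"

definition dual_manifolds :: "'a::euclidean_space set \<Rightarrow> 'a derivative_cell set set" where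
  "dual_manifolds P =
     derivative_complex P //
       generated_equivalence
         {(c, d). c \<in> derivative_complex P \<and> d \<in> derivative_complex P \<and> cell_le c d}"

definition surface_f_vector :: "'a::euclidean_space derivative_cell set \<Rightarrow> nat list" where
  "surface_f_vector K = map (\<lambda>k. card {c \<in> K. cell_dim c = int k}) [0..<3]"


section \<open>Geometric realization and the canonical immersion\<close>

text \<open>
  The geometric realization of a finite complex with cell set \<open>K\<close>, via its barycentric subdivision:
  the vertices are the barycenters of the cells, the simplices are the chains of cells, and a point
  is given by its barycentric coordinates.  It carries the topology of pointwise convergence, which
  for finite \<open>K\<close> is the usual one.
\<close>

definition geometric_realization ::
    "'a derivative_cell set \<Rightarrow> ('a derivative_cell \<Rightarrow> real) topology" where
  "geometric_realization K =
     top_of_set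
       {t. (\<forall>c. 0 \<le> t c) \<and> {c. t c \<noteq> 0} \<subseteq> K \<and> finite {c. t c \<noteq> 0} \<and>
           (\<forall>c d. t c \<noteq> 0 \<longrightarrow> t d \<noteq> 0 \<longrightarrow> cell_le c d \<or> cell_le d c) \<and>
           (\<Sum>c | t c \<noteq> 0. t c) = 1}"

definition vertex_centroid :: "'a::euclidean_space set \<Rightarrow> 'a" where
  "vertex_centroid F =
     (\<Sum>v | v extreme_point_of F. v) /\<^sub>R real (card {v. v extreme_point_of F})"

text \<open>
  The canonical map into the boundary of the polytope is affine on the simplices of the barycentric
  subdivision and sends the barycenter of the cell \<open>(F, C)\<close> to the centroid of the vertices of \<open>F\<close>.
  In particular the vertex \<open>(e, {e})\<close> goes to the midpoint of \<open>e\<close>, and if \<open>F\<close> is a metric cube,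
  the cell \<open>(F, C)\<close> goes to the square through the midpoints of the edges in \<open>C\<close>.  (In a general
  combinatorial cube these four midpoints need not be coplanar.)
\<close>

definition canonical_map :: "('a::euclidean_space derivative_cell \<Rightarrow> real) \<Rightarrow> 'a" where
  "canonical_map t = (\<Sum>c | t c \<noteq> 0. t c *\<^sub>R vertex_centroid (fst c))"

definition topological_immersion ::
    "'a topology \<Rightarrow> 'b topology \<Rightarrow> ('a \<Rightarrow> 'b) \<Rightarrow> bool" where
  "topological_immersion X Y f \<longleftrightarrow>
     continuous_map X Y f \<and>
     (\<forall>x \<in> topspace X. \<exists>U. openin X U \<and> x \<in> U \<and> embedding_map (subtopology X U) Y f)"


section \<open>The Klein bottle\<close>

definition quotient_topology :: "'a topology \<Rightarrow> ('a \<times> 'a) set \<Rightarrow> 'a set topology" where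
  "quotient_topology X r =
     topology (\<lambda>U. U \<subseteq> topspace X // r \<and> openin X {x \<in> topspace X. r `` {x} \<in> U})"

lemma openin_quotient_topology:
  "openin (quotient_topology X r) U \<longleftrightarrow>
     U \<subseteq> topspace X // r \<and> openin X {x \<in> topspace X. r `` {x} \<in> U}"
proof -
  have "istopology (\<lambda>U. U \<subseteq> topspace X // r \<and> openin X {x \<in> topspace X. r `` {x} \<in> U})"
    unfolding istopology_def
  proof (intro conjI allI impI; (elim conjE)?)
    fix S T
    assume "openin X {x \<in> topspace X. r `` {x} \<in> S}" "openin X {x \<in> topspace X. r `` {x} \<in> T}"
    then have "openin X ({x \<in> topspace X. r `` {x} \<in> S} \<inter> {x \<in> topspace X. r `` {x} \<in> T})"
      by blast
    moreover have "{x \<in> topspace X. r `` {x} \<in> S} \<inter> {x \<in> topspace X. r `` {x} \<in> T} =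
        {x \<in> topspace X. r `` {x} \<in> S \<inter> T}" by blast
    ultimately show "openin X {x \<in> topspace X. r `` {x} \<in> S \<inter> T}" by simp
  next
    fix \<K>
    assume *: "\<forall>K\<in>\<K>. K \<subseteq> topspace X // r \<and> openin X {x \<in> topspace X. r `` {x} \<in> K}"
    have "{x \<in> topspace X. r `` {x} \<in> \<Union>\<K>} = (\<Union>K\<in>\<K>. {x \<in> topspace X. r `` {x} \<in> K})" by blast
    with * show "openin X {x \<in> topspace X. r `` {x} \<in> \<Union>\<K>}" by auto
  qed blast+
  then show ?thesis
    by (simp add: quotient_topology_def topology_inverse')
qed

definition klein_bottle :: "(real \<times> real) set topology" where
  "klein_bottle =
     quotient_topology (top_of_set ({0..1} \<times> {0..1}))
       (generated_equivalence
          ({((0, y), (1, y)) | y. 0 \<le> y \<and> y \<le> 1} \<union> {((x, 0), (1 - x, 1)) | x. 0 \<le> x \<and> x \<le> 1}))"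

definition immersed_klein_bottle ::
    "'a::euclidean_space set \<Rightarrow> 'a derivative_cell set \<Rightarrow> bool" where
  "immersed_klein_bottle P K \<longleftrightarrow>
     geometric_realization K homeomorphic_space klein_bottle \<and>
     topological_immersion (geometric_realization K) (top_of_set (rel_frontier P)) canonical_map"

end

(*
  The polytope is the connected sum of two cubical 4-polytopes along a facet, given by explicit
  rational coordinates.  It is certified by an abstract presentation: 72 points and 62 half-spaces
  such that the points on each bounding hyperplane are indexed by the subsets of a 3-element set of
  directions, and every such cube has a neighbouring facet across each of its six sides.  Walking
  across sides shows that the convex hull of the points is the intersection of the half-spaces, and
  that all proper faces are combinatorial cubes; the face lattice is then read off the tables.

  One dual manifold consists of 80 squares.  They are glued together one at a time, each along an
  arc of the boundary of the disc obtained so far (a shelling), which yields a disc whose boundary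
  word is b a b a^-1 for two closed edge paths a and b; hence the surface is a Klein bottle.

  The canonical map is an immersion for every finite subcomplex of the derivative complex: near a
  point, only the cells above its carrier matter, these are determined by their polytope faces, and
  barycentric subdivision of the boundary of a polytope is injective.
*)
theory Submission
  imports Defs "HOL-Library.Code_Binary_Nat" "HOL-Library.List_Lexorder"
begin

section \<open>Combinatorial cubes\<close>

text \<open>The two summands are congruent: the second is the image of the first under (x, y, v, z)
  -> (-x, y, v, -z), and they share the cube [-1, 1]^3 in z = 0, which vanishes inside the sum. Its
  centre, the origin, lies strictly inside all half-spaces, so points can be compared with the
  boundary along rays. No hull is computed: the certificate is local, one facet and its six
  neighbours at a time, and a pair of antipodal facets rules out unbounded directions. For the
  topology, the obstacle is that a partly glued surface has repeated boundary vertices and so is not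
  a disc as a subspace. A disc is therefore only a map of the closed unit disc, injective on the
  open disc, with a known boundary path; all boundary identifications wait for the last step, when
  the four sides of a square are compared. Interiors are described by sets of cells, so that
  injectivity of all gluings reduces to the distinctness of one list. The numerical facts are
  integer statements about tables, settled by evaluation.\<close>

definition flip :: "'k \<Rightarrow> 'k set \<Rightarrow> 'k set" where
  "flip k S = (if k \<in> S then S - {k} else insert k S)"

text \<open>A face of a cube is an interval in the subset lattice of the directions: those in
  \<open>A\<close> are fixed at their upper value, those outside \<open>B\<close> at their lower
  value, those in \<open>B - A\<close> are free.\<close>

definition cube_face :: "('k set \<Rightarrow> 'a::real_vector) \<Rightarrow> 'k set \<Rightarrow> 'k set \<Rightarrow> 'a set" where
  "cube_face v A B = convex hull (v ` {S. A \<subseteq> S \<and> S \<subseteq> B})"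

text \<open>Opposite sides need not be parallel, so each direction has two unrelated functionals,
  one tight exactly on the lower side and one exactly on the upper side. The dimension bound makes
  the cube simple: at each vertex as many functionals are tight as there are dimensions.\<close>

locale simple_cube =
  fixes K :: "'k set" and v :: "'k set \<Rightarrow> 'a::euclidean_space"
    and lo up :: "'k \<Rightarrow> 'a" and lob upb :: "'k \<Rightarrow> real"
  assumes finite_K: "finite K"
    and lo_eq: "\<And>S k. S \<subseteq> K \<Longrightarrow> k \<in> K \<Longrightarrow> k \<notin> S \<Longrightarrow> lo k \<bullet> v S = lob k"
    and lo_less: "\<And>S k. S \<subseteq> K \<Longrightarrow> k \<in> S \<Longrightarrow> lo k \<bullet> v S < lob k"
    and up_eq: "\<And>S k. S \<subseteq> K \<Longrightarrow> k \<in> S \<Longrightarrow> up k \<bullet> v S = upb k"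
    and up_less: "\<And>S k. S \<subseteq> K \<Longrightarrow> k \<in> K \<Longrightarrow> k \<notin> S \<Longrightarrow> up k \<bullet> v S < upb k"
    and aff_dim_le: "aff_dim (v ` Pow K) \<le> int (card K)"
begin

text \<open>Of the two functionals of direction \<open>k\<close>, the one that is tight at the
  vertex \<open>S\<close>; \<open>tb\<close> is its bound.\<close>

definition tn :: "'k \<Rightarrow> 'k set \<Rightarrow> 'a" where "tn k S = (if k \<in> S then up k else lo k)"
definition tb :: "'k \<Rightarrow> 'k set \<Rightarrow> real" where "tb k S = (if k \<in> S then upb k else lob k)"
definition edge_dir :: "'k set \<Rightarrow> 'k \<Rightarrow> 'a" where "edge_dir S k = v (flip k S) - v S"

lemma flip_subset: "S \<subseteq> K \<Longrightarrow> k \<in> K \<Longrightarrow> flip k S \<subseteq> K"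
  by (auto simp: flip_def)

lemma tn_eq: "S \<subseteq> K \<Longrightarrow> T \<subseteq> K \<Longrightarrow> k \<in> K \<Longrightarrow> k \<in> S \<longleftrightarrow> k \<in> T \<Longrightarrow> tn k S \<bullet> v T = tb k S"
  by (auto simp: tn_def tb_def lo_eq up_eq)

lemma tn_less: "S \<subseteq> K \<Longrightarrow> T \<subseteq> K \<Longrightarrow> k \<in> K \<Longrightarrow> k \<in> S \<longleftrightarrow> k \<notin> T \<Longrightarrow> tn k S \<bullet> v T < tb k S"
  by (auto simp: tn_def tb_def lo_less up_less)

lemma tn_le: "S \<subseteq> K \<Longrightarrow> T \<subseteq> K \<Longrightarrow> k \<in> K \<Longrightarrow> tn k S \<bullet> v T \<le> tb k S"
  using tn_eq tn_less by (metis less_eq_real_def)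

text \<open>An edge in another direction stays on the same side of direction \<open>k\<close>.
  Together with the next lemma this makes the tight functionals and the edge vectors at
  \<open>S\<close> dual to each other up to negative factors.\<close>

lemma tn_edge_dir_other:
  assumes "S \<subseteq> K" "k \<in> K" "m \<in> K" "m \<noteq> k" shows "tn k S \<bullet> edge_dir S m = 0"
  using tn_eq[OF assms(1) assms(1) assms(2)] tn_eq[OF assms(1) flip_subset[OF assms(1,3)] assms(2)] assms(4)
  by (auto simp: edge_dir_def flip_def inner_diff_right)

lemma tn_edge_dir_same:
  assumes "S \<subseteq> K" "k \<in> K" shows "tn k S \<bullet> edge_dir S k < 0"
  using tn_eq[OF assms(1) assms(1) assms(2)] tn_less[OF assms(1) flip_subset[OF assms(1,2)] assms(2)]
  by (auto simp: edge_dir_def flip_def inner_diff_right)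

lemma tn_sum_edge_dir:
  assumes "S \<subseteq> K" "k \<in> K"
  shows "tn k S \<bullet> (\<Sum>m\<in>K. t m *\<^sub>R edge_dir S m) = t k * (tn k S \<bullet> edge_dir S k)"
proof -
  have "tn k S \<bullet> (\<Sum>m\<in>K. t m *\<^sub>R edge_dir S m) = (\<Sum>m\<in>K. t m * (tn k S \<bullet> edge_dir S m))"
    by (simp add: inner_sum_right)
  also have "\<dots> = (\<Sum>m\<in>K. if m = k then t k * (tn k S \<bullet> edge_dir S k) else 0)"
    using assms by (intro sum.cong) (auto simp: tn_edge_dir_other)
  finally show ?thesis using assms finite_K by simp
qed

lemma inj_on_edge_dir:
  assumes "S \<subseteq> K" shows "inj_on (edge_dir S) K"
proof (rule inj_onI, rule ccontr)
  fix k m assume "k \<in> K" "m \<in> K" "edge_dir S k = edge_dir S m" "k \<noteq> m"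
  then show False
    using tn_edge_dir_other[OF assms, of k m] tn_edge_dir_same[OF assms, of k] by simp
qed

lemma independent_edge_dir:
  assumes S: "S \<subseteq> K" shows "independent (edge_dir S ` K)"
proof (rule independent_if_scalars_zero)
  show "finite (edge_dir S ` K)" using finite_K by simp
next
  fix f x assume *: "(\<Sum>x\<in>edge_dir S ` K. f x *\<^sub>R x) = 0" and x: "x \<in> edge_dir S ` K"
  then obtain k where k: "k \<in> K" "x = edge_dir S k" by auto
  have "(\<Sum>m\<in>K. f (edge_dir S m) *\<^sub>R edge_dir S m) = 0"
    using * by (subst (asm) sum.reindex[OF inj_on_edge_dir[OF S]]) simp
  then have "f (edge_dir S k) * (tn k S \<bullet> edge_dir S k) = 0"
    using tn_sum_edge_dir[OF S k(1), of "\<lambda>m. f (edge_dir S m)"] by simp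
  then show "f x = 0" using tn_edge_dir_same[OF S k(1)] k by auto
qed

text \<open>The edge vectors at \<open>S\<close> are independent and as many as the dimension bound
  allows, so they span. The coordinates \<open>t\<close> thus exist at every vertex, and the
  functionals tight at \<open>S\<close> read them off with reversed sign.\<close>

lemma tangent_decomposition:
  assumes S: "S \<subseteq> K" and y: "y \<in> affine hull (v ` Pow K)"
  obtains t where "y = v S + (\<Sum>k\<in>K. t k *\<^sub>R edge_dir S k)"
proof -
  let ?W = "span ((\<lambda>x. - v S + x) ` v ` Pow K)"
  have vS: "v S \<in> v ` Pow K" using S by auto
  have hull: "affine hull (v ` Pow K) = (\<lambda>x. v S + x) ` ?W"
    by (rule affine_hull_span_gen[OF hull_inc[OF vS]])
  have dimW: "int (dim ?W) = aff_dim (v ` Pow K)"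
    using aff_dim_eq_dim[OF hull_inc[OF vS]] by simp
  have sub: "edge_dir S ` K \<subseteq> ?W"
  proof
    fix x assume "x \<in> edge_dir S ` K"
    then obtain k where "k \<in> K" "x = - v S + v (flip k S)" by (auto simp: edge_dir_def)
    then show "x \<in> ?W" using flip_subset[OF S] by (intro span_base) auto
  qed
  have "dim ?W \<le> card (edge_dir S ` K)"
    using dimW aff_dim_le card_image[OF inj_on_edge_dir[OF S]] by simp
  then have "?W \<subseteq> span (edge_dir S ` K)"
    by (rule card_ge_dim_independent[OF sub independent_edge_dir[OF S]])
  moreover obtain w where w: "w \<in> ?W" "y = v S + w" using y hull by auto
  ultimately have "w \<in> span (edge_dir S ` K)" by auto
  then obtain u where "w = (\<Sum>x\<in>edge_dir S ` K. u x *\<^sub>R x)"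
    using finite_K by (auto simp: span_finite)
  then have "w = (\<Sum>k\<in>K. u (edge_dir S k) *\<^sub>R edge_dir S k)"
    by (subst (asm) sum.reindex[OF inj_on_edge_dir[OF S]]) simp
  then show thesis by (intro that[of "\<lambda>k. u (edge_dir S k)"]) (simp only: w(2))
qed

text \<open>A point outside the hull is separated by some \<open>a\<close>. At a vertex
  \<open>S\<close> minimising \<open>a\<close>, all edge vectors weakly increase \<open>a\<close>,
  and the inequalities tight at \<open>S\<close> make the coordinates of the point at
  \<open>S\<close> nonnegative; so \<open>a\<close> cannot be smaller at the point than at
  \<open>S\<close>.\<close>

lemma hull_eq:
  "convex hull (v ` Pow K) =
    {y \<in> affine hull (v ` Pow K). \<forall>k\<in>K. lo k \<bullet> y \<le> lob k \<and> up k \<bullet> y \<le> upb k}" (is "_ = ?Y")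
proof
  have "convex ?Y"
  proof -
    have "?Y = affine hull (v ` Pow K) \<inter> (\<Inter>k\<in>K. {y. lo k \<bullet> y \<le> lob k} \<inter> {y. up k \<bullet> y \<le> upb k})"
      by auto
    then show ?thesis
      by (simp only:) (intro convex_Int convex_INT convex_halfspace_le affine_imp_convex affine_affine_hull)
  qed
  moreover have "v ` Pow K \<subseteq> ?Y"
    using tn_le[of "{}"] tn_le[of K] by (auto simp: hull_inc tn_def tb_def)
  ultimately show "convex hull (v ` Pow K) \<subseteq> ?Y" by (simp add: hull_minimal)
next
  show "?Y \<subseteq> convex hull (v ` Pow K)"
  proof
    fix y assume y: "y \<in> ?Y"
    show "y \<in> convex hull (v ` Pow K)"
    proof (rule ccontr)
      assume "y \<notin> convex hull (v ` Pow K)"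
      moreover have "compact (convex hull (v ` Pow K))"
        using finite_K by (simp add: finite_imp_compact_convex_hull)
      ultimately obtain a b where ab: "a \<bullet> y < b" "\<forall>x\<in>convex hull (v ` Pow K). b < a \<bullet> x"
        using separating_hyperplane_closed_point[of "convex hull (v ` Pow K)" y]
        by (auto simp: compact_imp_closed)
      have "finite ((\<lambda>S. a \<bullet> v S) ` Pow K)" "(\<lambda>S. a \<bullet> v S) ` Pow K \<noteq> {}" using finite_K by auto
      from Min_in[OF this] obtain S where S: "S \<subseteq> K" "a \<bullet> v S = Min ((\<lambda>S. a \<bullet> v S) ` Pow K)" by auto
      have min: "a \<bullet> v S \<le> a \<bullet> v T" if "T \<subseteq> K" for T
        using S that finite_K by auto
      obtain t where t: "y = v S + (\<Sum>k\<in>K. t k *\<^sub>R edge_dir S k)"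
        using tangent_decomposition[OF S(1)] y by blast
      have "0 \<le> t k" if k: "k \<in> K" for k
      proof -
        have "tn k S \<bullet> y \<le> tb k S" using y k by (auto simp: tn_def tb_def)
        then have "t k * (tn k S \<bullet> edge_dir S k) \<le> 0"
          using tn_eq[OF S(1) S(1) k] tn_sum_edge_dir[OF S(1) k] by (simp add: t inner_add_right)
        then show ?thesis using tn_edge_dir_same[OF S(1) k]
          by (simp add: mult_le_0_iff)
      qed
      moreover have "0 \<le> a \<bullet> edge_dir S k" if "k \<in> K" for k
        using min[OF flip_subset[OF S(1) that]] by (simp add: edge_dir_def inner_diff_right)
      ultimately have "a \<bullet> v S \<le> a \<bullet> y"
        by (auto simp: t inner_add_right inner_sum_right intro!: sum_nonneg)
      moreover have "v S \<in> convex hull (v ` Pow K)" using S by (auto intro: hull_inc)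
      ultimately show False using ab by force
    qed
  qed
qed

lemma hull_eq_cube_face: "convex hull (v ` Pow K) = cube_face v {} K"
  by (simp add: cube_face_def Pow_def)

lemma up_eq_cube_face:
  assumes "B \<subseteq> K" "k \<in> A" "y \<in> cube_face v A B" shows "up k \<bullet> y = upb k"
proof -
  have "cube_face v A B \<subseteq> {y. up k \<bullet> y = upb k}"
    unfolding cube_face_def using assms
    by (intro hull_minimal) (auto simp: convex_hyperplane up_eq)
  then show ?thesis using assms by auto
qed

lemma lo_eq_cube_face:
  assumes "B \<subseteq> K" "k \<in> K" "k \<notin> B" "y \<in> cube_face v A B" shows "lo k \<bullet> y = lob k"
proof -
  have "cube_face v A B \<subseteq> {y. lo k \<bullet> y = lob k}"
    unfolding cube_face_def using assms
    by (intro hull_minimal) (auto simp: convex_hyperplane intro!: lo_eq)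
  then show ?thesis using assms by auto
qed

lemma vertex_in_cube_face_iff:
  assumes "B \<subseteq> K" "T \<subseteq> K" shows "v T \<in> cube_face v A B \<longleftrightarrow> A \<subseteq> T \<and> T \<subseteq> B"
proof
  assume *: "v T \<in> cube_face v A B"
  show "A \<subseteq> T \<and> T \<subseteq> B"
  proof (intro conjI subsetI; rule ccontr)
    fix k assume k: "k \<in> A" "k \<notin> T"
    have "cube_face v A B \<noteq> {}" using * by auto
    then have "A \<subseteq> B" by (auto simp: cube_face_def)
    then show False
      using up_eq_cube_face[OF assms(1) k(1) *] up_less[OF assms(2) _ k(2)] k assms by auto
  next
    fix k assume k: "k \<in> T" "k \<notin> B"
    then show False
      using lo_eq_cube_face[OF assms(1) _ k(2) *] lo_less[OF assms(2) k(1)] assms by auto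
  qed
qed (auto simp: cube_face_def intro: hull_inc)

lemma cube_face_subset_iff:
  assumes "A \<subseteq> B" "B \<subseteq> K" "B' \<subseteq> K"
  shows "cube_face v A B \<subseteq> cube_face v A' B' \<longleftrightarrow> A' \<subseteq> A \<and> B \<subseteq> B'"
proof
  assume "cube_face v A B \<subseteq> cube_face v A' B'"
  moreover have "v A \<in> cube_face v A B" "v B \<in> cube_face v A B"
    using assms by (auto simp: cube_face_def intro: hull_inc)
  ultimately show "A' \<subseteq> A \<and> B \<subseteq> B'"
    using vertex_in_cube_face_iff[OF assms(3), of A A'] vertex_in_cube_face_iff[OF assms(3), of B A'] assms
    by auto
qed (auto simp: cube_face_def intro!: hull_mono image_mono)

lemma cube_face_eq_iff:
  assumes "A \<subseteq> B" "B \<subseteq> K" "A' \<subseteq> B'" "B' \<subseteq> K"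
  shows "cube_face v A B = cube_face v A' B' \<longleftrightarrow> A = A' \<and> B = B'"
  using cube_face_subset_iff[of A B B' A'] cube_face_subset_iff[of A' B' B A] assms by auto

lemma face_of_hull_vertices:
  assumes "F face_of convex hull (v ` Pow K)"
  shows "F = convex hull (v ` {T. T \<subseteq> K \<and> v T \<in> F})"
proof
  have "compact (v ` Pow K)" using finite_K by (simp add: finite_imp_compact)
  then obtain S' where S': "S' \<subseteq> v ` Pow K" "F = convex hull S'"
    by (rule face_of_convex_hull_subset[OF _ assms])
  have "S' \<subseteq> F" unfolding S'(2) by (rule hull_subset)
  have "S' \<subseteq> v ` {T. T \<subseteq> K \<and> v T \<in> F}"
  proof
    fix x assume x: "x \<in> S'"
    then obtain T where "T \<subseteq> K" "x = v T" using S'(1) by auto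
    then show "x \<in> v ` {T. T \<subseteq> K \<and> v T \<in> F}" using x \<open>S' \<subseteq> F\<close> by auto
  qed
  then show "F \<subseteq> convex hull (v ` {T. T \<subseteq> K \<and> v T \<in> F})"
    unfolding S'(2) by (rule hull_mono)
  show "convex hull (v ` {T. T \<subseteq> K \<and> v T \<in> F}) \<subseteq> F"
    using face_of_imp_convex[OF assms] by (intro hull_minimal) auto
qed

text \<open>The sum of the functionals of all fixed sides supports the cube, and it reaches its
  bound only where every summand does.\<close>

lemma cube_face_face_of:
  assumes "A \<subseteq> B" "B \<subseteq> K"
  shows "cube_face v A B face_of convex hull (v ` Pow K)"
proof -
  define c where "c = (\<Sum>k\<in>A. up k) + (\<Sum>k\<in>K-B. lo k)"
  define d where "d = (\<Sum>k\<in>A. upb k) + (\<Sum>k\<in>K-B. lob k)"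
  have fin: "finite A" using assms finite_K by (meson finite_subset)
  have c: "c \<bullet> y = (\<Sum>k\<in>A. up k \<bullet> y) + (\<Sum>k\<in>K-B. lo k \<bullet> y)" for y
    by (simp add: c_def inner_add_left inner_sum_left)
  have AK: "A \<subseteq> K" using assms by auto
  have "c \<bullet> y \<le> d" if "y \<in> convex hull (v ` Pow K)" for y
    unfolding c d_def using that AK unfolding hull_eq by (auto intro!: add_mono sum_mono)
  then have face: "(convex hull (v ` Pow K) \<inter> {x. c \<bullet> x = d}) face_of convex hull (v ` Pow K)"
    by (intro face_of_Int_supporting_hyperplane_le) auto
  have mem: "v T \<in> convex hull (v ` Pow K) \<inter> {x. c \<bullet> x = d} \<longleftrightarrow> A \<subseteq> T \<and> T \<subseteq> B" if T: "T \<subseteq> K" for T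
  proof
    assume *: "A \<subseteq> T \<and> T \<subseteq> B"
    then have "c \<bullet> v T = d" unfolding c d_def using T 
      using AK by (intro arg_cong2[of _ _ _ _ "(+)"] sum.cong) (auto intro!: up_eq lo_eq)
    then show "v T \<in> convex hull (v ` Pow K) \<inter> {x. c \<bullet> x = d}" using T by (auto intro: hull_inc)
  next
    assume "v T \<in> convex hull (v ` Pow K) \<inter> {x. c \<bullet> x = d}"
    then have "(\<Sum>k\<in>A. upb k - up k \<bullet> v T) + (\<Sum>k\<in>K-B. lob k - lo k \<bullet> v T) = 0"
      by (auto simp: c d_def sum_subtractf)
    moreover have "0 \<le> upb k - up k \<bullet> v T" "0 \<le> lob k - lo k \<bullet> v T" if "k \<in> K" for k
      using that T tn_le[of K T] tn_le[of "{}" T] by (auto simp: tn_def tb_def)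
    ultimately have "(\<Sum>k\<in>A. upb k - up k \<bullet> v T) = 0" "(\<Sum>k\<in>K-B. lob k - lo k \<bullet> v T) = 0"
      using AK by (smt (verit) sum_nonneg subsetD DiffD1)+
    then have "\<forall>k\<in>A. upb k - up k \<bullet> v T = 0" "\<forall>k\<in>K-B. lob k - lo k \<bullet> v T = 0"
      using AK fin finite_K \<open>\<And>k. k \<in> K \<Longrightarrow> 0 \<le> upb k - up k \<bullet> v T\<close> \<open>\<And>k. k \<in> K \<Longrightarrow> 0 \<le> lob k - lo k \<bullet> v T\<close>
      by (subst (asm) sum_nonneg_eq_0_iff; auto)+
    then have "\<not> up k \<bullet> v T < upb k" if "k \<in> A" for k using that by fastforce
    moreover have "\<not> lo k \<bullet> v T < lob k" if "k \<in> K - B" for k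
      using that \<open>\<forall>k\<in>K-B. lob k - lo k \<bullet> v T = 0\<close> by fastforce
    ultimately show "A \<subseteq> T \<and> T \<subseteq> B"
      using up_less[OF T] lo_less[OF T] T AK by blast
  qed
  have "{T. T \<subseteq> K \<and> v T \<in> convex hull (v ` Pow K) \<inter> {x. c \<bullet> x = d}} = {T. A \<subseteq> T \<and> T \<subseteq> B}"
  proof (intro Collect_cong)
    fix T show "(T \<subseteq> K \<and> v T \<in> convex hull (v ` Pow K) \<inter> {x. c \<bullet> x = d}) = (A \<subseteq> T \<and> T \<subseteq> B)"
      using mem[of T] assms(2) by (cases "T \<subseteq> K") auto
  qed
  then have "convex hull (v ` Pow K) \<inter> {x. c \<bullet> x = d} = cube_face v A B"
    using face_of_hull_vertices[OF face] by (simp add: cube_face_def)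
  with face show ?thesis by simp
qed

text \<open>A functional exposing the face is weakly decreasing along every edge at a vertex
  \<open>S\<close> of it. The coordinates of another vertex at \<open>S\<close> are nonnegative and
  vanish just where the two agree, so that vertex is on the face iff it agrees with \<open>S\<close>
  on \<open>K0\<close>, the strictly decreasing directions. This describes an interval.\<close>

lemma face_of_cubeE:
  assumes F: "F face_of convex hull (v ` Pow K)" "F \<noteq> {}"
  obtains A B where "A \<subseteq> B" "B \<subseteq> K" "F = cube_face v A B"
proof -
  let ?P = "convex hull (v ` Pow K)"
  have "polyhedron ?P"
    using finite_K by (intro polytope_imp_polyhedron polytope_convex_hull) auto
  then have "F exposed_face_of ?P" using F exposed_face_of_polyhedron by blast
  then obtain a b where ab: "?P \<subseteq> {x. a \<bullet> x \<le> b}" "F = ?P \<inter> {x. a \<bullet> x = b}"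
    by (auto simp: exposed_face_of_def)
  have inP: "v T \<in> ?P" if "T \<subseteq> K" for T using that by (auto intro: hull_inc)
  have "{T. T \<subseteq> K \<and> v T \<in> F} \<noteq> {}"
    using face_of_hull_vertices[OF F(1)] F(2) by (metis convex_hull_empty image_empty)
  then obtain S where S: "S \<subseteq> K" "v S \<in> F" by auto
  then have Sb: "a \<bullet> v S = b" using ab by auto
  define K0 where "K0 = {k\<in>K. a \<bullet> edge_dir S k < 0}"
  have dir: "a \<bullet> edge_dir S k \<le> 0" if "k \<in> K" for k
    using inP[OF flip_subset[OF S(1) that]] ab Sb by (auto simp: edge_dir_def inner_diff_right)
  have mem: "v T \<in> F \<longleftrightarrow> (\<forall>k\<in>K0. k \<in> T \<longleftrightarrow> k \<in> S)" if T: "T \<subseteq> K" for T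
  proof -
    have "v T \<in> affine hull (v ` Pow K)" using T by (auto intro: hull_inc)
    then obtain t where t: "v T = v S + (\<Sum>k\<in>K. t k *\<^sub>R edge_dir S k)"
      using tangent_decomposition[OF S(1)] by blast
    have tk: "t k * (tn k S \<bullet> edge_dir S k) = tn k S \<bullet> v T - tb k S" if "k \<in> K" for k
      using tn_sum_edge_dir[OF S(1) that, of t] tn_eq[OF S(1) S(1) that] by (simp add: t inner_add_right)
    have t0: "t k = 0" if "k \<in> K" "k \<in> T \<longleftrightarrow> k \<in> S" for k
      using tk[OF that(1)] tn_eq[OF S(1) T that(1)] tn_edge_dir_same[OF S(1) that(1)] that(2) by auto
    have tpos: "0 < t k" if "k \<in> K" "\<not> (k \<in> T \<longleftrightarrow> k \<in> S)" for k
    proof -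
      have "t k * (tn k S \<bullet> edge_dir S k) < 0"
        using tk[OF that(1)] tn_less[OF S(1) T that(1)] that(2) by auto
      then show ?thesis using tn_edge_dir_same[OF S(1) that(1)] by (simp add: mult_less_0_iff)
    qed
    have tnn: "0 \<le> t k" if "k \<in> K" for k using t0[OF that] tpos[OF that] by fastforce
    have "v T \<in> F \<longleftrightarrow> (\<Sum>k\<in>K. t k * (a \<bullet> edge_dir S k)) = 0"
      using ab inP[OF T] Sb by (auto simp: t inner_add_right inner_sum_right)
    also have "\<dots> \<longleftrightarrow> (\<Sum>k\<in>K. t k * (- (a \<bullet> edge_dir S k))) = 0" by (simp add: sum_negf)
    also have "\<dots> \<longleftrightarrow> (\<forall>k\<in>K. t k * (- (a \<bullet> edge_dir S k)) = 0)"
      using finite_K dir tnn by (intro sum_nonneg_eq_0_iff) (auto simp: mult_nonneg_nonpos)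
    also have "\<dots> \<longleftrightarrow> (\<forall>k\<in>K0. t k = 0)" using dir unfolding K0_def by force
    also have "\<dots> \<longleftrightarrow> (\<forall>k\<in>K0. k \<in> T \<longleftrightarrow> k \<in> S)"
      using t0 tpos unfolding K0_def by fastforce
    finally show ?thesis .
  qed
  have "{T. T \<subseteq> K \<and> v T \<in> F} = {T. K0 \<inter> S \<subseteq> T \<and> T \<subseteq> K - (K0 - S)}"
    using mem S(1) unfolding K0_def by (auto; blast)
  then have "F = cube_face v (K0 \<inter> S) (K - (K0 - S))"
    using face_of_hull_vertices[OF F(1)] by (simp add: cube_face_def)
  moreover have "K0 \<inter> S \<subseteq> K - (K0 - S)" using S by auto
  ultimately show thesis using that by blast
qed

lemma face_of_cube_face_iff:
  assumes "A \<subseteq> B" "B \<subseteq> K"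
  shows "G face_of cube_face v A B \<longleftrightarrow>
    G = {} \<or> (\<exists>A' B'. A \<subseteq> A' \<and> A' \<subseteq> B' \<and> B' \<subseteq> B \<and> G = cube_face v A' B')" (is "?L \<longleftrightarrow> ?R")
proof
  assume L: ?L
  show ?R
  proof (cases "G = {}")
    case False
    have "G face_of convex hull (v ` Pow K)"
      using L cube_face_face_of[OF assms] face_of_trans by blast
    then obtain A' B' where G: "A' \<subseteq> B'" "B' \<subseteq> K" "G = cube_face v A' B'"
      using face_of_cubeE False by metis
    moreover have "G \<subseteq> cube_face v A B" using L face_of_imp_subset by blast
    ultimately have "A \<subseteq> A' \<and> B' \<subseteq> B" using cube_face_subset_iff[of A' B' B A] assms by auto
    with G show ?thesis by blast
  qed simp
next
  assume ?R
  then show ?L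
  proof (elim disjE exE conjE)
    fix A' B' assume *: "A \<subseteq> A'" "A' \<subseteq> B'" "B' \<subseteq> B" "G = cube_face v A' B'"
    then have "G face_of convex hull (v ` Pow K)" using cube_face_face_of[of A' B'] assms by auto
    moreover have "G \<subseteq> cube_face v A B" using * cube_face_subset_iff[of A' B' B A] assms by auto
    moreover have "cube_face v A B \<subseteq> convex hull (v ` Pow K)"
      using cube_face_face_of[OF assms] face_of_imp_subset by blast
    ultimately show ?L by (meson face_of_subset)
  qed simp
qed

text \<open>In the coordinates at the vertex \<open>A\<close>, the tight functionals of the fixed
  directions are constant on the face, so only the edge vectors of the free directions
  occur.\<close>

lemma aff_dim_cube_face:
  assumes "A \<subseteq> B" "B \<subseteq> K" shows "aff_dim (cube_face v A B) = int (card (B - A))"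
proof -
  have AK: "A \<subseteq> K" using assms by auto
  have vA: "v A \<in> cube_face v A B" using assms by (auto simp: cube_face_def intro: hull_inc)
  let ?W = "(+) (- v A) ` cube_face v A B"
  let ?D = "edge_dir A ` (B - A)"
  have sub: "?D \<subseteq> ?W"
  proof
    fix x assume "x \<in> ?D"
    then obtain k where k: "k \<in> B - A" "x = - v A + v (insert k A)" by (auto simp: edge_dir_def flip_def)
    then have "v (insert k A) \<in> cube_face v A B" using assms by (auto simp: cube_face_def intro: hull_inc)
    then show "x \<in> ?W" using k by auto
  qed
  have "?W \<subseteq> span ?D"
  proof
    fix x assume "x \<in> ?W"
    then obtain y where y: "y \<in> cube_face v A B" "x = y - v A" by auto
    have "y \<in> convex hull (v ` Pow K)"
      using y(1) cube_face_face_of[OF assms] face_of_imp_subset by blast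
    then have "y \<in> affine hull (v ` Pow K)" using convex_hull_subset_affine_hull by blast
    then obtain t where t: "y = v A + (\<Sum>k\<in>K. t k *\<^sub>R edge_dir A k)"
      using tangent_decomposition[OF AK] by blast
    have "t k = 0" if "k \<in> K - (B - A)" for k
    proof -
      have k: "k \<in> K" using that by auto
      have "tn k A \<bullet> y = tb k A"
        using up_eq_cube_face[OF assms(2) _ y(1)] lo_eq_cube_face[OF assms(2) _ _ y(1)] that
        by (auto simp: tn_def tb_def)
      then have "t k * (tn k A \<bullet> edge_dir A k) = 0"
        using tn_sum_edge_dir[OF AK k, of t] tn_eq[OF AK AK k] by (simp add: t inner_add_right)
      then show ?thesis using tn_edge_dir_same[OF AK k] by auto
    qed
    then have "x = (\<Sum>k\<in>B-A. t k *\<^sub>R edge_dir A k)"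
      unfolding y(2) t using finite_K assms by (simp, intro sum.mono_neutral_right) auto
    then show "x \<in> span ?D" by (simp only:) (intro span_sum span_scale span_base imageI)
  qed
  moreover have "independent ?D"
    using independent_edge_dir[OF AK] assms by (meson Diff_subset image_mono independent_mono subset_trans)
  ultimately have "dim ?W = card ?D"
    using sub by (metis basis_card_eq_dim dim_span)
  moreover have "card ?D = card (B - A)"
    using inj_on_edge_dir[OF AK] assms by (intro card_image) (auto intro: inj_on_subset)
  ultimately show ?thesis
    using aff_dim_eq_dim[OF hull_inc[OF vA]] by simp
qed

end

text \<open>Recovers the interval from the face as a point set, which makes the map of face lattices
  below well defined.\<close>

lemma (in simple_cube) cube_face_extremes:
  assumes "A \<subseteq> B" "B \<subseteq> K"
  shows "\<Inter> {T. T \<subseteq> K \<and> v T \<in> cube_face v A B} = A" "\<Union> {T. T \<subseteq> K \<and> v T \<in> cube_face v A B} = B"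
proof -
  have "{T. T \<subseteq> K \<and> v T \<in> cube_face v A B} = {T. A \<subseteq> T \<and> T \<subseteq> B}"
    using vertex_in_cube_face_iff[OF assms(2)] assms by auto
  then show "\<Inter> {T. T \<subseteq> K \<and> v T \<in> cube_face v A B} = A" "\<Union> {T. T \<subseteq> K \<and> v T \<in> cube_face v A B} = B"
    using assms(1) by (auto; blast)+
qed

text \<open>A bijection \<open>h\<close> of the free directions induces an order isomorphism
  \<open>g\<close> between the two intervals of subsets, and so a correspondence of their
  subintervals, which are the nonempty faces.\<close>

lemma cube_faces_combinatorially_equivalent:
  fixes v :: "'k set \<Rightarrow> 'a::euclidean_space" and v' :: "'l set \<Rightarrow> 'b::euclidean_space"
  assumes c: "simple_cube K v lo up lob upb" and c': "simple_cube K' v' lo' up' lob' upb'"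
    and AB: "A \<subseteq> B" "B \<subseteq> K" and AB': "A' \<subseteq> B'" "B' \<subseteq> K'" and card: "card (B - A) = card (B' - A')"
  shows "combinatorially_equivalent (cube_face v A B) (cube_face v' A' B')"
proof -
  interpret c: simple_cube K v lo up lob upb by (rule c)
  interpret c': simple_cube K' v' lo' up' lob' upb' by (rule c')
  have "finite (B - A)" "finite (B' - A')" using c.finite_K c'.finite_K AB AB' by (auto intro: finite_subset)
  then obtain h where h: "bij_betw h (B - A) (B' - A')" using card finite_same_card_bij by blast
  define g where "g X = A' \<union> h ` (X - A)" for X
  have g_mono: "g X \<subseteq> g Y \<longleftrightarrow> X \<subseteq> Y" if "A \<subseteq> X" "X \<subseteq> B" "A \<subseteq> Y" "Y \<subseteq> B" for X Y
  proof
    assume *: "g X \<subseteq> g Y"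
    show "X \<subseteq> Y"
    proof
      fix x assume x: "x \<in> X"
      show "x \<in> Y"
      proof (cases "x \<in> A")
        case False
        then have "h x \<in> B' - A'" using bij_betwE[OF h] x that by blast
        moreover have "h x \<in> g Y" using * x False by (auto simp: g_def)
        ultimately obtain y where "y \<in> Y - A" "h x = h y" by (auto simp: g_def)
        then show ?thesis using h x that False by (auto simp: bij_betw_def dest!: inj_onD)
      qed (use that in auto)
    qed
  qed (auto simp: g_def)
  have g_range: "A' \<subseteq> g X" "g X \<subseteq> B'" if "A \<subseteq> X" "X \<subseteq> B" for X
    using bij_betwE[OF h] that AB' by (auto simp: g_def)
  have g_surj: "\<exists>X. A \<subseteq> X \<and> X \<subseteq> B \<and> g X = Y" if "A' \<subseteq> Y" "Y \<subseteq> B'" for Y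
  proof (intro exI conjI)
    let ?X = "A \<union> {x \<in> B - A. h x \<in> Y}"
    show "A \<subseteq> ?X" "?X \<subseteq> B" using AB by auto
    have "h ` (?X - A) = Y - A'" using h that by (auto simp: bij_betw_def image_iff; blast)
    then show "g ?X = Y" using that by (auto simp: g_def)
  qed
  \<comment> \<open>The empty face belongs to no interval and is sent to itself.\<close>
  define \<phi> where "\<phi> F = (if F = {} then {} else cube_face v' (g (\<Inter> {T. T \<subseteq> K \<and> v T \<in> F})) (g (\<Union> {T. T \<subseteq> K \<and> v T \<in> F})))" for F
  have nonempty: "cube_face v X Y \<noteq> {}" "cube_face v' X' Y' \<noteq> {}" if "X \<subseteq> Y" "X' \<subseteq> Y'" for X Y X' Y'
    using that by (auto simp: cube_face_def)
  have \<phi>_face: "\<phi> (cube_face v X Y) = cube_face v' (g X) (g Y)" if "A \<subseteq> X" "X \<subseteq> Y" "Y \<subseteq> B" for X Y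
    using that AB nonempty(1)[OF that(2) subset_refl] by (simp add: \<phi>_def c.cube_face_extremes)
  have \<phi>_empty: "\<phi> {} = {}" by (simp add: \<phi>_def)
  let ?F = "{F. F face_of cube_face v A B}" and ?G = "{G. G face_of cube_face v' A' B'}"
  have faces: "?F = insert {} {cube_face v X Y | X Y. A \<subseteq> X \<and> X \<subseteq> Y \<and> Y \<subseteq> B}"
    using c.face_of_cube_face_iff[OF AB] by auto
  have faces': "?G = insert {} {cube_face v' X Y | X Y. A' \<subseteq> X \<and> X \<subseteq> Y \<and> Y \<subseteq> B'}"
    using c'.face_of_cube_face_iff[OF AB'] by auto
  have mono: "F \<subseteq> F' \<longleftrightarrow> \<phi> F \<subseteq> \<phi> F'" if F: "F \<in> ?F" "F' \<in> ?F" for F F'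
  proof (cases "F = {} \<or> F' = {}")
    case True
    then show ?thesis
      using F nonempty \<phi>_face g_mono unfolding faces by (auto simp: \<phi>_empty; fastforce)
  next
    case False
    then obtain X Y X' Y' where *: "F = cube_face v X Y" "A \<subseteq> X" "X \<subseteq> Y" "Y \<subseteq> B"
      "F' = cube_face v X' Y'" "A \<subseteq> X'" "X' \<subseteq> Y'" "Y' \<subseteq> B"
      using F unfolding faces by auto
    have "F \<subseteq> F' \<longleftrightarrow> X' \<subseteq> X \<and> Y \<subseteq> Y'" using * AB by (simp add: c.cube_face_subset_iff)
    also have "\<dots> \<longleftrightarrow> g X' \<subseteq> g X \<and> g Y \<subseteq> g Y'" using * g_mono[of X' X] g_mono[of Y Y'] by auto
    also have "\<dots> \<longleftrightarrow> \<phi> F \<subseteq> \<phi> F'"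
    proof -
      have "A \<subseteq> Y" "A \<subseteq> Y'" "X \<subseteq> B" using * by auto
      then have "g X \<subseteq> g Y" "g Y \<subseteq> K'" "g Y' \<subseteq> K'"
        using * AB' g_mono[of X Y] g_range(2)[of Y] g_range(2)[of Y'] by blast+
      then show ?thesis using * by (simp add: \<phi>_face c'.cube_face_subset_iff)
    qed
    finally show ?thesis .
  qed
  have inj: "inj_on \<phi> ?F"
    by (rule inj_onI) (metis mono subset_antisym subset_refl)
  have "\<phi> ` ?F = ?G"
  proof
    show "\<phi> ` ?F \<subseteq> ?G"
    proof (rule image_subsetI)
      fix F assume "F \<in> ?F"
      then consider "F = {}" | X Y where "A \<subseteq> X" "X \<subseteq> Y" "Y \<subseteq> B" "F = cube_face v X Y"
        unfolding faces by auto
      then show "\<phi> F \<in> ?G"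
      proof cases
        case 2
        then have "\<phi> F = cube_face v' (g X) (g Y)" "A' \<subseteq> g X" "g X \<subseteq> g Y" "g Y \<subseteq> B'"
          using \<phi>_face g_range g_mono[of X Y] by auto
        then show ?thesis unfolding faces' by blast
      qed (simp add: \<phi>_empty)
    qed
    show "?G \<subseteq> \<phi> ` ?F"
    proof
      fix G assume "G \<in> ?G"
      then consider "G = {}" | X' Y' where "A' \<subseteq> X'" "X' \<subseteq> Y'" "Y' \<subseteq> B'" "G = cube_face v' X' Y'"
        unfolding faces' by auto
      then show "G \<in> \<phi> ` ?F"
      proof cases
        case 1 then show ?thesis unfolding faces by (simp add: \<phi>_empty)
      next
        case 2
        obtain X Y where XY: "A \<subseteq> X" "X \<subseteq> B" "g X = X'" "A \<subseteq> Y" "Y \<subseteq> B" "g Y = Y'"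
          using g_surj[of X'] g_surj[of Y'] subset_trans[OF 2(1,2)] subset_trans[OF 2(2,3)] 2(1,3) by auto
        then have "X \<subseteq> Y" using g_mono[of X Y] 2 by auto
        then have "G = \<phi> (cube_face v X Y)" using XY 2 \<phi>_face by simp
        moreover have "cube_face v X Y \<in> ?F" unfolding faces using XY \<open>X \<subseteq> Y\<close> by blast
        ultimately show ?thesis by blast
      qed
    qed
  qed
  with inj mono show ?thesis
    unfolding combinatorially_equivalent_def by (intro exI[of _ \<phi>]) (auto simp: bij_betw_def)
qed

lemma simple_cube_unit:
  fixes B :: "'a::euclidean_space set"
  assumes B: "B \<subseteq> Basis"
  shows "simple_cube B (\<lambda>S. \<Sum>S) uminus (\<lambda>b. b) (\<lambda>_. 0) (\<lambda>_. 1)"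
proof
  show fin: "finite B" using B finite_Basis finite_subset by blast
  have *: "b \<bullet> \<Sum>S = (if b \<in> S then 1 else 0)" if "S \<subseteq> B" "b \<in> B" for b S
  proof -
    have "b \<bullet> \<Sum>S = (\<Sum>i\<in>S. if i = b then 1 else 0)"
      unfolding inner_sum_right using that B by (intro sum.cong refl) (auto simp: inner_Basis subset_iff)
    then show ?thesis using that fin by (auto simp: finite_subset)
  qed
  show "- k \<bullet> \<Sum>S = 0" if "S \<subseteq> B" "k \<in> B" "k \<notin> S" for k S using *[of S k] that by auto
  show "- k \<bullet> \<Sum>S < 0" if "S \<subseteq> B" "k \<in> S" for k S using *[of S k] that by auto
  show "k \<bullet> \<Sum>S = 1" if "S \<subseteq> B" "k \<in> S" for k S using *[of S k] that by auto
  show "k \<bullet> \<Sum>S < 1" if "S \<subseteq> B" "k \<in> B" "k \<notin> S" for k S using *[of S k] that by auto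
  have "(\<lambda>S. \<Sum>S) ` Pow B \<subseteq> span B" by (intro image_subsetI span_sum span_base) auto
  then have "aff_dim ((\<lambda>S. \<Sum>S) ` Pow B) \<le> aff_dim (span B)" by (rule aff_dim_subset)
  also have "\<dots> = int (dim B)" by (simp add: aff_dim_subspace)
  also have "\<dots> \<le> int (card B)" using fin by (simp add: dim_le_card')
  finally show "aff_dim ((\<lambda>S. \<Sum>S) ` Pow B) \<le> int (card B)" .
qed

text \<open>Links the reference cube in the definition of a combinatorial cube to the interval
  description. The affine hull of the vertex sums is \<open>span B\<close>, which amounts to the
  vanishing of all other coordinates.\<close>

lemma unit_cube_eq_cube_face:
  fixes B :: "'a::euclidean_space set"
  assumes B: "B \<subseteq> Basis"
  shows "cbox 0 (\<Sum>B) = cube_face (\<lambda>S. \<Sum>S) {} B"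
proof -
  interpret simple_cube B "\<lambda>S. \<Sum>S" uminus "\<lambda>b. b" "\<lambda>_. 0" "\<lambda>_. 1" by (rule simple_cube_unit[OF B])
  have 0: "0 \<in> (\<lambda>S. \<Sum>S) ` Pow B" by (rule image_eqI[of _ _ "{}"]) auto
  have "B \<subseteq> (\<lambda>S. \<Sum>S) ` Pow B"
  proof
    fix b assume "b \<in> B" then show "b \<in> (\<lambda>S. \<Sum>S) ` Pow B" by (intro image_eqI[of _ _ "{b}"]) auto
  qed
  then have "span B \<subseteq> span ((\<lambda>S. \<Sum>S) ` Pow B)" by (rule span_mono)
  moreover have "span ((\<lambda>S. \<Sum>S) ` Pow B) \<subseteq> span B"
    by (intro span_minimal subspace_span image_subsetI span_sum span_base) auto
  ultimately have hull: "affine hull ((\<lambda>S. \<Sum>S) ` Pow B) = span B"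
    using affine_hull_span_0[OF hull_inc[OF 0]] by auto
  have coord: "(\<Sum>B) \<bullet> i = (if i \<in> B then 1 else 0)" if "i \<in> Basis" for i
  proof -
    have "(\<Sum>B) \<bullet> i = (\<Sum>b\<in>B. if b = i then 1 else 0)"
      unfolding inner_sum_left using that B by (intro sum.cong) (auto simp: inner_Basis)
    then show ?thesis using finite_K by auto
  qed
  have "y \<in> span B" if "\<And>i. i \<in> Basis \<Longrightarrow> i \<notin> B \<Longrightarrow> y \<bullet> i = 0" for y
  proof -
    have "y = (\<Sum>i\<in>Basis. (y \<bullet> i) *\<^sub>R i)" by (simp add: euclidean_representation)
    also have "\<dots> = (\<Sum>i\<in>B. (y \<bullet> i) *\<^sub>R i)" using that B by (intro sum.mono_neutral_right) auto
    finally show ?thesis by (rule ssubst) (intro span_sum span_scale span_base)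
  qed
  moreover have "y \<bullet> i = 0" if "y \<in> span B" "i \<in> Basis" "i \<notin> B" for y i
  proof -
    have "span B \<subseteq> {y. y \<bullet> i = 0}"
      using B that by (intro span_minimal) (auto simp: inner_Basis subspace_hyperplane2)
    then show ?thesis using that by auto
  qed
  ultimately have span_iff: "y \<in> span B \<longleftrightarrow> (\<forall>i\<in>Basis - B. y \<bullet> i = 0)" for y by blast
  have "y \<in> cbox 0 (\<Sum>B) \<longleftrightarrow> y \<in> span B \<and> (\<forall>k\<in>B. - k \<bullet> y \<le> 0 \<and> k \<bullet> y \<le> 1)" for y
  proof -
    have "y \<in> cbox 0 (\<Sum>B) \<longleftrightarrow> (\<forall>i\<in>Basis. 0 \<le> y \<bullet> i \<and> y \<bullet> i \<le> (if i \<in> B then 1 else 0))"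
      unfolding mem_box using coord by (intro ball_cong) auto
    also have "\<dots> \<longleftrightarrow> (\<forall>i\<in>Basis - B. y \<bullet> i = 0) \<and> (\<forall>i\<in>B. 0 \<le> y \<bullet> i \<and> y \<bullet> i \<le> 1)"
    proof -
      have "(\<forall>i\<in>Basis. Q i) \<longleftrightarrow> (\<forall>i\<in>Basis - B. Q i) \<and> (\<forall>i\<in>B. Q i)" for Q using B by blast
      moreover have "(\<forall>i\<in>Basis - B. 0 \<le> y \<bullet> i \<and> y \<bullet> i \<le> (if i \<in> B then 1 else 0)) \<longleftrightarrow> (\<forall>i\<in>Basis - B. y \<bullet> i = 0)"
        by (intro ball_cong) auto
      ultimately show ?thesis by simp
    qed
    finally show ?thesis unfolding span_iff by (simp add: inner_commute)
  qed
  then have "cbox 0 (\<Sum>B) = {y \<in> span B. \<forall>k\<in>B. - k \<bullet> y \<le> 0 \<and> k \<bullet> y \<le> 1}" by blast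
  also have "\<dots> = cube_face (\<lambda>S. \<Sum>S) {} B"
    unfolding hull_eq_cube_face[symmetric] hull_eq hull ..
  finally show ?thesis .
qed

section \<open>Cubical presentations of polytopes\<close>

text \<open>Every condition is a finite one on vertex numbers or single inequalities. That the
  half-spaces cut out the hull, and that the listed cubes are all the facets, are consequences; the
  neighbour conditions only ask which corners a second facet shares.\<close>

locale cubical_presentation =
  fixes K :: "'k set" and n m :: nat and pt :: "nat \<Rightarrow> 'a::euclidean_space"
    and normal :: "nat \<Rightarrow> 'a" and bnd :: "nat \<Rightarrow> real" and corner :: "nat \<Rightarrow> 'k set \<Rightarrow> nat"
  assumes finite_directions: "finite K" and dim: "DIM('a) = Suc (card K)"
    and corner_less: "\<And>i S. i < m \<Longrightarrow> S \<subseteq> K \<Longrightarrow> corner i S < n"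
    and normal_le: "\<And>i j. i < m \<Longrightarrow> j < n \<Longrightarrow> normal i \<bullet> pt j \<le> bnd i"
    and normal_eq_iff: "\<And>i j. i < m \<Longrightarrow> j < n \<Longrightarrow> normal i \<bullet> pt j = bnd i \<longleftrightarrow> j \<in> corner i ` Pow K"
    and bnd_pos: "\<And>i. i < m \<Longrightarrow> 0 < bnd i"
    and lower_neighbour: "\<And>i k. i < m \<Longrightarrow> k \<in> K \<Longrightarrow> \<exists>j<m. \<forall>S\<subseteq>K. corner i S \<in> corner j ` Pow K \<longleftrightarrow> k \<notin> S"
    and upper_neighbour: "\<And>i k. i < m \<Longrightarrow> k \<in> K \<Longrightarrow> \<exists>j<m. \<forall>S\<subseteq>K. corner i S \<in> corner j ` Pow K \<longleftrightarrow> k \<in> S"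
    and opposite_facets: "\<exists>i<m. \<exists>j<m. normal j = - normal i"
    and vertex_in_facet: "\<And>j. j < n \<Longrightarrow> \<exists>i<m. j \<in> corner i ` Pow K"
begin

definition P :: "'a set" where "P = convex hull (pt ` {..<n})"

definition face :: "nat \<Rightarrow> 'k set \<Rightarrow> 'k set \<Rightarrow> 'a set" where
  "face i A B = cube_face (\<lambda>S. pt (corner i S)) A B"

definition lower :: "nat \<Rightarrow> 'k \<Rightarrow> nat" where
  "lower i k = (SOME j. j < m \<and> (\<forall>S\<subseteq>K. corner i S \<in> corner j ` Pow K \<longleftrightarrow> k \<notin> S))"

definition upper :: "nat \<Rightarrow> 'k \<Rightarrow> nat" where
  "upper i k = (SOME j. j < m \<and> (\<forall>S\<subseteq>K. corner i S \<in> corner j ` Pow K \<longleftrightarrow> k \<in> S))"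

lemma lower: "lower i k < m" "S \<subseteq> K \<Longrightarrow> corner i S \<in> corner (lower i k) ` Pow K \<longleftrightarrow> k \<notin> S"
  if "i < m" "k \<in> K" for S
  using someI_ex[OF lower_neighbour[OF that]] unfolding lower_def by blast+

lemma upper: "upper i k < m" "S \<subseteq> K \<Longrightarrow> corner i S \<in> corner (upper i k) ` Pow K \<longleftrightarrow> k \<in> S"
  if "i < m" "k \<in> K" for S
  using someI_ex[OF upper_neighbour[OF that]] unfolding upper_def by blast+

lemma normal_nonzero: "i < m \<Longrightarrow> normal i \<noteq> 0"
  using normal_eq_iff[of i "corner i {}"] corner_less[of i "{}"] bnd_pos[of i] by auto

text \<open>The facets across the six sides supply the functionals: each shares exactly the corners
  of one side, so it is tight there and strict on the opposite side. The hyperplane of the facet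
  itself bounds the dimension.\<close>

lemma simple_cube_facet:
  assumes i: "i < m"
  shows "simple_cube K (\<lambda>S. pt (corner i S)) (\<lambda>k. normal (lower i k)) (\<lambda>k. normal (upper i k))
    (\<lambda>k. bnd (lower i k)) (\<lambda>k. bnd (upper i k))"
proof
  show "finite K" by (rule finite_directions)
  have lo: "normal (lower i k) \<bullet> pt (corner i S) \<le> bnd (lower i k)"
    "normal (lower i k) \<bullet> pt (corner i S) = bnd (lower i k) \<longleftrightarrow> k \<notin> S" if "S \<subseteq> K" "k \<in> K" for S k
    using normal_le normal_eq_iff corner_less[OF i that(1)] lower[OF i that(2)] that(1) by auto
  have up: "normal (upper i k) \<bullet> pt (corner i S) \<le> bnd (upper i k)"
    "normal (upper i k) \<bullet> pt (corner i S) = bnd (upper i k) \<longleftrightarrow> k \<in> S" if "S \<subseteq> K" "k \<in> K" for S k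
    using normal_le normal_eq_iff corner_less[OF i that(1)] upper[OF i that(2)] that(1) by auto
  show "normal (lower i k) \<bullet> pt (corner i S) = bnd (lower i k)" if "S \<subseteq> K" "k \<in> K" "k \<notin> S" for S k
    using lo that by auto
  show "normal (lower i k) \<bullet> pt (corner i S) < bnd (lower i k)" if "S \<subseteq> K" "k \<in> S" for S k
    using lo[of S k] that by (metis less_eq_real_def subsetD)
  show "normal (upper i k) \<bullet> pt (corner i S) = bnd (upper i k)" if "S \<subseteq> K" "k \<in> S" for S k
    using up[of S k] that by blast
  show "normal (upper i k) \<bullet> pt (corner i S) < bnd (upper i k)" if "S \<subseteq> K" "k \<in> K" "k \<notin> S" for S k
    using up[of S k] that by (metis less_eq_real_def)
  have "(\<lambda>S. pt (corner i S)) ` Pow K \<subseteq> {x. normal i \<bullet> x = bnd i}"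
    using normal_eq_iff[OF i] corner_less[OF i] by auto
  then have "aff_dim ((\<lambda>S. pt (corner i S)) ` Pow K) \<le> aff_dim {x. normal i \<bullet> x = bnd i}"
    by (rule aff_dim_subset)
  also have "\<dots> = int (card K)" using normal_nonzero[OF i] dim by (simp add: aff_dim_hyperplane)
  finally show "aff_dim ((\<lambda>S. pt (corner i S)) ` Pow K) \<le> int (card K)" .
qed

lemma polytope_P: "polytope P"
  unfolding P_def by (intro polytope_convex_hull) auto

lemma P_subset: "P \<subseteq> {x. \<forall>i<m. normal i \<bullet> x \<le> bnd i}"
proof -
  have *: "{x. \<forall>i<m. normal i \<bullet> x \<le> bnd i} = (\<Inter>i<m. {x. normal i \<bullet> x \<le> bnd i})" by auto
  have "convex {x. \<forall>i<m. normal i \<bullet> x \<le> bnd i}"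
    unfolding * by (intro convex_INT convex_halfspace_le)
  then show ?thesis unfolding P_def by (intro hull_minimal) (auto simp: normal_le)
qed

lemma face_whole: "face i {} K = convex hull (pt ` corner i ` Pow K)"
  by (simp add: face_def cube_face_def image_image Pow_def)

lemma face_subset_P:
  assumes "i < m" "B \<subseteq> K" shows "face i A B \<subseteq> P"
  unfolding face_def cube_face_def P_def using assms corner_less[OF assms(1)]
  by (intro hull_mono) auto

text \<open>The corners span the whole hyperplane, since both have dimension \<open>card K\<close>.
  Inside it the cube is described by the inequalities of its neighbours alone.\<close>

lemma facet_of_inequalities:
  assumes i: "i < m" and y: "normal i \<bullet> y = bnd i" "\<And>j. j < m \<Longrightarrow> normal j \<bullet> y \<le> bnd j"
  shows "y \<in> face i {} K"
proof -
  interpret simple_cube K "\<lambda>S. pt (corner i S)" "\<lambda>k. normal (lower i k)" "\<lambda>k. normal (upper i k)"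
    "\<lambda>k. bnd (lower i k)" "\<lambda>k. bnd (upper i k)" by (rule simple_cube_facet[OF i])
  let ?V = "(\<lambda>S. pt (corner i S)) ` Pow K"
  have "?V \<subseteq> {x. normal i \<bullet> x = bnd i}"
    using normal_eq_iff[OF i] corner_less[OF i] by auto
  then have sub: "affine hull ?V \<subseteq> {x. normal i \<bullet> x = bnd i}"
    by (intro hull_minimal affine_hyperplane)
  have "aff_dim (affine hull ?V) = int (card K)"
    using aff_dim_cube_face[of "{}" K] by (simp add: hull_eq_cube_face[symmetric] aff_dim_convex_hull)
  also have "\<dots> = aff_dim {x. normal i \<bullet> x = bnd i}"
    using normal_nonzero[OF i] dim by (simp add: aff_dim_hyperplane)
  finally have "affine hull ?V = {x. normal i \<bullet> x = bnd i}"
    by (intro affine_dim_equal[OF affine_affine_hull affine_hyperplane _ sub]) auto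
  then have "y \<in> convex hull ?V"
    unfolding hull_eq using y lower(1)[OF i] upper(1)[OF i] by auto
  then show ?thesis by (simp add: face_whole image_image)
qed

text \<open>Otherwise \<open>x\<close> is orthogonal to the normals of two antipodal facets, and a
  ray from a corner of one of them in direction \<open>x\<close> keeps all inequalities and stays in
  that facet, which is bounded.\<close>

lemma some_normal_pos:
  assumes "x \<noteq> 0" shows "\<exists>i<m. 0 < normal i \<bullet> x"
proof (rule ccontr)
  assume "\<not> ?thesis"
  then have neg: "normal i \<bullet> x \<le> 0" if "i < m" for i using that by force
  obtain i j where ij: "i < m" "j < m" "normal j = - normal i" using opposite_facets by auto
  then have 0: "normal i \<bullet> x = 0" using neg[of i] neg[of j] by auto
  let ?v = "pt (corner i {})"
  have v: "normal k \<bullet> ?v \<le> bnd k" "normal i \<bullet> ?v = bnd i" if "k < m" for k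
    using normal_le[OF that corner_less[OF ij(1)]] normal_eq_iff[OF ij(1) corner_less[OF ij(1)]] by auto
  have "?v + t *\<^sub>R x \<in> P" if "t \<ge> 0" for t
  proof -
    have "?v + t *\<^sub>R x \<in> face i {} K"
    proof (rule facet_of_inequalities[OF ij(1)])
      fix k assume k: "k < m"
      show "normal k \<bullet> (?v + t *\<^sub>R x) \<le> bnd k"
        using v(1)[OF k] mult_nonneg_nonpos[OF that neg[OF k]] by (simp add: inner_add_right)
    qed (simp add: inner_add_right 0 v(2)[OF ij(1)])
    then show ?thesis using face_subset_P[OF ij(1) subset_refl] by blast
  qed
  moreover obtain b where b: "\<And>y. y \<in> P \<Longrightarrow> norm y \<le> b"
    using polytope_imp_bounded[OF polytope_P] by (auto simp: bounded_iff)
  ultimately have le: "norm (?v + t *\<^sub>R x) \<le> b" if "t \<ge> 0" for t using that by blast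
  have "norm ?v \<le> b" using le[of 0] by simp
  then have "b \<ge> 0" using norm_ge_zero[of ?v] by linarith
  define t where "t = (2 * b + 1) / norm x"
  have t: "0 \<le> t" "norm (t *\<^sub>R x) = 2 * b + 1" using \<open>b \<ge> 0\<close> assms by (auto simp: t_def)
  have "norm (t *\<^sub>R x) \<le> norm (?v + t *\<^sub>R x) + norm ?v"
    by (metis add_diff_cancel_left' norm_triangle_ineq4)
  then show False using le[OF t(1)] t(2) \<open>norm ?v \<le> b\<close> by linarith
qed

text \<open>\<open>l\<close> is the largest ratio of a normal at \<open>x\<close> to its bound, the
  gauge of the intersection of the half-spaces. Dividing by it makes that inequality tight and keeps
  the others, which puts the point on a facet.\<close>

lemma radial_projection:
  assumes "x \<noteq> 0"
  obtains l where "0 < l" "(1 / l) *\<^sub>R x \<in> P" "\<exists>i<m. l = normal i \<bullet> x / bnd i"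
proof -
  let ?R = "(\<lambda>i. normal i \<bullet> x / bnd i) ` {..<m}"
  obtain i0 where i0: "i0 < m" "0 < normal i0 \<bullet> x" using some_normal_pos[OF assms] by auto
  then have ne: "finite ?R" "?R \<noteq> {}" by auto
  define l where "l = Max ?R"
  obtain i where i: "i < m" "l = normal i \<bullet> x / bnd i" using Max_in[OF ne] by (auto simp: l_def)
  have max: "normal j \<bullet> x / bnd j \<le> l" if "j < m" for j unfolding l_def using that by (intro Max_ge) auto
  have l: "0 < l" using max[OF i0(1)] divide_pos_pos[OF i0(2) bnd_pos[OF i0(1)]] by linarith
  have "(1 / l) *\<^sub>R x \<in> face i {} K"
  proof (rule facet_of_inequalities[OF i(1)])
    show "normal i \<bullet> (1 / l) *\<^sub>R x = bnd i"
    proof -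
      have "normal i \<bullet> x = l * bnd i" using i(2) bnd_pos[OF i(1)] by simp
      then show ?thesis using l by simp
    qed
    fix j assume j: "j < m"
    have "normal j \<bullet> x \<le> l * bnd j" using max[OF j] bnd_pos[OF j] by (simp add: pos_divide_le_eq)
    then show "normal j \<bullet> (1 / l) *\<^sub>R x \<le> bnd j" using l by (simp add: pos_divide_le_eq mult.commute)
  qed
  then show thesis using that[OF l] face_subset_P[OF i(1) subset_refl] i by blast
qed

text \<open>The radial projections of a vector and of its negative lie in \<open>P\<close> on
  opposite rays, and \<open>P\<close> is convex.\<close>

lemma zero_in_P: "0 \<in> P"
proof -
  obtain b :: 'a where b: "b \<in> Basis" using nonempty_Basis by blast
  then have "b \<noteq> 0" by auto
  from radial_projection[OF this] obtain l where l: "0 < l" "(1 / l) *\<^sub>R b \<in> P" by blast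
  from radial_projection[of "- b"] \<open>b \<noteq> 0\<close> obtain l' where l': "0 < l'" "(1 / l') *\<^sub>R (- b) \<in> P" by auto
  have "convex P" by (simp add: P_def)
  then have "(l / (l + l')) *\<^sub>R (1 / l) *\<^sub>R b + (l' / (l + l')) *\<^sub>R (1 / l') *\<^sub>R (- b) \<in> P"
    using l l' by (intro convexD) (auto simp: add_divide_distrib[symmetric])
  also have "(l / (l + l')) *\<^sub>R (1 / l) *\<^sub>R b + (l' / (l + l')) *\<^sub>R (1 / l') *\<^sub>R (- b) = 0"
    using l l' by simp
  finally show ?thesis .
qed

lemma P_eq: "P = {x. \<forall>i<m. normal i \<bullet> x \<le> bnd i}"
proof
  show "{x. \<forall>i<m. normal i \<bullet> x \<le> bnd i} \<subseteq> P"
  proof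
    fix x assume x: "x \<in> {x. \<forall>i<m. normal i \<bullet> x \<le> bnd i}"
    show "x \<in> P"
    proof (cases "x = 0")
      case False
      then obtain l i where l: "0 < l" "(1 / l) *\<^sub>R x \<in> P" "i < m" "l = normal i \<bullet> x / bnd i"
        using radial_projection by metis
      \<comment> \<open>The gauge of a point of the intersection is at most 1, so the point lies
        between 0 and its radial projection.\<close>
      then have "l \<le> 1" using x bnd_pos[OF l(3)] by simp
      have "convex P" by (simp add: P_def)
      then have "l *\<^sub>R (1 / l) *\<^sub>R x + (1 - l) *\<^sub>R 0 \<in> P"
        using l zero_in_P \<open>l \<le> 1\<close> by (intro convexD) auto
      moreover have "l *\<^sub>R (1 / l) *\<^sub>R x = x" using l(1) by simp
      ultimately show ?thesis by simp
    qed (simp add: zero_in_P)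
  qed
qed (rule P_subset)

lemma strict_subset_interior: "{x. \<forall>i<m. normal i \<bullet> x < bnd i} \<subseteq> interior P"
proof (rule interior_maximal)
  have "{x. \<forall>i<m. normal i \<bullet> x < bnd i} = (\<Inter>i<m. {x. normal i \<bullet> x < bnd i})" by auto
  then show "open {x. \<forall>i<m. normal i \<bullet> x < bnd i}" by (auto simp: open_halfspace_lt)
  show "{x. \<forall>i<m. normal i \<bullet> x < bnd i} \<subseteq> P" unfolding P_eq by (auto intro: less_imp_le)
qed

lemma aff_dim_P: "aff_dim P = int DIM('a)"
proof -
  have "0 \<in> interior P" using strict_subset_interior bnd_pos by auto
  then have "interior P \<noteq> {}" by auto
  then show ?thesis by (rule aff_dim_nonempty_interior)
qed

lemma facet_face_of: 
  assumes i: "i < m" shows "face i {} K face_of P"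
proof -
  have "P \<inter> {x. normal i \<bullet> x = bnd i} face_of P"
    using P_subset i by (intro face_of_Int_supporting_hyperplane_le) (auto simp: P_def)
  moreover have "P \<inter> {x. normal i \<bullet> x = bnd i} = face i {} K"
  proof
    show "P \<inter> {x. normal i \<bullet> x = bnd i} \<subseteq> face i {} K"
      using facet_of_inequalities[OF i] P_subset by blast
    have "face i {} K \<subseteq> {x. normal i \<bullet> x = bnd i}"
      unfolding face_whole using normal_eq_iff[OF i] corner_less[OF i]
      by (intro hull_minimal) (auto simp: convex_hyperplane)
    then show "face i {} K \<subseteq> P \<inter> {x. normal i \<bullet> x = bnd i}" using face_subset_P[OF i] by blast
  qed
  ultimately show ?thesis by simp
qed

lemma aff_dim_face:
  assumes "i < m" "A \<subseteq> B" "B \<subseteq> K" shows "aff_dim (face i A B) = int (card (B - A))"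
  unfolding face_def by (rule simple_cube.aff_dim_cube_face[OF simple_cube_facet]) (use assms in auto)

lemma face_of_face_iff:
  assumes "i < m" "A \<subseteq> B" "B \<subseteq> K"
  shows "G face_of face i A B \<longleftrightarrow>
    G = {} \<or> (\<exists>A' B'. A \<subseteq> A' \<and> A' \<subseteq> B' \<and> B' \<subseteq> B \<and> G = face i A' B')"
  unfolding face_def by (rule simple_cube.face_of_cube_face_iff[OF simple_cube_facet]) (use assms in auto)

lemma face_face_of_P:
  assumes "i < m" "A \<subseteq> B" "B \<subseteq> K" shows "face i A B face_of P" "face i A B \<noteq> P" "face i A B \<noteq> {}"
proof -
  have "face i A B face_of face i {} K" using face_of_face_iff[of i "{}" K] assms by blast
  then show "face i A B face_of P" using facet_face_of[OF assms(1)] face_of_trans by blast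
  have "card (B - A) \<le> card K" using assms finite_directions by (intro card_mono) auto
  then show "face i A B \<noteq> P" using aff_dim_face[OF assms] aff_dim_P dim by auto
  show "face i A B \<noteq> {}" using assms by (auto simp: face_def cube_face_def)
qed

text \<open>A proper face misses the interior, so a relative interior point of it makes some
  inequality tight and lies on that facet. The facet then contains the whole face, and the faces of
  a facet are already classified.\<close>

lemma proper_face_iff:
  "F face_of P \<and> F \<noteq> P \<and> F \<noteq> {} \<longleftrightarrow> (\<exists>i<m. \<exists>A B. A \<subseteq> B \<and> B \<subseteq> K \<and> F = face i A B)"
proof
  assume F: "F face_of P \<and> F \<noteq> P \<and> F \<noteq> {}"
  then have "convex F" using face_of_imp_convex by blast
  then obtain y where y: "y \<in> rel_interior F" using F by (metis all_not_in_conv rel_interior_eq_empty)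
  have "convex P" by (simp add: P_def)
  then have "F \<inter> interior P = {}" using F face_of_disjoint_interior by blast
  then have "y \<notin> interior P" using y rel_interior_subset by blast
  then obtain i where i: "i < m" "bnd i \<le> normal i \<bullet> y" using strict_subset_interior by force
  have yP: "y \<in> P" using y F rel_interior_subset face_of_imp_subset by blast
  then have "y \<in> face i {} K" using i P_subset by (intro facet_of_inequalities) force+
  then have sub: "F \<subseteq> face i {} K"
    using subset_of_face_of[OF facet_face_of[OF i(1)]] y F face_of_imp_subset by blast
  have "F face_of face i {} K"
    using F sub face_subset_P[OF i(1) subset_refl] face_of_subset by blast
  then show "\<exists>i<m. \<exists>A B. A \<subseteq> B \<and> B \<subseteq> K \<and> F = face i A B"
    using face_of_face_iff[OF i(1), of "{}" K F] i(1) F by (simp, blast)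
qed (auto simp: face_face_of_P)

theorem cubical_P: "cubical_polytope P"
  unfolding cubical_polytope_def
proof (intro conjI allI impI)
  fix F k assume F: "F face_of P" "F \<noteq> P" "aff_dim F = int k"
  then have "F \<noteq> {}" using aff_dim_empty[of F] by linarith
  then have "\<exists>i<m. \<exists>A B. A \<subseteq> B \<and> B \<subseteq> K \<and> F = face i A B" using F by (simp flip: proper_face_iff)
  then obtain i A B where iAB: "i < m" "A \<subseteq> B" "B \<subseteq> K" "F = face i A B" by blast
  then have k: "k = card (B - A)" using aff_dim_face F by simp
  also have "\<dots> \<le> card K" using iAB finite_directions by (intro card_mono) auto
  also have "\<dots> \<le> card (Basis :: 'a set)" using dim by simp
  finally obtain C where C: "C \<subseteq> (Basis :: 'a set)" "card C = k" "finite C"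
    using obtain_subset_with_card_n by blast
  have "combinatorially_equivalent F (cbox 0 (\<Sum>C))"
    unfolding iAB(4) face_def unit_cube_eq_cube_face[OF C(1)]
    by (rule cube_faces_combinatorially_equivalent[OF simple_cube_facet[OF iAB(1)] simple_cube_unit[OF C(1)]])
      (use iAB C k in auto)
  then show "combinatorial_cube k F" using C by (auto simp: combinatorial_cube_def)
qed (rule polytope_P)

end

section \<open>The derivative complex of a cubical presentation\<close>

context cubical_presentation
begin

definition par :: "nat \<Rightarrow> 'k set \<Rightarrow> 'k set \<Rightarrow> 'k \<Rightarrow> 'a set set" where
  "par i A B k = {face i X (insert k X) | X. A \<subseteq> X \<and> X \<subseteq> B - {k}}"

definition verts :: "'a set \<Rightarrow> nat set" where "verts F = {j. j < n \<and> pt j \<in> F}"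

definition vset :: "nat \<Rightarrow> 'k set \<Rightarrow> 'k set \<Rightarrow> nat set" where
  "vset i A B = corner i ` {S. A \<subseteq> S \<and> S \<subseteq> B}"

lemma vertex_in_face_iff:
  assumes "i < m" "B \<subseteq> K" "S \<subseteq> K" shows "pt (corner i S) \<in> face i A B \<longleftrightarrow> A \<subseteq> S \<and> S \<subseteq> B"
  unfolding face_def
  by (rule simple_cube.vertex_in_cube_face_iff[OF simple_cube_facet[OF assms(1)] assms(2,3)])

lemma face_subset_iff:
  assumes "i < m" "A \<subseteq> B" "B \<subseteq> K" "B' \<subseteq> K"
  shows "face i A B \<subseteq> face i A' B' \<longleftrightarrow> A' \<subseteq> A \<and> B \<subseteq> B'"
  unfolding face_def
  by (rule simple_cube.cube_face_subset_iff[OF simple_cube_facet[OF assms(1)] assms(2-4)])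

lemma face_eq_iff:
  assumes "i < m" "A \<subseteq> B" "B \<subseteq> K" "A' \<subseteq> B'" "B' \<subseteq> K"
  shows "face i A B = face i A' B' \<longleftrightarrow> A = A' \<and> B = B'"
  unfolding face_def
  by (rule simple_cube.cube_face_eq_iff[OF simple_cube_facet[OF assms(1)] assms(2-5)])

lemma verts_face:
  assumes "i < m" "B \<subseteq> K" shows "verts (face i A B) = vset i A B"
proof
  show "verts (face i A B) \<subseteq> vset i A B"
  proof
    fix j assume j: "j \<in> verts (face i A B)"
    have "face i A B \<subseteq> {x. normal i \<bullet> x = bnd i}"
      unfolding face_def cube_face_def
      using normal_eq_iff[OF assms(1) corner_less[OF assms(1)]] assms(2)
      by (intro hull_minimal) (auto simp: convex_hyperplane)
    then have "normal i \<bullet> pt j = bnd i" using j by (auto simp: verts_def)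
    then obtain S where "S \<subseteq> K" "j = corner i S"
      using normal_eq_iff[OF assms(1)] j by (auto simp: verts_def)
    then show "j \<in> vset i A B" using j vertex_in_face_iff[OF assms] by (auto simp: verts_def vset_def)
  qed
  show "vset i A B \<subseteq> verts (face i A B)"
    unfolding vset_def verts_def using vertex_in_face_iff[OF assms] corner_less[OF assms(1)] assms(2) by auto
qed

lemma face_eq_hull_verts:
  assumes "i < m" "B \<subseteq> K" shows "convex hull (pt ` verts (face i A B)) = face i A B"
  by (simp add: verts_face[OF assms]) (simp add: vset_def face_def cube_face_def image_image)

definition subfaces :: "'a set set" where
  "subfaces = {face i A B | i A B. i < m \<and> A \<subseteq> B \<and> B \<subseteq> K}"

lemma verts_inverse: "F \<in> subfaces \<Longrightarrow> convex hull (pt ` verts F) = F"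
  by (auto simp: subfaces_def face_eq_hull_verts)

lemma inj_on_verts: "inj_on verts subfaces"
  using verts_inverse by (rule inj_on_inverseI)

lemma faces_of_dim_eq:
  assumes "k < DIM('a)"
  shows "{F. F face_of P \<and> aff_dim F = int k} =
    {face i A B | i A B. i < m \<and> A \<subseteq> B \<and> B \<subseteq> K \<and> card (B - A) = k}"
proof -
  have "F face_of P \<and> aff_dim F = int k \<longleftrightarrow> (F face_of P \<and> F \<noteq> P \<and> F \<noteq> {}) \<and> aff_dim F = int k" for F
    using aff_dim_P assms aff_dim_empty[of F] by auto
  then show ?thesis unfolding proper_face_iff using aff_dim_face by (auto; blast)
qed

text \<open>A face occurs in several facets under unrelated intervals. Since it is the hull of its
  vertices, sets of vertex numbers identify these copies and can be counted from tables.\<close>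

lemma card_faces_of_dim:
  assumes "k < DIM('a)"
  shows "card {F. F face_of P \<and> aff_dim F = int k} =
    card {vset i A B | i A B. i < m \<and> A \<subseteq> B \<and> B \<subseteq> K \<and> card (B - A) = k}"
proof -
  let ?F = "{face i A B | i A B. i < m \<and> A \<subseteq> B \<and> B \<subseteq> K \<and> card (B - A) = k}"
  have "?F \<subseteq> subfaces" by (auto simp: subfaces_def)
  then have "card (verts ` ?F) = card ?F" using inj_on_verts by (intro card_image) (auto intro: inj_on_subset)
  moreover have "verts ` ?F = {vset i A B | i A B. i < m \<and> A \<subseteq> B \<and> B \<subseteq> K \<and> card (B - A) = k}"
  proof (intro equalityI subsetI)
    fix x assume "x \<in> verts ` ?F"
    then obtain i A B where *: "i < m" "A \<subseteq> B" "B \<subseteq> K" "card (B - A) = k" "x = verts (face i A B)" by auto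
    then have "x = vset i A B" by (simp add: verts_face)
    with * show "x \<in> {vset i A B | i A B. i < m \<and> A \<subseteq> B \<and> B \<subseteq> K \<and> card (B - A) = k}" by blast
  next
    fix x assume "x \<in> {vset i A B | i A B. i < m \<and> A \<subseteq> B \<and> B \<subseteq> K \<and> card (B - A) = k}"
    then obtain i A B where *: "i < m" "A \<subseteq> B" "B \<subseteq> K" "card (B - A) = k" "x = vset i A B" by auto
    then have "x = verts (face i A B)" by (simp add: verts_face)
    with * show "x \<in> verts ` ?F" by blast
  qed
  ultimately show ?thesis unfolding faces_of_dim_eq[OF assms] by simp
qed

lemma edge_of_face_iff:
  assumes "i < m" "A \<subseteq> B" "B \<subseteq> K"
  shows "e edge_of face i A B \<longleftrightarrow> (\<exists>k\<in>B - A. e \<in> par i A B k)"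
proof
  assume e: "e edge_of face i A B"
  then have "e face_of face i A B" "aff_dim e = 1" by (auto simp: edge_of_def)
  then obtain A' B' where *: "A \<subseteq> A'" "A' \<subseteq> B'" "B' \<subseteq> B" "e = face i A' B'"
    using face_of_face_iff[OF assms] by fastforce
  then have "card (B' - A') = 1" using aff_dim_face[of i A' B'] \<open>aff_dim e = 1\<close> assms by auto
  then obtain k where "B' - A' = {k}" by (auto simp: card_1_singleton_iff)
  then have "B' = insert k A'" "k \<notin> A'" using * by auto
  then show "\<exists>k\<in>B - A. e \<in> par i A B k" using * unfolding par_def by (intro bexI[of _ k]) auto
next
  assume "\<exists>k\<in>B - A. e \<in> par i A B k"
  then obtain k X where *: "k \<in> B - A" "A \<subseteq> X" "X \<subseteq> B - {k}" "e = face i X (insert k X)"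
    by (auto simp: par_def)
  then have "insert k X - X = {k}" "insert k X \<subseteq> K" using assms by auto
  then have "aff_dim e = 1" using aff_dim_face[OF assms(1) subset_insertI, of k X] *(4) by simp
  moreover have "e face_of face i A B" using face_of_face_iff[OF assms] * by blast
  ultimately show "e edge_of face i A B" by (simp add: edge_of_def)
qed

text \<open>The intersection of two faces of a facet is again a face; if it is nonempty it has a
  corner, which must lie in both intervals.\<close>

lemma disjoint_faces_iff:
  assumes "i < m" "A \<subseteq> B" "B \<subseteq> K" "A' \<subseteq> B'" "B' \<subseteq> K"
  shows "face i A B \<inter> face i A' B' = {} \<longleftrightarrow> \<not> A \<union> A' \<subseteq> B \<inter> B'"
proof
  assume *: "face i A B \<inter> face i A' B' = {}"
  show "\<not> A \<union> A' \<subseteq> B \<inter> B'"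
  proof
    assume "A \<union> A' \<subseteq> B \<inter> B'"
    moreover from this have "A \<union> A' \<subseteq> K" using assms by blast
    ultimately have "pt (corner i (A \<union> A')) \<in> face i A B \<inter> face i A' B'"
      using vertex_in_face_iff[OF assms(1,3), of "A \<union> A'"] vertex_in_face_iff[OF assms(1,5), of "A \<union> A'"] assms
      by auto
    then show False using * by auto
  qed
next
  assume *: "\<not> A \<union> A' \<subseteq> B \<inter> B'"
  show "face i A B \<inter> face i A' B' = {}"
  proof (rule ccontr)
    assume ne: "face i A B \<inter> face i A' B' \<noteq> {}"
    have "face i A B face_of face i {} K" "face i A' B' face_of face i {} K"
      unfolding face_of_face_iff[OF assms(1) empty_subsetI subset_refl] using assms by blast+
    then have "face i A B \<inter> face i A' B' face_of face i {} K" by (rule face_of_Int)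
    then obtain X Y where XY: "X \<subseteq> Y" "Y \<subseteq> K" "face i A B \<inter> face i A' B' = face i X Y"
      unfolding face_of_face_iff[OF assms(1) empty_subsetI subset_refl] using ne by auto
    have "pt (corner i X) \<in> face i X Y"
      using vertex_in_face_iff[OF assms(1) XY(2), of X X] XY by auto
    then have "pt (corner i X) \<in> face i A B" "pt (corner i X) \<in> face i A' B'" using XY(3) by auto
    then have "A \<subseteq> X" "X \<subseteq> B" "A' \<subseteq> X" "X \<subseteq> B'"
      using vertex_in_face_iff[OF assms(1,3), of X A] vertex_in_face_iff[OF assms(1,5), of X A'] XY(1,2)
      by auto
    then show False using * by auto
  qed
qed

text \<open>In a square, edges of different directions share a corner. Disjoint edges of a 2-face
  thus have the same direction, and an edge determines its direction.\<close>

lemma opposite_edges_par: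
  assumes F: "i < m" "A \<subseteq> B" "B \<subseteq> K" and k: "k \<in> B - A"
    and e: "e \<in> par i A B k" and op: "(e, e') \<in> opposite_edges (face i A B)"
  shows "e' \<in> par i A B k"
proof -
  obtain S where S: "S face_of face i A B" "aff_dim S = 2" "e edge_of S" "e' edge_of S" "e \<inter> e' = {}"
    using op by (auto simp: opposite_edges_def)
  then have "S \<noteq> {}" by (auto simp: edge_of_def)
  then obtain A' B' where S': "A \<subseteq> A'" "A' \<subseteq> B'" "B' \<subseteq> B" "S = face i A' B'"
    using S(1) face_of_face_iff[OF F] by auto
  have B'K: "B' \<subseteq> K" using S' F by auto
  have card: "card (B' - A') = 2" using aff_dim_face[OF F(1) S'(2) B'K] S S' by simp
  obtain l X where X: "l \<in> B' - A'" "A' \<subseteq> X" "X \<subseteq> B' - {l}" "e = face i X (insert l X)"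
    using S(3) edge_of_face_iff[OF F(1) S'(2) B'K] S'(4) by (auto simp: par_def)
  obtain l' X' where X': "l' \<in> B' - A'" "A' \<subseteq> X'" "X' \<subseteq> B' - {l'}" "e' = face i X' (insert l' X')"
    using S(4) edge_of_face_iff[OF F(1) S'(2) B'K] S'(4) by (auto simp: par_def)
  have sub: "insert l X \<subseteq> K" "insert l' X' \<subseteq> K" using X X' B'K by auto
  have "\<not> X \<union> X' \<subseteq> insert l X \<inter> insert l' X'"
    using S(5) disjoint_faces_iff[OF F(1) subset_insertI sub(1) subset_insertI sub(2)] X X' by simp
  moreover have "l = l'"
  proof (rule ccontr)
    assume "l \<noteq> l'"
    then have "{l, l'} = B' - A'"
      using X(1) X'(1) card by (intro card_subset_eq) (auto simp: card_ge_0_finite)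
    then have "X \<subseteq> insert l' A'" "X' \<subseteq> insert l A'" using X X' by blast+
    then have "X \<union> X' \<subseteq> insert l X \<inter> insert l' X'" using X X' by blast
    then show False using calculation by blast
  qed
  moreover have "l = k"
  proof -
    obtain Z where Z: "Z \<subseteq> B - {k}" "e = face i Z (insert k Z)" using e by (auto simp: par_def)
    then have Zk: "insert k Z \<subseteq> K" using F k by auto
    have "face i X (insert l X) = face i Z (insert k Z)" using Z(2) X(4) by simp
    then have "X = Z \<and> insert l X = insert k Z"
      by (rule face_eq_iff[OF F(1) subset_insertI sub(1) subset_insertI Zk, THEN iffD1])
    then show ?thesis using Z X by auto
  qed
  ultimately show ?thesis using X' S' unfolding par_def by blast
qed

lemma par_opposite_edges:
  assumes F: "i < m" "A \<subseteq> B" "B \<subseteq> K" and k: "k \<in> B - A" and X: "A \<subseteq> X" "insert l X \<subseteq> B - {k}" "l \<notin> X"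
  shows "(face i X (insert k X), face i (insert l X) (insert k (insert l X))) \<in> opposite_edges (face i A B)"
proof -
  let ?S = "face i X (insert k (insert l X))"
  have sub: "insert k (insert l X) \<subseteq> B" using X k by auto
  have "insert k (insert l X) - X = {k, l}" "k \<noteq> l" using X by auto
  have SK: "X \<subseteq> insert k (insert l X)" "insert k (insert l X) \<subseteq> K" using sub F by auto
  have S: "aff_dim ?S = 2"
    using aff_dim_face[OF F(1) SK] \<open>_ = {k, l}\<close> \<open>k \<noteq> l\<close> by simp
  have "?S face_of face i A B"
    unfolding face_of_face_iff[OF F] using X sub by (intro disjI2 exI[of _ X] exI[of _ "insert k (insert l X)"]) auto
  moreover have "\<exists>k'\<in>insert k (insert l X) - X. e \<in> par i X (insert k (insert l X)) k'"
    if "e = face i X (insert k X) \<or> e = face i (insert l X) (insert k (insert l X))" for e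
    using that X unfolding par_def by (intro bexI[of _ k]) auto
  then have "face i X (insert k X) edge_of ?S" "face i (insert l X) (insert k (insert l X)) edge_of ?S"
    unfolding edge_of_face_iff[OF F(1) SK] by simp_all
  moreover have "face i X (insert k X) \<inter> face i (insert l X) (insert k (insert l X)) = {}"
    using disjoint_faces_iff[of i X "insert k X" "insert l X" "insert k (insert l X)"] F sub X by auto
  ultimately show ?thesis using S unfolding opposite_edges_def by blast
qed

text \<open>One inclusion is the invariance of the direction. For the other, every edge of direction
  \<open>k\<close> is reached from the one at \<open>A\<close> by adding further directions one at a
  time, each time crossing a square.\<close>

lemma parallel_class_eq:
  assumes F: "i < m" "A \<subseteq> B" "B \<subseteq> K" and k: "k \<in> B - A" and e: "e \<in> par i A B k"
  shows "generated_equivalence (opposite_edges (face i A B)) `` {e} = par i A B k"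
proof
  let ?r = "opposite_edges (face i A B)"
  have sym: "(e', e) \<in> ?r" if "(e, e') \<in> ?r" for e e'
    using that by (auto simp: opposite_edges_def)
  have "e' \<in> par i A B k" if "(e, e') \<in> (?r \<union> ?r\<inverse>)\<^sup>*" for e'
    using that by (induction rule: rtrancl_induct) (use e opposite_edges_par[OF F k] sym in auto)
  then show "generated_equivalence ?r `` {e} \<subseteq> par i A B k" by (auto simp: generated_equivalence_def)
  define g where "g X = face i X (insert k X)" for X
  have base: "(g A, g X) \<in> (?r \<union> ?r\<inverse>)\<^sup>* \<and> (g X, g A) \<in> (?r \<union> ?r\<inverse>)\<^sup>*" if X: "A \<subseteq> X" "X \<subseteq> B - {k}" for X
  proof -
    have "finite (X - A)" using X F finite_directions by (auto intro: finite_subset)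
    then have "A \<union> (X - A) \<subseteq> B - {k} \<longrightarrow> (g A, g (A \<union> (X - A))) \<in> (?r \<union> ?r\<inverse>)\<^sup>* \<and> (g (A \<union> (X - A)), g A) \<in> (?r \<union> ?r\<inverse>)\<^sup>*"
    proof (induction "X - A" arbitrary: X rule: finite_induct)
      case empty
      then have "A \<union> (X - A) = A" by auto
      then show ?case by simp
    next
      case (insert l Y)
      have l: "A \<union> (X - A) = insert l (A \<union> Y)" "l \<notin> A \<union> Y" "Y = (A \<union> Y) - A" using insert by auto
      show ?case
      proof
        assume sub: "A \<union> (X - A) \<subseteq> B - {k}"
        then have "(g (A \<union> Y), g (insert l (A \<union> Y))) \<in> ?r"
          unfolding g_def using l by (intro par_opposite_edges[OF F k]) auto
        moreover have "(g A, g (A \<union> Y)) \<in> (?r \<union> ?r\<inverse>)\<^sup>* \<and> (g (A \<union> Y), g A) \<in> (?r \<union> ?r\<inverse>)\<^sup>*"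
          using insert.hyps(3)[OF l(3)] l(3) sub l(1) by auto
        ultimately show "(g A, g (A \<union> (X - A))) \<in> (?r \<union> ?r\<inverse>)\<^sup>* \<and> (g (A \<union> (X - A)), g A) \<in> (?r \<union> ?r\<inverse>)\<^sup>*"
          unfolding l(1) by (auto intro: rtrancl.rtrancl_into_rtrancl converse_rtrancl_into_rtrancl)
      qed
    qed
    moreover have "A \<union> (X - A) = X" using X by auto
    ultimately show ?thesis using X by auto
  qed
  show "par i A B k \<subseteq> generated_equivalence ?r `` {e}"
  proof
    fix e' assume "e' \<in> par i A B k"
    then obtain X' where X': "A \<subseteq> X'" "X' \<subseteq> B - {k}" "e' = g X'" by (auto simp: par_def g_def)
    obtain X where X: "A \<subseteq> X" "X \<subseteq> B - {k}" "e = g X" using e by (auto simp: par_def g_def)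
    have "(e, e') \<in> (?r \<union> ?r\<inverse>)\<^sup>*" using base[OF X(1,2)] base[OF X'(1,2)] X X' by (meson rtrancl_trans)
    then show "e' \<in> generated_equivalence ?r `` {e}" by (simp add: generated_equivalence_def)
  qed
qed

lemma parallel_classes_face:
  assumes F: "i < m" "A \<subseteq> B" "B \<subseteq> K"
  shows "parallel_classes (face i A B) = par i A B ` (B - A)"
proof -
  have ne: "par i A B k \<noteq> {}" if "k \<in> B - A" for k
    using that F by (auto simp: par_def)
  show ?thesis
  proof (intro equalityI subsetI)
    fix C assume "C \<in> parallel_classes (face i A B)"
    then obtain e where e: "e edge_of face i A B"
      "C = generated_equivalence (opposite_edges (face i A B)) `` {e}"
      by (auto simp: parallel_classes_def quotient_def)
    then obtain k where "k \<in> B - A" "e \<in> par i A B k" using edge_of_face_iff[OF F] by auto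
    then show "C \<in> par i A B ` (B - A)" using e parallel_class_eq[OF F] by auto
  next
    fix C assume "C \<in> par i A B ` (B - A)"
    then obtain k where k: "k \<in> B - A" "C = par i A B k" by auto
    then obtain e where e: "e \<in> par i A B k" using ne by auto
    then have "e edge_of face i A B" using k edge_of_face_iff[OF F] by auto
    then show "C \<in> parallel_classes (face i A B)"
      unfolding parallel_classes_def k(2) parallel_class_eq[OF F k(1) e, symmetric] by (auto intro: quotientI)
  qed
qed

lemma derivative_complex_eq:
  "derivative_complex P = {(face i A B, par i A B k) | i A B k. i < m \<and> A \<subseteq> B \<and> B \<subseteq> K \<and> k \<in> B - A}"
proof (intro equalityI subsetI)
  fix c assume "c \<in> derivative_complex P"
  then obtain F C where c: "c = (F, C)" "F face_of P" "F \<noteq> P" "C \<in> parallel_classes F"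
    by (auto simp: derivative_complex_def)
  have "F \<noteq> {}"
  proof
    assume "F = {}"
    then show False using c(4) by (auto simp: parallel_classes_def quotient_def edge_of_def)
  qed
  then have "\<exists>i<m. \<exists>A B. A \<subseteq> B \<and> B \<subseteq> K \<and> F = face i A B" using c by (simp flip: proper_face_iff)
  then obtain i A B where *: "i < m" "A \<subseteq> B" "B \<subseteq> K" "F = face i A B" by blast
  then obtain k where "k \<in> B - A" "C = par i A B k" using c parallel_classes_face by auto
  then show "c \<in> {(face i A B, par i A B k) | i A B k. i < m \<and> A \<subseteq> B \<and> B \<subseteq> K \<and> k \<in> B - A}"
    using c * by blast
next
  fix c assume "c \<in> {(face i A B, par i A B k) | i A B k. i < m \<and> A \<subseteq> B \<and> B \<subseteq> K \<and> k \<in> B - A}"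
  then show "c \<in> derivative_complex P"
    unfolding derivative_complex_def using face_face_of_P parallel_classes_face by auto
qed

end

section \<open>Spaces of weights on chains\<close>

definition order_weights :: "('c \<Rightarrow> 'c \<Rightarrow> bool) \<Rightarrow> 'c set \<Rightarrow> ('c \<Rightarrow> real) set" where
  "order_weights le K =
     {t. (\<forall>c. 0 \<le> t c) \<and> {c. t c \<noteq> 0} \<subseteq> K \<and> finite {c. t c \<noteq> 0} \<and>
         (\<forall>c d. t c \<noteq> 0 \<longrightarrow> t d \<noteq> 0 \<longrightarrow> le c d \<or> le d c) \<and> (\<Sum>c | t c \<noteq> 0. t c) = 1}"

text \<open>With the order as a parameter, one development serves both the cells of the polytope and
  sets of numbers ordered by inclusion.\<close>

lemma geometric_realization_eq: "geometric_realization K = top_of_set (order_weights cell_le K)"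
  by (simp add: geometric_realization_def order_weights_def)

lemma sum_support:
  fixes t :: "'c \<Rightarrow> real" and g :: "'c \<Rightarrow> 'b::real_vector"
  assumes "finite K" "{c. t c \<noteq> 0} \<subseteq> K"
  shows "(\<Sum>c | t c \<noteq> 0. t c *\<^sub>R g c) = (\<Sum>c\<in>K. t c *\<^sub>R g c)" "(\<Sum>c | t c \<noteq> 0. t c) = (\<Sum>c\<in>K. t c)"
  by (rule sum.mono_neutral_left[OF assms]; simp)+

text \<open>For finite \<open>K\<close> the support conditions turn into equations and disjunctions
  of equations, which are closed conditions.\<close>

lemma order_weights_iff:
  assumes "finite K"
  shows "t \<in> order_weights le K \<longleftrightarrow> (\<forall>c. 0 \<le> t c) \<and> (\<forall>c. c \<notin> K \<longrightarrow> t c = 0) \<and>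
    (\<forall>c d. t c = 0 \<or> t d = 0 \<or> le c d \<or> le d c) \<and> (\<Sum>c\<in>K. t c) = 1"
proof -
  have "{c. t c \<noteq> 0} \<subseteq> K \<longleftrightarrow> (\<forall>c. c \<notin> K \<longrightarrow> t c = 0)" by blast
  then show ?thesis
    unfolding order_weights_def using sum_support(2)[OF assms, of t] finite_subset[OF _ assms, of "{c. t c \<noteq> 0}"]
    by auto
qed

lemma continuous_on_apply [continuous_intros]: "continuous_on S (\<lambda>t::'c \<Rightarrow> real. t c)"
  using continuous_on_product_coordinates by (rule continuous_on_subset) simp

text \<open>A closed subset of a product of compact intervals. The bound \<open>S\<close> on the
  support yields compact neighbourhoods inside a star of cells.\<close>

lemma compact_order_weights:
  fixes K :: "'c set"
  assumes K: "finite K"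
  shows "compact {t \<in> order_weights le K. \<forall>c. c \<notin> S \<longrightarrow> t c = 0}"
proof -
  let ?B = "PiE UNIV (\<lambda>c. if c \<in> K then {0..1} else {0 :: real})"
  let ?C = "{t :: 'c \<Rightarrow> real. (\<forall>c. 0 \<le> t c) \<and> (\<forall>c. c \<notin> K \<longrightarrow> t c = 0) \<and>
    (\<forall>c d. t c = 0 \<or> t d = 0 \<or> le c d \<or> le d c) \<and> (\<Sum>c\<in>K. t c) = 1 \<and> (\<forall>c. c \<notin> S \<longrightarrow> t c = 0)}"
  have "compactin (product_topology (\<lambda>c. euclidean) UNIV) ?B"
    by (auto simp: compactin_PiE)
  then have "compact ?B" by (simp add: euclidean_product_topology)
  moreover have "closed ?C"
    by (intro closed_Collect_conj closed_Collect_all closed_Collect_imp closed_Collect_disj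
        closed_Collect_le closed_Collect_eq closed_Collect_const open_Collect_const continuous_intros)
  moreover have "{t \<in> order_weights le K. \<forall>c. c \<notin> S \<longrightarrow> t c = 0} = ?B \<inter> ?C"
  proof -
    have "t c \<le> 1" if "\<forall>c. 0 \<le> t c" "(\<Sum>c\<in>K. t c) = 1" "c \<in> K" for t :: "'c \<Rightarrow> real" and c
      using member_le_sum[of c K t] that K by simp
    then show ?thesis by (auto simp: order_weights_iff[OF K] PiE_iff)
  qed
  ultimately show ?thesis by (simp add: compact_Int_closed)
qed

section \<open>Barycentric coordinates on the boundary of a polytope\<close>

lemma vertex_centroid_in_rel_interior:
  fixes F :: "'a::euclidean_space set"
  assumes "polytope F" "F \<noteq> {}" shows "vertex_centroid F \<in> rel_interior F"
proof -
  let ?V = "{v. v extreme_point_of F}"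
  have fin: "finite ?V" using finite_polyhedron_extreme_points[OF polytope_imp_polyhedron[OF assms(1)]] .
  have F: "F = convex hull ?V" using assms(1) by (intro Krein_Milman_Minkowski polytope_imp_compact polytope_imp_convex)
  then have "?V \<noteq> {}" using assms(2) by (metis convex_hull_empty)
  then have card: "0 < card ?V" using fin by (simp add: card_gt_0_iff)
  have "vertex_centroid F = (\<Sum>v\<in>?V. (1 / real (card ?V)) *\<^sub>R v)"
    by (simp add: vertex_centroid_def scaleR_sum_right inverse_eq_divide)
  moreover have "(\<Sum>v\<in>?V. 1 / real (card ?V)) = 1" "\<forall>v\<in>?V. 0 < 1 / real (card ?V)" using card by auto
  ultimately have "vertex_centroid F \<in> {y. \<exists>u. (\<forall>x\<in>?V. 0 < u x) \<and> sum u ?V = 1 \<and> (\<Sum>x\<in>?V. u x *\<^sub>R x) = y}"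
    by (intro CollectI exI[of _ "\<lambda>_. 1 / real (card ?V)"]) auto
  then show ?thesis
    using explicit_subset_rel_interior_convex_hull_minimal[OF fin] F by auto
qed

text \<open>Take the largest face carrying weight. The normalised remaining weights give a point of
  that face, and its centroid pulls this point into the relative interior. The total weight is only
  assumed positive because the uniqueness argument below peels weight off.\<close>

lemma barycentric_top:
  fixes f :: "'c \<Rightarrow> 'a::euclidean_space set" and w :: "'c \<Rightarrow> real"
  assumes P: "polytope P" and A: "finite A"
    and faces: "\<And>c. c \<in> A \<Longrightarrow> f c face_of P \<and> f c \<noteq> {}"
    and nonneg: "\<And>c. c \<in> A \<Longrightarrow> 0 \<le> w c"
    and chain: "\<And>c d. c \<in> A \<Longrightarrow> d \<in> A \<Longrightarrow> w c \<noteq> 0 \<Longrightarrow> w d \<noteq> 0 \<Longrightarrow> f c \<subseteq> f d \<or> f d \<subseteq> f c"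
    and pos: "0 < sum w A"
  obtains c where "c \<in> A" "0 < w c"
    "(1 / sum w A) *\<^sub>R (\<Sum>d\<in>A. w d *\<^sub>R vertex_centroid (f d)) \<in> rel_interior (f c)"
proof -
  let ?S = "{d\<in>A. w d \<noteq> 0}"
  have "?S \<noteq> {}" using pos by (metis (mono_tags, lifting) empty_Collect_eq less_irrefl sum.neutral)
  then have "finite (f ` ?S)" "f ` ?S \<noteq> {}" using A by auto
  then obtain M where M: "M \<in> f ` ?S" "\<forall>N\<in>f ` ?S. M \<subseteq> N \<longrightarrow> M = N"
    using finite_has_maximal[of "f ` ?S"] by blast
  then obtain c where c: "c \<in> A" "w c \<noteq> 0" "M = f c" by auto
  have max: "f d \<subseteq> f c" if "d \<in> A" "w d \<noteq> 0" for d
    using chain[OF c(1) that(1) c(2) that(2)] M(2) that c(3) by auto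
  have wc: "0 < w c" using nonneg[OF c(1)] c(2) by simp
  have conv: "convex (f c)" using faces[OF c(1)] face_of_imp_convex by blast
  have ri: "vertex_centroid (f d) \<in> rel_interior (f d)" if "d \<in> A" for d
    using faces[OF that] face_of_polytope_polytope[OF P] by (intro vertex_centroid_in_rel_interior) auto
  let ?s = "sum w A" and ?r = "sum w (A - {c})"
  have s: "?s = w c + ?r" using A c(1) by (simp add: sum.remove)
  have rnn: "0 \<le> ?r" using nonneg by (intro sum_nonneg) auto
  define x where "x = (\<Sum>d\<in>A - {c}. w d *\<^sub>R vertex_centroid (f d))"
  have sum: "(\<Sum>d\<in>A. w d *\<^sub>R vertex_centroid (f d)) = w c *\<^sub>R vertex_centroid (f c) + x"
    unfolding x_def using A c(1) by (simp add: sum.remove)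
  have "(1 / ?s) *\<^sub>R (\<Sum>d\<in>A. w d *\<^sub>R vertex_centroid (f d)) \<in> rel_interior (f c)"
  proof (cases "?r = 0")
    case True
    then have "\<forall>d\<in>A - {c}. w d = 0" using A nonneg by (subst (asm) sum_nonneg_eq_0_iff) auto
    then have "x = 0" by (simp add: x_def)
    then show ?thesis unfolding sum using s True wc ri[OF c(1)] by simp
  next
    case False
    then have r: "0 < ?r" using rnn by simp
    let ?S' = "{d\<in>A - {c}. w d \<noteq> 0}"
    have x': "x = (\<Sum>d\<in>?S'. w d *\<^sub>R vertex_centroid (f d))"
      unfolding x_def using A by (intro sum.mono_neutral_right) auto
    have r': "?r = sum w ?S'" using A by (intro sum.mono_neutral_right) auto
    have "(\<Sum>d\<in>?S'. (w d / ?r) *\<^sub>R vertex_centroid (f d)) \<in> f c"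
    proof (rule convex_sum[OF _ conv])
      show "(\<Sum>d\<in>?S'. w d / ?r) = 1" using r r' by (simp add: sum_divide_distrib[symmetric])
      show "vertex_centroid (f d) \<in> f c" if "d \<in> ?S'" for d
        using max[of d] that ri[of d] rel_interior_subset by blast
    qed (use A nonneg r in auto)
    moreover have "(\<Sum>d\<in>?S'. (w d / ?r) *\<^sub>R vertex_centroid (f d)) = (1 / ?r) *\<^sub>R x"
      by (simp add: x' scaleR_sum_right)
    ultimately have "(1 / ?r) *\<^sub>R x \<in> f c" by simp
    \<comment> \<open>The point moves towards the centroid by the share of the weight that the
      centroid carries.\<close>
    then have "(1 / ?r) *\<^sub>R x - (w c / ?s) *\<^sub>R ((1 / ?r) *\<^sub>R x - vertex_centroid (f c)) \<in> rel_interior (f c)"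
      using rel_interior_convex_shrink[OF conv ri[OF c(1)], of "(1 / ?r) *\<^sub>R x" "w c / ?s"] wc s r pos by simp
    moreover have "(1 / ?r) *\<^sub>R x - (w c / ?s) *\<^sub>R ((1 / ?r) *\<^sub>R x - vertex_centroid (f c)) =
        (1 / ?s) *\<^sub>R (w c *\<^sub>R vertex_centroid (f c) + x)"
    proof -
      have "1 / y - z / (z + y) * (1 / y) = 1 / (z + y)" if "0 < y" "0 < z + y" for y z :: real
      proof -
        have "1 / y - z / (z + y) * (1 / y) = (z + y - z) / ((z + y) * y)"
          using that by (simp only: diff_divide_distrib) simp
        then show ?thesis using that by simp
      qed
      then have "1 / ?r - w c / ?s * (1 / ?r) = 1 / ?s" using s r pos by simp
      then have "(1 / ?r) *\<^sub>R x - (w c / ?s * (1 / ?r)) *\<^sub>R x = (1 / ?s) *\<^sub>R x"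
        by (metis scaleR_left_diff_distrib)
      moreover have "(1 / ?r) *\<^sub>R x - (w c / ?s) *\<^sub>R ((1 / ?r) *\<^sub>R x - vertex_centroid (f c)) =
          ((1 / ?r) *\<^sub>R x - (w c / ?s * (1 / ?r)) *\<^sub>R x) + (w c / ?s) *\<^sub>R vertex_centroid (f c)"
        by (simp only: scaleR_right_diff_distrib scaleR_scaleR) simp
      moreover have "(1 / ?s) *\<^sub>R (w c *\<^sub>R vertex_centroid (f c) + x) =
          (1 / ?s) *\<^sub>R x + (w c / ?s) *\<^sub>R vertex_centroid (f c)"
        by (simp only: scaleR_add_right scaleR_scaleR) simp
      ultimately show ?thesis by simp
    qed
    ultimately show ?thesis unfolding sum by simp
  qed
  then show thesis using that[OF c(1) wc] by blast
qed

text \<open>Relative interiors of different faces of \<open>P\<close> are disjoint, so both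
  weightings have the same top face. Subtracting the smaller of the two top weights from both keeps
  all hypotheses and removes an element from one of the supports.\<close>

lemma barycentric_inj:
  fixes f :: "'c \<Rightarrow> 'a::euclidean_space set" and w u :: "'c \<Rightarrow> real"
  assumes P: "polytope P" and A: "finite A"
    and faces: "\<And>c. c \<in> A \<Longrightarrow> f c face_of P \<and> f c \<noteq> {}" and inj: "inj_on f A"
  assumes "\<And>c. c \<in> A \<Longrightarrow> 0 \<le> w c" "\<And>c. c \<in> A \<Longrightarrow> 0 \<le> u c"
    and "\<And>c d. c \<in> A \<Longrightarrow> d \<in> A \<Longrightarrow> w c \<noteq> 0 \<Longrightarrow> w d \<noteq> 0 \<Longrightarrow> f c \<subseteq> f d \<or> f d \<subseteq> f c"
    and "\<And>c d. c \<in> A \<Longrightarrow> d \<in> A \<Longrightarrow> u c \<noteq> 0 \<Longrightarrow> u d \<noteq> 0 \<Longrightarrow> f c \<subseteq> f d \<or> f d \<subseteq> f c"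
    and "sum w A = sum u A"
    and "(\<Sum>c\<in>A. w c *\<^sub>R vertex_centroid (f c)) = (\<Sum>c\<in>A. u c *\<^sub>R vertex_centroid (f c))"
  shows "\<forall>c\<in>A. w c = u c"
  using assms(5-)
proof (induction "card {c\<in>A. w c \<noteq> 0} + card {c\<in>A. u c \<noteq> 0}" arbitrary: w u rule: less_induct)
  case less
  note w = less.prems(1) and u = less.prems(2) and wc = less.prems(3) and uc = less.prems(4)
    and sums = less.prems(5) and pts = less.prems(6)
  show ?case
  proof (cases "sum w A = 0")
    case True
    then have "\<forall>c\<in>A. w c = 0" using A w by (subst (asm) sum_nonneg_eq_0_iff) auto
    moreover have "\<forall>c\<in>A. u c = 0" using True sums A u by (subst sum_nonneg_eq_0_iff[symmetric]) auto
    ultimately show ?thesis by simp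
  next
    case False
    then have pos: "0 < sum w A" using w by (metis less_eq_real_def sum_nonneg)
    obtain c where c: "c \<in> A" "0 < w c"
      "(1 / sum w A) *\<^sub>R (\<Sum>d\<in>A. w d *\<^sub>R vertex_centroid (f d)) \<in> rel_interior (f c)"
      by (rule barycentric_top[OF P A faces w wc pos])
    obtain d where d: "d \<in> A" "0 < u d"
      "(1 / sum u A) *\<^sub>R (\<Sum>d\<in>A. u d *\<^sub>R vertex_centroid (f d)) \<in> rel_interior (f d)"
      by (rule barycentric_top[OF P A faces u uc pos[unfolded sums]])
    have "f c = f d"
      using faces[OF c(1)] faces[OF d(1)] c(3) d(3) sums pts by (intro face_of_eq[of _ P]) auto
    then have cd: "d = c" using inj c(1) d(1) by (auto dest: inj_onD)
    define e where "e = min (w c) (u c)"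
    have e: "0 < e" "e \<le> w c" "e \<le> u c" "e = w c \<or> e = u c" using c(2) d(2) cd by (auto simp: e_def)
    define w' where "w' = w(c := w c - e)"
    define u' where "u' = u(c := u c - e)"
    have sub: "{x\<in>A. w' x \<noteq> 0} \<subseteq> {x\<in>A. w x \<noteq> 0}" "{x\<in>A. u' x \<noteq> 0} \<subseteq> {x\<in>A. u x \<noteq> 0}"
      using c d cd by (auto simp: w'_def u'_def split: if_splits)
    have strict: "{x\<in>A. w' x \<noteq> 0} \<subset> {x\<in>A. w x \<noteq> 0} \<or> {x\<in>A. u' x \<noteq> 0} \<subset> {x\<in>A. u x \<noteq> 0}"
    proof (cases "e = w c")
      case True
      then have "c \<notin> {x\<in>A. w' x \<noteq> 0}" "c \<in> {x\<in>A. w x \<noteq> 0}" using c by (auto simp: w'_def)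
      then show ?thesis using sub by blast
    next
      case False
      then have "c \<notin> {x\<in>A. u' x \<noteq> 0}" "c \<in> {x\<in>A. u x \<noteq> 0}" using c d cd e by (auto simp: u'_def)
      then show ?thesis using sub by blast
    qed
    have "card {x\<in>A. w' x \<noteq> 0} + card {x\<in>A. u' x \<noteq> 0} < card {x\<in>A. w x \<noteq> 0} + card {x\<in>A. u x \<noteq> 0}"
    proof -
      have fin: "finite {x\<in>A. w x \<noteq> 0}" "finite {x\<in>A. u x \<noteq> 0}" using A by auto
      show ?thesis
        using strict
      proof
        assume "{x\<in>A. w' x \<noteq> 0} \<subset> {x\<in>A. w x \<noteq> 0}"
        from psubset_card_mono[OF fin(1) this] card_mono[OF fin(2) sub(2)] show ?thesis by linarith
      next
        assume "{x\<in>A. u' x \<noteq> 0} \<subset> {x\<in>A. u x \<noteq> 0}"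
        from psubset_card_mono[OF fin(2) this] card_mono[OF fin(1) sub(1)] show ?thesis by linarith
      qed
    qed
    moreover have "0 \<le> w' x" "0 \<le> u' x" if "x \<in> A" for x
      using w u e that by (auto simp: w'_def u'_def)
    moreover have "f x \<subseteq> f y \<or> f y \<subseteq> f x" if "x \<in> A" "y \<in> A" "w' x \<noteq> 0" "w' y \<noteq> 0" for x y
      using wc[OF that(1,2)] sub(1) that by blast
    moreover have "f x \<subseteq> f y \<or> f y \<subseteq> f x" if "x \<in> A" "y \<in> A" "u' x \<noteq> 0" "u' y \<noteq> 0" for x y
      using uc[OF that(1,2)] sub(2) that by blast
    moreover have upd: "sum (g(c := g c - e)) A = sum g A - e" for g :: "'c \<Rightarrow> real"
      using A c(1) by (simp add: sum.remove)
    moreover have upd': "(\<Sum>x\<in>A. (g(c := g c - e)) x *\<^sub>R vertex_centroid (f x)) =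
        (\<Sum>x\<in>A. g x *\<^sub>R vertex_centroid (f x)) - e *\<^sub>R vertex_centroid (f c)" for g :: "'c \<Rightarrow> real"
    proof -
      have "(\<Sum>x\<in>A - {c}. (g(c := g c - e)) x *\<^sub>R vertex_centroid (f x)) =
        (\<Sum>x\<in>A - {c}. g x *\<^sub>R vertex_centroid (f x))" by (intro sum.cong) auto
      then show ?thesis using A c(1) by (simp add: sum.remove scaleR_left_diff_distrib)
    qed
    ultimately have eq: "\<forall>x\<in>A. w' x = u' x"
      using sums pts by (intro less.hyps) (auto simp: w'_def u'_def)
    show ?thesis
    proof
      fix x assume "x \<in> A"
      then have "w' x = u' x" using eq by simp
      then show "w x = u x" by (auto simp: w'_def u'_def split: if_splits)
    qed
  qed
qed

section \<open>Local injectivity of the canonical map\<close>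

context cubical_presentation
begin

lemma par_inter:
  assumes "i < m" "A \<subseteq> B" "B \<subseteq> K" "k \<in> B" "A' \<subseteq> B'" "B' \<subseteq> K" "k' \<in> B'" "e \<in> par i A B k" "e \<in> par i A' B' k'"
  shows "k = k'"
proof -
  obtain X where X: "X \<subseteq> B - {k}" "e = face i X (insert k X)" using assms by (auto simp: par_def)
  obtain Y where Y: "Y \<subseteq> B' - {k'}" "e = face i Y (insert k' Y)" using assms by (auto simp: par_def)
  have sub: "insert k X \<subseteq> K" "insert k' Y \<subseteq> K" using X Y assms by auto
  have "face i X (insert k X) = face i Y (insert k' Y)" using X(2) Y(2) by simp
  then have "X = Y \<and> insert k X = insert k' Y"
    by (rule face_eq_iff[OF assms(1) subset_insertI sub(1) subset_insertI sub(2), THEN iffD1])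
  then show ?thesis using X Y by auto
qed

lemma par_nonempty: "A \<subseteq> B \<Longrightarrow> k \<in> B - A \<Longrightarrow> par i A B k \<noteq> {}"
  by (auto simp: par_def)

lemma derivative_cellE:
  assumes "c \<in> derivative_complex P"
  obtains i A B k where "i < m" "A \<subseteq> B" "B \<subseteq> K" "k \<in> B - A" "c = (face i A B, par i A B k)"
  using assms unfolding derivative_complex_eq by blast

lemma derivative_cell_eqI:
  assumes "(F, E) \<in> derivative_complex P" "(F, E') \<in> derivative_complex P" "E \<inter> E' \<noteq> {}"
  shows "E = E'"
proof -
  obtain i A B k where *: "i < m" "A \<subseteq> B" "B \<subseteq> K" "k \<in> B - A" "F = face i A B" "E = par i A B k"
    using assms(1) by (auto elim!: derivative_cellE)
  have "E' \<in> parallel_classes (face i A B)" using assms(2) * by (auto simp: derivative_complex_def)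
  then obtain k' where k': "k' \<in> B - A" "E' = par i A B k'" using parallel_classes_face * by auto
  then show ?thesis using par_inter[of i A B k A B k'] assms(3) * by blast
qed

text \<open>Globally \<open>fst\<close> is not injective, as one face carries several parallel
  classes; there the sheets of the immersion cross. Among the cells comparable with
  \<open>c0\<close>, two classes on one face are forced to share an edge, and then they are
  equal.\<close>

lemma inj_on_fst_star:
  assumes c0: "c0 \<in> derivative_complex P"
  shows "inj_on fst {c \<in> derivative_complex P. cell_le c c0 \<or> cell_le c0 c}"
proof (rule inj_onI)
  fix c c' assume c: "c \<in> {c \<in> derivative_complex P. cell_le c c0 \<or> cell_le c0 c}"
    and c': "c' \<in> {c \<in> derivative_complex P. cell_le c c0 \<or> cell_le c0 c}" and eq: "fst c = fst c'"
  obtain F0 E0 where F0: "c0 = (F0, E0)" by (cases c0)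
  obtain F E E' where F: "c = (F, E)" "c' = (F, E')" using eq by (cases c; cases c') auto
  obtain j A0 B0 l where j: "j < m" "A0 \<subseteq> B0" "B0 \<subseteq> K" "l \<in> B0 - A0" "F0 = face j A0 B0" "E0 = par j A0 B0 l"
    using c0 F0 by (auto elim!: derivative_cellE)
  have ne: "E0 \<noteq> {}" "E \<noteq> {}" "E' \<noteq> {}"
    using c c' c0 F F0 par_nonempty by (auto elim!: derivative_cellE)
  have inter: "E \<inter> E' \<noteq> {}"
  \<comment> \<open>If both cells lie below \<open>c0\<close>, the face is an interval in the cube
    of \<open>c0\<close>, and both classes must have the direction \<open>l\<close> of
    \<open>c0\<close>. Otherwise a class is nested between the others or \<open>c0\<close> lies in
    both.\<close>
  proof (cases "cell_le c c0 \<and> cell_le c' c0")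
    case True
    have "F face_of P" "F0 face_of P" "F \<subseteq> F0" using True c c0 F F0 by (auto simp: derivative_complex_def cell_le_def)
    then have "F face_of F0" by (meson face_of_imp_subset face_of_subset)
    moreover have "F \<noteq> {}"
    proof
      assume "F = {}"
      then show False using c F by (auto simp: derivative_complex_def parallel_classes_def quotient_def edge_of_def)
    qed
    ultimately obtain A B where AB: "A0 \<subseteq> A" "A \<subseteq> B" "B \<subseteq> B0" "F = face j A B"
      using face_of_face_iff[OF j(1-3)] j(5) by auto
    have BK: "B \<subseteq> K" using AB j by auto
    have "E \<in> parallel_classes (face j A B)" "E' \<in> parallel_classes (face j A B)"
      using c c' F AB by (auto simp: derivative_complex_def)
    then obtain k k' where k: "k \<in> B - A" "E = par j A B k" "k' \<in> B - A" "E' = par j A B k'"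
      using parallel_classes_face[OF j(1) AB(2) BK] by auto
    have "E \<subseteq> E0" "E' \<subseteq> E0" using True F F0 by (auto simp: cell_le_def)
    then obtain e e' where e: "e \<in> E" "e \<in> E0" "e' \<in> E'" "e' \<in> E0" using ne by blast
    have "k = l" using par_inter[OF j(1) AB(2) BK _ j(2,3)] k e j by blast
    moreover have "k' = l" using par_inter[OF j(1) AB(2) BK _ j(2,3)] k e j by blast
    ultimately show ?thesis using k ne by auto
  next
    case False
    then have "(E0 \<subseteq> E \<and> E0 \<subseteq> E') \<or> (E \<subseteq> E0 \<and> E0 \<subseteq> E') \<or> (E' \<subseteq> E0 \<and> E0 \<subseteq> E)"
      using c c' F F0 by (auto simp: cell_le_def)
    then show ?thesis using ne by blast
  qed
  then show "c = c'" using derivative_cell_eqI c c' F by blast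
qed

text \<open>The points giving weight to \<open>c0\<close> form an open set \<open>?U\<close> and lie
  in the compact set \<open>?C\<close> of points supported on cells comparable with
  \<open>c0\<close>. There the faces determine the cells, so the map is injective by uniqueness of
  barycentric coordinates, and compactness makes it a homeomorphism onto its image.\<close>

lemma canonical_immersion:
  assumes K: "\<K> \<subseteq> derivative_complex P" "finite \<K>"
  shows "topological_immersion (geometric_realization \<K>) (top_of_set (rel_frontier P)) canonical_map"
proof -
  let ?R = "order_weights cell_le \<K>"
  have canon: "canonical_map t = (\<Sum>c\<in>\<K>. t c *\<^sub>R vertex_centroid (fst c))" if "t \<in> ?R" for t
    using that unfolding canonical_map_def order_weights_def by (intro sum_support[OF K(2)]) auto
  have cont: "continuous_on ?R canonical_map"
    using canon by (subst continuous_on_cong[OF refl canon]) (auto intro!: continuous_intros)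
  have faces: "fst c face_of P \<and> fst c \<noteq> {}" "fst c \<noteq> P" if "c \<in> \<K>" for c
  proof -
    have "c \<in> derivative_complex P" using that K by auto
    then obtain i A B k where "i < m" "A \<subseteq> B" "B \<subseteq> K" "c = (face i A B, par i A B k)" by (elim derivative_cellE)
    then show "fst c face_of P \<and> fst c \<noteq> {}" "fst c \<noteq> P" using face_face_of_P by auto
  qed
  have bd: "canonical_map t \<in> rel_frontier P" if t: "t \<in> ?R" for t
  proof -
    have t': "\<And>c. 0 \<le> t c" "\<And>c d. t c \<noteq> 0 \<Longrightarrow> t d \<noteq> 0 \<Longrightarrow> cell_le c d \<or> cell_le d c" "sum t \<K> = 1"
      using t unfolding order_weights_iff[OF K(2)] by blast+
    obtain c where c: "c \<in> \<K>" "(1 / sum t \<K>) *\<^sub>R (\<Sum>d\<in>\<K>. t d *\<^sub>R vertex_centroid (fst d)) \<in> rel_interior (fst c)"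
    proof (rule barycentric_top[OF polytope_P K(2), of fst t])
      show "fst c \<subseteq> fst d \<or> fst d \<subseteq> fst c" if "t c \<noteq> 0" "t d \<noteq> 0" for c d
        using t'(2)[OF that] unfolding cell_le_def by blast
    qed (use t' faces in auto)
    then have "canonical_map t \<in> fst c"
      using canon[OF t] t' subsetD[OF rel_interior_subset] by simp
    moreover have "fst c \<subseteq> rel_frontier P"
      using faces[OF c(1)] by (intro face_of_subset_rel_frontier) auto
    ultimately show ?thesis by blast
  qed
  have "continuous_map (geometric_realization \<K>) (top_of_set (rel_frontier P)) canonical_map"
    unfolding geometric_realization_eq using cont bd by auto
  moreover have "\<exists>U. openin (geometric_realization \<K>) U \<and> t \<in> U \<and>
      embedding_map (subtopology (geometric_realization \<K>) U) (top_of_set (rel_frontier P)) canonical_map"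
    if "t \<in> topspace (geometric_realization \<K>)" for t
  proof -
    have t: "t \<in> ?R" using that by (simp add: geometric_realization_eq)
    then have "sum t \<K> = 1" unfolding order_weights_iff[OF K(2)] by auto
    then obtain c0 where c0: "c0 \<in> \<K>" "t c0 \<noteq> 0" by (metis sum.neutral zero_neq_one)
    let ?S = "{c \<in> derivative_complex P. cell_le c c0 \<or> cell_le c0 c}"
    let ?C = "{s \<in> ?R. \<forall>c. c \<notin> ?S \<longrightarrow> s c = 0}"
    let ?U = "?R \<inter> {s. s c0 \<noteq> 0}"
    have "?U \<subseteq> ?C"
    proof (intro subsetI CollectI conjI allI impI)
      fix s c assume s: "s \<in> ?U" and c: "c \<notin> ?S"
      then have "s c = 0 \<or> s c0 = 0 \<or> cell_le c c0 \<or> cell_le c0 c" "c \<notin> \<K> \<longrightarrow> s c = 0"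
        unfolding Int_iff order_weights_iff[OF K(2)] by blast+
      then show "s c = 0" using s c K(1) by auto
    qed auto
    have inj: "inj_on canonical_map ?C"
    proof (rule inj_onI)
      fix s s' assume s: "s \<in> ?C" and s': "s' \<in> ?C" and eq: "canonical_map s = canonical_map s'"
      let ?A = "\<K> \<inter> ?S"
      have S: "\<And>c. 0 \<le> s c" "\<And>c d. s c \<noteq> 0 \<Longrightarrow> s d \<noteq> 0 \<Longrightarrow> cell_le c d \<or> cell_le d c" "sum s \<K> = 1"
        "\<And>c. c \<notin> ?A \<Longrightarrow> s c = 0"
        using s unfolding order_weights_iff[OF K(2)] by blast+
      have S': "\<And>c. 0 \<le> s' c" "\<And>c d. s' c \<noteq> 0 \<Longrightarrow> s' d \<noteq> 0 \<Longrightarrow> cell_le c d \<or> cell_le d c" "sum s' \<K> = 1"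
        "\<And>c. c \<notin> ?A \<Longrightarrow> s' c = 0"
        using s' unfolding order_weights_iff[OF K(2)] by blast+
      have restr: "sum g \<K> = sum g ?A" if "\<And>c. c \<notin> ?A \<Longrightarrow> g c = 0" for g :: "_ \<Rightarrow> real"
        using K(2) that by (intro sum.mono_neutral_right) auto
      have restr': "(\<Sum>c\<in>\<K>. g c *\<^sub>R vertex_centroid (fst c)) = (\<Sum>c\<in>?A. g c *\<^sub>R vertex_centroid (fst c))"
        if "\<And>c. c \<notin> ?A \<Longrightarrow> g c = 0" for g :: "_ \<Rightarrow> real"
        using K(2) that by (intro sum.mono_neutral_right) auto
      have "\<forall>c\<in>?A. s c = s' c"
      proof (rule barycentric_inj[OF polytope_P, where f = fst])
        show "finite ?A" using K(2) by auto
        show "inj_on fst ?A" using inj_on_fst_star[of c0] c0 K(1) by (auto intro: inj_on_subset)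
        show "sum s ?A = sum s' ?A" using restr[OF S(4)] restr[OF S'(4)] S(3) S'(3) by simp
        show "(\<Sum>c\<in>?A. s c *\<^sub>R vertex_centroid (fst c)) = (\<Sum>c\<in>?A. s' c *\<^sub>R vertex_centroid (fst c))"
          using eq canon s s' restr'[OF S(4)] restr'[OF S'(4)] by simp
        show "fst c face_of P \<and> fst c \<noteq> {}" if "c \<in> ?A" for c using faces that by blast
        show "fst c \<subseteq> fst d \<or> fst d \<subseteq> fst c" if "s c \<noteq> 0" "s d \<noteq> 0" for c d
          using S(2)[OF that] unfolding cell_le_def by blast
        show "fst c \<subseteq> fst d \<or> fst d \<subseteq> fst c" if "s' c \<noteq> 0" "s' d \<noteq> 0" for c d
          using S'(2)[OF that] unfolding cell_le_def by blast
      qed (rule S(1) S'(1))+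
      then have "s c = s' c" for c using S(4)[of c] S'(4)[of c] by (cases "c \<in> ?A") auto
      then show "s = s'" by (rule ext)
    qed
    have "continuous_on ?C canonical_map" using cont by (rule continuous_on_subset) auto
    then obtain g where g: "homeomorphism ?C (canonical_map ` ?C) canonical_map g"
      using homeomorphism_compact[OF compact_order_weights[OF K(2)] _ refl inj] by blast
    then have "homeomorphism ?U (canonical_map ` ?U) canonical_map g"
      using \<open>?U \<subseteq> ?C\<close> by (intro homeomorphism_of_subsets[OF g]) auto
    then have "homeomorphic_map (top_of_set ?U) (top_of_set (canonical_map ` ?U)) canonical_map"
      unfolding homeomorphic_map_maps homeomorphic_maps_def homeomorphism_def
      by (intro exI[of _ g]) auto
    moreover have "subtopology (geometric_realization \<K>) ?U = top_of_set ?U"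
      by (simp add: geometric_realization_eq subtopology_subtopology)
    moreover have "subtopology (top_of_set (rel_frontier P)) (canonical_map ` ?U) = top_of_set (canonical_map ` ?U)"
    proof -
      have "rel_frontier P \<inter> canonical_map ` ?U = canonical_map ` ?U" using bd by auto
      then show ?thesis by (simp add: subtopology_subtopology)
    qed
    ultimately have "embedding_map (subtopology (geometric_realization \<K>) ?U) (top_of_set (rel_frontier P)) canonical_map"
      by (simp add: embedding_map_def)
    moreover have "openin (geometric_realization \<K>) ?U"
    proof -
      have "open {s :: _ \<Rightarrow> real. s c0 \<noteq> 0}"
        by (intro open_Collect_neq continuous_intros)
      then show ?thesis unfolding geometric_realization_eq by (rule openin_open_Int)
    qed
    moreover have "t \<in> ?U" using t c0 by simp
    ultimately show ?thesis by blast
  qed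
  ultimately show ?thesis unfolding topological_immersion_def by blast
qed

end

section \<open>Maps from the disc with prescribed boundary\<close>

text \<open>Relatively closed subsets of \<open>A\<close> are compact, so their images are compact
  and hence closed: \<open>\<pi>\<close> is a quotient map onto its image.\<close>

lemma continuous_on_compact_quotient:
  fixes \<pi> :: "'a::topological_space \<Rightarrow> 'b::t2_space" and g :: "'b \<Rightarrow> 'c::topological_space"
  assumes A: "compact A" and \<pi>: "continuous_on A \<pi>" and g: "continuous_on A (\<lambda>x. g (\<pi> x))"
  shows "continuous_on (\<pi> ` A) g"
  unfolding continuous_on_closed_invariant
proof (intro allI impI)
  fix B :: "'c set" assume "closed B"
  then obtain C where C: "closed C" "C \<inter> A = (\<lambda>x. g (\<pi> x)) -` B \<inter> A"
    using g unfolding continuous_on_closed_invariant by blast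
  have "compact (\<pi> ` (A \<inter> C))"
    using A C(1) \<pi> by (intro compact_continuous_image compact_Int_closed) (auto intro: continuous_on_subset)
  then have "closed (\<pi> ` (A \<inter> C))" by (rule compact_imp_closed)
  moreover have "\<pi> ` (A \<inter> C) \<inter> \<pi> ` A = g -` B \<inter> \<pi> ` A"
    using C(2) by (auto simp: set_eq_iff)
  ultimately show "\<exists>C. closed C \<and> C \<inter> \<pi> ` A = g -` B \<inter> \<pi> ` A" by blast
qed

section \<open>Paths through barycentres\<close>

definition hat :: "real \<Rightarrow> real" where "hat x = max 0 (1 - \<bar>x\<bar>)"

text \<open>Adding two terms instead of choosing between them makes \<open>seg c c \<theta>\<close>
  the vertex \<open>c\<close>, which is how single vertices are written below.\<close>

definition seg :: "'c \<Rightarrow> 'c \<Rightarrow> real \<Rightarrow> 'c \<Rightarrow> real" where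
  "seg c d \<theta> = (\<lambda>x. (if x = c then 1 - \<theta> else 0) + (if x = d then \<theta> else 0))"

text \<open>Unit speed along the segments of the order complex: at any time at most two of the hat
  functions are nonzero. Equal entries of \<open>w\<close> add their weights, so words with
  repetitions are allowed.\<close>

definition upath :: "'c list \<Rightarrow> real \<Rightarrow> 'c \<Rightarrow> real" where
  "upath w x = (\<lambda>c. \<Sum>i<length w. if w ! i = c then hat (x - real i) else 0)"

abbreviation plen :: "'c list \<Rightarrow> real" where "plen w \<equiv> real (length w - 1)"

lemma upath_seg:
  assumes "Suc i < length w" "0 \<le> \<theta>" "\<theta> \<le> 1"
  shows "upath w (real i + \<theta>) = seg (w ! i) (w ! Suc i) \<theta>"
proof
  fix c
  have "upath w (real i + \<theta>) c =
      (\<Sum>j<length w. (if j = i then (if w ! i = c then 1 - \<theta> else 0) else 0) +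
                       (if j = Suc i then (if w ! Suc i = c then \<theta> else 0) else 0))"
    unfolding upath_def
  proof (rule sum.cong[OF refl])
    fix j
    consider "j = i" | "j = Suc i" | "real j \<le> real i - 1" | "real j \<ge> real i + 2"
      by (cases "j < i"; cases "j = i"; cases "j = Suc i") (auto simp: of_nat_diff)
    then show "(if w ! j = c then hat (real i + \<theta> - real j) else 0) =
        (if j = i then (if w ! i = c then 1 - \<theta> else 0) else 0) +
        (if j = Suc i then (if w ! Suc i = c then \<theta> else 0) else 0)"
      using assms by cases (auto simp: hat_def)
  qed
  also have "\<dots> = seg (w ! i) (w ! Suc i) \<theta> c"
    using assms by (auto simp: sum.distrib seg_def)
  finally show "upath w (real i + \<theta>) c = seg (w ! i) (w ! Suc i) \<theta> c" .
qed

lemma segment_param: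
  assumes "2 \<le> length w" "0 \<le> x" "x \<le> plen w"
  obtains i \<theta> where "Suc i < length w" "0 \<le> \<theta>" "\<theta> \<le> 1" "x = real i + \<theta>"
proof (cases "x = plen w")
  case True
  show thesis by (rule that[of "length w - 2" 1]) (use assms True in \<open>auto simp: of_nat_diff\<close>)
next
  case False
  then have "x < plen w" using assms by simp
  then have "nat \<lfloor>x\<rfloor> < length w - 1" using assms by linarith
  then show thesis using assms by (intro that[of "nat \<lfloor>x\<rfloor>" "x - real (nat \<lfloor>x\<rfloor>)"]) linarith+
qed

lemma continuous_on_upath: "continuous_on S (upath w)"
proof (rule continuous_on_coordinatewise_then_product)
  fix c show "continuous_on S (\<lambda>x. upath w x c)"
    unfolding upath_def hat_def
  proof (rule continuous_on_sum)
    fix i show "continuous_on S (\<lambda>x. if w ! i = c then max 0 (1 - \<bar>x - real i\<bar>) else 0)"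
      by (cases "w ! i = c") (auto intro!: continuous_intros)
  qed
qed

lemma upath_start: "2 \<le> length w \<Longrightarrow> upath w 0 = seg (hd w) (hd w) 0"
  using upath_seg[of 0 w 0] hd_conv_nth[of w] by (fastforce simp: seg_def)

lemma upath_end: "2 \<le> length w \<Longrightarrow> upath w (plen w) = seg (last w) (last w) 0"
proof -
  assume *: "2 \<le> length w"
  have "plen w = real (length w - 2) + 1" "Suc (length w - 2) < length w" "Suc (length w - 2) = length w - 1"
    using * by (auto simp: of_nat_diff)
  moreover have "last w = w ! (length w - 1)" using * by (intro last_conv_nth) auto
  ultimately show ?thesis using upath_seg[of "length w - 2" w 1] by (auto simp: seg_def fun_eq_iff)
qed

lemma upath_append1:
  assumes "2 \<le> length w" "0 \<le> x" "x \<le> plen w"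
  shows "upath (w @ w') x = upath w x"
proof -
  obtain i \<theta> where *: "Suc i < length w" "0 \<le> \<theta>" "\<theta> \<le> 1" "x = real i + \<theta>" by (rule segment_param[OF assms])
  then show ?thesis using upath_seg[of i w \<theta>] upath_seg[of i "w @ w'" \<theta>] by (simp add: nth_append)
qed

lemma nth_join:
  assumes "w \<noteq> []" "w' \<noteq> []" "last w = hd w'" shows "(w @ tl w') ! (length w - 1 + j) = w' ! j"
proof (cases j)
  case 0
  then show ?thesis using assms by (simp add: nth_append last_conv_nth hd_conv_nth)
next
  case (Suc k)
  then have "length w - 1 + j = length w + k" using assms by (cases w) auto
  then show ?thesis using assms Suc by (simp only: nth_append_length_plus) (cases w', auto simp: nth_append)
qed

lemma upath_append2:
  assumes "w \<noteq> []" "2 \<le> length w'" "last w = hd w'" "0 \<le> x" "x \<le> plen w'"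
  shows "upath (w @ tl w') (plen w + x) = upath w' x"
proof -
  obtain i \<theta> where *: "Suc i < length w'" "0 \<le> \<theta>" "\<theta> \<le> 1" "x = real i + \<theta>" by (rule segment_param[OF assms(2,4,5)])
  have w': "w' \<noteq> []" using assms(2) by auto
  have "upath (w @ tl w') (real (length w - 1 + i) + \<theta>) = seg (w' ! i) (w' ! Suc i) \<theta>"
    using upath_seg[of "length w - 1 + i" "w @ tl w'" \<theta>] * nth_join[OF assms(1) w' assms(3), of i]
      nth_join[OF assms(1) w' assms(3), of "Suc i"] assms(1) by (cases w) auto
  then show ?thesis using upath_seg[OF *(1-3)] *(4) by (simp add: algebra_simps)
qed

lemma upath_rev:
  assumes "2 \<le> length w" "0 \<le> x" "x \<le> plen w"
  shows "upath (rev w) x = upath w (plen w - x)"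
proof -
  obtain i \<theta> where *: "Suc i < length w" "0 \<le> \<theta>" "\<theta> \<le> 1" "x = real i + \<theta>" by (rule segment_param[OF assms])
  let ?j = "length w - Suc (Suc i)"
  have "plen w - x = real ?j + (1 - \<theta>)" using * by (simp add: of_nat_diff)
  moreover have "Suc ?j < length w" "0 \<le> 1 - \<theta>" "1 - \<theta> \<le> 1" using * by auto
  ultimately have "upath w (plen w - x) = seg (w ! ?j) (w ! Suc ?j) (1 - \<theta>)"
    using upath_seg[of ?j w "1 - \<theta>"] by metis
  moreover have "upath (rev w) x = seg (rev w ! i) (rev w ! Suc i) \<theta>" using upath_seg[of i "rev w" \<theta>] * by simp
  moreover have "rev w ! i = w ! Suc ?j" "rev w ! Suc i = w ! ?j"
    using * by (auto simp: rev_nth Suc_diff_Suc)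
  ultimately show ?thesis by (auto simp: seg_def fun_eq_iff)
qed

section \<open>Polar coordinates and maps from the disc\<close>

definition polar :: "real \<Rightarrow> real \<Rightarrow> complex" where "polar r s = of_real r * cis (2 * pi * s)"

lemma norm_polar: "0 \<le> r \<Longrightarrow> cmod (polar r s) = r"
  by (simp add: polar_def norm_mult)

lemma polar_cases:
  obtains s where "0 \<le> s" "s < 1" "z = polar (cmod z) s"
proof (rule that[of "Arg2pi z / (2 * pi)"])
  show "0 \<le> Arg2pi z / (2 * pi)" "Arg2pi z / (2 * pi) < 1"
    using Arg2pi_ge_0[of z] Arg2pi_lt_2pi[of z] by (auto simp: divide_simps)
  show "z = polar (cmod z) (Arg2pi z / (2 * pi))"
    using Arg2pi_eq[of z] by (simp add: polar_def cis_conv_exp mult.commute)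
qed

lemma Arg2pi_polar:
  assumes "0 < r" "0 \<le> s" "s < 1" shows "Arg2pi (polar r s) = 2 * pi * s"
proof (rule Arg2pi_unique)
  show "of_real r * exp (\<i> * of_real (2 * pi * s)) = polar r s" by (simp add: polar_def cis_conv_exp)
qed (use assms in auto)

lemma polar_inj:
  assumes "polar r s = polar r' s'" "0 < r" "0 \<le> r'" "0 \<le> s" "s < 1" "0 \<le> s'" "s' < 1"
  shows "r = r'" "s = s'"
proof -
  show r: "r = r'" using arg_cong[OF assms(1), of cmod] norm_polar[of r] norm_polar[of r'] assms(2,3) by simp
  have "Arg2pi (polar r s) = 2 * pi * s" if "0 \<le> s" "s < 1" for s
    by (rule Arg2pi_polar[OF assms(2) that])
  moreover have "Arg2pi (polar r s) = Arg2pi (polar r s')"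
    using arg_cong[OF assms(1), of Arg2pi] unfolding r[symmetric] .
  ultimately have "2 * pi * s = 2 * pi * s'" using assms(4-7) by metis
  then show "s = s'" by simp
qed

definition radial :: "(real \<Rightarrow> real \<Rightarrow> 'c) \<Rightarrow> complex \<Rightarrow> 'c" where
  "radial F z = F (cmod z) (Arg2pi z / (2 * pi))"

lemma radial_polar:
  assumes "0 \<le> r" "0 \<le> s" "s \<le> 1" and zero: "\<And>s. 0 \<le> s \<Longrightarrow> s \<le> 1 \<Longrightarrow> F 0 s = F 0 0" and per: "F r 1 = F r 0"
  shows "radial F (polar r s) = F r s"
proof (cases "r = 0")
  case True
  have "0 \<le> Arg2pi (polar r s) / (2 * pi)" "Arg2pi (polar r s) / (2 * pi) \<le> 1"
    using Arg2pi_ge_0[of "polar r s"] Arg2pi_lt_2pi[of "polar r s"] by (auto simp: divide_simps)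
  then have "F 0 (Arg2pi (polar r s) / (2 * pi)) = F 0 0" by (rule zero)
  also have "\<dots> = F r s" using zero[OF assms(2,3)] True by simp
  finally show ?thesis using True by (simp add: radial_def norm_polar)
next
  case False
  obtain s' where s': "0 \<le> s'" "s' < 1" "polar r s = polar r s'" "F r s = F r s'"
  proof (cases "s = 1")
    case True
    then show thesis using per by (intro that[of 0]) (auto simp: polar_def)
  qed (use assms that[of s] in auto)
  have "Arg2pi (polar r s') = 2 * pi * s'"
    using s' assms(1) False by (intro Arg2pi_polar) auto
  then show ?thesis using s' assms by (simp add: radial_def norm_polar)
qed

lemma polar_image: "(\<lambda>(r, s). polar r s) ` ({0..1} \<times> {0..1}) = cball 0 1"
proof
  show "(\<lambda>(r, s). polar r s) ` ({0..1} \<times> {0..1}) \<subseteq> cball 0 1" by (auto simp: norm_polar)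
  show "cball 0 1 \<subseteq> (\<lambda>(r, s). polar r s) ` ({0..1} \<times> {0..1})"
  proof
    fix z :: complex assume "z \<in> cball 0 1"
    moreover obtain s where "0 \<le> s" "s < 1" "z = polar (cmod z) s" by (rule polar_cases)
    ultimately show "z \<in> (\<lambda>(r, s). polar r s) ` ({0..1} \<times> {0..1})"
      by (intro image_eqI[of _ _ "(cmod z, s)"]) auto
  qed
qed

text \<open>By compactness the polar coordinate map is a quotient map from the unit square, so
  \<open>F\<close> only has to be constant on its fibres: the side of radius 0, and opposite points
  of the sides of angle 0 and 1.\<close>

lemma continuous_on_radial:
  fixes F :: "real \<Rightarrow> real \<Rightarrow> 'c::topological_space"
  assumes "continuous_on ({0..1} \<times> {0..1}) (\<lambda>(r, s). F r s)"
    and "\<And>s. 0 \<le> s \<Longrightarrow> s \<le> 1 \<Longrightarrow> F 0 s = F 0 0" "\<And>r. 0 \<le> r \<Longrightarrow> r \<le> 1 \<Longrightarrow> F r 1 = F r 0"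
  shows "continuous_on (cball 0 1) (radial F)"
proof -
  have "continuous_on ((\<lambda>(r, s). polar r s) ` ({0..1} \<times> {0..1})) (radial F)"
  proof (rule continuous_on_compact_quotient)
    show "compact ({0..1::real} \<times> {0..1::real})" by (intro compact_Times) auto
    show "continuous_on ({0..1} \<times> {0..1}) (\<lambda>(r, s). polar r s)"
      unfolding polar_def case_prod_beta by (intro continuous_intros)
    have "(case x of (r, s) \<Rightarrow> F r s) = radial F (case x of (r, s) \<Rightarrow> polar r s)" if x: "x \<in> {0..1} \<times> {0..1}" for x
    proof -
      obtain r s where rs: "x = (r, s)" "0 \<le> r" "r \<le> 1" "0 \<le> s" "s \<le> 1" using x by auto
      then show ?thesis using radial_polar[of r s F, OF rs(2,4,5) assms(2) assms(3)[OF rs(2,3)]] by simp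
    qed
    then show "continuous_on ({0..1} \<times> {0..1}) (\<lambda>x. radial F (case x of (r, s) \<Rightarrow> polar r s))"
      using assms(1) by (simp cong: continuous_on_cong)
  qed
  then show ?thesis by (simp add: polar_image)
qed

text \<open>Injectivity is required only on the open disc. The boundary path may repeat points, so a
  disc can be glued along part of its boundary while other identifications stay open.\<close>

definition disc_map :: "(complex \<Rightarrow> 'c \<Rightarrow> real) \<Rightarrow> ('c \<Rightarrow> real) set \<Rightarrow> (real \<Rightarrow> 'c \<Rightarrow> real) \<Rightarrow> bool" where
  "disc_map f U \<gamma> \<longleftrightarrow> continuous_on (cball 0 1) f \<and> inj_on f (ball 0 1) \<and> f ` ball 0 1 = U \<and>
     (\<forall>s\<in>{0..1}. f (polar 1 s) = \<gamma> s)"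

lemma disc_map_cong:
  assumes "disc_map f U \<gamma>" "\<And>s. 0 \<le> s \<Longrightarrow> s \<le> 1 \<Longrightarrow> \<gamma> s = \<gamma>' s" shows "disc_map f U \<gamma>'"
  using assms by (auto simp: disc_map_def)

text \<open>A reparametrisation of the circle extends along radii to a homeomorphism of the disc
  that preserves the open disc, so the image of the interior is untouched.\<close>

lemma circle_reparam:
  fixes h k :: "real \<Rightarrow> real"
  assumes h: "continuous_on {0..1} h" "h 0 = 0" "h 1 = 1" "\<And>s. s \<in> {0..1} \<Longrightarrow> h s \<in> {0..1}"
    and k: "continuous_on {0..1} k" "k 0 = 0" "k 1 = 1" "\<And>s. s \<in> {0..1} \<Longrightarrow> k s \<in> {0..1}"
    and hk: "\<And>s. s \<in> {0..1} \<Longrightarrow> h (k s) = s" "\<And>s. s \<in> {0..1} \<Longrightarrow> k (h s) = s"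
    and f: "disc_map f U \<gamma>"
  shows "\<exists>f'. disc_map f' U (\<lambda>s. \<gamma> (h s))"
proof -
  let ?H = "\<lambda>g. radial (\<lambda>r s. polar r (g s))"
  have H: "?H g (polar r s) = polar r (g s)" "continuous_on (cball 0 1) (?H g)" "cmod (?H g z) = cmod z"
    if g: "continuous_on {0..1} g" "g 0 = 0" "g 1 = 1" and rs: "0 \<le> r" "0 \<le> s" "s \<le> 1" for g r s z
  proof -
    show "?H g (polar r s) = polar r (g s)" using rs g by (intro radial_polar) (auto simp: polar_def)
    have "continuous_on ({0..1} \<times> {0..1}) (\<lambda>x. g (snd x))"
      by (rule continuous_on_compose2[OF g(1)]) (auto intro: continuous_intros)
    then show "continuous_on (cball 0 1) (?H g)"
      using g by (intro continuous_on_radial) (auto simp: polar_def case_prod_beta intro!: continuous_intros)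
    show "cmod (?H g z) = cmod z" by (simp add: radial_def norm_polar)
  qed
  have inv: "?H g (?H g' z) = z"
    if "continuous_on {0..1} g" "g 0 = 0" "g 1 = 1" "continuous_on {0..1} g'" "g' 0 = 0" "g' 1 = 1"
      "\<And>s. s \<in> {0..1} \<Longrightarrow> g (g' s) = s" "\<And>s. s \<in> {0..1} \<Longrightarrow> g' s \<in> {0..1}" for g g' z
  proof -
    obtain s where s: "0 \<le> s" "s < 1" "z = polar (cmod z) s" by (rule polar_cases)
    have "g' s \<in> {0..1}" using that(8) s by auto
    have "?H g (?H g' (polar (cmod z) s)) = polar (cmod z) (g (g' s))"
      using H(1)[OF that(4-6), of "cmod z" s] H(1)[OF that(1-3), of "cmod z" "g' s"] s \<open>g' s \<in> {0..1}\<close> by auto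
    then show ?thesis using that(7)[of s] s by auto
  qed
  have bij: "?H h ` ball 0 1 = ball 0 1" "inj_on (?H h) (ball 0 1)"
  proof -
    show "?H h ` ball 0 1 = ball 0 1"
    proof
      show "?H h ` ball 0 1 \<subseteq> ball 0 1" using H(3)[OF h(1-3), of 0 0] by auto
      show "ball 0 1 \<subseteq> ?H h ` ball 0 1"
      proof
        fix z :: complex assume "z \<in> ball 0 1"
        then have "?H k z \<in> ball 0 1" "z = ?H h (?H k z)"
          using H(3)[OF k(1-3), of 0 0 z] inv[OF h(1-3) k(1-3) hk(1) k(4), of z] by auto
        then show "z \<in> ?H h ` ball 0 1" by blast
      qed
    qed
    show "inj_on (?H h) (ball 0 1)"
      by (rule inj_on_inverseI[of _ "?H k"]) (rule inv[OF k(1-3) h(1-3) hk(2) h(4)])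
  qed
  have "disc_map (\<lambda>z. f (?H h z)) U (\<lambda>s. \<gamma> (h s))"
    unfolding disc_map_def
  proof (intro conjI ballI)
    have f': "continuous_on (cball 0 1) f" "inj_on f (ball 0 1)" "f ` ball 0 1 = U"
      "\<And>s. s \<in> {0..1} \<Longrightarrow> f (polar 1 s) = \<gamma> s" using f by (auto simp: disc_map_def)
    show "continuous_on (cball 0 1) (\<lambda>z. f (?H h z))"
      using H(2)[OF h(1-3), of 0 0] H(3)[OF h(1-3), of 0 0]
      by (intro continuous_on_compose2[OF f'(1)]) auto
    show "inj_on (\<lambda>z. f (?H h z)) (ball 0 1)"
      using comp_inj_on[OF bij(2)] f'(2) bij(1) by (auto simp: o_def)
    show "(\<lambda>z. f (?H h z)) ` ball 0 1 = U"
      using bij(1) f'(3) by (metis image_image)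
    fix s :: real assume "s \<in> {0..1}"
    then show "f (?H h (polar 1 s)) = \<gamma> (h s)" using H(1)[OF h(1-3), of 1 s] f'(4) h(4) by auto
  qed
  then show ?thesis by blast
qed

text \<open>The piecewise linear homeomorphism of the unit interval that fixes the ends and moves
  the break point from \<open>a\<close> to \<open>b\<close>; exchanging \<open>a\<close> and
  \<open>b\<close> inverts it.\<close>

definition pl :: "real \<Rightarrow> real \<Rightarrow> real \<Rightarrow> real" where
  "pl a b s = (if s \<le> a then b / a * s else b + (1 - b) / (1 - a) * (s - a))"

lemma pl:
  assumes "0 < a" "a < 1" "0 < b" "b < 1"
  shows "continuous_on {0..1} (pl a b)" "pl a b 0 = 0" "pl a b 1 = 1" "s \<in> {0..1} \<Longrightarrow> pl a b s \<in> {0..1}"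
    "s \<in> {0..1} \<Longrightarrow> pl b a (pl a b s) = s"
proof -
  have "continuous_on ({0..a} \<union> {a..1}) (pl a b)"
    unfolding pl_def using assms by (intro continuous_on_If) (auto intro!: continuous_intros)
  moreover have "{0..a} \<union> {a..1} = {0..1}" using assms by auto
  ultimately show "continuous_on {0..1} (pl a b)" by simp
  show "pl a b 0 = 0" "pl a b 1 = 1" using assms by (auto simp: pl_def)
  have 1: "pl a b s \<in> {0..b} \<and> pl b a (pl a b s) = s" if "s \<in> {0..a}"
  proof -
    have "b / a * s \<le> b / a * a" using that assms by (intro mult_left_mono) auto
    then show ?thesis using that assms by (auto simp: pl_def)
  qed
  have 2: "pl a b s \<in> {b<..1} \<and> pl b a (pl a b s) = s" if "s \<in> {a<..1}"
  proof -
    have "(1 - b) / (1 - a) * (s - a) \<le> (1 - b) / (1 - a) * (1 - a)" using that assms by (intro mult_left_mono) auto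
    moreover have "0 < (1 - b) / (1 - a) * (s - a)" using that assms by (intro mult_pos_pos divide_pos_pos) auto
    ultimately show ?thesis using that assms by (auto simp: pl_def)
  qed
  show "s \<in> {0..1} \<Longrightarrow> pl a b s \<in> {0..1}" "s \<in> {0..1} \<Longrightarrow> pl b a (pl a b s) = s"
    using 1 2 assms by (cases "s \<le> a"; force)+
qed

lemma disc_map_pl:
  assumes "0 < a" "a < 1" "0 < b" "b < 1" "disc_map f U \<gamma>"
  shows "\<exists>f'. disc_map f' U (\<lambda>s. \<gamma> (pl a b s))"
  by (rule circle_reparam[of "pl a b" "pl b a", OF pl(1-3)[OF assms(1-4)] _ pl(1-3)[OF assms(3,4,1,2)] _ _ _ assms(5)])
    (use pl(4,5)[OF assms(1-4)] pl(4,5)[OF assms(3,4,1,2)] in auto)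

lemma polar_1: "polar 1 s = Complex (cos (2 * pi * s)) (sin (2 * pi * s))"
  by (simp add: polar_def cis.code)

text \<open>Multiplication by a unit complex number; the case split is the passage of the boundary
  parameter through 1.\<close>

lemma disc_map_rotate:
  assumes f: "disc_map f U \<gamma>" and a: "0 \<le> a" "a \<le> 1"
  shows "disc_map (\<lambda>z. f (z * polar 1 a)) U (\<lambda>s. if s \<le> 1 - a then \<gamma> (s + a) else \<gamma> (s + a - 1))"
  unfolding disc_map_def
proof (intro conjI ballI)
  have f': "continuous_on (cball 0 1) f" "inj_on f (ball 0 1)" "f ` ball 0 1 = U"
    "\<And>s. s \<in> {0..1} \<Longrightarrow> f (polar 1 s) = \<gamma> s" using f by (auto simp: disc_map_def)
  have c: "cmod (polar 1 a) = 1" "polar 1 a \<noteq> 0" by (auto simp: norm_polar polar_def)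
  show "continuous_on (cball 0 1) (\<lambda>z. f (z * polar 1 a))"
    using c by (intro continuous_on_compose2[OF f'(1)]) (auto intro!: continuous_intros simp: norm_mult)
  have im: "(\<lambda>z. z * polar 1 a) ` ball 0 1 = ball 0 1"
  proof
    show "ball 0 1 \<subseteq> (\<lambda>z. z * polar 1 a) ` ball 0 1"
      using c by (intro subsetI image_eqI[of _ _ "_ / polar 1 a"]) (auto simp: norm_divide)
  qed (use c in \<open>auto simp: norm_mult\<close>)
  show "inj_on (\<lambda>z. f (z * polar 1 a)) (ball 0 1)"
    using comp_inj_on[of "\<lambda>z. z * polar 1 a" "ball 0 1" f] f'(2) c(2) unfolding im
    by (auto simp: o_def inj_on_def)
  show "(\<lambda>z. f (z * polar 1 a)) ` ball 0 1 = U"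
    using im f'(3) by (metis image_image)
  fix s :: real assume s: "s \<in> {0..1}"
  have mult: "polar 1 s * polar 1 a = polar 1 (s + a)" by (simp add: polar_def cis_mult algebra_simps)
  have per: "polar 1 (s + a) = polar 1 (s + a - 1)"
  proof -
    have "2 * pi * (s + a) = 2 * pi * (s + a - 1) + 2 * pi" by (simp add: algebra_simps)
    then show ?thesis unfolding polar_1 by (metis cos_periodic sin_periodic)
  qed
  show "f (polar 1 s * polar 1 a) = (if s \<le> 1 - a then \<gamma> (s + a) else \<gamma> (s + a - 1))"
    using f'(4)[of "s + a"] f'(4)[of "s + a - 1"] s a mult per by auto
qed

section \<open>Gluing two discs along half circles\<close>

definition halfh :: "real \<Rightarrow> real" where "halfh x = sqrt (1 - x\<^sup>2)"

text \<open>\<open>halfh x\<close> is half the length of the vertical chord of the disc over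
  \<open>x\<close>.\<close>

lemma Complex_in_ball_iff: "Complex x y \<in> ball 0 1 \<longleftrightarrow> \<bar>x\<bar> < 1 \<and> \<bar>y\<bar> < halfh x"
proof -
  have "Complex x y \<in> ball 0 1 \<longleftrightarrow> y\<^sup>2 < 1 - x\<^sup>2" by (auto simp: cmod_def)
  also have "\<dots> \<longleftrightarrow> \<bar>y\<bar> < halfh x"
    unfolding halfh_def by (metis real_sqrt_abs real_sqrt_less_iff)
  also have "\<dots> \<longleftrightarrow> \<bar>x\<bar> < 1 \<and> \<bar>y\<bar> < halfh x"
  proof -
    have "\<bar>x\<bar> < 1" if "\<bar>y\<bar> < halfh x"
    proof -
      have "0 < halfh x" using that by linarith
      then show ?thesis by (simp add: halfh_def abs_square_less_1)
    qed
    then show ?thesis by blast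
  qed
  finally show ?thesis .
qed

lemma Complex_in_cball_iff: "Complex x y \<in> cball 0 1 \<longleftrightarrow> \<bar>x\<bar> \<le> 1 \<and> \<bar>y\<bar> \<le> halfh x"
proof -
  have "Complex x y \<in> cball 0 1 \<longleftrightarrow> y\<^sup>2 \<le> 1 - x\<^sup>2" by (auto simp: cmod_def)
  also have "\<dots> \<longleftrightarrow> \<bar>y\<bar> \<le> halfh x"
    unfolding halfh_def by (metis real_sqrt_abs real_sqrt_le_iff)
  also have "\<dots> \<longleftrightarrow> \<bar>x\<bar> \<le> 1 \<and> \<bar>y\<bar> \<le> halfh x"
  proof -
    have "\<bar>x\<bar> \<le> 1" if "\<bar>y\<bar> \<le> halfh x"
    proof -
      have "0 \<le> halfh x" using that by linarith
      then show ?thesis by (simp add: halfh_def abs_square_le_1)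
    qed
    then show ?thesis by blast
  qed
  finally show ?thesis .
qed

text \<open>Complex conjugate points of the circle have turns \<open>u / 2\<close> and
  \<open>1 - u / 2\<close> and bound a vertical chord. Gluing matches the lower arc of one disc with
  the upper arc of the other in this way.\<close>

lemma arc_param:
  assumes "\<bar>x\<bar> \<le> 1"
  obtains u where "0 \<le> u" "u \<le> 1" "Complex x (halfh x) = polar 1 (u / 2)" "Complex x (- halfh x) = polar 1 (1 - u / 2)"
    "\<bar>x\<bar> < 1 \<Longrightarrow> 0 < u \<and> u < 1"
proof -
  define u where "u = arccos x / pi"
  have x: "- 1 \<le> x" "x \<le> 1" using assms by auto
  have u: "2 * pi * (u / 2) = arccos x" by (simp add: u_def)
  have u': "2 * pi * (1 - u / 2) = 2 * pi - arccos x" by (simp add: u_def algebra_simps)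
  show thesis
  proof (rule that[of u])
    show "0 \<le> u" "u \<le> 1" using arccos_lbound[OF x] arccos_ubound[OF x] by (auto simp: u_def divide_simps)
    show "Complex x (halfh x) = polar 1 (u / 2)" "Complex x (- halfh x) = polar 1 (1 - u / 2)"
      unfolding polar_1 u u' using x by (simp_all add: sin_arccos halfh_def cos_diff sin_diff)
    show "0 < u \<and> u < 1" if "\<bar>x\<bar> < 1"
      using arccos_lt_bounded[of x] that by (auto simp: u_def divide_simps)
  qed
qed

lemma arc_point:
  assumes "0 \<le> u" "u \<le> 1"
  shows "polar 1 (u / 2) = Complex (cos (pi * u)) (halfh (cos (pi * u)))"
proof -
  have "0 \<le> sin (pi * u)" using assms by (intro sin_ge_zero) (auto simp: mult_le_cancel_left1)
  moreover have "1 - (cos (pi * u))\<^sup>2 = (sin (pi * u))\<^sup>2" by (simp add: sin_squared_eq)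
  ultimately show ?thesis by (simp add: polar_1 halfh_def mult.assoc)
qed

text \<open>\<open>up\<close> stretches each upper half chord to a full chord and \<open>dn\<close>
  each lower one. The diameter goes to the lower arc for \<open>f\<close> and to the upper arc for
  \<open>g\<close>, where the boundary paths agree; its open part becomes the new interior piece
  \<open>B\<close>.\<close>

lemma disc_glue:
  fixes f g :: "complex \<Rightarrow> 'c \<Rightarrow> real"
  assumes f: "disc_map f U \<gamma>" and g: "disc_map g V \<delta>"
    and common: "\<And>u. 0 \<le> u \<Longrightarrow> u \<le> 1 \<Longrightarrow> \<gamma> (1 - u / 2) = \<delta> (u / 2)"
    and inj: "inj_on (\<lambda>u. \<delta> (u / 2)) {0<..<1}" and B: "B = (\<lambda>u. \<delta> (u / 2)) ` {0<..<1}"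
    and disj: "U \<inter> V = {}" "B \<inter> U = {}" "B \<inter> V = {}"
  shows "\<exists>h. disc_map h (U \<union> V \<union> B) (\<lambda>s. if s \<le> 1 / 2 then \<gamma> s else \<delta> s)"
proof -
  have f': "continuous_on (cball 0 1) f" "inj_on f (ball 0 1)" "f ` ball 0 1 = U"
    "\<And>s. s \<in> {0..1} \<Longrightarrow> f (polar 1 s) = \<gamma> s" using f by (auto simp: disc_map_def)
  have g': "continuous_on (cball 0 1) g" "inj_on g (ball 0 1)" "g ` ball 0 1 = V"
    "\<And>s. s \<in> {0..1} \<Longrightarrow> g (polar 1 s) = \<delta> s" using g by (auto simp: disc_map_def)
  define up where "up z = Complex (Re z) (2 * Im z - halfh (Re z))" for z
  define dn where "dn z = Complex (Re z) (2 * Im z + halfh (Re z))" for z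
  define h where "h z = (if 0 \<le> Im z then f (up z) else g (dn z))" for z
  have upc: "up z \<in> cball 0 1" if "z \<in> cball 0 1" "0 \<le> Im z" for z
  proof -
    have "\<bar>Re z\<bar> \<le> 1 \<and> \<bar>Im z\<bar> \<le> halfh (Re z)" using that(1) Complex_in_cball_iff[of "Re z" "Im z"] by simp
    then show ?thesis unfolding up_def Complex_in_cball_iff using that(2) by auto
  qed
  have dnc: "dn z \<in> cball 0 1" if "z \<in> cball 0 1" "Im z \<le> 0" for z
  proof -
    have "\<bar>Re z\<bar> \<le> 1 \<and> \<bar>Im z\<bar> \<le> halfh (Re z)" using that(1) Complex_in_cball_iff[of "Re z" "Im z"] by simp
    then show ?thesis unfolding dn_def Complex_in_cball_iff using that(2) by auto
  qed
  have upb: "up z \<in> ball 0 1" if "z \<in> ball 0 1" "0 < Im z" for z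
  proof -
    have "\<bar>Re z\<bar> < 1 \<and> \<bar>Im z\<bar> < halfh (Re z)" using that(1) Complex_in_ball_iff[of "Re z" "Im z"] by simp
    then show ?thesis unfolding up_def Complex_in_ball_iff using that(2) by auto
  qed
  have dnb: "dn z \<in> ball 0 1" if "z \<in> ball 0 1" "Im z < 0" for z
  proof -
    have "\<bar>Re z\<bar> < 1 \<and> \<bar>Im z\<bar> < halfh (Re z)" using that(1) Complex_in_ball_iff[of "Re z" "Im z"] by simp
    then show ?thesis unfolding dn_def Complex_in_ball_iff using that(2) by auto
  qed
  have mid: "\<exists>u. 0 \<le> u \<and> u \<le> 1 \<and> Complex (Re z) (halfh (Re z)) = polar 1 (u / 2) \<and> f (up z) = \<delta> (u / 2) \<and>
      g (dn z) = \<delta> (u / 2) \<and> (\<bar>Re z\<bar> < 1 \<longrightarrow> 0 < u \<and> u < 1)"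
    if z: "\<bar>Re z\<bar> \<le> 1" "Im z = 0" for z
  proof -
    obtain u where u: "0 \<le> u" "u \<le> 1" "Complex (Re z) (halfh (Re z)) = polar 1 (u / 2)"
      "Complex (Re z) (- halfh (Re z)) = polar 1 (1 - u / 2)" "\<bar>Re z\<bar> < 1 \<Longrightarrow> 0 < u \<and> u < 1"
      using arc_param[OF z(1)] by blast
    have "f (up z) = \<gamma> (1 - u / 2)" using u f'(4)[of "1 - u / 2"] z by (simp add: up_def)
    moreover have "g (dn z) = \<delta> (u / 2)" using u g'(4)[of "u / 2"] z by (simp add: dn_def)
    ultimately show ?thesis using common u by (intro exI[of _ u]) auto
  qed
  have "continuous_on ({z \<in> cball 0 1. 0 \<le> Im z} \<union> {z \<in> cball 0 1. Im z \<le> 0}) h"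
    unfolding h_def
  proof (rule continuous_on_cases)
    have "{z \<in> cball (0 :: complex) 1. 0 \<le> Im z} = cball 0 1 \<inter> {z. 0 \<le> Im z}" by auto
    then show "closed {z \<in> cball (0 :: complex) 1. 0 \<le> Im z}" by (auto simp: closed_halfspace_Im_ge)
    have "{z \<in> cball (0 :: complex) 1. Im z \<le> 0} = cball 0 1 \<inter> {z. Im z \<le> 0}" by auto
    then show "closed {z \<in> cball (0 :: complex) 1. Im z \<le> 0}" by (auto simp: closed_halfspace_Im_le)
    have ud: "continuous_on S up" "continuous_on S dn" for S
      unfolding up_def dn_def halfh_def Complex_eq by (auto intro!: continuous_intros)
    show "continuous_on {z \<in> cball 0 1. 0 \<le> Im z} (\<lambda>z. f (up z))"
      by (rule continuous_on_compose2[OF f'(1) ud(1)]) (use upc in auto)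
    show "continuous_on {z \<in> cball 0 1. Im z \<le> 0} (\<lambda>z. g (dn z))"
      by (rule continuous_on_compose2[OF g'(1) ud(2)]) (use dnc in auto)
    show "\<forall>z. z \<in> {z \<in> cball 0 1. 0 \<le> Im z} \<and> \<not> 0 \<le> Im z \<or> z \<in> {z \<in> cball 0 1. Im z \<le> 0} \<and> 0 \<le> Im z \<longrightarrow> f (up z) = g (dn z)"
    proof (intro allI impI)
      fix z assume "z \<in> {z \<in> cball 0 1. 0 \<le> Im z} \<and> \<not> 0 \<le> Im z \<or> z \<in> {z \<in> cball 0 1. Im z \<le> 0} \<and> 0 \<le> Im z"
      then have z: "z \<in> cball 0 1" "Im z = 0" by auto
      then have "\<bar>Re z\<bar> \<le> 1" using abs_Re_le_cmod[of z] by simp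
      then show "f (up z) = g (dn z)" using mid[of z] z(2) by auto
    qed
  qed
  moreover have "{z \<in> cball 0 1. 0 \<le> Im z} \<union> {z \<in> cball 0 1. Im z \<le> 0} = cball 0 1" by auto
  ultimately have cont: "continuous_on (cball 0 1) h" by simp
  have cases: "(0 < Im z \<and> h z = f (up z) \<and> up z \<in> ball 0 1) \<or> (Im z < 0 \<and> h z = g (dn z) \<and> dn z \<in> ball 0 1) \<or>
      (\<exists>u\<in>{0<..<1}. Im z = 0 \<and> Complex (Re z) (halfh (Re z)) = polar 1 (u / 2) \<and> h z = \<delta> (u / 2))"
    if z: "z \<in> ball 0 1" for z
  proof -
    have "\<bar>Re z\<bar> < 1" using z Complex_in_ball_iff[of "Re z" "Im z"] by simp
    then show ?thesis
      using upb[OF z] dnb[OF z] mid[of z] by (cases "Im z" "0 :: real" rule: linorder_cases) (auto simp: h_def)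
  qed
  have fU: "f z \<in> U" if "z \<in> ball 0 1" for z using that f'(3) by blast
  have gV: "g z \<in> V" if "z \<in> ball 0 1" for z using that g'(3) by blast
  have dB: "\<delta> (u / 2) \<in> B" if "u \<in> {0<..<1}" for u using that B by blast
  have upinj: "z = z'" if "up z = up z'" for z z'
    using that by (auto simp: up_def complex_eq_iff)
  have dninj: "z = z'" if "dn z = dn z'" for z z'
    using that by (auto simp: dn_def complex_eq_iff)
  have "inj_on h (ball 0 1)"
  proof (rule inj_onI)
    fix z z' assume z: "z \<in> ball 0 1" "z' \<in> ball 0 1" "h z = h z'"
    have UVB: "\<not> (t \<in> U \<and> t \<in> V)" "\<not> (t \<in> B \<and> t \<in> U)" "\<not> (t \<in> B \<and> t \<in> V)" for t using disj by auto
    from cases[OF z(1)] consider "h z = f (up z)" "up z \<in> ball 0 1" | "h z = g (dn z)" "dn z \<in> ball 0 1"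
      | u where "u \<in> {0<..<1}" "Im z = 0" "Complex (Re z) (halfh (Re z)) = polar 1 (u / 2)" "h z = \<delta> (u / 2)" by blast
    then show "z = z'"
    proof cases
      case 1
      then have "h z' = f (up z')" "up z' \<in> ball 0 1"
        using cases[OF z(2)] UVB[of "h z"] fU gV dB z(3) by metis+
      then show ?thesis using 1 z(3) f'(2) upinj by (metis inj_onD)
    next
      case 2
      then have "h z' = g (dn z')" "dn z' \<in> ball 0 1"
        using cases[OF z(2)] UVB[of "h z"] fU gV dB z(3) by metis+
      then show ?thesis using 2 z(3) g'(2) dninj by (metis inj_onD)
    next
      case 3
      then obtain u' where "u' \<in> {0<..<1}" "Im z' = 0" "Complex (Re z') (halfh (Re z')) = polar 1 (u' / 2)" "h z' = \<delta> (u' / 2)"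
        using cases[OF z(2)] UVB[of "h z"] fU gV dB z(3) by metis
      moreover from this have "u = u'" using inj 3 z(3) by (auto dest: inj_onD)
      ultimately show ?thesis using 3 by (simp add: complex_eq_iff)
    qed
  qed
  moreover have "h ` ball 0 1 = U \<union> V \<union> B"
  proof
    show "h ` ball 0 1 \<subseteq> U \<union> V \<union> B"
    proof (rule image_subsetI)
      fix z :: complex assume "z \<in> ball 0 1"
      from cases[OF this] show "h z \<in> U \<union> V \<union> B" using fU gV dB by (elim disjE conjE bexE) simp_all
    qed
    show "U \<union> V \<union> B \<subseteq> h ` ball 0 1"
    proof
      fix t assume "t \<in> U \<union> V \<union> B"
      then consider w where "w \<in> ball 0 1" "t = f w" | w where "w \<in> ball 0 1" "t = g w"
        | u where "u \<in> {0<..<1}" "t = \<delta> (u / 2)" using f'(3) g'(3) B by blast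
      then show "t \<in> h ` ball 0 1"
      proof cases
        case 1
        have w: "\<bar>Re w\<bar> < 1 \<and> \<bar>Im w\<bar> < halfh (Re w)" using 1(1) Complex_in_ball_iff[of "Re w" "Im w"] by simp
        let ?z = "Complex (Re w) ((Im w + halfh (Re w)) / 2)"
        have "?z \<in> ball 0 1" "0 \<le> Im ?z" "up ?z = w"
          unfolding Complex_in_ball_iff using w by (auto simp: up_def complex_eq_iff add_divide_distrib)
        then show ?thesis using 1 by (intro image_eqI[of _ _ ?z]) (auto simp: h_def)
      next
        case 2
        have w: "\<bar>Re w\<bar> < 1 \<and> \<bar>Im w\<bar> < halfh (Re w)" using 2(1) Complex_in_ball_iff[of "Re w" "Im w"] by simp
        let ?z = "Complex (Re w) ((Im w - halfh (Re w)) / 2)"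
        have "?z \<in> ball 0 1" "\<not> 0 \<le> Im ?z" "dn ?z = w"
          unfolding Complex_in_ball_iff using w by (auto simp: dn_def complex_eq_iff diff_divide_distrib)
        then show ?thesis using 2 by (intro image_eqI[of _ _ ?z]) (auto simp: h_def)
      next
        case 3
        \<comment> \<open>The point of the diameter below the circle point with turn
          \<open>u / 2\<close>.\<close>
        let ?z = "Complex (cos (pi * u)) 0"
        have s: "0 < sin (pi * u)" using 3(1) by (intro sin_gt_zero) auto
        then have "\<bar>cos (pi * u)\<bar> < 1"
          by (metis abs_square_less_1 less_add_same_cancel1 sin_cos_squared_add3 sin_cos_squared_add2 zero_less_power power2_eq_square)
        moreover from this have "0 < halfh (cos (pi * u))" by (simp add: halfh_def abs_square_less_1)
        ultimately have z: "?z \<in> ball 0 1" unfolding Complex_in_ball_iff by simp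
        from cases[OF z] obtain u' where u': "u' \<in> {0<..<1}" "Complex (Re ?z) (halfh (Re ?z)) = polar 1 (u' / 2)" "h ?z = \<delta> (u' / 2)"
          by auto
        have "polar 1 (u / 2) = polar 1 (u' / 2)" using arc_point[of u] 3(1) u'(2) by simp
        then have "u = u'" using polar_inj(2)[of 1 "u / 2" 1 "u' / 2"] 3(1) u'(1) by auto
        then show ?thesis using 3 u' z by (intro image_eqI[of _ _ ?z]) auto
      qed
    qed
  qed
  moreover have "h (polar 1 s) = (if s \<le> 1 / 2 then \<gamma> s else \<delta> s)" if s: "s \<in> {0..1}" for s
  proof (cases "s \<le> 1 / 2")
    case True
    then have p: "polar 1 s = Complex (cos (pi * (2 * s))) (halfh (cos (pi * (2 * s))))"
      using arc_point[of "2 * s"] s by simp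
    have "0 \<le> halfh (cos (pi * (2 * s)))" by (simp add: halfh_def abs_square_le_1)
    then have "0 \<le> Im (polar 1 s)" "up (polar 1 s) = polar 1 s" by (auto simp: p up_def complex_eq_iff)
    then show ?thesis using True f'(4) s by (simp add: h_def)
  next
    case False
    have "pi < 2 * pi * s" using False by (simp add: field_simps)
    have p: "Re (polar 1 s) = Re (polar 1 (1 - s))" "Im (polar 1 s) = - Im (polar 1 (1 - s))"
    proof -
      have "2 * pi * (1 - s) = 2 * pi - 2 * pi * s" by (simp add: algebra_simps)
      then show "Re (polar 1 s) = Re (polar 1 (1 - s))" "Im (polar 1 s) = - Im (polar 1 (1 - s))"
        by (auto simp: polar_1 cos_diff sin_diff)
    qed
    have q: "polar 1 (1 - s) = Complex (cos (pi * (2 * (1 - s)))) (halfh (cos (pi * (2 * (1 - s)))))"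
    proof -
      have "2 * (1 - s) / 2 = 1 - s" by simp
      then show ?thesis using arc_point[of "2 * (1 - s)"] s False by (simp only:) simp
    qed
    have d: "dn (polar 1 s) = polar 1 s" "up (polar 1 s) = polar 1 s" if "Im (polar 1 s) = 0"
      using that p q by (auto simp: dn_def up_def complex_eq_iff)
    have d': "dn (polar 1 s) = polar 1 s" using p q by (auto simp: dn_def complex_eq_iff)
    have nn: "0 \<le> halfh (cos (pi * (2 * (1 - s))))" by (simp add: halfh_def abs_square_le_1)
    show ?thesis
    proof (cases "Im (polar 1 s) = 0")
      case True
      have "\<bar>Re (polar 1 s)\<bar> \<le> 1" using abs_Re_le_cmod[of "polar 1 s"] by (simp add: norm_polar)
      from mid[OF this True] have "f (up (polar 1 s)) = g (dn (polar 1 s))" by auto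
      then show ?thesis using True False d' g'(4) s by (simp add: h_def)
    next
      case False
      then have "\<not> 0 \<le> Im (polar 1 s)" using p q nn by auto
      then show ?thesis using \<open>\<not> s \<le> 1 / 2\<close> d' g'(4) s by (simp add: h_def)
    qed
  qed
  ultimately show ?thesis using cont unfolding disc_map_def by blast
qed

section \<open>Cutting, rotating and joining boundary words\<close>

definition elen :: "'c list \<Rightarrow> real" where "elen w = real (length w - 1)"

lemma elen_pos: "2 \<le> length w \<Longrightarrow> 0 < elen w"
  by (simp add: elen_def)

definition unif :: "'c list \<Rightarrow> real \<Rightarrow> 'c \<Rightarrow> real" where "unif w s = upath w (elen w * s)"

definition join_half :: "(real \<Rightarrow> 'd) \<Rightarrow> (real \<Rightarrow> 'd) \<Rightarrow> real \<Rightarrow> 'd" where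
  "join_half p q s = (if s \<le> 1 / 2 then p (2 * s) else q (2 * s - 1))"

lemma unif_ends: "2 \<le> length w \<Longrightarrow> unif w 0 = seg (hd w) (hd w) 0" "2 \<le> length w \<Longrightarrow> unif w 1 = seg (last w) (last w) 0"
  using upath_start upath_end[folded elen_def] by (auto simp: unif_def)

lemma unif_rev: "2 \<le> length w \<Longrightarrow> 0 \<le> s \<Longrightarrow> s \<le> 1 \<Longrightarrow> unif (rev w) s = unif w (1 - s)"
  unfolding unif_def using upath_rev[folded elen_def, of w "elen w * s"] mult_left_le[of s "elen w"]
  by (simp add: right_diff_distrib elen_def)

lemma elen_join:
  assumes "2 \<le> length w" "2 \<le> length w'" shows "elen (w @ tl w') = elen w + elen w'"
  using assms by (simp add: of_nat_diff elen_def)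

lemma unif_join1:
  assumes "2 \<le> length w" "2 \<le> length w'" "0 \<le> s" "s \<le> elen w / (elen w + elen w')"
  shows "unif (w @ tl w') s = unif w (s * (elen w + elen w') / elen w)"
proof -
  have "0 < elen w" "0 < elen w'" using assms elen_pos by auto
  then have "(elen w + elen w') * s \<le> elen w" using assms(4) by (simp add: field_simps)
  moreover have "0 \<le> (elen w + elen w') * s" using assms(3) \<open>0 < elen w\<close> \<open>0 < elen w'\<close> by simp
  ultimately show ?thesis unfolding unif_def elen_join[OF assms(1,2)]
    using upath_append1[folded elen_def, OF assms(1), of "(elen w + elen w') * s" "tl w'"] assms \<open>0 < elen w\<close> by (simp add: mult.commute)
qed

lemma unif_join2:
  assumes "2 \<le> length w" "2 \<le> length w'" "last w = hd w'" "elen w / (elen w + elen w') \<le> s" "s \<le> 1"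
  shows "unif (w @ tl w') s = unif w' ((s * (elen w + elen w') - elen w) / elen w')"
proof -
  have p: "0 < elen w" "0 < elen w'" using assms elen_pos by auto
  define y where "y = (elen w + elen w') * s - elen w"
  have "elen w \<le> (elen w + elen w') * s" using assms(4) p by (simp add: field_simps)
  moreover have "(elen w + elen w') * s \<le> elen w + elen w'" using p assms(5) by (simp add: mult_left_le)
  ultimately have y: "0 \<le> y" "y \<le> elen w'" by (auto simp: y_def)
  have "w \<noteq> []" using assms by auto
  from upath_append2[folded elen_def, OF this assms(2,3) y]
  have "unif (w @ tl w') s = upath w' y" unfolding unif_def elen_join[OF assms(1,2)] by (simp add: y_def)
  also have "y = elen w' * ((s * (elen w + elen w') - elen w) / elen w')" using p by (simp add: y_def mult.commute)
  finally show ?thesis unfolding unif_def .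
qed

text \<open>At constant speed the first piece of a joined word takes a share proportional to its
  length, whereas gluing wants half of the circle; \<open>pl\<close> moves one break point to the
  other.\<close>

lemma unif_join_pl:
  assumes "2 \<le> length w" "2 \<le> length w'" "last w = hd w'" and s: "0 \<le> s" "s \<le> 1"
  shows "unif (w @ tl w') (pl (1/2) (elen w / (elen w + elen w')) s) = join_half (unif w) (unif w') s"
proof -
  let ?a = "elen w / (elen w + elen w')"
  have p: "0 < elen w" "0 < elen w'" using assms elen_pos by auto
  then have a: "0 < ?a" "?a < 1" by (auto simp: field_simps)
  show ?thesis
  proof (cases "s \<le> 1/2")
    case True
    then have e: "pl (1/2) ?a s = ?a * (2 * s)" by (simp add: pl_def)
    have "?a * (2 * s) \<le> ?a" using True a by (intro mult_left_le) auto
    moreover have "0 \<le> ?a * (2 * s)" using a s by (intro mult_nonneg_nonneg) auto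
    moreover have "?a * (2 * s) * (elen w + elen w') / elen w = 2 * s" using p by simp
    ultimately show ?thesis using unif_join1[OF assms(1,2), of "?a * (2 * s)"] True
      by (simp add: e join_half_def)
  next
    case False
    then have e: "pl (1/2) ?a s = ?a + (1 - ?a) * (2 * s - 1)" by (simp add: pl_def algebra_simps)
    have "(1 - ?a) * (2 * s - 1) \<le> 1 - ?a" using a s by (intro mult_left_le) auto
    moreover have "0 \<le> (1 - ?a) * (2 * s - 1)" using a False by simp
    moreover have "((?a + (1 - ?a) * (2 * s - 1)) * (elen w + elen w') - elen w) / elen w' = 2 * s - 1"
    proof -
      have "?a * (elen w + elen w') = elen w" using p by simp
      moreover have "(1 - ?a) * (elen w + elen w') = elen w'" using p by (simp add: left_diff_distrib)
      moreover have "(x + y * t) * z = x * z + (y * z) * t" for x y z t :: real by (simp add: algebra_simps)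
      ultimately have "(?a + (1 - ?a) * (2 * s - 1)) * (elen w + elen w') = elen w + elen w' * (2 * s - 1)"
        by (simp only:)
      then show ?thesis using p by simp
    qed
    ultimately show ?thesis
      using unif_join2[OF assms(1-3), of "?a + (1 - ?a) * (2 * s - 1)"] False by (simp add: e join_half_def)
  qed
qed

text \<open>The boundary is reparametrised so that the cut falls on the point -1 of the circle,
  where the two arcs used for gluing meet.\<close>

lemma disc_map_split:
  assumes "2 \<le> length w" "2 \<le> length w'" "last w = hd w'" "disc_map f U (unif (w @ tl w'))"
  shows "\<exists>f'. disc_map f' U (join_half (unif w) (unif w'))"
proof -
  let ?a = "elen w / (elen w + elen w')"
  have p: "0 < elen w" "0 < elen w'" using assms elen_pos by auto
  then have a: "0 < ?a" "?a < 1" by (auto simp: field_simps)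
  obtain f' where f': "disc_map f' U (\<lambda>s. unif (w @ tl w') (pl (1/2) ?a s))"
    using disc_map_pl[of "1/2" ?a f U "unif (w @ tl w')"] a assms(4) by auto
  then show ?thesis using disc_map_cong[OF f'] unif_join_pl[OF assms(1-3)] by blast
qed

lemma disc_map_merge:
  assumes "2 \<le> length w" "2 \<le> length w'" "last w = hd w'" "disc_map f U (join_half (unif w) (unif w'))"
  shows "\<exists>f'. disc_map f' U (unif (w @ tl w'))"
proof -
  let ?a = "elen w / (elen w + elen w')"
  have p: "0 < elen w" "0 < elen w'" using assms elen_pos by auto
  then have a: "0 < ?a" "?a < 1" by (auto simp: field_simps)
  obtain f' where f': "disc_map f' U (\<lambda>s. join_half (unif w) (unif w') (pl ?a (1/2) s))"
    using disc_map_pl[of ?a "1/2" f U "join_half (unif w) (unif w')"] a assms(4) by auto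
  have "join_half (unif w) (unif w') (pl ?a (1/2) s) = unif (w @ tl w') s" if s: "0 \<le> s" "s \<le> 1" for s
  proof (cases "s \<le> ?a")
    case True
    then have e: "pl ?a (1/2) s = s / ?a / 2" by (simp add: pl_def mult.commute)
    have "s / ?a \<le> 1" using True a by (simp only: pos_divide_le_eq)
    then have h: "s / ?a / 2 \<le> 1 / 2" by (rule divide_right_mono) simp
    have "2 * (s / ?a / 2) = s * (elen w + elen w') / elen w" by simp
    then show ?thesis
      unfolding e join_half_def if_P[OF h] unif_join1[OF assms(1,2) s(1) True] by (rule arg_cong)
  next
    case False
    then have e: "pl ?a (1/2) s = 1/2 + (s - ?a) / (1 - ?a) / 2" by (simp add: pl_def)
    have pos: "0 < (s - ?a) / (1 - ?a)" using False a by simp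
    have jh: "join_half p q (1/2 + x / 2) = q x" if "0 < x" for p q :: "real \<Rightarrow> 'a \<Rightarrow> real" and x
      using that by (simp add: join_half_def)
    have "(s * (elen w + elen w') - elen w) / elen w' = (s - ?a) / (1 - ?a)"
    proof -
      have "1 - ?a = elen w' / (elen w + elen w')" using p by (simp add: field_simps)
      moreover have "s - ?a = (s * (elen w + elen w') - elen w) / (elen w + elen w')" using p by (simp add: field_simps)
      ultimately show ?thesis using p by simp
    qed
    moreover have "?a \<le> s" using False by simp
    ultimately show ?thesis using unif_join2[OF assms(1-3), of s] s(2) by (simp only: e jh[OF pos])
  qed
  then show ?thesis using disc_map_cong[OF f'] by blast
qed

text \<open>Once each part of the word takes half of the circle, a half turn of the disc exchanges
  them.\<close>

lemma disc_map_swap: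
  assumes "2 \<le> length w" "2 \<le> length w'" "last w = hd w'" "last w' = hd w" "disc_map f U (unif (w @ tl w'))"
  shows "\<exists>f'. disc_map f' U (unif (w' @ tl w))"
proof -
  obtain f1 where f1: "disc_map f1 U (join_half (unif w) (unif w'))"
    using disc_map_split[OF assms(1-3,5)] by blast
  let ?g = "\<lambda>s. if s \<le> 1 - 1/2 then join_half (unif w) (unif w') (s + 1/2) else join_half (unif w) (unif w') (s + 1/2 - 1)"
  have "disc_map (\<lambda>z. f1 (z * polar 1 (1/2))) U ?g"
    by (rule disc_map_rotate[OF f1]) auto
  moreover have "?g s = join_half (unif w') (unif w) s" if "0 \<le> s" "s \<le> 1" for s
    using that unif_ends[of w] unif_ends[of w'] assms(1-4)
    by (cases "s = 0") (auto simp: join_half_def algebra_simps)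
  ultimately have "disc_map (\<lambda>z. f1 (z * polar 1 (1/2))) U (join_half (unif w') (unif w))"
    by (rule disc_map_cong)
  then show ?thesis by (rule disc_map_merge[OF assms(2,1,4)])
qed

text \<open>The old boundary reads \<alpha> \<beta>, that of the new disc \<beta> reversed followed
  by \<delta>; gluing along \<beta> leaves \<alpha> \<delta>. Only the open arc \<beta> has to be
  new and embedded, since its ends stay on the boundary.\<close>

lemma disc_map_attach:
  assumes len: "2 \<le> length \<alpha>" "2 \<le> length \<beta>" "2 \<le> length \<delta>"
    and ends: "last \<alpha> = hd \<beta>" "last \<beta> = hd \<alpha>" "hd \<delta> = hd \<beta>" "last \<delta> = last \<beta>"
    and f: "disc_map f U (unif (\<alpha> @ tl \<beta>))" and g: "disc_map g V (unif (rev \<beta> @ tl \<delta>))"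
    and inj: "inj_on (unif \<beta>) {0<..<1}" and disj: "U \<inter> V = {}" "unif \<beta> ` {0<..<1} \<inter> U = {}" "unif \<beta> ` {0<..<1} \<inter> V = {}"
  shows "\<exists>h. disc_map h (U \<union> V \<union> unif \<beta> ` {0<..<1}) (unif (\<alpha> @ tl \<delta>))"
proof -
  obtain f1 where f1: "disc_map f1 U (join_half (unif \<alpha>) (unif \<beta>))"
    using disc_map_split[OF len(1,2) ends(1) f] by blast
  have "last (rev \<beta>) = hd \<delta>" using len(2) ends(3) by (simp add: last_rev)
  then obtain g1 where g1: "disc_map g1 V (join_half (unif (rev \<beta>)) (unif \<delta>))"
    using disc_map_split[OF _ len(3) _ g] len(2) by auto
  have rev: "join_half (unif (rev \<beta>)) (unif \<delta>) (u / 2) = unif \<beta> (1 - u)" if "0 \<le> u" "u \<le> 1" for u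
    using that len(2) unif_rev[of \<beta> u] by (simp add: join_half_def)
  have im: "unif \<beta> ` {0<..<1} = (\<lambda>u. join_half (unif (rev \<beta>)) (unif \<delta>) (u / 2)) ` {0<..<1}"
  proof -
    have "(\<lambda>u. join_half (unif (rev \<beta>)) (unif \<delta>) (u / 2)) ` {0<..<1} = (\<lambda>u. unif \<beta> (1 - u)) ` {0<..<1}"
      by (intro image_cong) (auto simp: rev)
    also have "\<dots> = unif \<beta> ` ((\<lambda>u. 1 - u) ` {0<..<1})" by (simp add: image_image)
    also have "(\<lambda>u. 1 - u) ` {0<..<1} = {0<..<1 :: real}"
      by (auto intro!: image_eqI[of _ _ "1 - _"])
    finally show ?thesis by simp
  qed
  have "\<exists>h. disc_map h (U \<union> V \<union> unif \<beta> ` {0<..<1})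
     (\<lambda>s. if s \<le> 1 / 2 then join_half (unif \<alpha>) (unif \<beta>) s else join_half (unif (rev \<beta>)) (unif \<delta>) s)"
  proof (rule disc_glue[OF f1 g1 _ _ im disj])
    show "join_half (unif \<alpha>) (unif \<beta>) (1 - u / 2) = join_half (unif (rev \<beta>)) (unif \<delta>) (u / 2)" if "0 \<le> u" "u \<le> 1" for u
    proof (cases "u = 1")
      case True
      then show ?thesis unfolding rev[OF that] using unif_ends[of \<alpha>] unif_ends[of \<beta>] len ends by (simp add: join_half_def)
    next
      case False
      then show ?thesis unfolding rev[OF that] using that by (simp add: join_half_def)
    qed
    show "inj_on (\<lambda>u. join_half (unif (rev \<beta>)) (unif \<delta>) (u / 2)) {0<..<1}"
    proof (rule inj_onI)
      fix u u' :: real assume "u \<in> {0<..<1}" "u' \<in> {0<..<1}"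
        "join_half (unif (rev \<beta>)) (unif \<delta>) (u / 2) = join_half (unif (rev \<beta>)) (unif \<delta>) (u' / 2)"
      then have "unif \<beta> (1 - u) = unif \<beta> (1 - u')" "1 - u \<in> {0<..<1}" "1 - u' \<in> {0<..<1}" using rev by auto
      then have "1 - u = 1 - u'" using inj by (auto dest: inj_onD)
      then show "u = u'" by simp
    qed
  qed
  then obtain h where "disc_map h (U \<union> V \<union> unif \<beta> ` {0<..<1})
     (\<lambda>s. if s \<le> 1 / 2 then join_half (unif \<alpha>) (unif \<beta>) s else join_half (unif (rev \<beta>)) (unif \<delta>) s)" by blast
  then have "disc_map h (U \<union> V \<union> unif \<beta> ` {0<..<1}) (join_half (unif \<alpha>) (unif \<delta>))"
    by (rule disc_map_cong) (simp add: join_half_def)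
  moreover have "last \<alpha> = hd \<delta>" using ends by simp
  ultimately show ?thesis by (intro disc_map_merge[OF len(1,3)])
qed

text \<open>Points of two half-open segments agree only at a common start, along the same segment,
  or along the same segment reversed. The reversed case is the one that a simple closed path must
  exclude.\<close>

lemma seg_eqD:
  assumes "c \<noteq> d" "c' \<noteq> d'" "0 \<le> \<theta>" "\<theta> < 1" "0 \<le> \<phi>" "\<phi> < 1" "seg c d \<theta> = seg c' d' \<phi>"
  shows "(\<theta> = 0 \<and> \<phi> = 0 \<and> c = c') \<or> (c = c' \<and> d = d' \<and> \<theta> = \<phi>) \<or> (c = d' \<and> d = c' \<and> \<theta> = 1 - \<phi>)"
  using fun_cong[OF assms(7), of c] fun_cong[OF assms(7), of d] fun_cong[OF assms(7), of c'] fun_cong[OF assms(7), of d'] assms(1-6)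
  unfolding seg_def by (auto split: if_splits)

text \<open>At least three segments are needed: with two, the closed path would run back over its
  first segment. With more, two positions are never cyclic successors of each other.\<close>

lemma inj_on_unif_closed:
  assumes w: "4 \<le> length w" "distinct (butlast w)" "hd w = last w"
  shows "inj_on (unif w) {0..<1}"
proof (rule inj_onI)
  fix s s' :: real assume s: "s \<in> {0..<1}" "s' \<in> {0..<1}" "unif w s = unif w s'"
  let ?m = "length w - 1"
  have nth: "w ! i = w ! j \<longleftrightarrow> i = j" if "i < ?m" "j < ?m" for i j
    using w(2) that by (metis distinct_conv_nth length_butlast nth_butlast)
  have last: "w ! ?m = w ! 0"
    using w by (metis hd_conv_nth last_conv_nth length_0_conv not_numeral_le_zero)
  have par: "\<exists>i \<theta>. i < ?m \<and> 0 \<le> \<theta> \<and> \<theta> < 1 \<and> elen w * s = real i + \<theta> \<and> unif w s = seg (w ! i) (w ! Suc i) \<theta> \<and> w ! i \<noteq> w ! Suc i"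
    if "s \<in> {0..<1}" for s :: real
  proof (intro exI conjI)
    let ?i = "nat \<lfloor>elen w * s\<rfloor>" and ?\<theta> = "elen w * s - real (nat \<lfloor>elen w * s\<rfloor>)"
    have "0 \<le> elen w * s" "elen w * s < elen w" using that w(1) by (auto simp: elen_def)
    then show i: "?i < ?m" "0 \<le> ?\<theta>" "?\<theta> < 1" "elen w * s = real ?i + ?\<theta>" unfolding elen_def by linarith+
    show "unif w s = seg (w ! ?i) (w ! Suc ?i) ?\<theta>"
      unfolding unif_def using upath_seg[of ?i w ?\<theta>] i(1-3) by (simp flip: i(4))
    show "w ! ?i \<noteq> w ! Suc ?i"
    proof (cases "Suc ?i < ?m")
      case True
      then show ?thesis using nth[of ?i "Suc ?i"] i(1) by simp
    next
      case False
      then have "Suc ?i = ?m" using i(1) by simp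
      moreover from this have "?i \<noteq> 0" using w(1) by linarith
      ultimately show ?thesis using nth[of ?i 0] i(1) last w(1) by simp
    qed
  qed
  obtain i \<theta> where i: "i < ?m" "0 \<le> \<theta>" "\<theta> < 1" "elen w * s = real i + \<theta>" "unif w s = seg (w ! i) (w ! Suc i) \<theta>" "w ! i \<noteq> w ! Suc i"
    using par[OF s(1)] by blast
  obtain j \<phi> where j: "j < ?m" "0 \<le> \<phi>" "\<phi> < 1" "elen w * s' = real j + \<phi>" "unif w s' = seg (w ! j) (w ! Suc j) \<phi>" "w ! j \<noteq> w ! Suc j"
    using par[OF s(2)] by blast
  have suc: "w ! Suc k = w ! (if Suc k = ?m then 0 else Suc k)" for k using last by auto
  have "\<not> (w ! i = w ! Suc j \<and> w ! Suc i = w ! j)"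
  proof
    assume *: "w ! i = w ! Suc j \<and> w ! Suc i = w ! j"
    have lt: "(if Suc k = ?m then 0 else Suc k) < ?m" if "k < ?m" for k using that by auto
    have "i = (if Suc j = ?m then 0 else Suc j)"
      by (rule iffD1[OF nth[OF i(1) lt[OF j(1)]] trans[OF conjunct1[OF *] suc]])
    moreover have "j = (if Suc i = ?m then 0 else Suc i)"
      by (rule iffD1[OF nth[OF j(1) lt[OF i(1)]] trans[OF conjunct2[OF *, symmetric] suc]])
    ultimately have "(Suc j = ?m \<and> i = 0) \<or> i = Suc j" "(Suc i = ?m \<and> j = 0) \<or> j = Suc i"
      by presburger+
    then show False using w(1) by linarith
  qed
  then have "i = j \<and> \<theta> = \<phi>"
    using seg_eqD[OF i(6) j(6) i(2,3) j(2,3)] s(3) i(5) j(5) nth[OF i(1) j(1)] by auto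
  then have "elen w * s = elen w * s'" using i(4) j(4) by simp
  then show "s = s'" using elen_pos[of w] w(1) by simp
qed

text \<open>The mean of the positions \<open>j\<close>, weighted by the values at
  \<open>w ! j\<close>, is the parameter times \<open>elen w\<close>; this is an explicit left
  inverse.\<close>

lemma inj_on_unif_distinct:
  assumes w: "2 \<le> length w" "distinct w"
  shows "inj_on (unif w) {0..1}"
proof (rule inj_on_inverseI)
  fix s :: real assume s: "s \<in> {0..1}"
  have "0 \<le> elen w * s" "elen w * s \<le> elen w" using s elen_pos[OF w(1)] by (auto simp: mult_left_le)
  then obtain i \<theta> where i: "Suc i < length w" "0 \<le> \<theta>" "\<theta> \<le> 1" "elen w * s = real i + \<theta>"
    by (rule segment_param[folded elen_def, OF w(1)])
  have "(\<Sum>j<length w. real j * unif w s (w ! j)) =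
    (\<Sum>j<length w. (if j = i then real i * (1 - \<theta>) else 0) + (if j = Suc i then real (Suc i) * \<theta> else 0))"
  proof (rule sum.cong[OF refl])
    fix j assume "j \<in> {..<length w}"
    then have "w ! j = w ! i \<longleftrightarrow> j = i" "w ! j = w ! Suc i \<longleftrightarrow> j = Suc i"
      using w(2) i(1) by (auto simp: nth_eq_iff_index_eq)
    then show "real j * unif w s (w ! j) = (if j = i then real i * (1 - \<theta>) else 0) + (if j = Suc i then real (Suc i) * \<theta> else 0)"
      unfolding unif_def i(4) upath_seg[OF i(1-3)] by (auto simp: seg_def)
  qed
  also have "\<dots> = real i + \<theta>" using i(1) by (simp add: sum.distrib algebra_simps)
  also have "\<dots> = elen w * s" using i(4) by simp
  finally show "(\<Sum>j<length w. real j * unif w s (w ! j)) / elen w = s" using elen_pos[OF w(1)] by simp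
qed

text \<open>\<open>Q\<close> does not occur on the path, so its weight is \<open>1 - r\<close> and
  gives back the radius; the remaining weights, divided by \<open>r\<close>, give the point of the
  path.\<close>

lemma disc_map_cone:
  assumes w: "4 \<le> length w" "distinct (butlast w)" "hd w = last w" and Q: "Q \<notin> set w"
  shows "\<exists>f. disc_map f {(\<lambda>c. r * unif w s c + (1 - r) * (if c = Q then 1 else 0)) | r s. 0 \<le> r \<and> r < 1 \<and> 0 \<le> s \<and> s \<le> 1} (unif w)"
proof -
  define F where "F r s = (\<lambda>c. r * unif w s c + (1 - r) * (if c = Q then 1 else 0))" for r s
  have per: "F r 1 = F r 0" for r
    using unif_ends[of w] w by (simp add: F_def)
  have Q0: "unif w s Q = 0" for s
    using Q unfolding unif_def upath_def by (intro sum.neutral) auto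
  have FQ: "F r s Q = 1 - r" for r s by (simp add: F_def Q0)
  have rad: "radial F (polar r s) = F r s" if "0 \<le> r" "0 \<le> s" "s \<le> 1" for r s
    using that per by (intro radial_polar) (auto simp: F_def)
  have "continuous_on ({0..1} \<times> {0..1}) (\<lambda>x. F (fst x) (snd x))"
  proof (rule continuous_on_coordinatewise_then_product)
    fix c
    have "continuous_on UNIV (\<lambda>x. unif w x c)"
      unfolding unif_def by (rule continuous_on_compose2[of UNIV "\<lambda>t. upath w t c"])
        (auto intro!: continuous_intros continuous_on_product_then_coordinatewise[OF continuous_on_upath])
    then have "continuous_on ({0..1} \<times> {0..1}) (\<lambda>x. unif w (snd x) c)"
      by (rule continuous_on_compose2) (auto intro: continuous_intros)
    then show "continuous_on ({0..1} \<times> {0..1}) (\<lambda>x. F (fst x) (snd x) c)"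
      unfolding F_def by (auto intro!: continuous_intros)
  qed
  then have cont: "continuous_on (cball 0 1) (radial F)"
    using per by (intro continuous_on_radial) (auto simp: F_def case_prod_beta)
  have "inj_on (radial F) (ball 0 1)"
  proof (rule inj_onI)
    fix z z' :: complex assume z: "z \<in> ball 0 1" "z' \<in> ball 0 1" "radial F z = radial F z'"
    obtain s where s: "0 \<le> s" "s < 1" "z = polar (cmod z) s" by (rule polar_cases)
    obtain s' where s': "0 \<le> s'" "s' < 1" "z' = polar (cmod z') s'" by (rule polar_cases)
    have eq: "F (cmod z) s = F (cmod z') s'"
      using z(3) rad[of "cmod z" s] rad[of "cmod z'" s'] s s' by simp
    then have r: "cmod z = cmod z'" using FQ by (metis diff_left_imp_eq diff_eq_diff_eq add_diff_cancel_left' diff_diff_eq2 eq_iff_diff_eq_0)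
    show "z = z'"
    proof (cases "z = 0")
      case False
      have "unif w s = unif w s'"
      proof
        fix c show "unif w s c = unif w s' c"
          using fun_cong[OF eq, of c] False unfolding F_def r[symmetric] by simp
      qed
      then have "s = s'" using inj_on_unif_closed[OF w] s s' by (auto dest: inj_onD)
      then show ?thesis using s s' r by metis
    qed (use r in auto)
  qed
  moreover have "radial F ` ball 0 1 = {F r s | r s. 0 \<le> r \<and> r < 1 \<and> 0 \<le> s \<and> s \<le> 1}"
  proof
    show "radial F ` ball 0 1 \<subseteq> {F r s | r s. 0 \<le> r \<and> r < 1 \<and> 0 \<le> s \<and> s \<le> 1}"
    proof (rule image_subsetI)
      fix z :: complex assume z: "z \<in> ball 0 1"
      obtain s where s: "0 \<le> s" "s < 1" "z = polar (cmod z) s" by (rule polar_cases)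
      then have "radial F z = F (cmod z) s" using rad[of "cmod z" s] by simp
      then show "radial F z \<in> {F r s | r s. 0 \<le> r \<and> r < 1 \<and> 0 \<le> s \<and> s \<le> 1}" using z s by force
    qed
    show "{F r s | r s. 0 \<le> r \<and> r < 1 \<and> 0 \<le> s \<and> s \<le> 1} \<subseteq> radial F ` ball 0 1"
    proof clarify
      fix r s :: real assume "0 \<le> r" "r < 1" "0 \<le> s" "s \<le> 1"
      then show "F r s \<in> radial F ` ball 0 1" using rad[of r s] norm_polar[of r s]
        by (intro image_eqI[of _ _ "polar r s"]) auto
    qed
  qed
  moreover have "radial F (polar 1 s) = unif w s" if "s \<in> {0..1}" for s
    using rad[of 1 s] that by (simp add: F_def)
  ultimately have "disc_map (radial F) {F r s | r s. 0 \<le> r \<and> r < 1 \<and> 0 \<le> s \<and> s \<le> 1} (unif w)"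
    using cont unfolding disc_map_def by blast
  then show ?thesis unfolding F_def by blast
qed

section \<open>Complexes of quadrilaterals\<close>

text \<open>The barycentric subdivision of an edge path: vertices and edges alternate, each written
  as its set of vertices.\<close>

fun nodes :: "'v list \<Rightarrow> 'v set list" where
  "nodes [] = []"
| "nodes [a] = [{a}]"
| "nodes (a # b # xs) = {a} # {a, b} # nodes (b # xs)"

lemma length_nodes: "length (nodes vs) = 2 * length vs - 1"
  by (induction vs rule: nodes.induct) auto

lemma nodes_eq_Nil_iff [simp]: "nodes vs = [] \<longleftrightarrow> vs = []"
  by (cases vs rule: nodes.cases) auto

lemma hd_nodes: "vs \<noteq> [] \<Longrightarrow> hd (nodes vs) = {hd vs}"
  by (cases vs rule: nodes.cases) auto

lemma last_nodes: "vs \<noteq> [] \<Longrightarrow> last (nodes vs) = {last vs}"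
  by (induction vs rule: nodes.induct) auto

lemma nodes_join:
  assumes "xs \<noteq> []" "ys \<noteq> []" "last xs = hd ys"
  shows "nodes (xs @ tl ys) = nodes xs @ tl (nodes ys)"
  using assms
proof (induction xs rule: nodes.induct)
  case (2 a)
  then show ?case by (cases ys rule: nodes.cases) auto
qed auto

lemma nodes_rev: "nodes (rev vs) = rev (nodes vs)"
proof (induction vs rule: nodes.induct)
  case (3 a b xs)
  have "nodes (rev (b # xs) @ tl [b, a]) = nodes (rev (b # xs)) @ tl (nodes [b, a])"
    by (rule nodes_join) auto
  then show ?case using 3 by (auto simp: insert_commute)
qed auto

lemma nodes_nth_even: "j < length vs \<Longrightarrow> nodes vs ! (2 * j) = {vs ! j}"
proof (induction vs arbitrary: j rule: nodes.induct)
  case (3 a b xs) then show ?case by (cases j) auto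
qed auto

lemma nodes_nth_odd: "Suc j < length vs \<Longrightarrow> nodes vs ! (2 * j + 1) = {vs ! j, vs ! Suc j}"
proof (induction vs arbitrary: j rule: nodes.induct)
  case (3 a b xs) then show ?case by (cases j) auto
qed auto

lemma in_nodesE:
  assumes "c \<in> set (nodes vs)"
  obtains j where "j < length vs" "c = {vs ! j}" "c = nodes vs ! (2 * j)"
  | j where "Suc j < length vs" "c = {vs ! j, vs ! Suc j}" "c = nodes vs ! (2 * j + 1)"
proof -
  obtain i where i: "i < 2 * length vs - 1" "c = nodes vs ! i"
    using assms by (auto simp: in_set_conv_nth length_nodes)
  show thesis
  proof (cases "even i")
    case True
    then obtain j where "i = 2 * j" by auto
    then show thesis using i that(1)[of j] nodes_nth_even[of j vs] by auto
  next
    case False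
    then obtain j where "i = 2 * j + 1" by (auto elim: oddE)
    then show thesis using i that(2)[of j] nodes_nth_odd[of j vs] by auto
  qed
qed

definition chain_sets :: "'v set set \<Rightarrow> bool" where
  "chain_sets S \<longleftrightarrow> (\<forall>c\<in>S. \<forall>d\<in>S. c \<subseteq> d \<or> d \<subseteq> c)"

text \<open>Distinct vertices are incomparable and so are distinct edges, hence a chain has at most
  one of each. If both occur they are incident, and the vertex stands right before or right after
  the edge in \<open>nodes\<close>.\<close>

lemma chain_in_nodes:
  assumes vs: "2 \<le> length vs" "\<And>j. Suc j < length vs \<Longrightarrow> vs ! j \<noteq> vs ! Suc j"
    and S: "S \<subseteq> set (nodes vs)" "S \<noteq> {}" "chain_sets S"
  obtains i where "Suc i < length (nodes vs)" "S \<subseteq> {nodes vs ! i, nodes vs ! Suc i}"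
proof (cases "\<exists>j. Suc j < length vs \<and> {vs ! j, vs ! Suc j} \<in> S")
  case True
  then obtain j where j: "Suc j < length vs" "{vs ! j, vs ! Suc j} \<in> S" by auto
  let ?e = "{vs ! j, vs ! Suc j}"
  have sub: "d = ?e \<or> d = {vs ! j} \<or> d = {vs ! Suc j}" if "d \<in> S" for d
  proof -
    have cmp: "d \<subseteq> ?e \<or> ?e \<subseteq> d" using S(3)[unfolded chain_sets_def, rule_format, OF that j(2)] .
    from that S(1) have "d \<in> set (nodes vs)" by auto
    then show ?thesis
    proof (cases rule: in_nodesE)
      case (1 k) then show ?thesis using cmp vs(2)[OF j(1)] by auto
    next
      case (2 k) then show ?thesis using cmp vs(2)[OF j(1)] vs(2)[OF 2(1)] by (auto simp: doubleton_eq_iff)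
    qed
  qed
  have "\<not> ({vs ! j} \<in> S \<and> {vs ! Suc j} \<in> S)"
    using S(3)[unfolded chain_sets_def, rule_format, of "{vs ! j}" "{vs ! Suc j}"] vs(2)[OF j(1)] by auto
  then consider "S \<subseteq> {{vs ! j}, ?e}" | "S \<subseteq> {?e, {vs ! Suc j}}" using sub by blast
  then show thesis
  proof cases
    case 1
    then show thesis using that[of "2 * j"] nodes_nth_even[of j vs] nodes_nth_odd[of j vs] j by (simp add: length_nodes)
  next
    case 2
    then show thesis using that[of "2 * j + 1"] nodes_nth_even[of "Suc j" vs] nodes_nth_odd[of j vs] j
      by (simp add: length_nodes)
  qed
next
  case False
  obtain c where c: "c \<in> S" using S(2) by auto
  then have "c \<in> set (nodes vs)" using S(1) by auto
  then obtain j where j: "j < length vs" "c = {vs ! j}" using c False by (cases rule: in_nodesE) auto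
  have "d = c" if d: "d \<in> S" for d
  proof -
    have "d \<in> set (nodes vs)" using S(1) d by auto
    then obtain k where "d = {vs ! k}" using d False by (cases rule: in_nodesE) auto
    moreover have "d \<subseteq> c \<or> c \<subseteq> d" using S(3)[unfolded chain_sets_def, rule_format, OF d c] .
    ultimately show ?thesis using j by auto
  qed
  then have "S \<subseteq> {c}" by auto
  show thesis
  proof (cases "Suc j < length vs")
    case True
    then show thesis
      using \<open>S \<subseteq> {c}\<close> j nodes_nth_even[of j vs] by (intro that[of "2 * j"]) (auto simp: length_nodes)
  next
    case False
    then have "Suc (2 * (j - 1) + 1) = 2 * j" using j vs(1) by auto
    then show thesis using \<open>S \<subseteq> {c}\<close> j vs(1) nodes_nth_even[of j vs]
      by (intro that[of "2 * (j - 1) + 1"]) (auto simp: length_nodes)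
  qed
qed

lemma nodes_consecutive:
  assumes "Suc i < length (nodes vs)"
  obtains j where "Suc j < length vs" "nodes vs ! i = {vs ! j}" "nodes vs ! Suc i = {vs ! j, vs ! Suc j}" "i = 2 * j"
  | j where "Suc j < length vs" "nodes vs ! i = {vs ! j, vs ! Suc j}" "nodes vs ! Suc i = {vs ! Suc j}" "i = 2 * j + 1"
proof (cases "even i")
  case True
  then obtain j where "i = 2 * j" by auto
  then show thesis using assms that(1)[of j] nodes_nth_even[of j vs] nodes_nth_odd[of j vs] by (auto simp: length_nodes)
next
  case False
  then obtain j where "i = 2 * j + 1" by (auto elim: oddE)
  then show thesis using assms that(2)[of j] nodes_nth_even[of "Suc j" vs] nodes_nth_odd[of j vs] by (auto simp: length_nodes)
qed

lemma unif_cases: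
  assumes w: "2 \<le> length w" and s: "s \<in> {0..1}"
  obtains i \<theta> where "Suc i < length w" "0 \<le> \<theta>" "\<theta> \<le> 1" "elen w * s = real i + \<theta>" "unif w s = seg (w ! i) (w ! Suc i) \<theta>"
proof -
  have "0 \<le> elen w * s" "elen w * s \<le> elen w" using s elen_pos[OF w] by (auto simp: mult_left_le)
  then obtain i \<theta> where "Suc i < length w" "0 \<le> \<theta>" "\<theta> \<le> 1" "elen w * s = real i + \<theta>"
    by (rule segment_param[folded elen_def, OF w])
  then show thesis using that upath_seg[of i w \<theta>] by (simp add: unif_def)
qed

lemma unif_onto:
  assumes "Suc i < length w" "0 \<le> \<theta>" "\<theta> \<le> 1"
  obtains s where "s \<in> {0..1}" "elen w * s = real i + \<theta>" "unif w s = seg (w ! i) (w ! Suc i) \<theta>"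
proof (rule that[of "(real i + \<theta>) / elen w"])
  have p: "0 < elen w" using assms elen_pos[of w] by auto
  show "(real i + \<theta>) / elen w \<in> {0..1}" using assms p by (auto simp: elen_def divide_simps of_nat_diff)
  show "elen w * ((real i + \<theta>) / elen w) = real i + \<theta>" using p by simp
  then show "unif w ((real i + \<theta>) / elen w) = seg (w ! i) (w ! Suc i) \<theta>"
    unfolding unif_def by (simp only: upath_seg[OF assms])
qed

text \<open>The list is read cyclically; its order tells the four sides from the two
  diagonals.\<close>

definition quad_cells :: "'v list \<Rightarrow> 'v set set" where
  "quad_cells q = insert (set q) (set (nodes (q @ [hd q])))"

text \<open>Cells are sets of vertices ordered by inclusion. \<open>no_diagonal\<close> keeps this
  faithful: a side of one square that is a diagonal of another would otherwise become a face of the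
  latter.\<close>

locale quad_complex =
  fixes Qs :: "'v list set"
  assumes finite_Qs: "finite Qs"
    and quad: "\<And>q. q \<in> Qs \<Longrightarrow> length q = 4 \<and> distinct q"
    and no_diagonal: "\<And>q c. q \<in> Qs \<Longrightarrow> c \<in> \<Union>(quad_cells ` Qs) \<Longrightarrow> c \<subset> set q \<Longrightarrow> c \<in> set (nodes (q @ [hd q]))"
begin

definition cells :: "'v set set" where "cells = \<Union>(quad_cells ` Qs)"

definition X :: "('v set \<Rightarrow> real) set" where "X = order_weights (\<subseteq>) cells"

text \<open>The points with carrier \<open>c\<close>. These open cells partition \<open>X\<close>,
  so statements about regions become statements about sets of cells.\<close>

definition opc :: "'v set \<Rightarrow> ('v set \<Rightarrow> real) set" where
  "opc c = {t \<in> X. t c \<noteq> 0 \<and> (\<forall>d. t d \<noteq> 0 \<longrightarrow> d \<subseteq> c)}"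

definition region :: "'v set set \<Rightarrow> ('v set \<Rightarrow> real) set" where "region C = (\<Union>c\<in>C. opc c)"

lemma finite_cells: "finite cells"
  using finite_Qs by (auto simp: cells_def quad_cells_def)

lemma cells_nonempty: "c \<in> cells \<Longrightarrow> c \<noteq> {}"
  using quad[of "[]"] unfolding cells_def quad_cells_def by (auto elim: in_nodesE)

lemma X_D:
  assumes "t \<in> X"
  shows "0 \<le> t c" "t c \<noteq> 0 \<Longrightarrow> c \<in> cells" "chain_sets {c. t c \<noteq> 0}" "sum t cells = 1"
  using assms unfolding X_def order_weights_iff[OF finite_cells] chain_sets_def by blast+

lemma X_support_sum:
  assumes "t \<in> X" "{c. t c \<noteq> 0} \<subseteq> S" "finite S" shows "sum t S = 1"
proof -
  have "sum t S = sum t (S \<inter> cells)" using X_D(2)[OF assms(1)] assms(3) by (intro sum.mono_neutral_right) auto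
  also have "\<dots> = sum t cells" using assms finite_cells by (intro sum.mono_neutral_left) auto
  finally show ?thesis using X_D(4)[OF assms(1)] by simp
qed

lemma region_disjoint: "C \<inter> D = {} \<Longrightarrow> region C \<inter> region D = {}"
proof (rule ccontr)
  assume CD: "C \<inter> D = {}" and "region C \<inter> region D \<noteq> {}"
  then obtain t c d where t: "c \<in> C" "d \<in> D" "t \<in> opc c" "t \<in> opc d" by (auto simp: region_def)
  then have "c = d" by (auto simp: opc_def)
  then show False using t CD by auto
qed

lemma X_eq_region: "X = region cells"
proof
  show "X \<subseteq> region cells"
  proof
    fix t assume t: "t \<in> X"
    let ?S = "{c. t c \<noteq> 0}"
    have S: "?S \<subseteq> cells" using X_D(2)[OF t] by auto
    have "?S \<noteq> {}"
    proof
      assume "?S = {}"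
      then have "sum t cells = 0" by (intro sum.neutral) auto
      then show False using X_D(4)[OF t] by simp
    qed
    then obtain M where M: "M \<in> ?S" "\<forall>N\<in>?S. M \<subseteq> N \<longrightarrow> M = N"
      using finite_has_maximal[of ?S] finite_subset[OF S finite_cells] by blast
    then have "d \<subseteq> M" if "t d \<noteq> 0" for d
      using X_D(3)[OF t] that unfolding chain_sets_def by blast
    then have "t \<in> opc M" using M t by (auto simp: opc_def)
    then show "t \<in> region cells" using M S unfolding region_def by blast
  qed
qed (auto simp: region_def opc_def)

lemma seg_in_X:
  assumes "c \<in> cells" "d \<in> cells" "c \<subseteq> d \<or> d \<subseteq> c" "0 \<le> \<theta>" "\<theta> \<le> 1"
  shows "seg c d \<theta> \<in> X"
proof -
  have "sum (seg c d \<theta>) cells = 1"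
    using assms(1,2) finite_cells by (simp add: seg_def sum.distrib)
  then show ?thesis
    unfolding X_def order_weights_iff[OF finite_cells] using assms by (auto simp: seg_def)
qed

lemma X_eq_segI:
  assumes "t \<in> X" "c \<noteq> d" "{x. t x \<noteq> 0} \<subseteq> {c, d}" shows "t = seg c d (t d)" "0 \<le> t d" "t d \<le> 1"
proof -
  have "t c + t d = 1" using X_support_sum[OF assms(1,3)] assms(2) by simp
  then show "t = seg c d (t d)" using assms(2,3) by (auto simp: seg_def fun_eq_iff)
  show "0 \<le> t d" "t d \<le> 1" using X_D(1)[OF assms(1)] \<open>t c + t d = 1\<close> by (auto simp: le_diff_eq intro: order_trans) (metis add_increasing order_refl)
qed

end

section \<open>Open squares and edge paths as regions\<close>

definition inner_nodes :: "'v list \<Rightarrow> 'v set set" where "inner_nodes vs = set (butlast (tl (nodes vs)))"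

lemma inner_nodes_iff: "c \<in> inner_nodes vs \<longleftrightarrow> (\<exists>i. 0 < i \<and> Suc i < length (nodes vs) \<and> c = nodes vs ! i)"
proof -
  have "c \<in> inner_nodes vs \<longleftrightarrow> (\<exists>i<length (nodes vs) - 2. c = nodes vs ! Suc i)"
    unfolding inner_nodes_def in_set_conv_nth by (auto simp: nth_butlast nth_tl length_butlast numeral_2_eq_2)
  also have "\<dots> \<longleftrightarrow> (\<exists>i. 0 < i \<and> Suc i < length (nodes vs) \<and> c = nodes vs ! i)"
  proof
    assume "\<exists>i<length (nodes vs) - 2. c = nodes vs ! Suc i"
    then obtain i where "i < length (nodes vs) - 2" "c = nodes vs ! Suc i" by auto
    then show "\<exists>i. 0 < i \<and> Suc i < length (nodes vs) \<and> c = nodes vs ! i" by (intro exI[of _ "Suc i"]) auto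
  next
    assume "\<exists>i. 0 < i \<and> Suc i < length (nodes vs) \<and> c = nodes vs ! i"
    then obtain i where "0 < i" "Suc i < length (nodes vs)" "c = nodes vs ! i" by auto
    then show "\<exists>i<length (nodes vs) - 2. c = nodes vs ! Suc i" by (intro exI[of _ "i - 1"]) auto
  qed
  finally show ?thesis .
qed

context quad_complex
begin

lemma quad_nodes:
  assumes "q \<in> Qs"
  shows "length (nodes (q @ [hd q])) = 9" "distinct (butlast (nodes (q @ [hd q])))"
    "hd (nodes (q @ [hd q])) = last (nodes (q @ [hd q]))" "set q \<notin> set (nodes (q @ [hd q]))"
    "\<And>c. c \<in> set (nodes (q @ [hd q])) \<Longrightarrow> c \<subset> set q" "\<And>j. Suc j < length (q @ [hd q]) \<Longrightarrow> (q @ [hd q]) ! j \<noteq> (q @ [hd q]) ! Suc j"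
proof -
  obtain a b c d where q: "q = [a, b, c, d]" "distinct [a, b, c, d]"
    using quad[OF assms] by (auto simp: length_Suc_conv numeral_eq_Suc)
  show "length (nodes (q @ [hd q])) = 9" "distinct (butlast (nodes (q @ [hd q])))"
    "hd (nodes (q @ [hd q])) = last (nodes (q @ [hd q]))" "set q \<notin> set (nodes (q @ [hd q]))"
    using q(2) unfolding q(1) by (auto simp: doubleton_eq_iff)
  show "e \<subset> set q" if "e \<in> set (nodes (q @ [hd q]))" for e
    using that q(2) unfolding q(1) by auto
  show "(q @ [hd q]) ! j \<noteq> (q @ [hd q]) ! Suc j" if "Suc j < length (q @ [hd q])" for j
  proof -
    have "j = 0 \<or> j = 1 \<or> j = 2 \<or> j = 3" using that q(1) by auto
    then show ?thesis using q by auto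
  qed
qed

lemma nodes_in_cells: "q \<in> Qs \<Longrightarrow> c \<in> set (nodes (q @ [hd q])) \<Longrightarrow> c \<in> cells"
  by (auto simp: cells_def quad_cells_def)

lemma quad_in_cells: "q \<in> Qs \<Longrightarrow> set q \<in> cells"
  by (auto simp: cells_def quad_cells_def)

lemma consecutive_comparable:
  assumes "Suc i < length (nodes vs)"
  shows "nodes vs ! i \<subseteq> nodes vs ! Suc i \<or> nodes vs ! Suc i \<subseteq> nodes vs ! i"
  using assms by (cases rule: nodes_consecutive) auto

text \<open>An open square is the cone from its barycentre over its boundary: the weight of the
  square is \<open>1 - r\<close>, and the rest of the support is a chain of boundary cells, hence
  lies on one segment of the subdivided boundary.\<close>

lemma quad_region:
  assumes q: "q \<in> Qs"
  shows "{(\<lambda>c. r * unif (nodes (q @ [hd q])) s c + (1 - r) * (if c = set q then 1 else 0)) | r s.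
    0 \<le> r \<and> r < 1 \<and> 0 \<le> s \<and> s \<le> 1} = region {set q}" (is "?L = _")
proof -
  let ?Q = "set q" and ?w = "nodes (q @ [hd q])"
  note w = quad_nodes[OF q]
  have w2: "2 \<le> length ?w" using w(1) by simp
  have Qw: "?w ! i \<noteq> ?Q" if "i < length ?w" for i using w(4) that by (metis nth_mem)
  have "t \<in> opc ?Q" if tL: "t \<in> ?L" for t
  proof -
    obtain r s where t: "t = (\<lambda>c. r * unif ?w s c + (1 - r) * (if c = ?Q then 1 else 0))"
      and rs: "0 \<le> r" "r < 1" "s \<in> {0..1}" using tL by auto
    obtain i \<theta> where i: "Suc i < length ?w" "0 \<le> \<theta>" "\<theta> \<le> 1" "unif ?w s = seg (?w ! i) (?w ! Suc i) \<theta>"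
      using unif_cases[OF w2 rs(3)] by metis
    let ?c = "?w ! i" and ?d = "?w ! Suc i"
    have mem: "?c \<in> set ?w" "?d \<in> set ?w" using i(1) by auto
    have cd: "?c \<in> cells" "?d \<in> cells" "?c \<subset> ?Q" "?d \<subset> ?Q" using mem nodes_in_cells[OF q] w(5) by auto
    have cmp: "?c \<subseteq> ?d \<or> ?d \<subseteq> ?c" by (rule consecutive_comparable[OF i(1)])
    have tt: "t x = r * ((if x = ?c then 1 - \<theta> else 0) + (if x = ?d then \<theta> else 0)) + (1 - r) * (if x = ?Q then 1 else 0)" for x
      unfolding t i(4) by (simp add: seg_def)
    have supp: "x = ?c \<or> x = ?d \<or> x = ?Q" if "t x \<noteq> 0" for x using that unfolding tt by (auto split: if_splits)
    have "sum t cells = r * (sum (seg ?c ?d \<theta>) cells) + (1 - r) * (\<Sum>x\<in>cells. if x = ?Q then 1 else 0)"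
      unfolding t i(4) by (simp add: sum.distrib sum_distrib_left)
    also have "\<dots> = 1" using cd quad_in_cells[OF q] finite_cells by (simp add: seg_def sum.distrib)
    finally have "sum t cells = 1" .
    moreover have "0 \<le> t x" for x unfolding tt using rs i by (intro add_nonneg_nonneg mult_nonneg_nonneg) auto
    moreover have "t x = 0" if "x \<notin> cells" for x using supp[of x] that cd quad_in_cells[OF q] by auto
    moreover have "t x = 0 \<or> t y = 0 \<or> x \<subseteq> y \<or> y \<subseteq> x" for x y
      using supp[of x] supp[of y] cmp cd(3,4) by blast
    ultimately have "t \<in> X" unfolding X_def order_weights_iff[OF finite_cells] by blast
    moreover have "t ?Q \<noteq> 0" unfolding tt using cd rs by auto
    moreover have "x \<subseteq> ?Q" if "t x \<noteq> 0" for x using supp[OF that] cd by auto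
    ultimately show ?thesis by (simp add: opc_def)
  qed
  moreover have "t \<in> ?L" if t: "t \<in> opc ?Q" for t
  proof -
    have tX: "t \<in> X" "t ?Q \<noteq> 0" "\<And>d. t d \<noteq> 0 \<Longrightarrow> d \<subseteq> ?Q" using t by (auto simp: opc_def)
    let ?S = "{c. t c \<noteq> 0} - {?Q}"
    have S: "?S \<subseteq> set ?w"
    proof
      fix c assume "c \<in> ?S"
      then have "c \<in> cells" "c \<subset> ?Q" using X_D(2)[OF tX(1)] tX(3) by auto
      then show "c \<in> set ?w" using no_diagonal[OF q] unfolding cells_def by blast
    qed
    have "chain_sets ?S" using X_D(3)[OF tX(1)] unfolding chain_sets_def by blast
    have "\<exists>i. Suc i < length ?w \<and> ?S \<subseteq> {?w ! i, ?w ! Suc i}"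
    proof (cases "?S = {}")
      case True
      then have "Suc 0 < length ?w \<and> ?S \<subseteq> {?w ! 0, ?w ! Suc 0}" using w2 by (simp only: True) simp
      then show ?thesis by (rule exI)
    next
      case False
      have "2 \<le> length (q @ [hd q])" using quad[OF q] by simp
      then show ?thesis
        by (rule chain_in_nodes[OF _ w(6) S False \<open>chain_sets ?S\<close>]) (assumption | blast)+
    qed
    then obtain i where i: "Suc i < length ?w" "?S \<subseteq> {?w ! i, ?w ! Suc i}" by blast
    let ?c = "?w ! i" and ?d = "?w ! Suc i"
    have cdQ: "?c \<noteq> ?Q" "?d \<noteq> ?Q" using Qw i(1) by auto
    have cd: "?c \<noteq> ?d" using i(1)
    proof (cases rule: nodes_consecutive)
      case (1 j) then show ?thesis using w(6)[OF 1(1)] by auto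
    next
      case (2 j) then show ?thesis using w(6)[OF 2(1)] by auto
    qed
    have "sum t {?c, ?d, ?Q} = 1" using i(2) by (intro X_support_sum[OF tX(1)]) auto
    then have sum: "t ?c + t ?d + t ?Q = 1" using cd cdQ by simp
    define r where "r = t ?c + t ?d"
    have nn: "0 \<le> t ?c" "0 \<le> t ?d" "0 < t ?Q" using X_D(1)[OF tX(1)] tX(2) by (auto simp: less_le)
    then have r: "0 \<le> r" "r < 1" using sum by (auto simp: r_def)
    \<comment> \<open>At the barycentre the direction is arbitrary; 0 is chosen.\<close>
    define \<theta> where "\<theta> = (if r = 0 then 0 else t ?d / r)"
    have \<theta>: "0 \<le> \<theta>" "\<theta> \<le> 1" "r * \<theta> = t ?d" "r * (1 - \<theta>) = t ?c"
      using nn r by (auto simp: \<theta>_def r_def divide_le_eq_1 right_diff_distrib split: if_splits)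
    obtain s where s: "s \<in> {0..1}" "unif ?w s = seg ?c ?d \<theta>" using unif_onto[OF i(1) \<theta>(1,2)] by metis
    have "t = (\<lambda>c. r * unif ?w s c + (1 - r) * (if c = ?Q then 1 else 0))"
    proof
      fix x
      have "t x = 0" if "x \<noteq> ?c" "x \<noteq> ?d" "x \<noteq> ?Q" using i(2) that by auto
      then show "t x = r * unif ?w s x + (1 - r) * (if x = ?Q then 1 else 0)"
        using sum \<theta> cd cdQ unfolding s(2) by (auto simp: seg_def r_def)
    qed
    then show ?thesis using r s(1) by auto
  qed
  ultimately show ?thesis by (auto simp: region_def)
qed

lemma disc_quad:
  assumes q: "q \<in> Qs" shows "\<exists>f. disc_map f (region {set q}) (unif (nodes (q @ [hd q])))"
  using disc_map_cone[of "nodes (q @ [hd q])" "set q"] quad_nodes[OF q] quad_region[OF q] by simp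

definition edge_path :: "'v list \<Rightarrow> bool" where
  "edge_path vs \<longleftrightarrow> 2 \<le> length vs \<and> set (nodes vs) \<subseteq> cells \<and>
     (\<forall>j. Suc j < length vs \<longrightarrow> vs ! j \<noteq> vs ! Suc j \<and>
        (\<forall>c\<in>cells. c \<subset> {vs ! j, vs ! Suc j} \<longrightarrow> c = {vs ! j} \<or> c = {vs ! Suc j}))"

lemma edge_path_iff:
  "edge_path vs \<longleftrightarrow> 2 \<le> length vs \<and> set (nodes vs) \<subseteq> cells \<and> (\<forall>j. Suc j < length vs \<longrightarrow> vs ! j \<noteq> vs ! Suc j)"
proof -
  have "c = {a} \<or> c = {b}" if "c \<in> cells" "c \<subset> {a, b}" for a b c
    using cells_nonempty[OF that(1)] that(2) by auto
  then show ?thesis unfolding edge_path_def by blast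
qed

text \<open>Of two consecutive nodes the edge is the larger one, so every point of the segment
  except the vertex itself has the edge as its carrier. Parameters strictly between 0 and 1 avoid
  the first and the last position.\<close>

lemma edge_path_point:
  assumes vs: "edge_path vs" and s: "s \<in> {0..1}" shows "unif (nodes vs) s \<in> region (set (nodes vs))"
    "0 < s \<Longrightarrow> s < 1 \<Longrightarrow> unif (nodes vs) s \<in> region (inner_nodes vs)"
proof -
  let ?w = "nodes vs"
  have len: "2 \<le> length ?w" using vs by (auto simp: edge_path_def length_nodes)
  obtain i \<theta> where i: "Suc i < length ?w" "0 \<le> \<theta>" "\<theta> \<le> 1" "elen ?w * s = real i + \<theta>" "unif ?w s = seg (?w ! i) (?w ! Suc i) \<theta>"
    by (rule unif_cases[OF len s])
  let ?c = "?w ! i" and ?d = "?w ! Suc i"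
  have mem: "?c \<in> cells" "?d \<in> cells" using i(1) vs by (auto simp: edge_path_def)
  have segX: "seg ?c ?d \<theta> \<in> X" by (rule seg_in_X[OF mem consecutive_comparable[OF i(1)] i(2,3)])
  have supp: "x = ?c \<or> x = ?d" if "seg ?c ?d \<theta> x \<noteq> 0" for x using that by (auto simp: seg_def split: if_splits)
  have c: "seg ?c ?d \<theta> \<in> opc ?c" if "?d \<subset> ?c" "\<theta> < 1"
  proof -
    have "seg ?c ?d \<theta> ?c \<noteq> 0" using that by (auto simp: seg_def)
    then show ?thesis using segX supp that unfolding opc_def by blast
  qed
  have d: "seg ?c ?d \<theta> \<in> opc ?d" if "?c \<subset> ?d" "0 < \<theta>"
  proof -
    have "seg ?c ?d \<theta> ?d \<noteq> 0" using that by (auto simp: seg_def)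
    then show ?thesis using segX supp that unfolding opc_def by blast
  qed
  have c': "seg ?c ?d \<theta> \<in> opc ?c" if "\<theta> = 0"
    using segX that unfolding opc_def by (auto simp: seg_def split: if_splits)
  have d': "seg ?c ?d \<theta> \<in> opc ?d" if "\<theta> = 1"
    using segX that unfolding opc_def by (auto simp: seg_def split: if_splits)
  have cd: "?c \<subset> ?d \<and> even i \<or> ?d \<subset> ?c \<and> odd i" using i(1)
  proof (cases rule: nodes_consecutive)
    case (1 j) then show ?thesis using vs by (auto simp: edge_path_def)
  next
    case (2 j) then show ?thesis using vs by (auto simp: edge_path_def)
  qed
  have "\<theta> = 0 \<or> \<theta> = 1 \<or> (0 < \<theta> \<and> \<theta> < 1)" using i by linarith
  then have "seg ?c ?d \<theta> \<in> opc ?c \<or> seg ?c ?d \<theta> \<in> opc ?d" using c d c' d' cd by blast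
  moreover have "?c \<in> set ?w" "?d \<in> set ?w" using i(1) by auto
  ultimately show "unif ?w s \<in> region (set ?w)" unfolding i(5) region_def by blast
  assume s': "0 < s" "s < 1"
  have pos: "0 < elen ?w * s" "elen ?w * s < elen ?w" using s' elen_pos[OF len] by auto
  have ci: "?c \<in> inner_nodes vs" if "0 < i" using that i(1) inner_nodes_iff by blast
  have di: "?d \<in> inner_nodes vs" if "Suc (Suc i) < length ?w" using that inner_nodes_iff by blast
  have oddlen: "odd (length ?w)" using len by (auto simp: length_nodes)
  have "\<exists>x\<in>inner_nodes vs. seg ?c ?d \<theta> \<in> opc x"
  proof (cases "\<theta> = 0")
    case True
    then have "0 < i" using pos i(4) by (cases i) auto
    then show ?thesis using ci c' True by blast
  next
    case nz: False
    show ?thesis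
    proof (cases "even i")
      case True
      \<comment> \<open>Vertices stand at even positions and the number of nodes is odd, so the edge
        after a vertex is never the last node.\<close>
      then have "Suc (Suc i) < length ?w" using i(1) oddlen by (metis Suc_lessI even_Suc)
      moreover have "?c \<subset> ?d" using cd True by blast
      ultimately show ?thesis using di d nz i(2) by auto
    next
      case False
      then have "0 < i" by (cases i) auto
      show ?thesis
      proof (cases "\<theta> = 1")
        case True
        then have "real (Suc i) < elen ?w" using pos i(4) by simp
        then have "Suc (Suc i) < length ?w" by (simp add: elen_def)
        then show ?thesis using di d' True by blast
      next
        case f: False
        moreover have "?d \<subset> ?c" using cd False by blast
        ultimately show ?thesis using ci c i(3) \<open>0 < i\<close> by auto
      qed
    qed
  qed
  then show "unif ?w s \<in> region (inner_nodes vs)" unfolding i(5) region_def by blast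
qed

text \<open>Every cell below a node of the path is itself a node, so the support of the point is a
  chain of nodes and lies on one segment.\<close>

lemma edge_path_onto:
  assumes vs: "edge_path vs" and t: "t \<in> region (set (nodes vs))"
  obtains s where "s \<in> {0..1}" "unif (nodes vs) s = t"
proof -
  let ?w = "nodes vs"
  obtain c where c: "c \<in> set ?w" "t \<in> opc c" using t by (auto simp: region_def)
  then have tX: "t \<in> X" "t c \<noteq> 0" "\<And>d. t d \<noteq> 0 \<Longrightarrow> d \<subseteq> c" by (auto simp: opc_def)
  let ?S = "{d. t d \<noteq> 0}"
  have S: "?S \<subseteq> set ?w"
  proof
    fix d assume "d \<in> ?S"
    then have d: "d \<in> cells" "d \<subseteq> c" "d \<noteq> {}" using X_D(2)[OF tX(1)] tX(3) cells_nonempty by auto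
    from c(1) show "d \<in> set ?w"
    proof (cases rule: in_nodesE)
      case (1 j)
      then have "d = c" using d by auto
      then show ?thesis using c(1) by simp
    next
      case (2 j)
      have "d = {vs ! j} \<or> d = {vs ! Suc j} \<or> d = c" using d 2(2) by blast
      then show ?thesis
        using c(1) nodes_nth_even[of j vs] nodes_nth_even[of "Suc j" vs] 2(1)
          nth_mem[of "2 * j" ?w] nth_mem[of "2 * Suc j" ?w] by (auto simp: length_nodes)
    qed
  qed
  have step: "\<And>j. Suc j < length vs \<Longrightarrow> vs ! j \<noteq> vs ! Suc j" and len: "2 \<le> length vs"
    using vs by (auto simp: edge_path_def)
  have "?S \<noteq> {}" using tX(2) by auto
  then obtain i where i: "Suc i < length ?w" "?S \<subseteq> {?w ! i, ?w ! Suc i}"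
    using chain_in_nodes[OF len step S _ X_D(3)[OF tX(1)]] by blast
  have ne: "?w ! i \<noteq> ?w ! Suc i" using i(1)
  proof (cases rule: nodes_consecutive)
    case (1 j) then show ?thesis using step[OF 1(1)] by auto
  next
    case (2 j) then show ?thesis using step[OF 2(1)] by auto
  qed
  note tt = X_eq_segI[OF tX(1) ne i(2)]
  obtain s where s: "s \<in> {0..1}" "unif ?w s = seg (?w ! i) (?w ! Suc i) (t (?w ! Suc i))"
    using unif_onto[OF i(1) tt(2,3)] by metis
  have "unif ?w s = t" by (rule trans[OF s(2) tt(1)[symmetric]])
  then show thesis by (rule that[OF s(1)])
qed

lemma node_subset:
  assumes "c \<in> set (nodes vs)" shows "c \<subseteq> set vs"
  using assms
proof (cases rule: in_nodesE)
  case (1 j) then show ?thesis using nth_mem[of j vs] by simp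
next
  case (2 j) then show ?thesis using nth_mem[of j vs] nth_mem[of "Suc j" vs] by simp
qed

lemma distinct_nodes:
  assumes "distinct vs" shows "distinct (nodes vs)"
  using assms
proof (induction vs rule: nodes.induct)
  case (3 a b xs)
  have "\<Union> (set (nodes (b # xs))) \<subseteq> set (b # xs)" using node_subset by (rule Union_least)
  moreover have "a \<notin> set (b # xs)" using 3 by auto
  ultimately have "{a} \<notin> set (nodes (b # xs))" "{a, b} \<notin> set (nodes (b # xs))" by blast+
  then show ?case using 3 by auto
qed auto

text \<open>With distinct vertices the end nodes occur only at the ends, so an inner carrier
  excludes the parameters 0 and 1.\<close>

lemma path_interior:
  assumes vs: "edge_path vs" "distinct vs"
  shows "unif (nodes vs) ` {0<..<1} = region (inner_nodes vs)"
proof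
  show "unif (nodes vs) ` {0<..<1} \<subseteq> region (inner_nodes vs)" using edge_path_point(2)[OF vs(1)] by auto
  have len: "2 \<le> length (nodes vs)" using vs by (auto simp: edge_path_def length_nodes)
  have vsne: "vs \<noteq> []" using vs by (auto simp: edge_path_def)
  show "region (inner_nodes vs) \<subseteq> unif (nodes vs) ` {0<..<1}"
  proof
    fix t assume t: "t \<in> region (inner_nodes vs)"
    moreover have "inner_nodes vs \<subseteq> set (nodes vs)" by (auto simp: inner_nodes_iff)
    ultimately have t': "t \<in> region (set (nodes vs))" unfolding region_def by blast
    obtain s where s: "s \<in> {0..1}" "unif (nodes vs) s = t" by (rule edge_path_onto[OF vs(1) t'])
    obtain c where c: "c \<in> inner_nodes vs" "t \<in> opc c" using t by (auto simp: region_def)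
    have dn: "distinct (nodes vs)" by (rule distinct_nodes[OF vs(2)])
    have "c \<noteq> hd (nodes vs)" "c \<noteq> last (nodes vs)"
      using c(1) dn len unfolding inner_nodes_iff
      by (auto simp: hd_conv_nth last_conv_nth nth_eq_iff_index_eq vsne)
    then have "s \<noteq> 0" "s \<noteq> 1"
      using c(2) unif_ends[OF len] s(2) by (auto simp: opc_def seg_def split: if_splits)
    then show "t \<in> unif (nodes vs) ` {0<..<1}" using s by (auto intro!: image_eqI[of _ _ s])
  qed
qed

text \<open>The square is listed as \<beta> backwards followed by further vertices, which gives its
  boundary word the shape needed for attaching. The interior grows by the open square and the inner
  cells of \<beta>; \<open>new\<close> makes these disjoint from each other and from
  \<open>C\<close>.\<close>

lemma disc_attach_quad:
  assumes f: "disc_map f (region C) (unif (nodes (\<alpha> @ tl \<beta>)))"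
    and len: "2 \<le> length \<alpha>" and ends: "last \<alpha> = hd \<beta>" "last \<beta> = hd \<alpha>"
    and \<beta>: "edge_path \<beta>" "distinct \<beta>"
    and q: "rev \<beta> @ ds \<in> Qs" and new: "set \<beta> \<union> set ds \<notin> C" "inner_nodes \<beta> \<inter> C = {}" "set \<beta> \<union> set ds \<notin> inner_nodes \<beta>"
  shows "\<exists>h. disc_map h (region (insert (set \<beta> \<union> set ds) C \<union> inner_nodes \<beta>)) (unif (nodes (\<alpha> @ ds @ [last \<beta>])))"
proof -
  let ?q = "rev \<beta> @ ds" and ?\<delta> = "hd \<beta> # ds @ [last \<beta>]"
  have \<beta>l: "2 \<le> length \<beta>" "\<beta> \<noteq> []" using \<beta> by (auto simp: edge_path_def)
  have \<alpha>ne: "\<alpha> \<noteq> []" using len by auto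
  have Q: "set ?q = set \<beta> \<union> set ds" by simp
  have hdq: "hd ?q = last \<beta>" using \<beta>l by (simp add: hd_rev hd_append)
  obtain g where g: "disc_map g (region {set \<beta> \<union> set ds}) (unif (nodes (?q @ [hd ?q])))"
    using disc_quad[OF q] Q by auto
  have word: "nodes (?q @ [hd ?q]) = rev (nodes \<beta>) @ tl (nodes ?\<delta>)"
  proof -
    have "?q @ [hd ?q] = rev \<beta> @ tl ?\<delta>" using hdq by simp
    also have "nodes \<dots> = nodes (rev \<beta>) @ tl (nodes ?\<delta>)"
      using \<beta>l by (intro nodes_join) (auto simp: last_rev)
    finally show ?thesis by (simp add: nodes_rev)
  qed
  have word1: "nodes (\<alpha> @ tl \<beta>) = nodes \<alpha> @ tl (nodes \<beta>)" by (rule nodes_join[OF \<alpha>ne \<beta>l(2) ends(1)])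
  have word2: "nodes (\<alpha> @ ds @ [last \<beta>]) = nodes \<alpha> @ tl (nodes ?\<delta>)"
    using nodes_join[of \<alpha> ?\<delta>] \<alpha>ne ends(1) by simp
  have "\<exists>h. disc_map h (region C \<union> region {set \<beta> \<union> set ds} \<union> unif (nodes \<beta>) ` {0<..<1}) (unif (nodes \<alpha> @ tl (nodes ?\<delta>)))"
  proof (rule disc_map_attach)
    show "2 \<le> length (nodes \<alpha>)" "2 \<le> length (nodes \<beta>)" "2 \<le> length (nodes ?\<delta>)"
      using len \<beta>l by (auto simp: length_nodes)
    show "last (nodes \<alpha>) = hd (nodes \<beta>)" "last (nodes \<beta>) = hd (nodes \<alpha>)" "hd (nodes ?\<delta>) = hd (nodes \<beta>)"
      "last (nodes ?\<delta>) = last (nodes \<beta>)"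
      using \<alpha>ne \<beta>l ends by (simp_all add: hd_nodes last_nodes)
    show "disc_map f (region C) (unif (nodes \<alpha> @ tl (nodes \<beta>)))" using f unfolding word1 .
    show "disc_map g (region {set \<beta> \<union> set ds}) (unif (rev (nodes \<beta>) @ tl (nodes ?\<delta>)))" using g unfolding word .
    have "inj_on (unif (nodes \<beta>)) {0..1}"
      using \<beta>l by (intro inj_on_unif_distinct distinct_nodes[OF \<beta>(2)]) (auto simp: length_nodes)
    then show "inj_on (unif (nodes \<beta>)) {0<..<1}" by (rule inj_on_subset) auto
    show "region C \<inter> region {set \<beta> \<union> set ds} = {}" using new by (intro region_disjoint) auto
    show "unif (nodes \<beta>) ` {0<..<1} \<inter> region C = {}" "unif (nodes \<beta>) ` {0<..<1} \<inter> region {set \<beta> \<union> set ds} = {}"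
      unfolding path_interior[OF \<beta>] using new by (intro region_disjoint; auto)+
  qed
  moreover have "region C \<union> region {set \<beta> \<union> set ds} \<union> unif (nodes \<beta>) ` {0<..<1} = region (insert (set \<beta> \<union> set ds) C \<union> inner_nodes \<beta>)"
    unfolding path_interior[OF \<beta>] by (auto simp: region_def)
  ultimately show ?thesis by (simp only: word2)
qed

end

section \<open>The Klein bottle\<close>

lemma open_vimage_apply: "open U \<Longrightarrow> open ((\<lambda>f::'a \<Rightarrow> 'b::topological_space. f x) -` U)"
  by (rule open_vimage[OF _ continuous_on_product_coordinates])

text \<open>Realizations live in function spaces with the product topology. Their Hausdorff property
  makes images of compact sets closed in the quotient argument below.\<close>

instance "fun" :: (type, t0_space) t0_space
proof
  fix f g :: "'a \<Rightarrow> 'b" assume "f \<noteq> g"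
  then obtain x where "f x \<noteq> g x" by auto
  from t0_space_class.t0_space[OF this] obtain U where "open U" "\<not> (f x \<in> U \<longleftrightarrow> g x \<in> U)" by (elim exE conjE)
  then show "\<exists>U. open U \<and> \<not> (f \<in> U \<longleftrightarrow> g \<in> U)"
    by (intro exI[of _ "(\<lambda>f. f x) -` U"]) (auto intro: open_vimage_apply)
qed

instance "fun" :: (type, t1_space) t1_space
proof
  fix f g :: "'a \<Rightarrow> 'b" assume "f \<noteq> g"
  then obtain x where "f x \<noteq> g x" by auto
  from t1_space_class.t1_space[OF this] obtain U where "open U" "f x \<in> U" "g x \<notin> U" by (elim exE conjE)
  then show "\<exists>U. open U \<and> f \<in> U \<and> g \<notin> U"
    by (intro exI[of _ "(\<lambda>f. f x) -` U"]) (auto intro: open_vimage_apply)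
qed

instance "fun" :: (type, t2_space) t2_space
proof
  fix f g :: "'a \<Rightarrow> 'b" assume "f \<noteq> g"
  then obtain x where "f x \<noteq> g x" by auto
  from hausdorff[OF this] obtain U V where "open U" "open V" "f x \<in> U" "g x \<in> V" "U \<inter> V = {}"
    by (elim exE conjE)
  then have "open ((\<lambda>f::'a \<Rightarrow> 'b. f x) -` U)" "open ((\<lambda>f::'a \<Rightarrow> 'b. f x) -` V)" by (auto intro: open_vimage_apply)
  then show "\<exists>U V. open U \<and> open V \<and> f \<in> U \<and> g \<in> V \<and> U \<inter> V = {}"
    using \<open>f x \<in> U\<close> \<open>g x \<in> V\<close> \<open>U \<inter> V = {}\<close>
    by (intro exI[of _ "(\<lambda>f. f x) -` U"] exI[of _ "(\<lambda>f. f x) -` V"]) auto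
qed

text \<open>A continuous map from a compact space onto a Hausdorff space is a quotient map, and the
  classes of \<open>r\<close> are the fibres of \<open>G\<close>. \<open>F\<close> sends a point to
  its fibre, \<open>H\<close> evaluates \<open>G\<close> on a representative.\<close>

lemma quotient_homeomorphic:
  fixes G :: "'a::topological_space \<Rightarrow> 'b::t2_space"
  assumes S: "compact S" and G: "continuous_on S G" and GS: "G ` S = Y"
    and r: "\<And>p q. p \<in> S \<Longrightarrow> (p, q) \<in> r \<longleftrightarrow> q \<in> S \<and> G p = G q"
  shows "top_of_set Y homeomorphic_space quotient_topology (top_of_set S) r"
proof -
  let ?Q = "quotient_topology (top_of_set S) r"
  define F where "F t = {p \<in> S. G p = t}" for t
  define H where "H c = G (SOME p. p \<in> c)" for c
  have cls: "r `` {p} = F (G p)" if "p \<in> S" for p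
    by (auto simp only: F_def Image_singleton_iff r[OF that] mem_Collect_eq)
  have top: "topspace ?Q = S // r"
  proof
    show "topspace ?Q \<subseteq> S // r" using openin_quotient_topology[of "top_of_set S" r] openin_topspace by fastforce
    have "{x \<in> S. r `` {x} \<in> S // r} = S" by (auto intro: quotientI)
    then have "openin ?Q (S // r)" by (simp add: openin_quotient_topology)
    then show "S // r \<subseteq> topspace ?Q" by (rule openin_subset)
  qed
  have quot: "S // r = F ` Y" unfolding quotient_def using cls GS by force
  have HF: "H (F t) = t" if t: "t \<in> Y" for t
  proof -
    obtain p where "p \<in> S" "G p = t" using t GS by auto
    then have "p \<in> F t" by (simp add: F_def)
    then have "(SOME p. p \<in> F t) \<in> F t" by (rule someI)
    then show ?thesis by (simp add: H_def F_def)
  qed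
  have "continuous_map (top_of_set Y) ?Q F"
    unfolding continuous_map_def
  proof (intro conjI allI impI)
    show "F \<in> topspace (top_of_set Y) \<rightarrow> topspace ?Q" using top quot by auto
    fix U assume U: "openin ?Q U"
    let ?V = "{x \<in> S. r `` {x} \<in> U}"
    have "openin (top_of_set S) ?V" using U by (simp add: openin_quotient_topology)
    then have "closedin (top_of_set S) (S - ?V)" by (simp add: closedin_diff)
    then have "compact (S - ?V)" using S closedin_compact by blast
    then have "compact (G ` (S - ?V))" using G by (intro compact_continuous_image) (auto intro: continuous_on_subset)
    then have "closed (G ` (S - ?V))" by (rule compact_imp_closed)
    moreover have "{t \<in> Y. F t \<in> U} = Y - G ` (S - ?V)"
    proof -
      have *: "F (G p) \<in> U \<longleftrightarrow> p \<in> ?V" if "p \<in> S" for p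
        unfolding cls[OF that, symmetric] using that by simp
      show ?thesis
      proof (intro equalityI subsetI)
        fix t assume "t \<in> {t \<in> Y. F t \<in> U}"
        moreover from this have "t \<notin> G ` (S - ?V)" using * by blast
        ultimately show "t \<in> Y - G ` (S - ?V)" by blast
      next
        fix t assume t: "t \<in> Y - G ` (S - ?V)"
        then obtain p where p: "p \<in> S" "t = G p" using GS by blast
        then have "p \<in> ?V" using t by blast
        then show "t \<in> {t \<in> Y. F t \<in> U}" using * p t by blast
      qed
    qed
    ultimately have "openin (top_of_set Y) {t \<in> Y. F t \<in> U}"
      by (simp add: Diff_eq openin_open_Int open_Compl)
    then show "openin (top_of_set Y) {x \<in> topspace (top_of_set Y). F x \<in> U}" by simp
  qed
  moreover have "continuous_map ?Q (top_of_set Y) H"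
    unfolding continuous_map_def
  proof (intro conjI allI impI)
    show "H \<in> topspace ?Q \<rightarrow> topspace (top_of_set Y)" using top quot HF by auto
    fix U assume U: "openin (top_of_set Y) U"
    have "openin (top_of_set S) (S \<inter> G -` U)"
      by (rule continuous_on_open[THEN iffD1, rule_format, OF G U[folded GS]])
    moreover have "{x \<in> S. r `` {x} \<in> {c \<in> topspace ?Q. H c \<in> U}} = S \<inter> G -` U"
    proof (intro set_eqI)
      fix x
      have "r `` {x} \<in> topspace ?Q \<and> H (r `` {x}) = G x" if "x \<in> S"
      proof -
        have "G x \<in> Y" using that GS by blast
        then show ?thesis using HF[of "G x"] cls[OF that] unfolding top quot by simp
      qed
      then show "x \<in> {x \<in> S. r `` {x} \<in> {c \<in> topspace ?Q. H c \<in> U}} \<longleftrightarrow> x \<in> S \<inter> G -` U" by auto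
    qed
    ultimately show "openin ?Q {c \<in> topspace ?Q. H c \<in> U}"
      unfolding openin_quotient_topology using top by auto
  qed
  moreover have "F (H c) = c" if c: "c \<in> topspace ?Q" for c
  proof -
    obtain t where "t \<in> Y" "c = F t" using c unfolding top quot by blast
    then show ?thesis using HF by simp
  qed
  ultimately show ?thesis
    unfolding homeomorphic_space_def homeomorphic_maps_def using HF
    by (intro exI[of _ F] exI[of _ H]) auto
qed

section \<open>The square as a disc\<close>

definition sq :: "(real \<times> real) set" where "sq = {0..1} \<times> {0..1}"

text \<open>Each side takes a quarter of the parameter, counterclockwise from the corner (0, 0), so
  that four equal boundary pieces of a disc fall on the four sides.\<close>

definition bnd_point :: "real \<Rightarrow> real \<times> real" where
  "bnd_point s = (if s \<le> 1/4 then (4 * s, 0) else if s \<le> 1/2 then (1, 4 * s - 1)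
     else if s \<le> 3/4 then (3 - 4 * s, 1) else (0, 4 - 4 * s))"

definition bnd_param :: "real \<times> real \<Rightarrow> real" where
  "bnd_param p = (if snd p = 0 then fst p / 4 else if fst p = 1 then 1/4 + snd p / 4
     else if snd p = 1 then 3/4 - fst p / 4 else 1 - snd p / 4)"

text \<open>Twice the distance from the centre in the maximum norm; within the square it is 1
  exactly on the sides.\<close>

definition sq_radius :: "real \<times> real \<Rightarrow> real" where
  "sq_radius p = 2 * max \<bar>fst p - 1/2\<bar> \<bar>snd p - 1/2\<bar>"

definition sq_dir :: "real \<times> real \<Rightarrow> real \<times> real" where
  "sq_dir p = (1/2 + (fst p - 1/2) / sq_radius p, 1/2 + (snd p - 1/2) / sq_radius p)"

definition sq_point :: "real \<Rightarrow> real \<Rightarrow> real \<times> real" where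
  "sq_point r s = (1/2 + r * (fst (bnd_point s) - 1/2), 1/2 + r * (snd (bnd_point s) - 1/2))"

definition sq_to_disc :: "real \<times> real \<Rightarrow> complex" where
  "sq_to_disc p = polar (sq_radius p) (if sq_radius p = 0 then 0 else bnd_param (sq_dir p))"

lemma bnd_point_cases:
  assumes "0 \<le> s" "s \<le> 1"
  obtains x where "s = x / 4" "0 \<le> x" "x \<le> 1" "bnd_point s = (x, 0)"
  | y where "s = 1/4 + y / 4" "0 < y" "y \<le> 1" "bnd_point s = (1, y)"
  | x where "s = 3/4 - x / 4" "0 \<le> x" "x < 1" "bnd_point s = (x, 1)"
  | y where "s = 1 - y / 4" "0 \<le> y" "y < 1" "bnd_point s = (0, y)"
proof -
  consider "s \<le> 1/4" | "1/4 < s" "s \<le> 1/2" | "1/2 < s" "s \<le> 3/4" | "3/4 < s" by linarith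
  then show thesis
  proof cases
    case 1 show thesis by (rule that(1)[of "4 * s"]) (use 1 assms in \<open>auto simp: bnd_point_def field_simps\<close>)
  next
    case 2 show thesis by (rule that(2)[of "4 * s - 1"]) (use 2 assms in \<open>auto simp: bnd_point_def field_simps\<close>)
  next
    case 3 show thesis by (rule that(3)[of "3 - 4 * s"]) (use 3 assms in \<open>auto simp: bnd_point_def field_simps\<close>)
  next
    case 4 show thesis by (rule that(4)[of "4 - 4 * s"]) (use 4 assms in \<open>auto simp: bnd_point_def field_simps\<close>)
  qed
qed

lemma bnd_param_point: "0 \<le> s \<Longrightarrow> s < 1 \<Longrightarrow> bnd_param (bnd_point s) = s"
  by (rule bnd_point_cases[of s]) (auto simp: bnd_param_def)

lemma sq_radius_bnd_point: "0 \<le> s \<Longrightarrow> s \<le> 1 \<Longrightarrow> sq_radius (bnd_point s) = 1"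
  by (rule bnd_point_cases[of s]) (auto simp: sq_radius_def max_def abs_if)

lemma bnd_point_param:
  assumes "p \<in> sq" "sq_radius p = 1" shows "bnd_point (bnd_param p) = p" "0 \<le> bnd_param p" "bnd_param p < 1"
proof -
  obtain x y where p: "p = (x, y)" by (cases p)
  have xy: "0 \<le> x" "x \<le> 1" "0 \<le> y" "y \<le> 1" using assms(1) by (auto simp: sq_def p)
  have "x = 0 \<or> x = 1 \<or> y = 0 \<or> y = 1"
    using assms(2) xy by (auto simp: p sq_radius_def max_def abs_if split: if_splits)
  then show "bnd_point (bnd_param p) = p" "0 \<le> bnd_param p" "bnd_param p < 1"
    using xy by (auto simp: p bnd_param_def bnd_point_def field_simps)
qed

lemma sq_radius_sq: "p \<in> sq \<Longrightarrow> 0 \<le> sq_radius p \<and> sq_radius p \<le> 1"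
  by (auto simp: sq_def sq_radius_def max_def abs_if)

lemma sq_radius_scale: "0 \<le> r \<Longrightarrow> sq_radius (1/2 + r * a, 1/2 + r * b) = r * (2 * max \<bar>a\<bar> \<bar>b\<bar>)"
  by (simp add: sq_radius_def abs_mult max_mult_distrib_left)

lemma sq_dir:
  assumes "p \<in> sq" "sq_radius p \<noteq> 0" shows "sq_dir p \<in> sq" "sq_radius (sq_dir p) = 1"
proof -
  have pos: "0 < sq_radius p" using assms sq_radius_sq by fastforce
  have "sq_radius (sq_dir p) = sq_radius (1/2 + (1 / sq_radius p) * (fst p - 1/2), 1/2 + (1 / sq_radius p) * (snd p - 1/2))"
    by (simp add: sq_dir_def)
  also have "\<dots> = (1 / sq_radius p) * sq_radius p" using pos by (subst sq_radius_scale) (auto simp: sq_radius_def)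
  finally show 1: "sq_radius (sq_dir p) = 1" using pos by simp
  then have "\<bar>fst (sq_dir p) - 1/2\<bar> \<le> 1/2" "\<bar>snd (sq_dir p) - 1/2\<bar> \<le> 1/2"
    by (auto simp: sq_radius_def max_def split: if_splits)
  then show "sq_dir p \<in> sq" unfolding sq_def mem_Times_iff atLeastAtMost_iff by (intro conjI; linarith)
qed

lemma sq_point_eq:
  assumes "p \<in> sq" shows "sq_point (sq_radius p) (if sq_radius p = 0 then 0 else bnd_param (sq_dir p)) = p"
proof (cases "sq_radius p = 0")
  case True
  then have "fst p = 1/2" "snd p = 1/2" by (auto simp: sq_radius_def max_def split: if_splits)
  then show ?thesis using True by (cases p) (simp add: sq_point_def)
next
  case False
  have "bnd_point (bnd_param (sq_dir p)) = sq_dir p" using sq_dir[OF assms False] bnd_point_param by blast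
  then show ?thesis using False by (cases p) (simp add: sq_point_def sq_dir_def)
qed

lemma sq_to_disc_point:
  assumes "0 \<le> r" "r \<le> 1" "0 \<le> s" "s \<le> 1" shows "sq_to_disc (sq_point r s) = polar r s"
proof -
  have rad: "sq_radius (sq_point r s) = r"
    unfolding sq_point_def sq_radius_scale[OF assms(1)]
    using sq_radius_bnd_point[OF assms(3,4)] by (simp add: sq_radius_def)
  show ?thesis
  proof (cases "r = 0")
    case False
    have "sq_dir (sq_point r s) = bnd_point s"
      using False unfolding sq_dir_def rad by (simp add: sq_point_def)
    then have "sq_to_disc (sq_point r s) = polar r (bnd_param (bnd_point s))" using rad False by (simp add: sq_to_disc_def)
    moreover have "polar r (bnd_param (bnd_point 1)) = polar r 1" by (simp add: bnd_point_def bnd_param_def polar_def)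
    ultimately show ?thesis using bnd_param_point[OF assms(3)] assms(4) by (cases "s = 1") auto
  qed (use rad in \<open>simp add: sq_to_disc_def polar_def\<close>)
qed

lemma sq_point_image: "(\<lambda>x. sq_point (fst x) (snd x)) ` ({0..1} \<times> {0..1}) = sq"
proof
  show "(\<lambda>x. sq_point (fst x) (snd x)) ` ({0..1} \<times> {0..1}) \<subseteq> sq"
  proof (rule image_subsetI)
    fix x :: "real \<times> real" assume "x \<in> {0..1} \<times> {0..1}"
    then obtain r s where rs: "x = (r, s)" "0 \<le> r" "r \<le> 1" "0 \<le> s" "s \<le> 1" by auto
    have "\<bar>fst (bnd_point s) - 1/2\<bar> \<le> 1/2" "\<bar>snd (bnd_point s) - 1/2\<bar> \<le> 1/2"
      using sq_radius_bnd_point[OF rs(4,5)] by (auto simp: sq_radius_def max_def split: if_splits)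
    then have "\<bar>r * (fst (bnd_point s) - 1/2)\<bar> \<le> 1 * (1/2)" "\<bar>r * (snd (bnd_point s) - 1/2)\<bar> \<le> 1 * (1/2)"
      unfolding abs_mult using rs by (intro mult_mono; auto)+
    then show "sq_point (fst x) (snd x) \<in> sq" by (auto simp: sq_def sq_point_def rs(1) abs_le_iff)
  qed
  show "sq \<subseteq> (\<lambda>x. sq_point (fst x) (snd x)) ` ({0..1} \<times> {0..1})"
  proof
    fix p assume p: "p \<in> sq"
    have "sq_radius p \<noteq> 0 \<Longrightarrow> 0 \<le> bnd_param (sq_dir p) \<and> bnd_param (sq_dir p) \<le> 1"
      using sq_dir[OF p] bnd_point_param less_imp_le by blast
    then show "p \<in> (\<lambda>x. sq_point (fst x) (snd x)) ` ({0..1} \<times> {0..1})"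
      using sq_point_eq[OF p] sq_radius_sq[OF p]
      by (intro image_eqI[of _ _ "(sq_radius p, if sq_radius p = 0 then 0 else bnd_param (sq_dir p))"]) auto
  qed
qed

lemma continuous_on_bnd_point: "continuous_on {0..1} bnd_point"
proof -
  \<comment> \<open>The coordinates as clamped tent functions, for which continuity needs no case
    analysis.\<close>
  have "continuous_on {0..1} (\<lambda>s::real. (max 0 (min 1 (min (4 * s) (3 - 4 * s))), max 0 (min 1 (min (4 * s - 1) (4 - 4 * s)))))"
    by (intro continuous_intros)
  then show ?thesis
    by (rule continuous_on_eq) (auto simp: bnd_point_def min_def max_def)
qed

text \<open>\<open>bnd_param\<close> jumps at the corner (0, 0), so continuity is obtained on the
  parameters instead: composed with the quotient map \<open>sq_point\<close>, the map is
  \<open>polar\<close>.\<close>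

lemma continuous_on_sq_to_disc: "continuous_on sq sq_to_disc"
  unfolding sq_point_image[symmetric]
proof (rule continuous_on_compact_quotient)
  show "compact ({0..1::real} \<times> {0..1::real})" by (intro compact_Times) auto
  have b: "continuous_on ({0..1} \<times> {0..1}) (\<lambda>x::real \<times> real. bnd_point (snd x))"
    by (rule continuous_on_compose2[OF continuous_on_bnd_point]) (auto intro: continuous_intros)
  show "continuous_on ({0..1} \<times> {0..1}) (\<lambda>x. sq_point (fst x) (snd x))"
    unfolding sq_point_def by (intro continuous_intros b)
  have "sq_to_disc (sq_point (fst x) (snd x)) = polar (fst x) (snd x)" if "x \<in> {0..1} \<times> {0..1}" for x
    using that by (auto simp: sq_to_disc_point)
  then show "continuous_on ({0..1} \<times> {0..1}) (\<lambda>x. sq_to_disc (sq_point (fst x) (snd x)))"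
    by (simp cong: continuous_on_cong) (auto simp: polar_def intro!: continuous_intros)
qed

lemma sq_to_disc_bij: "sq_to_disc ` sq = cball 0 1" "inj_on sq_to_disc sq" "p \<in> sq \<Longrightarrow> cmod (sq_to_disc p) = sq_radius p"
proof -
  have "sq_to_disc ` sq = (\<lambda>x. sq_to_disc (sq_point (fst x) (snd x))) ` ({0..1} \<times> {0..1})"
    by (simp add: sq_point_image[symmetric] image_image)
  also have "\<dots> = (\<lambda>(r, s). polar r s) ` ({0..1} \<times> {0..1})"
    by (intro image_cong) (auto simp: sq_to_disc_point)
  finally show "sq_to_disc ` sq = cball 0 1" by (simp add: polar_image)
  show norm: "cmod (sq_to_disc p) = sq_radius p" if "p \<in> sq" for p
    using sq_radius_sq[OF that] by (simp add: sq_to_disc_def norm_polar)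
  show "inj_on sq_to_disc sq"
  proof (rule inj_onI)
    fix p q assume pq: "p \<in> sq" "q \<in> sq" "sq_to_disc p = sq_to_disc q"
    let ?s = "\<lambda>p. if sq_radius p = 0 then 0 else bnd_param (sq_dir p)"
    have r: "sq_radius p = sq_radius q" using norm[OF pq(1)] norm[OF pq(2)] pq(3) by simp
    have s: "0 \<le> ?s p \<and> ?s p < 1" if "p \<in> sq" for p using sq_dir[OF that] bnd_point_param by auto
    have "?s p = ?s q"
    proof (cases "sq_radius p = 0")
      case False
      then have "0 < sq_radius p" using sq_radius_sq[OF pq(1)] by simp
      then show ?thesis
        using polar_inj(2)[of "sq_radius p" "?s p" "sq_radius q" "?s q"] pq(3) r s[OF pq(1)] s[OF pq(2)]
        by (simp only: sq_to_disc_def)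
    qed (use r in auto)
    then show "p = q" using sq_point_eq[OF pq(1)] sq_point_eq[OF pq(2)] r by metis
  qed
qed

section \<open>Recognising the Klein bottle\<close>

definition klein_rel :: "((real \<times> real) \<times> (real \<times> real)) set" where
  "klein_rel = {((0, y), (1, y)) | y. 0 \<le> y \<and> y \<le> 1} \<union> {((x, 0), (1 - x, 1)) | x. 0 \<le> x \<and> x \<le> 1}"

lemma klein_bottle_eq: "klein_bottle = quotient_topology (top_of_set sq) (generated_equivalence klein_rel)"
  by (simp add: klein_bottle_def klein_rel_def sq_def)

lemma join_half_join_half:
  "join_half (join_half p q) (join_half p' q') s =
    (if s \<le> 1/4 then p (4 * s) else if s \<le> 1/2 then q (4 * s - 1)
     else if s \<le> 3/4 then p' (4 * s - 2) else q' (4 * s - 3))"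
  by (auto simp: join_half_def algebra_simps)

text \<open>The quarters of the boundary go to the sides: bottom \<open>B\<close>, right
  \<open>A\<close> upwards, top from right to left \<open>B\<close>, left downwards \<open>A\<close>
  reversed. So \<open>G\<close> agrees at (0, y) and (1, y) and at (x, 0) and (1 - x, 1), as the
  Klein bottle requires; injectivity inside and along the loops excludes any other
  identification.\<close>

theorem klein_from_disc:
  fixes f :: "complex \<Rightarrow> 'c \<Rightarrow> real"
  assumes f: "disc_map f U (join_half (join_half B A) (join_half B (\<lambda>s. A (1 - s))))"
    and Y: "f ` cball 0 1 = Y"
    and bdU: "\<And>s. s \<in> {0..1} \<Longrightarrow> A s \<notin> U" "\<And>s. s \<in> {0..1} \<Longrightarrow> B s \<notin> U"
    and ends: "A 0 = A 1" "B 0 = B 1" "A 0 = B 0"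
    and inj: "inj_on A {0..<1}" "inj_on B {0..<1}"
    and disj: "\<And>s s'. s \<in> {0<..<1} \<Longrightarrow> s' \<in> {0..<1} \<Longrightarrow> A s \<noteq> B s'"
  shows "top_of_set Y homeomorphic_space klein_bottle"
proof -
  have f': "continuous_on (cball 0 1) f" "inj_on f (ball 0 1)" "f ` ball 0 1 = U"
    using f by (auto simp: disc_map_def)
  have fs: "f (polar 1 s) = join_half (join_half B A) (join_half B (\<lambda>s. A (1 - s))) s" if "s \<in> {0..1}" for s
    using f that by (auto simp: disc_map_def)
  define G where "G p = f (sq_to_disc p)" for p
  have Gb: "G (bnd_point s) = f (polar 1 s)" if "0 \<le> s" "s \<le> 1" for s
  proof -
    have "sq_point 1 s = bnd_point s" by (simp add: sq_point_def)
    then show ?thesis using sq_to_disc_point[of 1 s] that by (simp add: G_def)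
  qed
  have Gj: "G (bnd_point s) = (if s \<le> 1/4 then B (4 * s) else if s \<le> 1/2 then A (4 * s - 1)
     else if s \<le> 3/4 then B (4 * s - 2) else A (1 - (4 * s - 3)))" if "0 \<le> s" "s \<le> 1" for s
    using Gb[OF that] fs[of s] that unfolding join_half_join_half by simp
  have G0: "G (x, 0) = B x" if "0 \<le> x" "x \<le> 1" for x
  proof -
    have "bnd_point (x / 4) = (x, 0)" using that by (simp add: bnd_point_def)
    then show ?thesis using Gj[of "x / 4"] that by simp
  qed
  have G1: "G (1, y) = A y" if "0 \<le> y" "y \<le> 1" for y
  proof (cases "y = 0")
    case True
    then show ?thesis using G0[of 1] ends by simp
  next
    case False
    then have "bnd_point (1/4 + y / 4) = (1, y)" "\<not> 1/4 + y / 4 \<le> 1/4" "1/4 + y / 4 \<le> 1/2" "4 * (1/4 + y / 4) - 1 = y"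
      using that by (auto simp: bnd_point_def)
    then show ?thesis using Gj[of "1/4 + y / 4"] that by simp
  qed
  have G2: "G (1 - x, 1) = B x" if "0 \<le> x" "x \<le> 1" for x
  proof (cases "x = 0")
    case True
    then show ?thesis using G1[of 1] ends by simp
  next
    case False
    then have "\<not> 1/2 + x / 4 \<le> 1/4" "\<not> 1/2 + x / 4 \<le> 1/2" "1/2 + x / 4 \<le> 3/4" "4 * (1/2 + x / 4) - 2 = x" "3 - 4 * (1/2 + x / 4) = 1 - x"
      using that by auto
    then have "bnd_point (1/2 + x / 4) = (1 - x, 1)" "G (bnd_point (1/2 + x / 4)) = B x"
      using Gj[of "1/2 + x / 4"] that unfolding bnd_point_def by (simp_all only: if_False if_True)
    then show ?thesis by simp
  qed
  have G3: "G (0, y) = A y" if "0 \<le> y" "y \<le> 1" for y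
  proof (cases "y = 1")
    case True
    then show ?thesis using G2[of 1] ends by simp
  next
    case False
    then have "\<not> 1 - y / 4 \<le> 1/4" "\<not> 1 - y / 4 \<le> 1/2" "\<not> 1 - y / 4 \<le> 3/4" "1 - (4 * (1 - y / 4) - 3) = y" "4 - 4 * (1 - y / 4) = y"
      using that by auto
    then have "bnd_point (1 - y / 4) = (0, y)" "G (bnd_point (1 - y / 4)) = A y"
      using Gj[of "1 - y / 4"] that unfolding bnd_point_def by (simp_all only: if_False if_True)
    then show ?thesis by simp
  qed
  let ?r = "generated_equivalence klein_rel"
  have step: "q \<in> sq \<and> G q = G p" if "(p, q) \<in> klein_rel \<union> klein_rel\<inverse>" "p \<in> sq" for p q
    using that G0 G1 G2 G3 by (auto simp: klein_rel_def sq_def)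
  have rG: "q \<in> sq \<and> G p = G q" if "(p, q) \<in> ?r" "p \<in> sq" for p q
    using that(1) unfolding generated_equivalence_def
  proof (induction rule: rtrancl_induct)
    case (step y z)
    then show ?case using \<open>\<And>p q. (p, q) \<in> klein_rel \<union> klein_rel\<inverse> \<Longrightarrow> p \<in> sq \<Longrightarrow> q \<in> sq \<and> G q = G p\<close>[of y z] by auto
  qed (use that in simp)
  have rsym: "(q, p) \<in> ?r" if "(p, q) \<in> ?r" for p q
    using that unfolding generated_equivalence_def
    by (metis converse_Un converse_converse rtrancl_converseD rtrancl_converseI sup_commute converse_iff)
  have rtr: "(p, t) \<in> ?r" if "(p, q) \<in> ?r" "(q, t) \<in> ?r" for p q t
    using that unfolding generated_equivalence_def by (rule rtrancl_trans)
  have r1: "((0, y), (1, y)) \<in> ?r" if "0 \<le> y" "y \<le> 1" for y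
    using that unfolding generated_equivalence_def klein_rel_def by (intro r_into_rtrancl) auto
  have r2: "((x, 0), (1 - x, 1)) \<in> ?r" if "0 \<le> x" "x \<le> 1" for x
    using that unfolding generated_equivalence_def klein_rel_def by (intro r_into_rtrancl) auto
  have rrefl: "(p, p) \<in> ?r" for p by (simp add: generated_equivalence_def)
  have corner: "((1, 0), (0, 0)) \<in> ?r" "((0, 1), (0, 0)) \<in> ?r" "((1, 1), (0, 0)) \<in> ?r"
  proof -
    show 1: "((1, 0), (0, 0)) \<in> ?r" using rsym[OF r1[of 0]] by simp
    show 2: "((1, 1), (0, 0)) \<in> ?r" using rsym[OF r2[of 0]] by simp
    show "((0, 1), (0, 0)) \<in> ?r" using rtr[OF r1[of 1] 2] by simp
  qed
  \<comment> \<open>Normal form of boundary points: all four corners reduce to (0, 0), the others to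
    the bottom or to the right side.\<close>
  have norm: "(\<exists>x\<in>{0..<1}. (p, (x, 0)) \<in> ?r \<and> G p = B x) \<or> (\<exists>y\<in>{0<..<1}. (p, (1, y)) \<in> ?r \<and> G p = A y)"
    if p: "p \<in> sq" "sq_radius p = 1" for p
  proof -
    have "(\<exists>x\<in>{0..<1}. (p, (x, 0)) \<in> ?r) \<or> (\<exists>y\<in>{0<..<1}. (p, (1, y)) \<in> ?r)"
    proof -
      obtain s where s: "0 \<le> s" "s \<le> 1" "p = bnd_point s" using bnd_point_param[OF p] by (metis less_imp_le)
      from s(1,2) show ?thesis
      proof (cases rule: bnd_point_cases)
        case (1 x)
        then show ?thesis using s corner rrefl by (cases "x = 1") force+
      next
        case (2 y)
        then show ?thesis using s corner rrefl by (cases "y = 1") force+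
      next
        case (3 x)
        show ?thesis
        proof (cases "x = 0")
          case True then show ?thesis using s 3 corner by force
        next
          case False
          then have "((x, 1), (1 - x, 0)) \<in> ?r" using rsym[OF r2[of "1 - x"]] 3 by simp
          then show ?thesis using s 3 False by force
        qed
      next
        case (4 y)
        show ?thesis
        proof (cases "y = 0")
          case True then show ?thesis using s 4 rrefl by force
        next
          case False
          then have "((0, y), (1, y)) \<in> ?r" using r1[of y] 4 by simp
          then show ?thesis using s 4 False by force
        qed
      qed
    qed
    then show ?thesis using rG[OF _ p(1)] G0 G1 by fastforce
  qed
  have "(p, q) \<in> ?r \<longleftrightarrow> q \<in> sq \<and> G p = G q" if p: "p \<in> sq" for p q
  proof
    assume "(p, q) \<in> ?r" then show "q \<in> sq \<and> G p = G q" using rG p by blast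
  next
    assume *: "q \<in> sq \<and> G p = G q"
    have inU: "G x \<in> U" "sq_to_disc x \<in> ball 0 1" if "x \<in> sq" "sq_radius x < 1" for x
      using sq_to_disc_bij(3)[OF that(1)] that(2) f'(3) by (auto simp: G_def)
    have notU: "G x \<notin> U" if "x \<in> sq" "sq_radius x = 1" for x
      using norm[OF that] bdU by fastforce
    have le1: "sq_radius x = 1 \<or> sq_radius x < 1" if "x \<in> sq" for x using sq_radius_sq[OF that] by auto
    show "(p, q) \<in> ?r"
    proof (cases "sq_radius p = 1")
      case True
      then have q1: "sq_radius q = 1" using notU[OF p] inU(1)[of q] * le1[of q] by auto
      from norm[OF p True] norm[OF conjunct1[OF *] q1]
      show ?thesis
      proof (elim disjE bexE conjE)
        fix x x' assume "x \<in> {0..<1}" "x' \<in> {0..<1}" "(p, (x, 0)) \<in> ?r" "(q, (x', 0)) \<in> ?r" "G p = B x" "G q = B x'"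
        moreover from this have "x = x'" using inj(2) * by (auto dest: inj_onD)
        ultimately show ?thesis using rtr rsym by blast
      next
        fix y y' assume "y \<in> {0<..<1}" "y' \<in> {0<..<1}" "(p, (1, y)) \<in> ?r" "(q, (1, y')) \<in> ?r" "G p = A y" "G q = A y'"
        moreover from this have "y = y'" using inj(1) * by (auto dest!: inj_onD)
        ultimately show ?thesis using rtr rsym by blast
      qed (use disj * in metis)+
    next
      case False
      then have p1: "sq_radius p < 1" using le1[OF p] by simp
      then have q1: "sq_radius q < 1" using notU[of q] inU(1)[OF p] * le1[of q] by auto
      have "sq_to_disc p = sq_to_disc q"
        using f'(2) inU(2)[OF p p1] inU(2)[OF _ q1] * by (auto simp: G_def dest: inj_onD)
      then have "p = q" using sq_to_disc_bij(2) p * by (auto dest: inj_onD)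
      then show ?thesis using rrefl by simp
    qed
  qed
  moreover have "compact sq" unfolding sq_def by (intro compact_Times) auto
  moreover have "continuous_on sq G"
    unfolding G_def using sq_to_disc_bij(1) by (intro continuous_on_compose2[OF f'(1) continuous_on_sq_to_disc]) auto
  moreover have "G ` sq = Y" using sq_to_disc_bij(1) Y by (simp add: G_def image_image[symmetric])
  ultimately show ?thesis
    unfolding klein_bottle_eq by (intro quotient_homeomorphic) auto
qed

text \<open>One reparametrisation of the interval is applied to both halves of the circle;
  \<open>db\<close> is its doubled version.\<close>

lemma disc_map_halves:
  assumes ab: "0 < a" "a < 1" "0 < b" "b < 1" and f: "disc_map f U (join_half p q)"
  shows "\<exists>f'. disc_map f' U (join_half (\<lambda>s. p (pl a b s)) (\<lambda>s. q (pl a b s)))"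
proof -
  define db where "db g s = (if s \<le> 1/2 then g (2 * s) / 2 else 1/2 + g (2 * s - 1) / 2)" for g :: "real \<Rightarrow> real" and s
  have db: "continuous_on {0..1} (db g)" "db g 0 = 0" "db g 1 = 1" "\<And>s. s \<in> {0..1} \<Longrightarrow> db g s \<in> {0..1}"
    "\<And>s. s \<in> {0..1} \<Longrightarrow> db g' (db g s) = s"
    if g: "continuous_on {0..1} g" "g 0 = 0" "g 1 = 1" "\<And>s. s \<in> {0..1} \<Longrightarrow> g s \<in> {0..1}"
      "\<And>s. s \<in> {0..1} \<Longrightarrow> g' (g s) = s" "g' 0 = 0" for g g'
  proof -
    have "g (2 * s) / 2 = 1/2 + g (2 * s - 1) / 2" if "s * 2 = 1" for s
    proof -
      have "2 * s = 1" "2 * s - 1 = 0" using that by auto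
      then show ?thesis by (simp only: g(2,3))
    qed
    moreover have "continuous_on {0..1/2} (\<lambda>s. g (2 * s) / 2)" "continuous_on {1/2..1} (\<lambda>s. 1/2 + g (2 * s - 1) / 2)"
      by (auto intro!: continuous_intros continuous_on_compose2[OF g(1)])
    ultimately have "continuous_on ({0..1/2} \<union> {1/2..1}) (db g)"
      unfolding db_def by (intro continuous_on_If) fastforce+
    moreover have "{0..1/2} \<union> {1/2..1} = {0..1 :: real}" by auto
    ultimately show "continuous_on {0..1} (db g)" by simp
    show "db g 0 = 0" "db g 1 = 1" using g by (auto simp: db_def)
    show "db g s \<in> {0..1}" if "s \<in> {0..1}" for s
      using g(4)[of "2 * s"] g(4)[of "2 * s - 1"] that by (auto simp: db_def)
    show "db g' (db g s) = s" if s: "s \<in> {0..1}" for s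
    proof (cases "s \<le> 1/2")
      case True
      then show ?thesis using g(4)[of "2 * s"] g(5)[of "2 * s"] s by (auto simp: db_def)
    next
      case False
      then have *: "2 * s - 1 \<in> {0..1}" using s by auto
      show ?thesis
      proof (cases "g (2 * s - 1) = 0")
        case True
        then have "2 * s - 1 = 0" using g(5)[OF *] g(6) by simp
        then show ?thesis using False by simp
      next
        case nz: False
        then have "0 < g (2 * s - 1)" using g(4)[OF *] by auto
        then have "db g' (db g s) = 1/2 + g' (g (2 * s - 1)) / 2" using False by (simp add: db_def)
        then show ?thesis using g(5)[OF *] by (simp add: field_simps)
      qed
    qed
  qed
  note P = pl[OF ab] and P' = pl[OF ab(3,4,1,2)]
  obtain f' where f': "disc_map f' U (\<lambda>s. join_half p q (db (pl a b) s))"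
    using circle_reparam[of "db (pl a b)" "db (pl b a)" f U "join_half p q",
        OF db(1-4)[of "pl a b" "pl b a"] db(1-4)[of "pl b a" "pl a b"] db(5)[of "pl b a" "pl a b"] db(5)[of "pl a b" "pl b a"] f]
      P P' by auto
  have "join_half p q (db (pl a b) s) = join_half (\<lambda>s. p (pl a b s)) (\<lambda>s. q (pl a b s)) s" if s: "0 \<le> s" "s \<le> 1" for s
  proof (cases "s \<le> 1/2")
    case True
    then have "pl a b (2 * s) \<in> {0..1}" using P(4)[of "2 * s"] s by auto
    then show ?thesis using True by (simp add: join_half_def db_def)
  next
    case False
    then have *: "2 * s - 1 \<in> {0..1}" "2 * s - 1 \<noteq> 0" using s by auto
    have "pl a b (2 * s - 1) \<noteq> 0" using P(5)[OF *(1)] P'(2) *(2) by metis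
    then have "0 < pl a b (2 * s - 1)" using P(4)[OF *(1)] by auto
    then show ?thesis using False by (simp add: join_half_def db_def)
  qed
  then show ?thesis using disc_map_cong[OF f'] by blast
qed

lemma tl_ne: "2 \<le> length x \<Longrightarrow> tl x \<noteq> []"
  by (cases x) auto

context quad_complex
begin

text \<open>Cut in the middle, the word falls into two halves that divide in the same ratio, because
  \<open>a\<close> and its reverse are equally long. So one reparametrisation brings all four pieces
  to quarter length.\<close>

lemma klein_of_word:
  assumes f: "disc_map f (region C) (unif (nodes ((b @ tl a) @ tl (b @ tl (rev a)))))"
    and ab: "edge_path a" "edge_path b" and ends: "hd a = last a" "hd b = last b" "hd a = hd b"
    and len: "3 \<le> length a" "3 \<le> length b"
    and dist: "distinct (butlast (nodes a))" "distinct (butlast (nodes b))"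
    and disj: "inner_nodes a \<inter> set (nodes b) = {}" "C \<inter> set (nodes a) = {}" "C \<inter> set (nodes b) = {}"
    and cover: "cells \<subseteq> C \<union> set (nodes a) \<union> set (nodes b)"
  shows "top_of_set X homeomorphic_space klein_bottle"
proof -
  let ?a = "nodes a" and ?b = "nodes b"
  define A where "A = unif ?a"
  define B where "B = unif ?b"
  have ne: "a \<noteq> []" "b \<noteq> []" using len by auto
  have L: "5 \<le> length ?a" "5 \<le> length ?b" using len by (auto simp: length_nodes)
  have tlne: "tl a \<noteq> []" "tl (rev a) \<noteq> []" using len tl_ne[of a] tl_ne[of "rev a"] by auto
  have w1: "nodes (b @ tl a) = ?b @ tl ?a" using ends ne by (intro nodes_join) auto
  have w2: "nodes (b @ tl (rev a)) = ?b @ tl (rev ?a)"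
    using ends ne by (subst nodes_join) (auto simp: nodes_rev hd_rev)
  have w: "nodes ((b @ tl a) @ tl (b @ tl (rev a))) = (?b @ tl ?a) @ tl (?b @ tl (rev ?a))"
    unfolding w1[symmetric] w2[symmetric] using ends ne tlne by (intro nodes_join) (auto simp: last_tl)
  have hl: "hd ?a = last ?a" "hd ?b = last ?b" "hd ?a = hd ?b" using ends ne by (auto simp: hd_nodes last_nodes)
  have tlne': "tl ?a \<noteq> []" "tl (rev ?a) \<noteq> []" "?a \<noteq> []" "?b \<noteq> []" using L tl_ne[of ?a] tl_ne[of "rev ?a"] ne by auto
  have e1: "last (?b @ tl ?a) = hd (?b @ tl (rev ?a))" using hl tlne' by (simp add: last_tl)
  have lens: "2 \<le> length (?b @ tl ?a)" "2 \<le> length (?b @ tl (rev ?a))"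
    using L by (simp_all only: length_append)
  obtain f1 where f1: "disc_map f1 (region C) (join_half (unif (?b @ tl ?a)) (unif (?b @ tl (rev ?a))))"
    using disc_map_split[OF _ _ e1 f[unfolded w]] lens by blast
  let ?\<rho> = "elen ?b / (elen ?b + elen ?a)"
  have p: "0 < elen ?a" "0 < elen ?b" using L elen_pos[of ?a] elen_pos[of ?b] by linarith+
  have \<rho>: "0 < ?\<rho>" "?\<rho> < 1" using p by (auto simp: field_simps)
  obtain f2 where f2: "disc_map f2 (region C) (join_half (\<lambda>s. unif (?b @ tl ?a) (pl (1/2) ?\<rho> s)) (\<lambda>s. unif (?b @ tl (rev ?a)) (pl (1/2) ?\<rho> s)))"
    using disc_map_halves[OF _ _ \<rho> f1, of "1/2"] by auto
  have L2: "2 \<le> length ?a" "2 \<le> length ?b" "2 \<le> length (rev ?a)" using L by auto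
  have er: "elen (rev ?a) = elen ?a" by (simp add: elen_def)
  have u1: "unif (?b @ tl ?a) (pl (1/2) ?\<rho> s) = join_half B A s" if "0 \<le> s" "s \<le> 1" for s
    using unif_join_pl[OF L2(2,1) _ that] hl by (simp add: A_def B_def)
  have u2: "unif (?b @ tl (rev ?a)) (pl (1/2) ?\<rho> s) = join_half B (\<lambda>s. A (1 - s)) s" if "0 \<le> s" "s \<le> 1" for s
  proof -
    have "unif (?b @ tl (rev ?a)) (pl (1/2) ?\<rho> s) = join_half B (unif (rev ?a)) s"
      using unif_join_pl[OF L2(2,3) _ that] hl tlne' by (simp add: er B_def hd_rev)
    also have "\<dots> = join_half B (\<lambda>s. A (1 - s)) s"
      using that unif_rev[OF L2(1), of "2 * s - 1"] by (auto simp: join_half_def A_def)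
    finally show ?thesis .
  qed
  have f3: "disc_map f2 (region C) (join_half (join_half B A) (join_half B (\<lambda>s. A (1 - s))))"
    using f2 by (rule disc_map_cong) (auto simp: join_half_def[of "\<lambda>s. unif _ (_ s)"] join_half_def[of "join_half B A"] u1 u2)
  have AX: "A s \<in> region (set ?a)" "B s \<in> region (set ?b)" if "s \<in> {0..1}" for s
    unfolding A_def B_def using edge_path_point(1) ab that by blast+
  have regX: "region D \<subseteq> X" for D by (auto simp: region_def opc_def)
  have fs: "f2 (polar 1 s) = join_half (join_half B A) (join_half B (\<lambda>s. A (1 - s))) s" if "s \<in> {0..1}" for s
    using f3 that by (auto simp: disc_map_def)
  have f3': "f2 ` ball 0 1 = region C" using f3 by (auto simp: disc_map_def)
  show ?thesis
  proof (rule klein_from_disc[OF f3])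
    show "f2 ` cball 0 1 = X"
    proof
      show "f2 ` cball 0 1 \<subseteq> X"
      proof (rule image_subsetI)
        fix z :: complex assume z: "z \<in> cball 0 1"
        show "f2 z \<in> X"
        proof (cases "z \<in> ball 0 1")
          case True
          then have "f2 z \<in> region C" using f3' by blast
          then show ?thesis by (rule subsetD[OF regX])
        next
          case False
          obtain s where s: "0 \<le> s" "s < 1" "z = polar (cmod z) s" by (rule polar_cases)
          have "cmod z = 1" using z False by auto
          then have "f2 z = join_half (join_half B A) (join_half B (\<lambda>s. A (1 - s))) s" using fs[of s] s by auto
          then have val: "f2 z = (if s \<le> 1/4 then B (4 * s) else if s \<le> 1/2 then A (4 * s - 1)
              else if s \<le> 3/4 then B (4 * s - 2) else A (1 - (4 * s - 3)))"
            unfolding join_half_join_half .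
          consider "s \<le> 1/4" | "1/4 < s" "s \<le> 1/2" | "1/2 < s" "s \<le> 3/4" | "3/4 < s" by linarith
          then have "\<exists>u\<in>{0..1}. f2 z = A u \<or> f2 z = B u"
          proof cases
            case 1 then show ?thesis using val s by (intro bexI[of _ "4 * s"]) auto
          next
            case 2 then show ?thesis using val s by (intro bexI[of _ "4 * s - 1"]) auto
          next
            case 3 then show ?thesis using val s by (intro bexI[of _ "4 * s - 2"]) auto
          next
            case 4 then show ?thesis using val s by (intro bexI[of _ "1 - (4 * s - 3)"]) auto
          qed
          then obtain u where u: "u \<in> {0..1}" "f2 z = A u \<or> f2 z = B u" by blast
          from subsetD[OF regX AX(1)[OF u(1)]] subsetD[OF regX AX(2)[OF u(1)]] u(2) show ?thesis by metis
        qed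
      qed
      show "X \<subseteq> f2 ` cball 0 1"
      proof
        fix t assume "t \<in> X"
        then have "t \<in> region C \<or> t \<in> region (set ?a) \<or> t \<in> region (set ?b)"
          using cover unfolding X_eq_region region_def by blast
        then consider "t \<in> region C" | s where "s \<in> {0..1}" "t = A s" | s where "s \<in> {0..1}" "t = B s"
        proof (elim disjE)
          assume t: "t \<in> region (set ?a)"
          obtain s where "s \<in> {0..1}" "unif ?a s = t" by (rule edge_path_onto[OF ab(1) t])
          then show ?thesis using that(2)[of s] by (simp add: A_def)
        next
          assume t: "t \<in> region (set ?b)"
          obtain s where "s \<in> {0..1}" "unif ?b s = t" by (rule edge_path_onto[OF ab(2) t])
          then show ?thesis using that(3)[of s] by (simp add: B_def)
        qed (rule that(1))
        then show "t \<in> f2 ` cball 0 1"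
        proof cases
          case 1
          then have "t \<in> f2 ` ball 0 1" using f3' by simp
          then show ?thesis using ball_subset_cball by blast
        next
          case (2 s)
          have "f2 (polar 1 (1 - s / 4)) = A s"
          \<comment> \<open>At \<open>s = 1\<close> the parameter is 3/4, which the case distinction
            assigns to the preceding piece.\<close>
          proof (cases "s = 1")
            case True
            then have "f2 (polar 1 (1 - s / 4)) = B 1" using fs[of "3/4"] by (simp add: join_half_join_half)
            also have "\<dots> = A 1"
              using unif_ends(2)[OF L2(1)] unif_ends(2)[OF L2(2)] hl by (simp add: A_def B_def)
            finally show ?thesis using True by simp
          next
            case False
            then show ?thesis using fs[of "1 - s / 4"] 2(1) by (simp add: join_half_join_half)
          qed
          then show ?thesis using 2 by (intro image_eqI[of _ _ "polar 1 (1 - s / 4)"]) (auto simp: norm_polar)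
        next
          case (3 s)
          have "f2 (polar 1 (s / 4)) = B s" using fs[of "s / 4"] 3(1) by (simp add: join_half_join_half)
          then show ?thesis using 3 by (intro image_eqI[of _ _ "polar 1 (s / 4)"]) (auto simp: norm_polar)
        qed
      qed
    qed
    show "A s \<notin> region C" "B s \<notin> region C" if "s \<in> {0..1}" for s
      using AX[OF that] region_disjoint[OF disj(2)] region_disjoint[OF disj(3)] by blast+
    show "A 0 = A 1" "B 0 = B 1" "A 0 = B 0"
      using unif_ends(1)[OF L2(1)] unif_ends(2)[OF L2(1)] unif_ends(1)[OF L2(2)] unif_ends(2)[OF L2(2)] hl by (simp_all add: A_def B_def)
    show "inj_on A {0..<1}" "inj_on B {0..<1}"
      unfolding A_def B_def using L dist hl by (auto intro!: inj_on_unif_closed)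
    show "A s \<noteq> B s'" if "s \<in> {0<..<1}" "s' \<in> {0..<1}" for s s'
    proof -
      have "A s \<in> region (inner_nodes a)" unfolding A_def using edge_path_point(2)[OF ab(1), of s] that by auto
      moreover have "B s' \<in> region (set ?b)" using AX that by auto
      ultimately show ?thesis using region_disjoint[OF disj(1)] by auto
    qed
  qed
qed

end

section \<open>Gluing squares along boundary arcs\<close>

text \<open>Cells are represented by increasing lists, so that equality of cells can be tested on
  lists.\<close>

fun sorted_pair :: "nat \<Rightarrow> nat \<Rightarrow> nat list" where
  "sorted_pair a b = (if a < b then [a, b] else [b, a])"

fun inner_cells :: "nat list \<Rightarrow> nat list list" where
  "inner_cells [a, b] = [sorted_pair a b]"
| "inner_cells (a # b # c # xs) = sorted_pair a b # [b] # inner_cells (b # c # xs)"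
| "inner_cells _ = []"

lemma set_sorted_pair: "set (sorted_pair a b) = {a, b}"
  by auto

lemma set_inner_cells: "2 \<le> length vs \<Longrightarrow> set ` set (inner_cells vs) = inner_nodes vs"
proof (induction vs rule: inner_cells.induct)
  case (2 a b c xs)
  have "nodes (b # c # xs) = {b} # tl (nodes (b # c # xs))" by simp
  then have "inner_nodes (a # b # c # xs) = insert {a, b} (insert {b} (inner_nodes (b # c # xs)))"
    by (auto simp: inner_nodes_def)
  then show ?case using 2 by (simp add: set_sorted_pair del: sorted_pair.simps)
qed (auto simp: inner_nodes_def set_sorted_pair simp del: sorted_pair.simps)

type_synonym glue_state = "nat list \<times> nat list list \<times> nat list list"

text \<open>In a closed word the first vertex equals the last; \<open>tl\<close> avoids writing it
  twice, and the new last vertex is the one that now comes first.\<close>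

definition rotate_word :: "nat \<Rightarrow> nat list \<Rightarrow> nat list" where
  "rotate_word k W = drop k W @ take k (tl W)"

text \<open>A state consists of the boundary word of a disc (a closed path, with its first vertex repeated
  at the end), the squares used so far, and the cells in the interior of the disc.  The step
  \<open>(k, l, ds)\<close> rotates the word by \<open>k\<close> and attaches a square along the last \<open>l\<close> edges; \<open>ds\<close> are
  the new vertices of the square.\<close>

fun glue :: "nat \<times> nat \<times> nat list \<Rightarrow> glue_state \<Rightarrow> glue_state" where
  "glue (k, l, ds) (W, qs, cs) =
     (let W' = rotate_word k W; \<beta> = drop (length W' - Suc l) W'
      in (take (length W' - l) W' @ ds @ [last \<beta>], (rev \<beta> @ ds) # qs, sort (\<beta> @ ds) # inner_cells \<beta> @ cs))"

text \<open>The arc and its complement in the boundary each contain at least one edge.\<close>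

fun glue_ok :: "nat \<times> nat \<times> nat list \<Rightarrow> glue_state \<Rightarrow> bool" where
  "glue_ok (k, l, ds) (W, qs, cs) \<longleftrightarrow> k + 2 \<le> length W \<and> 1 \<le> l \<and> l + 2 \<le> length W"

fun glue_all :: "(nat \<times> nat \<times> nat list) list \<Rightarrow> glue_state \<Rightarrow> glue_state" where
  "glue_all [] st = st"
| "glue_all (x # xs) st = glue_all xs (glue x st)"

fun glue_all_ok :: "(nat \<times> nat \<times> nat list) list \<Rightarrow> glue_state \<Rightarrow> bool" where
  "glue_all_ok [] st = True"
| "glue_all_ok (x # xs) st \<longleftrightarrow> glue_ok x st \<and> glue_all_ok xs (glue x st)"

text \<open>Squares and interior cells are only ever added, so membership and distinctness
  established for the final lists pass to all intermediate ones.\<close>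

lemma glue_all_mono:
  "\<exists>W' qs' cs'. glue_all xs (W, qs, cs) = (W', qs' @ qs, cs' @ cs)"
proof (induction xs arbitrary: W qs cs)
  case (Cons x xs)
  obtain k l ds where x: "x = (k, l, ds)" by (cases x)
  let ?\<beta> = "drop (length (rotate_word k W) - Suc l) (rotate_word k W)"
  have "glue x (W, qs, cs) = (take (length (rotate_word k W) - l) (rotate_word k W) @ ds @ [last ?\<beta>],
      [rev ?\<beta> @ ds] @ qs, (sort (?\<beta> @ ds) # inner_cells ?\<beta>) @ cs)" by (simp add: x Let_def)
  then obtain W' q c where g: "glue x (W, qs, cs) = (W', q @ qs, c @ cs)" by blast
  obtain V qs' cs' where "glue_all xs (W', q @ qs, c @ cs) = (V, qs' @ q @ qs, cs' @ c @ cs)"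
    using Cons.IH[of W' "q @ qs" "c @ cs"] by blast
  then have "glue_all (x # xs) (W, qs, cs) = (V, (qs' @ q) @ qs, (cs' @ c) @ cs)" using g by simp
  then show ?case by blast
qed auto

lemma rotate_word_ends:
  assumes "W \<noteq> []" "hd W = last W" "k < length W"
  shows "hd (rotate_word k W) = last (rotate_word k W)" "length (rotate_word k W) = length W"
proof -
  show "length (rotate_word k W) = length W" using assms by (simp add: rotate_word_def)
  show "hd (rotate_word k W) = last (rotate_word k W)"
  proof (cases k)
    case 0 then show ?thesis using assms by (simp add: rotate_word_def)
  next
    case (Suc j)
    have "take k (tl W) = take j (tl W) @ [W ! k]"
      using Suc assms by (simp add: take_Suc_conv_app_nth nth_tl)
    then show ?thesis using assms by (simp add: rotate_word_def hd_drop_conv_nth)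
  qed
qed

context quad_complex
begin

lemma disc_rotate_word:
  assumes f: "disc_map f U (unif (nodes W))" and W: "hd W = last W" "k + 2 \<le> length W"
  shows "\<exists>f. disc_map f U (unif (nodes (rotate_word k W)))"
proof (cases "k = 0")
  case True
  then show ?thesis using f by (auto simp: rotate_word_def)
next
  case False
  let ?x = "take (Suc k) W" and ?y = "drop k W"
  have ne: "W \<noteq> []" "?x \<noteq> []" "?y \<noteq> []" using W by auto
  have lx: "last ?x = hd ?y" using W by (simp add: hd_drop_conv_nth take_Suc_conv_app_nth)
  have ly: "last ?y = hd ?x" using W by (cases W) auto
  have "W = ?x @ tl ?y" by (simp add: tl_drop drop_Suc[symmetric])
  then have w1: "nodes W = nodes ?x @ tl (nodes ?y)" using nodes_join[OF ne(2,3) lx] by simp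
  have w2: "nodes (rotate_word k W) = nodes ?y @ tl (nodes ?x)"
    using nodes_join[OF ne(3,2) ly] ne(1) by (simp add: rotate_word_def tl_take)
  have "2 \<le> length (nodes ?x)" "2 \<le> length (nodes ?y)" using False W by (auto simp: length_nodes)
  moreover have "last (nodes ?x) = hd (nodes ?y)" "last (nodes ?y) = hd (nodes ?x)"
    using lx ly ne by (simp_all add: hd_nodes last_nodes)
  ultimately show ?thesis using disc_map_swap[of "nodes ?x" "nodes ?y" f U] f unfolding w1 w2 by blast
qed

lemma edge_path_of_quad:
  assumes q: "rev \<beta> @ ds \<in> Qs" and \<beta>: "2 \<le> length \<beta>"
  shows "edge_path \<beta>" "distinct \<beta>"
proof -
  show d: "distinct \<beta>" using quad[OF q] by auto
  have "set (nodes \<beta>) = set (nodes (rev \<beta>))" by (simp add: nodes_rev)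
  also have "\<dots> \<subseteq> set (nodes (rev \<beta> @ tl (last (rev \<beta>) # ds @ [hd (rev \<beta> @ ds)])))"
  proof -
    have "nodes (rev \<beta> @ tl (last (rev \<beta>) # ds @ [hd (rev \<beta> @ ds)])) =
        nodes (rev \<beta>) @ tl (nodes (last (rev \<beta>) # ds @ [hd (rev \<beta> @ ds)]))"
      using \<beta> by (intro nodes_join) auto
    then show ?thesis by simp
  qed
  also have "\<dots> \<subseteq> cells" using nodes_in_cells[OF q] by auto
  finally show "edge_path \<beta>"
    unfolding edge_path_iff using \<beta> d by (auto simp: nth_eq_iff_index_eq)
qed

end

locale nat_quad_complex = quad_complex Qs for Qs :: "nat list set"
begin

text \<open>Distinctness of the final list of cells gives, at every step, that the attached square
  and the inner cells of the arc are not yet in the disc.\<close>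

theorem glue_all_disc:
  assumes "\<exists>f. disc_map f (region (set ` set cs)) (unif (nodes W))" "W \<noteq> []" "hd W = last W"
    and "glue_all_ok xs (W, qs, cs)" "glue_all xs (W, qs, cs) = (W', qs', cs')"
    and "distinct (map set cs')" "set qs' \<subseteq> Qs"
  shows "\<exists>f. disc_map f (region (set ` set cs')) (unif (nodes W'))"
  using assms
proof (induction xs arbitrary: W qs cs)
  case (Cons x xs)
  obtain k l ds where x: "x = (k, l, ds)" by (cases x)
  let ?W = "rotate_word k W"
  let ?\<beta> = "drop (length ?W - Suc l) ?W" and ?\<alpha> = "take (length ?W - l) ?W"
  have ok: "k + 2 \<le> length W" "1 \<le> l" "l + 2 \<le> length W" using Cons.prems(4) x by auto
  have rot: "hd ?W = last ?W" "length ?W = length W" using rotate_word_ends[of W k] Cons.prems(2,3) ok by auto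
  have g: "glue x (W, qs, cs) = (?\<alpha> @ ds @ [last ?\<beta>], (rev ?\<beta> @ ds) # qs, sort (?\<beta> @ ds) # inner_cells ?\<beta> @ cs)"
    unfolding x by (simp add: Let_def)
  have run: "glue_all xs (?\<alpha> @ ds @ [last ?\<beta>], (rev ?\<beta> @ ds) # qs, sort (?\<beta> @ ds) # inner_cells ?\<beta> @ cs) = (W', qs', cs')"
    using Cons.prems(5) g by simp
  obtain qs2 cs2 where mono: "qs' = qs2 @ (rev ?\<beta> @ ds) # qs" "cs' = cs2 @ sort (?\<beta> @ ds) # inner_cells ?\<beta> @ cs"
    using glue_all_mono[of xs "?\<alpha> @ ds @ [last ?\<beta>]" "(rev ?\<beta> @ ds) # qs" "sort (?\<beta> @ ds) # inner_cells ?\<beta> @ cs"]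
    unfolding run by auto
  have q: "rev ?\<beta> @ ds \<in> Qs" using Cons.prems(7) mono(1) by auto
  have len: "2 \<le> length ?\<beta>" "2 \<le> length ?\<alpha>" "?W \<noteq> []" using ok rot by auto
  note \<beta> = edge_path_of_quad[OF q len(1)]
  have "length ?W - l = Suc (length ?W - Suc l)" using ok rot by auto
  then have split: "?W = ?\<alpha> @ tl ?\<beta>" by (simp add: tl_drop drop_Suc[symmetric])
  have ends: "last ?\<alpha> = hd ?\<beta>" "last ?\<beta> = hd ?\<alpha>" "hd ?\<alpha> = hd ?W" "last ?\<beta> = last ?W"
    using ok rot len(3) by (auto simp: hd_drop_conv_nth last_conv_nth)
  have dist: "distinct (map set (sort (?\<beta> @ ds) # inner_cells ?\<beta> @ cs))" using Cons.prems(6) mono(2) by simp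
  have inn: "set ` set (inner_cells ?\<beta>) = inner_nodes ?\<beta>" by (rule set_inner_cells[OF len(1)])
  have new: "set ?\<beta> \<union> set ds \<notin> set ` set cs" "inner_nodes ?\<beta> \<inter> set ` set cs = {}" "set ?\<beta> \<union> set ds \<notin> inner_nodes ?\<beta>"
    using dist unfolding inn[symmetric] by auto
  obtain f where f: "disc_map f (region (set ` set cs)) (unif (nodes (?\<alpha> @ tl ?\<beta>)))"
    using disc_rotate_word[OF _ Cons.prems(3) ok(1)] Cons.prems(1) split by metis
  have "\<exists>h. disc_map h (region (insert (set ?\<beta> \<union> set ds) (set ` set cs) \<union> inner_nodes ?\<beta>)) (unif (nodes (?\<alpha> @ ds @ [last ?\<beta>])))"
    by (rule disc_attach_quad[OF f len(2) ends(1,2) \<beta> q new])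
  moreover have "insert (set ?\<beta> \<union> set ds) (set ` set cs) \<union> inner_nodes ?\<beta> = set ` set (sort (?\<beta> @ ds) # inner_cells ?\<beta> @ cs)"
    using inn by (simp add: image_Un Un_commute)
  moreover have "hd (?\<alpha> @ ds @ [last ?\<beta>]) = last (?\<alpha> @ ds @ [last ?\<beta>])"
  proof -
    have "?\<alpha> \<noteq> []" using len(2) by auto
    from hd_append2[OF this] show ?thesis using ends rot(1) by simp
  qed
  moreover have "glue_all_ok xs (glue x (W, qs, cs))" using Cons.prems(4) by simp
  ultimately show ?case
    using Cons.IH[OF _ _ _ _ run Cons.prems(6,7)] unfolding g by simp
qed auto

end

section \<open>Sorting without repetition\<close>

fun merge :: "'a::linorder list \<Rightarrow> 'a list \<Rightarrow> 'a list" where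
  "merge [] ys = ys"
| "merge xs [] = xs"
| "merge (x # xs) (y # ys) =
     (if x < y then x # merge xs (y # ys) else if y < x then y # merge (x # xs) ys else x # merge xs ys)"

fun merge_pairs :: "'a::linorder list list \<Rightarrow> 'a list list" where
  "merge_pairs (xs # ys # zss) = merge xs ys # merge_pairs zss"
| "merge_pairs zss = zss"

fun merge_rounds :: "nat \<Rightarrow> 'a::linorder list list \<Rightarrow> 'a list list" where
  "merge_rounds 0 zss = zss"
| "merge_rounds (Suc n) zss = merge_rounds n (merge_pairs zss)"

text \<open>Ten rounds of pairwise merging reduce up to 1024 entries to one list, more than occur
  below. \<open>concat\<close> keeps the set of elements right in any case.\<close>

definition sorted_elements :: "'a::linorder list \<Rightarrow> 'a list" where
  "sorted_elements xs = concat (merge_rounds 10 (map (\<lambda>x. [x]) xs))"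

lemma set_merge: "set (merge xs ys) = set xs \<union> set ys"
  by (induction xs ys rule: merge.induct) auto

lemma set_merge_pairs: "\<Union> (set ` set (merge_pairs zss)) = \<Union> (set ` set zss)"
  by (induction zss rule: merge_pairs.induct) (auto simp: set_merge)

lemma set_merge_rounds: "\<Union> (set ` set (merge_rounds n zss)) = \<Union> (set ` set zss)"
  by (induction n arbitrary: zss) (auto simp: set_merge_pairs)

lemma set_sorted_elements: "set (sorted_elements xs) = set xs"
  using set_merge_rounds[of 10 "map (\<lambda>x. [x]) xs"] by (auto simp: sorted_elements_def)

fun strictly_sorted :: "'a::linorder list \<Rightarrow> bool" where
  "strictly_sorted (x # y # xs) \<longleftrightarrow> x < y \<and> strictly_sorted (y # xs)"
| "strictly_sorted _ = True"

lemma strictly_sorted_distinct: "strictly_sorted xs \<Longrightarrow> distinct xs \<and> (\<forall>x\<in>set (tl xs). hd xs < x)"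
  by (induction xs rule: strictly_sorted.induct) force+

text \<open>For the merging only the preservation of the set is proved; that its result is strictly
  increasing is tested on the result itself.\<close>

lemma card_set_eqI:
  assumes "sorted_elements xs = ys" "strictly_sorted ys" shows "card (set xs) = length ys" "set xs = set ys"
proof -
  show "set xs = set ys" using set_sorted_elements[of xs] assms(1) by simp
  then show "card (set xs) = length ys"
    using distinct_card[of ys] strictly_sorted_distinct[OF assms(2)] by simp
qed

section \<open>Dual manifolds\<close>

text \<open>Weights are transported along the order isomorphism; both directions are continuous
  coordinate by coordinate.\<close>

lemma order_weights_homeomorphic:
  assumes bij: "bij_betw \<phi> K K'" and fin: "finite K"
    and iso: "\<And>c d. c \<in> K \<Longrightarrow> d \<in> K \<Longrightarrow> le c d \<longleftrightarrow> le' (\<phi> c) (\<phi> d)"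
  shows "top_of_set (order_weights le K) homeomorphic_space top_of_set (order_weights le' K')"
proof -
  let ?\<psi> = "inv_into K \<phi>"
  have fin': "finite K'" using bij fin bij_betw_finite by blast
  have \<psi>: "?\<psi> y \<in> K" "\<phi> (?\<psi> y) = y" if "y \<in> K'" for y
    using bij that by (auto simp: bij_betw_def inv_into_into f_inv_into_f)
  have \<phi>: "\<phi> x \<in> K'" "?\<psi> (\<phi> x) = x" if "x \<in> K" for x
    using bij that by (auto simp: bij_betw_def)
  define F where "F t = (\<lambda>y. if y \<in> K' then t (?\<psi> y) else 0)" for t :: "_ \<Rightarrow> real"
  define G where "G t = (\<lambda>x. if x \<in> K then t (\<phi> x) else 0)" for t :: "_ \<Rightarrow> real"
  have sum: "sum (\<lambda>y. t (?\<psi> y)) K' = sum t K" for t :: "_ \<Rightarrow> real"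
    by (rule sum.reindex_bij_betw[OF bij_betw_inv_into[OF bij]])
  have sum': "sum (\<lambda>x. t (\<phi> x)) K = sum t K'" for t :: "_ \<Rightarrow> real"
    by (rule sum.reindex_bij_betw[OF bij])
  have F: "F t \<in> order_weights le' K'" if t: "t \<in> order_weights le K" for t
  proof -
    have "le' c d \<or> le' d c" if "c \<in> K'" "d \<in> K'" "t (?\<psi> c) \<noteq> 0" "t (?\<psi> d) \<noteq> 0" for c d
    proof -
      have "le (?\<psi> c) (?\<psi> d) \<or> le (?\<psi> d) (?\<psi> c)" using t that(3,4) unfolding order_weights_iff[OF fin] by blast
      then show ?thesis using iso \<psi> that by metis
    qed
    then show ?thesis
      using t sum[of t] unfolding order_weights_iff[OF fin] order_weights_iff[OF fin'] F_def by auto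
  qed
  have G: "G t \<in> order_weights le K" if t: "t \<in> order_weights le' K'" for t
  proof -
    have "le c d \<or> le d c" if "c \<in> K" "d \<in> K" "t (\<phi> c) \<noteq> 0" "t (\<phi> d) \<noteq> 0" for c d
    proof -
      have "le' (\<phi> c) (\<phi> d) \<or> le' (\<phi> d) (\<phi> c)" using t that(3,4) unfolding order_weights_iff[OF fin'] by blast
      then show ?thesis using iso that by metis
    qed
    then show ?thesis
      using t sum'[of t] unfolding order_weights_iff[OF fin] order_weights_iff[OF fin'] G_def by auto
  qed
  have GF: "G (F t) = t" if "t \<in> order_weights le K" for t
    using that \<phi> unfolding order_weights_iff[OF fin] F_def G_def by (auto simp: fun_eq_iff)
  have FG: "F (G t) = t" if "t \<in> order_weights le' K'" for t
    using that \<psi> unfolding order_weights_iff[OF fin'] F_def G_def by (auto simp: fun_eq_iff)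
  have "continuous_on S F" for S
  proof (rule continuous_on_coordinatewise_then_product)
    fix y show "continuous_on S (\<lambda>t. F t y)" by (cases "y \<in> K'") (auto simp: F_def intro!: continuous_intros)
  qed
  moreover have "continuous_on S G" for S
  proof (rule continuous_on_coordinatewise_then_product)
    fix x show "continuous_on S (\<lambda>t. G t x)" by (cases "x \<in> K") (auto simp: G_def intro!: continuous_intros)
  qed
  ultimately show ?thesis
    unfolding homeomorphic_space_def homeomorphic_maps_def using F G GF FG
    by (intro exI[of _ F] exI[of _ G]) auto
qed

section \<open>Cells of the derivative complex as sets of edges\<close>

context cubical_presentation
begin

definition dset :: "nat \<Rightarrow> 'k set \<Rightarrow> 'k set \<Rightarrow> 'k \<Rightarrow> nat set set" where
  "dset i A B k = (\<lambda>X. {corner i X, corner i (insert k X)}) ` {X. A \<subseteq> X \<and> X \<subseteq> B - {k}}"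

definition edge_code :: "'a derivative_cell \<Rightarrow> nat set set" where "edge_code c = verts ` snd c"

lemma vset_edge: "vset i X (insert k X) = {corner i X, corner i (insert k X)}"
proof -
  have "{S. X \<subseteq> S \<and> S \<subseteq> insert k X} = {X, insert k X}" by auto
  then show ?thesis by (simp add: vset_def)
qed

lemma edge_code_cell:
  assumes "i < m" "A \<subseteq> B" "B \<subseteq> K" "k \<in> B - A"
  shows "edge_code (face i A B, par i A B k) = dset i A B k"
proof -
  have "verts (face i X (insert k X)) = {corner i X, corner i (insert k X)}" if "X \<subseteq> B - {k}" for X
    using verts_face[OF assms(1), of "insert k X" X] vset_edge[of i X k] that assms by auto
  moreover have "edge_code (face i A B, par i A B k) = (\<lambda>X. verts (face i X (insert k X))) ` {X. A \<subseteq> X \<and> X \<subseteq> B - {k}}"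
    by (auto simp: edge_code_def par_def)
  ultimately show ?thesis unfolding dset_def by (auto intro!: image_cong)
qed

text \<open>Every corner of the face is an end of an edge of direction \<open>k\<close>, so the
  parallel class alone determines the face.\<close>

lemma hull_par:
  assumes "i < m" "A \<subseteq> B" "B \<subseteq> K" "k \<in> B - A"
  shows "convex hull (\<Union> (par i A B k)) = face i A B"
proof
  have "face i X (insert k X) \<subseteq> face i A B" if "A \<subseteq> X" "X \<subseteq> B - {k}" for X
  proof -
    have "insert k X \<subseteq> K" using that assms by auto
    from face_subset_iff[OF assms(1) subset_insertI this assms(3)] show ?thesis using that assms by auto
  qed
  then have "\<Union> (par i A B k) \<subseteq> face i A B" by (auto simp: par_def)
  then show "convex hull (\<Union> (par i A B k)) \<subseteq> face i A B"
    by (rule hull_minimal) (simp add: face_def cube_face_def)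
  have "pt (corner i S) \<in> \<Union> (par i A B k)" if S: "A \<subseteq> S" "S \<subseteq> B" for S
  proof -
    let ?X = "S - {k}"
    have X: "A \<subseteq> ?X" "?X \<subseteq> B - {k}" "?X \<subseteq> S" "S \<subseteq> insert k ?X" "insert k ?X \<subseteq> K" "S \<subseteq> K" using S assms by auto
    then have "pt (corner i S) \<in> face i ?X (insert k ?X)"
      using vertex_in_face_iff[OF assms(1) X(5,6)] by blast
    moreover have "face i ?X (insert k ?X) \<in> par i A B k"
      unfolding par_def by (intro CollectI exI[of _ ?X] conjI refl X)
    ultimately show ?thesis by (rule UnionI[rotated])
  qed
  then show "face i A B \<subseteq> convex hull (\<Union> (par i A B k))"
    unfolding face_def cube_face_def by (intro hull_mono) auto
qed

lemma derivative_cell_facts: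
  assumes "c \<in> derivative_complex P"
  shows "snd c \<subseteq> subfaces" "convex hull (\<Union> (snd c)) = fst c" "snd c \<noteq> {}"
proof -
  obtain i A B k where c: "i < m" "A \<subseteq> B" "B \<subseteq> K" "k \<in> B - A" "c = (face i A B, par i A B k)"
    using assms by (rule derivative_cellE)
  show "convex hull (\<Union> (snd c)) = fst c" using hull_par[OF c(1-4)] c(5) by simp
  show "snd c \<noteq> {}" using par_nonempty[OF c(2,4)] c(5) by simp
  show "snd c \<subseteq> subfaces"
  proof
    fix e assume "e \<in> snd c"
    then obtain X where "A \<subseteq> X" "X \<subseteq> B - {k}" "e = face i X (insert k X)" using c(5) by (auto simp: par_def)
    moreover from this have "insert k X \<subseteq> K" using c by auto
    ultimately show "e \<in> subfaces" using c(1) unfolding subfaces_def by blast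
  qed
qed

text \<open>Vertex pairs identify edges, and the first component of a cell is the hull of the edges
  in the second; so inclusion of codes carries the whole order.\<close>

lemma cell_le_iff_edge_code:
  assumes c: "c \<in> derivative_complex P" and d: "d \<in> derivative_complex P"
  shows "cell_le c d \<longleftrightarrow> edge_code c \<subseteq> edge_code d"
proof -
  have "edge_code c \<subseteq> edge_code d \<longleftrightarrow> snd c \<subseteq> snd d"
    unfolding edge_code_def
    using inj_on_image_subset_iff[OF inj_on_verts derivative_cell_facts(1)[OF c] derivative_cell_facts(1)[OF d]] .
  moreover have "fst c \<subseteq> fst d" if "snd c \<subseteq> snd d"
    using hull_mono[OF Union_mono[OF that], of convex] derivative_cell_facts(2)[OF c] derivative_cell_facts(2)[OF d] by simp
  ultimately show ?thesis by (auto simp: cell_le_def)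
qed

lemma inj_on_edge_code: "inj_on edge_code (derivative_complex P)"
proof (rule inj_onI)
  fix c d assume c: "c \<in> derivative_complex P" "d \<in> derivative_complex P" "edge_code c = edge_code d"
  then have "cell_le c d" "cell_le d c" using cell_le_iff_edge_code by auto
  then show "c = d" by (auto simp: cell_le_def prod_eq_iff)
qed

lemma corner_inj:
  assumes "i < m" "S \<subseteq> K" "T \<subseteq> K" "corner i S = corner i T" shows "S = T"
proof -
  have "pt (corner i S) \<in> face i T T" using vertex_in_face_iff[OF assms(1,3,3), of T] assms(4) by simp
  then show ?thesis using vertex_in_face_iff[OF assms(1,3,2), of T] by auto
qed

lemma card_dset:
  assumes "i < m" "A \<subseteq> B" "B \<subseteq> K" "k \<in> B - A"
  shows "card (dset i A B k) = 2 ^ (card (B - A) - 1)"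
proof -
  have "inj_on (\<lambda>X. {corner i X, corner i (insert k X)}) {X. A \<subseteq> X \<and> X \<subseteq> B - {k}}"
  proof (rule inj_onI)
    fix X Y assume X: "X \<in> {X. A \<subseteq> X \<and> X \<subseteq> B - {k}}" and Y: "Y \<in> {X. A \<subseteq> X \<and> X \<subseteq> B - {k}}"
      and "{corner i X, corner i (insert k X)} = {corner i Y, corner i (insert k Y)}"
    then have "corner i X = corner i Y \<or> corner i X = corner i (insert k Y)" by (auto simp: doubleton_eq_iff)
    moreover have "X \<subseteq> K" "Y \<subseteq> K" "insert k Y \<subseteq> K" using X Y assms by auto
    ultimately have "X = Y \<or> X = insert k Y" using corner_inj[OF assms(1)] by blast
    then show "X = Y" using X by auto
  qed
  then have "card (dset i A B k) = card {X. A \<subseteq> X \<and> X \<subseteq> B - {k}}"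
    unfolding dset_def by (rule card_image)
  also have "{X. A \<subseteq> X \<and> X \<subseteq> B - {k}} = (\<lambda>Y. A \<union> Y) ` Pow (B - A - {k})"
  proof (intro equalityI subsetI)
    fix X assume "X \<in> {X. A \<subseteq> X \<and> X \<subseteq> B - {k}}"
    then show "X \<in> (\<lambda>Y. A \<union> Y) ` Pow (B - A - {k})" by (intro image_eqI[of _ _ "X - A"]) auto
  qed (use assms in auto)
  also have "card \<dots> = card (Pow (B - A - {k}))" by (intro card_image inj_onI) blast
  also have "\<dots> = 2 ^ (card (B - A) - 1)"
    using assms finite_directions finite_subset[of "B - A" K] by (subst card_Pow) auto
  finally show ?thesis .
qed

text \<open>A face of dimension \<open>j + 1\<close> has \<open>2 ^ j\<close> edges in each of its
  directions.\<close>

lemma cell_dim_iff: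
  assumes c: "c \<in> derivative_complex P" shows "cell_dim c = int j \<longleftrightarrow> card (edge_code c) = 2 ^ j"
proof -
  obtain i A B k where c: "i < m" "A \<subseteq> B" "B \<subseteq> K" "k \<in> B - A" "c = (face i A B, par i A B k)"
    using assms by (rule derivative_cellE)
  have "finite (B - A)" using c finite_directions finite_subset by blast
  then have pos: "0 < card (B - A)" using c(4) by (auto simp: card_gt_0_iff)
  have "cell_dim c = int (card (B - A)) - 1" using c aff_dim_face[OF c(1-3)] by (simp add: cell_dim_def)
  then have "cell_dim c = int j \<longleftrightarrow> card (B - A) - 1 = j" using pos by auto
  then show ?thesis using edge_code_cell[OF c(1-4)] card_dset[OF c(1-4)] c(5) by simp
qed

definition edge_component :: "nat set set \<Rightarrow> 'a derivative_cell set" where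
  "edge_component H = {c \<in> derivative_complex P. edge_code c \<subseteq> H}"

lemma finite_derivative_complex: "finite (derivative_complex P)"
proof -
  have "derivative_complex P \<subseteq> (\<lambda>(i, A, B, k). (face i A B, par i A B k)) ` ({..<m} \<times> Pow K \<times> Pow K \<times> K)"
  proof
    fix c assume "c \<in> derivative_complex P"
    then obtain i A B k where c: "i < m" "A \<subseteq> B" "B \<subseteq> K" "k \<in> B - A" "c = (face i A B, par i A B k)"
      by (rule derivative_cellE)
    then show "c \<in> (\<lambda>(i, A, B, k). (face i A B, par i A B k)) ` ({..<m} \<times> Pow K \<times> Pow K \<times> K)"
      by (intro image_eqI[of _ _ "(i, A, B, k)"]) auto
  qed
  then show ?thesis by (rule finite_subset) (simp add: finite_directions)
qed

text \<open>Classes of whole facets are enough, because every cell lies below one of them. By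
  \<open>closed\<close> none of them is cut by \<open>hs\<close>, so comparability never leaves the
  set; \<open>conn\<close> leads from every edge back to \<open>hs ! 0\<close> through
  squares.\<close>

theorem edge_component_dual_manifold:
  assumes closed: "\<And>i k. i < m \<Longrightarrow> k \<in> K \<Longrightarrow> dset i {} K k \<subseteq> set hs \<or> dset i {} K k \<inter> set hs = {}"
    and first: "0 < length hs" "\<exists>i<m. \<exists>k\<in>K. hs ! 0 \<in> dset i {} K k"
    and conn: "\<And>n. 0 < n \<Longrightarrow> n < length hs \<Longrightarrow> \<exists>n'<n. \<exists>i<m. \<exists>k\<in>K. hs ! n \<in> dset i {} K k \<and> hs ! n' \<in> dset i {} K k"
  shows "edge_component (set hs) \<in> dual_manifolds P"
proof -
  let ?D = "derivative_complex P"
  define R where "R = {(c, d). c \<in> ?D \<and> d \<in> ?D \<and> cell_le c d}"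
  let ?E = "(R \<union> R\<inverse>)\<^sup>*"
  have cell: "(face i {} K, par i {} K k) \<in> ?D" "edge_code (face i {} K, par i {} K k) = dset i {} K k" if "i < m" "k \<in> K" for i k
    using that edge_code_cell[of i "{}" K k] unfolding derivative_complex_eq by auto
  have vcell: "\<exists>c\<in>?D. edge_code c = {h}" if h: "h \<in> dset i A B k" "i < m" "A \<subseteq> B" "B \<subseteq> K" "k \<in> B - A" for h i A B k
  proof -
    obtain X where X: "A \<subseteq> X" "X \<subseteq> B - {k}" "h = {corner i X, corner i (insert k X)}" using h by (auto simp: dset_def)
    have sub: "X \<subseteq> insert k X" "insert k X \<subseteq> K" "k \<in> insert k X - X" using X h by auto
    have "{Y. X \<subseteq> Y \<and> Y \<subseteq> insert k X - {k}} = {X}" using X by auto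
    then have "dset i X (insert k X) k = {h}" using X by (simp add: dset_def)
    moreover have "(face i X (insert k X), par i X (insert k X) k) \<in> ?D"
      unfolding derivative_complex_eq
      by (intro CollectI exI[of _ i] exI[of _ X] exI[of _ "insert k X"] exI[of _ k] conjI refl sub) (rule h(2))
    moreover note edge_code_cell[OF h(2) sub]
    ultimately show ?thesis by (intro bexI[of _ "(face i X (insert k X), par i X (insert k X) k)"]) simp_all
  qed
  have link: "(c, d) \<in> ?E \<and> (d, c) \<in> ?E" if "c \<in> ?D" "d \<in> ?D" "edge_code c \<subseteq> edge_code d" for c d
  proof -
    have "(c, d) \<in> R" using that(1,2) that(3)[folded cell_le_iff_edge_code[OF that(1,2)]] unfolding R_def by (intro CollectI case_prodI conjI)
    then have "(c, d) \<in> R \<union> R\<inverse>" "(d, c) \<in> R \<union> R\<inverse>" by simp_all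
    then show ?thesis by (intro conjI r_into_rtrancl)
  qed
  obtain i0 k0 where 0: "i0 < m" "k0 \<in> K" "hs ! 0 \<in> dset i0 {} K k0" using first by auto
  obtain c0 where c0: "c0 \<in> ?D" "edge_code c0 = {hs ! 0}" using vcell[OF 0(3,1)] 0(2) by auto
  have reach: "n < length hs \<Longrightarrow> c \<in> ?D \<Longrightarrow> edge_code c = {hs ! n} \<Longrightarrow> (c0, c) \<in> ?E" for n c
  proof (induction n arbitrary: c rule: less_induct)
    case (less n)
    show ?case
    proof (cases "n = 0")
      case True
      then have "c = c0" using inj_onD[OF inj_on_edge_code] less.prems c0 by auto
      then show ?thesis by simp
    next
      case False
      then obtain n' i k where n': "n' < n" "i < m" "k \<in> K" "hs ! n \<in> dset i {} K k" "hs ! n' \<in> dset i {} K k"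
        using conn[of n] less.prems(1) by auto
      obtain c' where c': "c' \<in> ?D" "edge_code c' = {hs ! n'}" using vcell[OF n'(5,2)] n'(3) by auto
      have "(c0, c') \<in> ?E" using less.IH[OF n'(1)] n'(1) less.prems(1) c' by auto
      moreover have "(c', (face i {} K, par i {} K k)) \<in> ?E" using link[OF c'(1) cell(1)[OF n'(2,3)]] cell(2)[OF n'(2,3)] c'(2) n'(5) by auto
      moreover have "((face i {} K, par i {} K k), c) \<in> ?E"
        using link[OF less.prems(2) cell(1)[OF n'(2,3)]] cell(2)[OF n'(2,3)] less.prems(3) n'(4) by auto
      ultimately show ?thesis by (rule rtrancl_trans[OF _ rtrancl_trans])
    qed
  qed
  have comp: "d \<in> edge_component (set hs)" if c: "c \<in> edge_component (set hs)" and cd: "(c, d) \<in> R \<union> R\<inverse>" for c d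
  proof -
    have le: "c \<in> ?D" "d \<in> ?D" "cell_le c d \<or> cell_le d c" "edge_code c \<subseteq> set hs"
      using c cd by (auto simp: R_def edge_component_def)
    then have D: "c \<in> ?D" "d \<in> ?D" "edge_code c \<subseteq> edge_code d \<or> edge_code d \<subseteq> edge_code c" "edge_code c \<subseteq> set hs"
      by (simp_all only: cell_le_iff_edge_code[OF le(1,2)] cell_le_iff_edge_code[OF le(2,1)])
    obtain i A B k where d: "i < m" "A \<subseteq> B" "B \<subseteq> K" "k \<in> B - A" "d = (face i A B, par i A B k)"
      using D(2) by (rule derivative_cellE)
    have "{X. A \<subseteq> X \<and> X \<subseteq> B - {k}} \<subseteq> {X. {} \<subseteq> X \<and> X \<subseteq> K - {k}}" using d(3) by auto
    then have "edge_code d \<subseteq> dset i {} K k"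
      unfolding d(5) edge_code_cell[OF d(1-4)] dset_def by (rule image_mono)
    moreover have "edge_code c \<noteq> {}" "edge_code d \<noteq> {}"
      using derivative_cell_facts(3) D by (auto simp: edge_code_def)
    then have "edge_code d \<inter> set hs \<noteq> {}" using D(3,4) by blast
    ultimately have "dset i {} K k \<subseteq> set hs" using closed[of i k] d by blast
    then show ?thesis using \<open>edge_code d \<subseteq> dset i {} K k\<close> D(2) by (auto simp: edge_component_def)
  qed
  have c0comp: "c0 \<in> edge_component (set hs)" using c0 first by (auto simp: edge_component_def)
  have "?E `` {c0} = edge_component (set hs)"
  proof (intro equalityI subsetI)
    fix d assume "d \<in> ?E `` {c0}"
    then have "(c0, d) \<in> ?E" by auto
    then show "d \<in> edge_component (set hs)"
      by (induction rule: rtrancl_induct) (use c0comp comp in auto)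
  next
    fix d assume d: "d \<in> edge_component (set hs)"
    then have dD: "d \<in> ?D" "edge_code d \<subseteq> set hs" by (auto simp: edge_component_def)
    obtain i A B k where ik: "i < m" "A \<subseteq> B" "B \<subseteq> K" "k \<in> B - A" "d = (face i A B, par i A B k)"
      using dD(1) by (rule derivative_cellE)
    have "edge_code d \<noteq> {}" using derivative_cell_facts(3)[OF dD(1)] by (auto simp: edge_code_def)
    then obtain h where h: "h \<in> edge_code d" by auto
    then have "h \<in> set hs" using dD(2) by blast
    then obtain n where n: "n < length hs" "h = hs ! n" by (auto simp: in_set_conv_nth)
    obtain c where c: "c \<in> ?D" "edge_code c = {h}" using vcell[OF h[unfolded ik(5) edge_code_cell[OF ik(1-4)]] ik(1-4)] by blast
    have "(c0, c) \<in> ?E" using reach[OF n(1) c(1)] c(2) n(2) by simp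
    moreover have "(c, d) \<in> ?E" using link[OF c(1) dD(1)] c(2) h by auto
    ultimately have "(c0, d) \<in> ?E" by (rule rtrancl_trans)
    then show "d \<in> ?E `` {c0}" by simp
  qed
  moreover have "?E `` {c0} \<in> ?D // ?E" using c0(1) by (rule quotientI)
  ultimately show ?thesis unfolding dual_manifolds_def generated_equivalence_def R_def by simp
qed

text \<open>Positions in \<open>hs\<close> replace the edges, so that the cells of the surface
  become sets of small numbers.\<close>

definition ids :: "nat set list \<Rightarrow> nat set set \<Rightarrow> nat set" where "ids hs E = {n. n < length hs \<and> hs ! n \<in> E}"

lemma ids_code:
  assumes "distinct hs"
  shows "\<And>E E'. E \<subseteq> set hs \<Longrightarrow> E' \<subseteq> set hs \<Longrightarrow> ids hs E \<subseteq> ids hs E' \<longleftrightarrow> E \<subseteq> E'"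
    "\<And>E. E \<subseteq> set hs \<Longrightarrow> card (ids hs E) = card E"
proof -
  have im: "(\<lambda>n. hs ! n) ` ids hs E = E" if "E \<subseteq> set hs" for E
    using that by (force simp: ids_def in_set_conv_nth)
  show "ids hs E \<subseteq> ids hs E' \<longleftrightarrow> E \<subseteq> E'" if "E \<subseteq> set hs" "E' \<subseteq> set hs" for E E'
  proof
    assume "ids hs E \<subseteq> ids hs E'"
    then have "(\<lambda>n. hs ! n) ` ids hs E \<subseteq> (\<lambda>n. hs ! n) ` ids hs E'" by (rule image_mono)
    then show "E \<subseteq> E'" by (simp only: im[OF that(1)] im[OF that(2)])
  qed (auto simp: ids_def)
  have "inj_on (\<lambda>n. hs ! n) (ids hs E)" for E
    using assms by (auto simp: inj_on_def ids_def nth_eq_iff_index_eq)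
  then show "card (ids hs E) = card E" if "E \<subseteq> set hs" for E
    using card_image[of "\<lambda>n. hs ! n" "ids hs E"] im[OF that] by simp
qed

theorem edge_component_realization:
  assumes hs: "distinct hs" and C: "C = (\<lambda>c. ids hs (edge_code c)) ` edge_component (set hs)"
  shows "geometric_realization (edge_component (set hs)) homeomorphic_space top_of_set (order_weights (\<subseteq>) C)"
    "\<And>j. card {c \<in> edge_component (set hs). cell_dim c = int j} = card {x \<in> C. card x = 2 ^ j}"
proof -
  let ?K = "edge_component (set hs)" and ?f = "\<lambda>c. ids hs (edge_code c)"
  have D: "c \<in> derivative_complex P" "edge_code c \<subseteq> set hs" if "c \<in> ?K" for c
    using that by (auto simp: edge_component_def)
  have le: "cell_le c d \<longleftrightarrow> ?f c \<subseteq> ?f d" if "c \<in> ?K" "d \<in> ?K" for c d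
    using cell_le_iff_edge_code[OF D(1)[OF that(1)] D(1)[OF that(2)]] ids_code(1)[OF hs D(2)[OF that(1)] D(2)[OF that(2)]] by simp
  have inj: "inj_on ?f ?K"
  proof (rule inj_onI)
    fix c d assume cd: "c \<in> ?K" "d \<in> ?K" "?f c = ?f d"
    then have "cell_le c d" "cell_le d c" using le by auto
    then show "c = d" by (auto simp: cell_le_def prod_eq_iff)
  qed
  then have bij: "bij_betw ?f ?K C" by (simp add: bij_betw_def C)
  have fin: "finite ?K" using finite_derivative_complex by (auto simp: edge_component_def)
  show "geometric_realization ?K homeomorphic_space top_of_set (order_weights (\<subseteq>) C)"
    unfolding geometric_realization_eq
    by (rule order_weights_homeomorphic[where le = cell_le and le' = "(\<subseteq>)", OF bij fin]) (rule le)
  fix j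
  have "?f ` {c \<in> ?K. cell_dim c = int j} = {x \<in> C. card x = 2 ^ j}"
    unfolding C using cell_dim_iff[OF D(1)] ids_code(2)[OF hs D(2)] by auto
  then show "card {c \<in> ?K. cell_dim c = int j} = card {x \<in> C. card x = 2 ^ j}"
    using card_image[of ?f "{c \<in> ?K. cell_dim c = int j}"] inj_on_subset[OF inj] by auto
qed

end

section \<open>The tables\<close>

text \<open>An entry \<open>(x, y, v, z, w)\<close> stands for the point \<open>(x/w, y/w, v/w, z/w)\<close>.\<close>

definition vertex_table :: "(int \<times> int \<times> int \<times> int \<times> int) list" where
  "vertex_table =
    [(-1, -1, 1, 0, 1), (-1, -1, -1, 0, 1), (-1, -1, 1, 2, 5), (-1, -1, -1, 2, 5),
     (1, -1, 1, 0, 1), (1, -1, -1, 0, 1), (1, -1, 1, 2, 5), (1, -1, -1, 2, 5), (1, 1, 1, 0, 1),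
     (1, 1, -1, 0, 1), (1, 1, 1, 2, 5), (1, 1, -1, 2, 5), (-1, 1, 1, 0, 1), (-1, 1, -1, 0, 1),
     (-1, 1, 1, 2, 5), (-1, 1, -1, 2, 5), (5, -5, 3, 1, 6), (5, -5, -3, 1, 6),
     (5, -5, 3, 7, 18), (5, -5, -3, 7, 18), (-5, 5, 3, 1, 6), (-5, 5, -3, 1, 6),
     (-5, 5, 3, 7, 18), (-5, 5, -3, 7, 18), (5, 5, 3, 1, 6), (5, 5, -3, 1, 6),
     (5, 5, 3, 7, 18), (5, 5, -3, 7, 18), (4, -5, 1, 2, 7), (4, -5, -1, 2, 7),
     (4, -5, 1, 4, 11), (4, -5, -1, 4, 11), (-5, 4, 1, 2, 7), (-5, 4, -1, 2, 7),
     (-5, 4, 1, 4, 11), (-5, 4, -1, 4, 11), (4, 4, 1, 2, 7), (4, 4, -1, 2, 7),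
     (4, 4, 1, 4, 11), (4, 4, -1, 4, 11), (1, -1, 1, -2, 5), (1, -1, -1, -2, 5),
     (-1, -1, 1, -2, 5), (-1, -1, -1, -2, 5), (-1, 1, 1, -2, 5), (-1, 1, -1, -2, 5),
     (1, 1, 1, -2, 5), (1, 1, -1, -2, 5), (-5, -5, 3, -1, 6), (-5, -5, -3, -1, 6),
     (-5, -5, 3, -7, 18), (-5, -5, -3, -7, 18), (5, 5, 3, -1, 6), (5, 5, -3, -1, 6),
     (5, 5, 3, -7, 18), (5, 5, -3, -7, 18), (-5, 5, 3, -1, 6), (-5, 5, -3, -1, 6),
     (-5, 5, 3, -7, 18), (-5, 5, -3, -7, 18), (-4, -5, 1, -2, 7), (-4, -5, -1, -2, 7),
     (-4, -5, 1, -4, 11), (-4, -5, -1, -4, 11), (5, 4, 1, -2, 7), (5, 4, -1, -2, 7),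
     (5, 4, 1, -4, 11), (5, 4, -1, -4, 11), (-4, 4, 1, -2, 7), (-4, 4, -1, -2, 7),
     (-4, 4, 1, -4, 11), (-4, 4, -1, -4, 11)]"

text \<open>An entry \<open>((a, b, c, d, e), vs)\<close> stands for the half-space \<open>a x + b y + c v + d z + e \<ge> 0\<close>;
  \<open>vs ! c\<close> is the vertex of the facet whose coordinates in the cube are the binary digits of \<open>c\<close>.\<close>

definition facet_table :: "((int \<times> int \<times> int \<times> int \<times> int) \<times> nat list) list" where
  "facet_table =
    [((0, 1, 0, -1, 1), [0,28,4,16,1,29,5,17]), ((0, 1, -1, -4, 2), [0,28,4,16,2,30,6,18]),
     ((0, 1, 0, -7, 3), [2,30,6,18,3,31,7,19]), ((0, 1, 1, -4, 2), [1,29,5,17,3,31,7,19]),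
     ((0, 0, -1, -2, 1), [0,4,12,8,2,6,14,10]), ((0, 0, 0, -5, 2), [2,6,14,10,3,7,15,11]),
     ((0, 0, 1, -2, 1), [1,5,13,9,3,7,15,11]), ((1, 0, 0, -1, 1), [0,12,32,20,1,13,33,21]),
     ((1, 0, -1, -4, 2), [0,12,32,20,2,14,34,22]), ((1, 0, 0, -7, 3), [2,14,34,22,3,15,35,23]),
     ((1, 0, 1, -4, 2), [1,13,33,21,3,15,35,23]),
     ((0, -5, 0, -11, 6), [24,20,36,32,25,21,37,33]),
     ((0, -5, -1, -14, 7), [24,20,36,32,26,22,38,34]),
     ((0, -5, 0, -17, 8), [26,22,38,34,27,23,39,35]),
     ((0, -5, 1, -14, 7), [25,21,37,33,27,23,39,35]),
     ((-5, 0, 0, -11, 6), [24,36,16,28,25,37,17,29]),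
     ((-5, 0, -1, -14, 7), [24,36,16,28,26,38,18,30]),
     ((-5, 0, 0, -17, 8), [26,38,18,30,27,39,19,31]),
     ((-5, 0, 1, -14, 7), [25,37,17,29,27,39,19,31]),
     ((-1, 0, 0, -1, 1), [24,16,8,4,25,17,9,5]), ((-1, 0, -1, -4, 2), [24,16,8,4,26,18,10,6]),
     ((-1, 0, 0, -7, 3), [26,18,10,6,27,19,11,7]), ((-1, 0, 1, -4, 2), [25,17,9,5,27,19,11,7]),
     ((0, -1, 0, -1, 1), [24,8,20,12,25,9,21,13]),
     ((0, -1, -1, -4, 2), [24,8,20,12,26,10,22,14]),
     ((0, -1, 0, -7, 3), [26,10,22,14,27,11,23,15]),
     ((0, -1, 1, -4, 2), [25,9,21,13,27,11,23,15]), ((2, 7, 0, -18, 9), [0,2,1,3,28,30,29,31]),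
     ((-3, 0, 0, -8, 4), [28,30,29,31,36,38,37,39]),
     ((0, -3, 0, -8, 4), [36,38,37,39,32,34,33,35]),
     ((7, 2, 0, -18, 9), [32,34,33,35,0,2,1,3]), ((0, 1, 0, 1, 1), [4,60,0,48,5,61,1,49]),
     ((0, 1, -1, 4, 2), [4,60,0,48,40,62,42,50]), ((0, 1, 0, 7, 3), [40,62,42,50,41,63,43,51]),
     ((0, 1, 1, 4, 2), [5,61,1,49,41,63,43,51]), ((0, 0, -1, 2, 1), [4,0,8,12,40,42,46,44]),
     ((0, 0, 0, 5, 2), [40,42,46,44,41,43,47,45]), ((0, 0, 1, 2, 1), [5,1,9,13,41,43,47,45]),
     ((-1, 0, 0, 1, 1), [4,8,64,52,5,9,65,53]), ((-1, 0, -1, 4, 2), [4,8,64,52,40,46,66,54]),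
     ((-1, 0, 0, 7, 3), [40,46,66,54,41,47,67,55]),
     ((-1, 0, 1, 4, 2), [5,9,65,53,41,47,67,55]),
     ((0, -5, 0, 11, 6), [56,52,68,64,57,53,69,65]),
     ((0, -5, -1, 14, 7), [56,52,68,64,58,54,70,66]),
     ((0, -5, 0, 17, 8), [58,54,70,66,59,55,71,67]),
     ((0, -5, 1, 14, 7), [57,53,69,65,59,55,71,67]),
     ((5, 0, 0, 11, 6), [56,68,48,60,57,69,49,61]),
     ((5, 0, -1, 14, 7), [56,68,48,60,58,70,50,62]),
     ((5, 0, 0, 17, 8), [58,70,50,62,59,71,51,63]),
     ((5, 0, 1, 14, 7), [57,69,49,61,59,71,51,63]), ((1, 0, 0, 1, 1), [56,48,12,0,57,49,13,1]),
     ((1, 0, -1, 4, 2), [56,48,12,0,58,50,44,42]),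
     ((1, 0, 0, 7, 3), [58,50,44,42,59,51,45,43]), ((1, 0, 1, 4, 2), [57,49,13,1,59,51,45,43]),
     ((0, -1, 0, 1, 1), [56,12,52,8,57,13,53,9]),
     ((0, -1, -1, 4, 2), [56,12,52,8,58,44,54,46]),
     ((0, -1, 0, 7, 3), [58,44,54,46,59,45,55,47]),
     ((0, -1, 1, 4, 2), [57,13,53,9,59,45,55,47]),
     ((-2, 7, 0, 18, 9), [4,40,5,41,60,62,61,63]),
     ((3, 0, 0, 8, 4), [60,62,61,63,68,70,69,71]),
     ((0, -3, 0, 8, 4), [68,70,69,71,64,66,65,67]), ((-7, 2, 0, 18, 9), [64,66,65,67,4,40,5,41])]"

text \<open>The edges of the polytope that are vertices of the Klein bottle, in an order in which each one
  after the first shares a square of the dual manifold with an earlier one.\<close>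

definition dual_edges :: "nat list list" where
  "dual_edges =
    [[0,4], [1,5], [2,6], [8,12], [10,14], [16,28], [17,29], [18,30], [40,42], [44,46],
     [48,60], [49,61], [50,62], [3,7], [9,13], [11,15], [19,31], [41,43], [45,47], [51,63],
     [20,24], [21,25], [22,26], [52,56], [53,57], [54,58], [23,27], [24,36], [25,37], [26,38],
     [27,39], [55,59], [56,68], [57,69], [58,70], [59,71], [32,36], [33,37], [34,38], [35,39],
     [64,68], [65,69], [66,70], [67,71], [20,32], [21,33], [22,34], [23,35], [52,64], [53,65],
     [54,66], [55,67], [0,12], [1,13], [2,14], [3,15], [4,8], [5,9], [40,46], [41,47], [6,10],
     [42,44], [48,56], [49,57], [50,58], [7,11], [43,45], [51,59], [16,24], [17,25], [18,26],
     [19,27], [60,68], [61,69], [62,70], [63,71], [28,36], [29,37], [30,38], [31,39]]"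

text \<open>For each facet and each of its three directions, the cycle of positions in \<open>dual_edges\<close> of the
  four parallel edges, or \<open>[]\<close> if these do not belong to the dual manifold.\<close>

definition trace_table :: "nat list list list" where
  "trace_table =
    [[[], [0,5,6,1], []], [[], [0,5,7,2], []], [[], [2,7,16,13], []], [[], [1,6,16,13], []],
     [[0,3,4,2], [52,56,60,54], []], [[2,4,15,13], [54,60,65,55], []],
     [[1,14,15,13], [53,57,65,55], []], [[52,44,45,53], [], []], [[52,44,46,54], [], []],
     [[54,46,47,55], [], []], [[53,45,47,55], [], []], [[20,36,37,21], [27,44,45,28], []],
     [[20,36,38,22], [27,44,46,29], []], [[22,38,39,26], [29,46,47,30], []],
     [[21,37,39,26], [28,45,47,30], []], [[27,5,6,28], [68,76,77,69], []],
     [[27,5,7,29], [68,76,78,70], []], [[29,7,16,30], [70,78,79,71], []],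
     [[28,6,16,30], [69,77,79,71], []], [[68,56,57,69], [], []], [[68,56,60,70], [], []],
     [[70,60,65,71], [], []], [[69,57,65,71], [], []], [[], [20,3,14,21], []],
     [[], [20,3,4,22], []], [[], [22,4,15,26], []], [[], [21,14,15,26], []], [[], [], []],
     [[], [], [76,78,79,77]], [[], [], [36,38,39,37]], [[], [], []], [[], [0,10,11,1], []],
     [[], [0,10,12,8], []], [[], [8,12,19,17], []], [[], [1,11,19,17], []],
     [[0,3,9,8], [56,52,61,58], []], [[8,9,18,17], [58,61,66,59], []],
     [[1,14,18,17], [57,53,66,59], []], [[56,48,49,57], [], []], [[56,48,50,58], [], []],
     [[58,50,51,59], [], []], [[57,49,51,59], [], []], [[23,40,41,24], [32,48,49,33], []],
     [[23,40,42,25], [32,48,50,34], []], [[25,42,43,31], [34,50,51,35], []],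
     [[24,41,43,31], [33,49,51,35], []], [[32,10,11,33], [62,72,73,63], []],
     [[32,10,12,34], [62,72,74,64], []], [[34,12,19,35], [64,74,75,67], []],
     [[33,11,19,35], [63,73,75,67], []], [[62,52,53,63], [], []], [[62,52,61,64], [], []],
     [[64,61,66,67], [], []], [[63,53,66,67], [], []], [[], [23,3,14,24], []],
     [[], [23,3,9,25], []], [[], [25,9,18,31], []], [[], [24,14,18,31], []], [[], [], []],
     [[], [], [72,74,75,73]], [[], [], [40,42,43,41]], [[], [], []]]"

definition first_square :: "nat list" where "first_square = [57, 53, 66, 59]"

text \<open>A certificate of 79 steps, one for each further square. Arcs of 1, 2 or 3 edges leave 2,
  1 or 0 vertices to list. A listed vertex may already lie elsewhere on the boundary, as 0 does
  several times: these are the identifications that the disc map leaves open.\<close>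

definition gluing_steps :: "(nat \<times> nat \<times> nat list) list" where
  "gluing_steps =
    [(2, 1, [63,67]), (3, 1, [65,55]), (5, 1, [51,49]), (4, 1, [52,62]), (5, 1, [35,33]),
     (11, 1, [58,50]), (1, 2, [34]), (13, 2, [61]), (15, 2, [64]), (4, 1, [12,19]),
     (1, 2, [11]), (1, 1, [32,48]), (1, 2, [56]), (17, 2, [10]), (6, 1, [47,45]), (1, 2, [44]),
     (7, 1, [56,48]), (1, 2, [32]), (1, 2, [10]), (7, 1, [68,69]), (1, 2, [71]),
     (18, 1, [17,1]), (1, 2, [0]), (25, 2, [8]), (27, 2, [0]), (0, 1, [3,9]), (1, 2, [18]),
     (1, 2, [14]), (27, 1, [23,25]), (1, 2, [31]), (1, 2, [24]), (18, 1, [73,75]),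
     (1, 2, [74]), (33, 2, [72]), (33, 3, []), (2, 3, []), (1, 3, []), (2, 3, []),
     (8, 1, [42,43]), (26, 2, [40]), (1, 2, [41]), (2, 3, []), (0, 3, []), (1, 3, []),
     (11, 1, [60,54]), (1, 2, [46]), (21, 2, [70]), (5, 1, [28,27]), (24, 2, [30]),
     (25, 2, [29]), (12, 1, [15,13]), (27, 1, [4,2]), (10, 1, [79,78]), (30, 2, [77]),
     (31, 2, [76]), (2, 3, []), (1, 3, []), (1, 3, []), (1, 2, [52]), (1, 2, [44]),
     (1, 2, [27]), (2, 1, [16,6]), (1, 2, [5]), (25, 2, [7]), (27, 2, [5]), (13, 1, [20,21]),
     (1, 2, [26]), (1, 2, [22]), (13, 1, [0,2]), (1, 2, [13]), (1, 2, [1]), (1, 2, [0]),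
     (12, 1, [37,39]), (1, 2, [38]), (33, 2, [36]), (33, 3, []), (2, 3, []), (1, 3, []),
     (1, 3, [])]"

text \<open>This loop and \<open>loop_b\<close> meet only in their base point 0, the position of the
  edge \<open>[0,4]\<close>. Together they form the graph with 12 vertices and 13 edges to which the
  boundary of the disc is folded.\<close>

definition loop_a :: "nat list" where "loop_a = [0, 10, 32, 48, 56, 52, 44, 27, 5, 0]"

definition loop_b :: "nat list" where "loop_b = [0, 2, 13, 1, 0]"

section \<open>Checks by evaluation\<close>

fun dot5 :: "int \<times> int \<times> int \<times> int \<times> int \<Rightarrow> int \<times> int \<times> int \<times> int \<times> int \<Rightarrow> int" where
  "dot5 (a, b, c, d, e) (a', b', c', d', e') = a * a' + b * b' + c * c' + d * d' + e * e'"

fun last5 :: "int \<times> int \<times> int \<times> int \<times> int \<Rightarrow> int" where "last5 (a, b, c, d, e) = e"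

definition binary_code :: "nat set \<Rightarrow> nat" where "binary_code S = (\<Sum>k\<in>S. 2 ^ k)"

text \<open>One side of a facet as a pattern over its eight corners; the six such patterns are
  compared with the corners shared by another facet.\<close>

definition bit_pattern :: "bool \<Rightarrow> nat \<Rightarrow> bool list" where
  "bit_pattern v k = map (\<lambda>c. odd (c div 2 ^ k) = v) [0..<8]"

lemma incidence_check:
  "list_all (\<lambda>(a, vs). list_all (\<lambda>(j, h). let s = dot5 a h in
     if s = 0 then List.member vs j else 0 < s \<and> \<not> List.member vs j) (List.enumerate 0 vertex_table)) facet_table"
  by code_simp

lemma neighbour_check:
  "list_all (\<lambda>(a, vs). list_all (\<lambda>pat. list_ex (\<lambda>(b, ws). map (List.member ws) vs = pat) facet_table)
     (map (bit_pattern False) [0..<3] @ map (bit_pattern True) [0..<3])) facet_table"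
  by code_simp

lemma table_bounds:
  "length vertex_table = 72" "length facet_table = 62" "list_all (\<lambda>h. 0 < last5 h) vertex_table"
  "list_all (\<lambda>(a, vs). 0 < last5 a \<and> length vs = 8 \<and> list_all (\<lambda>j. j < 72) vs) facet_table"
  "sorted_elements (concat (map snd facet_table)) = [0..<72]"
  "List.member (map fst facet_table) (0, 0, 0, 5, 2)" "List.member (map fst facet_table) (0, 0, 0, -5, 2)"
  by code_simp+

text \<open>A face of a facet is a set of positions in its list of corners, and the same position
  lists serve all facets.\<close>

definition face_positions :: "nat \<Rightarrow> nat list list" where
  "face_positions d = [[[0],[1],[2],[3],[4],[5],[6],[7]],
     [[0,1],[2,3],[4,5],[6,7],[0,2],[1,3],[4,6],[5,7],[0,4],[1,5],[2,6],[3,7]],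
     [[0,1,2,3],[4,5,6,7],[0,1,4,5],[2,3,6,7],[0,2,4,6],[1,3,5,7]],
     [[0,1,2,3,4,5,6,7]]] ! d"

definition face_list :: "nat \<Rightarrow> nat list list" where
  "face_list d = concat (map (\<lambda>(a, vs). map (\<lambda>p. sort (map ((!) vs) p)) (face_positions d)) facet_table)"

lemma face_list_check:
  "list_all (\<lambda>d. list_all strictly_sorted (face_list d)) [0..<4]"
  "list_all (\<lambda>d. strictly_sorted (sorted_elements (face_list d))) [0..<4]"
  "map (\<lambda>d. length (sorted_elements (face_list d))) [0..<4] = [72, 196, 186, 62]"
  by code_simp+

lemma face_position_sets:
  "list_all (\<lambda>d. (\<lambda>(A, B). binary_code ` Set.filter (\<lambda>S. A \<subseteq> S \<and> S \<subseteq> B) (Pow {0, 1, 2})) `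
     Set.filter (\<lambda>(A, B). A \<subseteq> B \<and> card (B - A) = d) (Pow {0, 1, 2} \<times> Pow {0, 1, 2}) =
     set ` set (face_positions d)) [0..<4]"
  by code_simp

text \<open>The lower ends of the four edges of direction \<open>k\<close>, in cyclic order:
  neighbours differ in one bit, so consecutive edges lie on a common 2-face and the midpoints form a
  square in this order.\<close>

definition direction_cycle :: "nat \<Rightarrow> nat list" where
  "direction_cycle k = [[0, 2, 6, 4], [0, 1, 5, 4], [0, 1, 3, 2]] ! k"

text \<open>The faces of a cube that contain direction \<open>k\<close> form the face poset of a
  square on the lower ends of the four edges. This turns intervals of directions into cells of a
  quadrilateral.\<close>

lemma direction_cells:
  "list_all (\<lambda>k. (\<lambda>(A, B). binary_code ` Set.filter (\<lambda>S. A \<subseteq> S \<and> S \<subseteq> B - {k}) (Pow {0, 1, 2})) `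
     Set.filter (\<lambda>(A, B). A \<subseteq> B \<and> k \<in> B - A) (Pow {0, 1, 2} \<times> Pow {0, 1, 2}) =
     quad_cells (direction_cycle k)) [0..<3]"
  by code_simp

lemma direction_cycle_set: "list_all (\<lambda>k. binary_code ` Pow ({0, 1, 2} - {k}) = set (direction_cycle k)) [0..<3]"
  by code_simp

definition edge_quad :: "nat list \<Rightarrow> nat \<Rightarrow> nat list list" where
  "edge_quad vs k = map (\<lambda>c. sorted_pair (vs ! c) (vs ! (c + 2 ^ k))) (direction_cycle k)"

definition trace_check where
  "trace_check = list_all (\<lambda>((a, vs), r). length r = 3 \<and> list_all (\<lambda>(k, q). q = [] \<or>
     list_all (\<lambda>j. j < 80) q \<and> map ((!) dual_edges) q = edge_quad vs k) (List.enumerate 0 r)) (zip facet_table trace_table)"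

lemma trace_check: trace_check by code_simp

text \<open>The edges of the classes marked empty in \<open>trace_table\<close>. Their disjointness
  from \<open>dual_edges\<close> is what allows an empty entry to mean that the class misses the
  component.\<close>

definition other_edges :: "nat list list" where
  "other_edges = concat (map (\<lambda>((a, vs), r). concat (map (\<lambda>(k, q). if q = [] then edge_quad vs k else [])
     (List.enumerate 0 r))) (zip facet_table trace_table))"

lemma other_edges_check:
  "length trace_table = 62" "length dual_edges = 80" "strictly_sorted (sorted_elements dual_edges)"
  "length (sorted_elements dual_edges) = 80" "list_all strictly_sorted dual_edges"
  "length (sorted_elements other_edges) = 116" "length (sorted_elements (dual_edges @ other_edges)) = 196"
  "strictly_sorted (sorted_elements (dual_edges @ other_edges))" "list_all strictly_sorted other_edges"
  by code_simp+

definition trace_quads :: "nat list list" where "trace_quads = filter (\<lambda>q. q \<noteq> []) (concat trace_table)"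

lemma linked_check: "list_all (\<lambda>n. list_ex (\<lambda>q. List.member q n \<and> list_ex (\<lambda>j. j < n) q) trace_quads) [1..<80]"
  "list_ex (\<lambda>q. List.member q 0) trace_quads"
  by code_simp+

definition shelled where
  "shelled = glue_all gluing_steps (first_square @ [hd first_square], [first_square], [sort first_square])"

definition word where "word = fst shelled"
definition squares where "squares = fst (snd shelled)"
definition swept where "swept = snd (snd shelled)"
lemma glue_ok: "glue_all_ok gluing_steps (first_square @ [hd first_square], [first_square], [sort first_square])"
  by code_simp
text \<open>Of the 26 edges of the word, \<open>loop_b\<close> and \<open>loop_a\<close> account for
  4 and 9, each twice; the rotation by 25 makes it start at the base point.\<close>

lemma word: "rotate_word 25 word = (loop_b @ tl loop_a) @ tl (loop_b @ tl (rev loop_a))" by code_simp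

fun quad_edges :: "nat list \<Rightarrow> nat list list" where
  "quad_edges [a, b, c, d] = [sorted_pair a b, sorted_pair b c, sorted_pair c d, sorted_pair d a]"
| "quad_edges _ = []"

fun quad_diagonals :: "nat list \<Rightarrow> nat list list" where
  "quad_diagonals [a, b, c, d] = [sorted_pair a c, sorted_pair b d]"
| "quad_diagonals _ = []"

definition quad_cell_list :: "nat list \<Rightarrow> nat list list" where
  "quad_cell_list q = sort q # map (\<lambda>a. [a]) q @ quad_edges q"

definition complex_cells :: "nat list list \<Rightarrow> nat list list" where
  "complex_cells qs = sorted_elements (concat (map quad_cell_list qs))"

text \<open>The gluing run and \<open>trace_table\<close> list the squares in different orders and
  with different starting vertices, so their cells are compared. The counts 80, 160, 80 refer to
  cells with 1, 2 and 4 vertices.\<close>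

lemma squares_check: "complex_cells squares = complex_cells trace_quads"
  "strictly_sorted (complex_cells squares)" "list_all strictly_sorted (complex_cells squares)"
  "map (\<lambda>j. length (filter (\<lambda>c. length c = 2 ^ j) (complex_cells squares))) [0..<3] = [80, 160, 80]"
  "list_all (\<lambda>q. length q = 4 \<and> strictly_sorted (sort q)) squares"
  "list_all (\<lambda>q. length q = 4) trace_quads" "List.member squares first_square"
  by code_simp+

text \<open>As the number of distinct elements of the concatenation is the sum of the numbers of the
  two parts, no diagonal is a cell.\<close>

lemma diagonals_check:
  "length (sorted_elements (concat (map quad_diagonals squares) @ complex_cells squares)) =
     length (sorted_elements (concat (map quad_diagonals squares))) + length (complex_cells squares)"
  "strictly_sorted (sorted_elements (concat (map quad_diagonals squares) @ complex_cells squares))"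
  "strictly_sorted (sorted_elements (concat (map quad_diagonals squares)))"
  by code_simp+

definition cell_partition where
  "cell_partition = swept @ [[0]] @ inner_cells loop_a @ inner_cells loop_b"

text \<open>Equal sets and equal lengths mean that the interior cells, the base point and the inner
  cells of the two loops cover the complex without repetition. Disjointness during the gluing and in
  the final word both come from here.\<close>

lemma cell_partition_check:
  "sorted_elements cell_partition = complex_cells squares" "length cell_partition = length (complex_cells squares)"
  by code_simp+

lemma loops_distinct: "distinct (butlast (nodes loop_a))" "distinct (butlast (nodes loop_b))"
  by code_simp+

section \<open>Increasing lists as names of sets\<close>

lemma strictly_sorted_sorted: "strictly_sorted xs \<Longrightarrow> sorted xs \<and> distinct xs"
proof (induction xs rule: strictly_sorted.induct)
  case (1 x y xs)
  then have "x < y" "sorted (y # xs)" "distinct (y # xs)" by auto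
  then show ?case by force
qed auto

lemma inj_on_set_strictly_sorted: "inj_on set {xs. strictly_sorted xs}"
proof (rule inj_onI)
  fix xs ys :: "'a list" assume "xs \<in> {xs. strictly_sorted xs}" "ys \<in> {xs. strictly_sorted xs}" "set xs = set ys"
  then show "xs = ys" using strictly_sorted_sorted[of xs] strictly_sorted_sorted[of ys] by (intro sorted_distinct_set_unique) auto
qed

lemma card_set_set_strictly_sorted:
  assumes "list_all strictly_sorted xs" "strictly_sorted (sorted_elements xs)"
  shows "card (set ` set xs) = length (sorted_elements xs)"
proof -
  have "inj_on set (set xs)"
    by (rule inj_on_subset[OF inj_on_set_strictly_sorted]) (use assms(1) in \<open>auto simp: list_all_iff\<close>)
  then show ?thesis using card_set_eqI(1)[OF refl assms(2)] by (simp add: card_image)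
qed

section \<open>The polytope read off the tables\<close>

lemma vector_4:
  "(vector [a, b, c, d] :: ('a::zero)^4) $ 1 = a" "(vector [a, b, c, d] :: ('a::zero)^4) $ 2 = b"
  "(vector [a, b, c, d] :: ('a::zero)^4) $ 3 = c" "(vector [a, b, c, d] :: ('a::zero)^4) $ 4 = d"
  by (simp_all add: vector_def)

definition vertex :: "nat \<Rightarrow> real ^ 4" where
  "vertex j = (case vertex_table ! j of (x, y, v, z, w) \<Rightarrow>
     vector [of_int x / of_int w, of_int y / of_int w, of_int v / of_int w, of_int z / of_int w])"

text \<open>The table states half-spaces as nonnegativity of an affine form; the minus sign turns
  this into an upper bound on the linear part.\<close>

definition facet_normal :: "nat \<Rightarrow> real ^ 4" where
  "facet_normal i = (case fst (facet_table ! i) of (a, b, c, d, e) \<Rightarrow> - vector [of_int a, of_int b, of_int c, of_int d])"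

definition facet_offset :: "nat \<Rightarrow> real" where "facet_offset i = of_int (last5 (fst (facet_table ! i)))"

definition facet_corner :: "nat \<Rightarrow> nat set \<Rightarrow> nat" where
  "facet_corner i S = snd (facet_table ! i) ! binary_code S"

text \<open>The product \<open>dot5\<close> of homogeneous coordinates is the slack of the
  inequality times the common denominator of the point, so its sign and its vanishing can be decided
  with integers.\<close>

lemma slack:
  assumes "0 < last5 (vertex_table ! j)"
  shows "facet_offset i - facet_normal i \<bullet> vertex j =
    of_int (dot5 (fst (facet_table ! i)) (vertex_table ! j)) / of_int (last5 (vertex_table ! j))"
proof -
  obtain x y v z w where h: "vertex_table ! j = (x, y, v, z, w)" by (metis prod.exhaust)
  obtain a b c d e where n: "fst (facet_table ! i) = (a, b, c, d, e)" by (metis prod.exhaust)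
  show ?thesis
    using assms by (simp add: h n vertex_def facet_normal_def facet_offset_def inner_vec_def sum_4 vector_4 field_simps)
qed

lemma subset_012: "S \<subseteq> {0, 1, 2::nat} \<Longrightarrow> S \<in> {{}, {0}, {1}, {0, 1}, {2}, {0, 2}, {1, 2}, {0, 1, 2}}"
proof -
  have "Pow {0, 1, 2::nat} = {{}, {0}, {1}, {0, 1}, {2}, {0, 2}, {1, 2}, {0, 1, 2}}" by code_simp
  then show "S \<subseteq> {0, 1, 2} \<Longrightarrow> ?thesis" using Pow_iff by blast
qed

lemma binary_code_bit:
  assumes "S \<subseteq> {0, 1, 2}" "k \<in> {0, 1, 2}" shows "odd (binary_code S div 2 ^ k) \<longleftrightarrow> k \<in> S"
  using subset_012[OF assms(1)] assms(2) by (elim insertE emptyE) (simp_all add: binary_code_def)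

lemma binary_code_Pow: "binary_code ` Pow {0, 1, 2} = {..<8}"
proof -
  have "binary_code ` Pow {0, 1, 2} = set [0..<8]" by code_simp
  then show ?thesis by (simp only: atLeast_upt)
qed

lemma binary_code_less: "S \<subseteq> {0, 1, 2} \<Longrightarrow> binary_code S < 8"
  using binary_code_Pow by blast

lemma facet_table_nth:
  assumes "i < 62"
  shows "facet_table ! i \<in> set facet_table" "length (snd (facet_table ! i)) = 8"
    "set (snd (facet_table ! i)) \<subseteq> {..<72}" "0 < last5 (fst (facet_table ! i))"
proof -
  show mem: "facet_table ! i \<in> set facet_table" using assms table_bounds(2) by simp
  then show "length (snd (facet_table ! i)) = 8" "set (snd (facet_table ! i)) \<subseteq> {..<72}" "0 < last5 (fst (facet_table ! i))"
    using table_bounds(4) unfolding list_all_iff by (auto simp: case_prod_unfold)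
qed

lemma facet_corner_Pow: "i < 62 \<Longrightarrow> facet_corner i ` Pow {0, 1, 2} = set (snd (facet_table ! i))"
proof -
  assume i: "i < 62"
  have "facet_corner i ` Pow {0, 1, 2} = (!) (snd (facet_table ! i)) ` (binary_code ` Pow {0, 1, 2})"
    unfolding facet_corner_def image_image ..
  then show ?thesis unfolding binary_code_Pow using facet_table_nth(2)[OF i] by (auto simp: set_conv_nth)
qed

lemma incidence:
  assumes "i < 62" "j < 72"
  shows "facet_normal i \<bullet> vertex j \<le> facet_offset i"
    "facet_normal i \<bullet> vertex j = facet_offset i \<longleftrightarrow> j \<in> set (snd (facet_table ! i))"
proof -
  have j: "(j, vertex_table ! j) \<in> set (List.enumerate 0 vertex_table)"
    using assms(2) table_bounds(1) by (simp add: in_set_enumerate_eq)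
  have w: "0 < last5 (vertex_table ! j)" using table_bounds(1,3) assms(2) by (simp add: list_all_length)
  have "let s = dot5 (fst (facet_table ! i)) (vertex_table ! j) in
     if s = 0 then List.member (snd (facet_table ! i)) j else 0 < s \<and> \<not> List.member (snd (facet_table ! i)) j"
    using bspec[OF bspec[OF incidence_check[unfolded list_all_iff case_prod_unfold] facet_table_nth(1)[OF assms(1)]] j] by (simp only: fst_conv snd_conv)
  then have s: "0 \<le> dot5 (fst (facet_table ! i)) (vertex_table ! j)"
    "dot5 (fst (facet_table ! i)) (vertex_table ! j) = 0 \<longleftrightarrow> j \<in> set (snd (facet_table ! i))"
    by (auto simp: Let_def List.member_iff split: if_splits)
  have "0 \<le> facet_offset i - facet_normal i \<bullet> vertex j" unfolding slack[OF w] using s(1) w by simp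
  then show "facet_normal i \<bullet> vertex j \<le> facet_offset i" by simp
  have "facet_offset i - facet_normal i \<bullet> vertex j = 0 \<longleftrightarrow> j \<in> set (snd (facet_table ! i))"
    unfolding slack[OF w] using s(2) w by simp
  then show "facet_normal i \<bullet> vertex j = facet_offset i \<longleftrightarrow> j \<in> set (snd (facet_table ! i))" by auto
qed

lemma neighbour:
  assumes i: "i < 62" and k: "k \<in> {0, 1, 2}"
  shows "\<exists>j<62. \<forall>S\<subseteq>{0, 1, 2}. facet_corner i S \<in> facet_corner j ` Pow {0, 1, 2} \<longleftrightarrow> (k \<in> S) = v"
proof -
  let ?vs = "snd (facet_table ! i)"
  have "bit_pattern v k \<in> set (map (bit_pattern False) [0..<3] @ map (bit_pattern True) [0..<3])"
    using k by (cases v) auto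
  then obtain bw where bw: "bw \<in> set facet_table" "map (List.member (snd bw)) ?vs = bit_pattern v k"
    using bspec[OF bspec[OF neighbour_check[unfolded list_all_iff list_ex_iff case_prod_unfold] facet_table_nth(1)[OF i]]] by blast
  then obtain j where j: "j < 62" "bw = facet_table ! j" using table_bounds(2) by (auto simp: in_set_conv_nth)
  have "facet_corner i S \<in> set (snd (facet_table ! j)) \<longleftrightarrow> (k \<in> S) = v" if S: "S \<subseteq> {0, 1, 2}" for S
  proof -
    have "facet_corner i S \<in> set (snd (facet_table ! j)) \<longleftrightarrow> map (List.member (snd bw)) ?vs ! binary_code S"
      using binary_code_less[OF S] facet_table_nth(2)[OF i] j(2) by (simp add: facet_corner_def List.member_iff)
    also have "\<dots> \<longleftrightarrow> odd (binary_code S div 2 ^ k) = v"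
      unfolding bw(2) bit_pattern_def using binary_code_less[OF S] by simp
    finally show ?thesis using binary_code_bit[OF S k] by simp
  qed
  then show ?thesis unfolding facet_corner_Pow[OF j(1), symmetric] using j(1) by (intro exI[of _ j]) simp
qed

interpretation P72: cubical_presentation "{0, 1, 2::nat}" 72 62 vertex facet_normal facet_offset facet_corner
proof
  show "finite {0, 1, 2::nat}" by simp
  show "DIM(real ^ 4) = Suc (card {0, 1, 2::nat})" by simp
  show "facet_corner i S < 72" if "i < 62" "S \<subseteq> {0, 1, 2}" for i S
  proof -
    have "facet_corner i S \<in> facet_corner i ` Pow {0, 1, 2}" by (rule imageI) (use that(2) in simp)
    then have "facet_corner i S \<in> {..<72}"
      unfolding facet_corner_Pow[OF that(1)] by (rule subsetD[OF facet_table_nth(3)[OF that(1)]])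
    then show ?thesis by simp
  qed
  show "facet_normal i \<bullet> vertex j \<le> facet_offset i" if "i < 62" "j < 72" for i j by (rule incidence(1)[OF that])
  show "facet_normal i \<bullet> vertex j = facet_offset i \<longleftrightarrow> j \<in> facet_corner i ` Pow {0, 1, 2}" if "i < 62" "j < 72" for i j
    unfolding facet_corner_Pow[OF that(1)] by (rule incidence(2)[OF that])
  show "0 < facet_offset i" if "i < 62" for i using facet_table_nth(4)[OF that] by (simp add: facet_offset_def)
  show "\<exists>j<62. \<forall>S\<subseteq>{0, 1, 2}. facet_corner i S \<in> facet_corner j ` Pow {0, 1, 2} \<longleftrightarrow> k \<notin> S" if "i < 62" "k \<in> {0, 1, 2}" for i k
    using neighbour[OF that, of False] by simp
  show "\<exists>j<62. \<forall>S\<subseteq>{0, 1, 2}. facet_corner i S \<in> facet_corner j ` Pow {0, 1, 2} \<longleftrightarrow> k \<in> S" if "i < 62" "k \<in> {0, 1, 2}" for i k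
    using neighbour[OF that, of True] by simp
  \<comment> \<open>The facets in the hyperplanes z = -2/5 and z = 2/5.\<close>
  show "\<exists>i<62. \<exists>j<62. facet_normal j = - facet_normal i"
  proof -
    have at: "\<exists>i<62. fst (facet_table ! i) = h" if "List.member (map fst facet_table) h" for h
      using that table_bounds(2) unfolding List.member_iff in_set_conv_nth by auto
    obtain i j where "i < 62" "j < 62" "fst (facet_table ! i) = (0, 0, 0, 5, 2)" "fst (facet_table ! j) = (0, 0, 0, -5, 2)"
      using at[OF table_bounds(6)] at[OF table_bounds(7)] by blast
    then show ?thesis
      by (intro exI[of _ i] conjI exI[of _ j]) (auto simp: facet_normal_def vec_eq_iff forall_4 vector_4)
  qed
  show "\<exists>i<62. j \<in> facet_corner i ` Pow {0, 1, 2}" if "j < 72" for j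
  proof -
    have "set (concat (map snd facet_table)) = {0..<72}"
      using set_sorted_elements[of "concat (map snd facet_table)"] unfolding table_bounds(5) by simp
    then have "j \<in> set (concat (map snd facet_table))" using that by (simp only: atLeastLessThan_iff le0)
    then obtain a where a: "a \<in> set facet_table" "j \<in> set (snd a)" by auto
    then obtain i where "i < 62" "j \<in> set (snd (facet_table ! i))"
      using table_bounds(2) unfolding in_set_conv_nth[of a] by auto
    then show ?thesis by (intro exI[of _ i]) (simp only: facet_corner_Pow simp_thms)
  qed
qed

text \<open>Intervals of directions become position lists, and these become increasing lists of
  vertex numbers. Distinct increasing lists stand for distinct sets, so the merged list counts the
  faces.\<close>

lemma P72_card_faces:
  assumes d: "d < 4"
  shows "card {F. F face_of P72.P \<and> aff_dim F = int d} = length (sorted_elements (face_list d))"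
proof -
  have d': "d \<in> set [0..<4]" "d < DIM(real ^ 4)" using d by auto
  let ?I = "\<lambda>A B. {S. A \<subseteq> S \<and> S \<subseteq> B}"
  have filt: "Set.filter (\<lambda>S. A \<subseteq> S \<and> S \<subseteq> B) (Pow {0, 1, 2}) = ?I A B" if "B \<subseteq> {0, 1, 2::nat}" for A B
    using that by auto
  have "set ` set (face_positions d) = (\<lambda>(A, B). binary_code ` Set.filter (\<lambda>S. A \<subseteq> S \<and> S \<subseteq> B) (Pow {0, 1, 2})) `
     Set.filter (\<lambda>(A, B). A \<subseteq> B \<and> card (B - A) = d) (Pow {0, 1, 2} \<times> Pow {0, 1, 2})"
    using face_position_sets d'(1) unfolding list_all_iff by auto
  also have "\<dots> = {binary_code ` ?I A B | A B. A \<subseteq> B \<and> B \<subseteq> {0, 1, 2} \<and> card (B - A) = d}" (is "?L = ?R")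
  proof (intro equalityI subsetI)
    fix x assume "x \<in> ?L"
    then obtain A B where "A \<subseteq> B" "B \<subseteq> {0, 1, 2}" "card (B - A) = d" "x = binary_code ` Set.filter (\<lambda>S. A \<subseteq> S \<and> S \<subseteq> B) (Pow {0, 1, 2})"
      by auto
    then show "x \<in> ?R" unfolding filt[OF \<open>B \<subseteq> {0, 1, 2}\<close>] by blast
  next
    fix x assume "x \<in> ?R"
    then obtain A B where *: "A \<subseteq> B" "B \<subseteq> {0, 1, 2}" "card (B - A) = d" "x = binary_code ` ?I A B" by blast
    then have "A \<subseteq> {0, 1, 2}" by simp
    with * show "x \<in> ?L" by (intro image_eqI[of _ _ "(A, B)"]) (auto simp: filt)
  qed
  finally have pos: "set ` set (face_positions d) = ?R" .
  have "{P72.vset i A B | i A B. i < 62 \<and> A \<subseteq> B \<and> B \<subseteq> {0, 1, 2} \<and> card (B - A) = d} = (\<Union>i<62. (`) ((!) (snd (facet_table ! i))) ` ?R)"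
  proof -
    have "P72.vset i A B = (!) (snd (facet_table ! i)) ` binary_code ` ?I A B" for i A B
      by (simp add: P72.vset_def facet_corner_def image_image)
    then show ?thesis by (simp only:) blast
  qed
  also have "\<dots> = (\<Union>a\<in>set facet_table. (`) ((!) (snd a)) ` set ` set (face_positions d))"
  proof -
    have "set facet_table = (!) facet_table ` {..<62}" using table_bounds(2) by (auto simp: set_conv_nth)
    then show ?thesis unfolding pos[symmetric] by simp
  qed
  also have "\<dots> = set ` set (face_list d)"
    unfolding face_list_def by (simp add: case_prod_unfold image_UN image_image)
  finally have "card {F. F face_of P72.P \<and> aff_dim F = int d} = card (set ` set (face_list d))"
    unfolding P72.card_faces_of_dim[OF d'(2)] by simp
  also have "\<dots> = length (sorted_elements (face_list d))"
    by (rule card_set_set_strictly_sorted) (use face_list_check(1,2) d'(1) in \<open>auto simp: list_all_iff\<close>)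
  finally show ?thesis .
qed

lemma P72_f_vector: "polytope_f_vector P72.P = [72, 196, 186, 62]"
proof -
  have "polytope_f_vector P72.P = map (\<lambda>d. length (sorted_elements (face_list d))) [0..<4]"
    unfolding polytope_f_vector_def P72.aff_dim_P using P72_card_faces by simp
  then show ?thesis using face_list_check(3) by simp
qed

section \<open>The dual manifold read off the tables\<close>

definition dual_vertices :: "nat set list" where "dual_vertices = map set dual_edges"

lemma distinct_of_sorted_elements:
  assumes "strictly_sorted (sorted_elements xs)" "length (sorted_elements xs) = length xs" shows "distinct xs"
  using card_set_eqI(1)[OF refl assms(1)] assms(2) card_distinct by simp

lemma distinct_map_set:
  assumes "distinct xs" "list_all strictly_sorted xs" shows "distinct (map set xs)"
  unfolding distinct_map
  using assms inj_on_subset[OF inj_on_set_strictly_sorted, of "set xs"] by (auto simp: list_all_iff)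

lemma distinct_dual_vertices: "distinct dual_vertices"
  unfolding dual_vertices_def using other_edges_check(2-5) distinct_of_sorted_elements[of dual_edges]
  by (intro distinct_map_set) simp_all

lemma length_dual_vertices: "length dual_vertices = 80"
  using other_edges_check(2) by (simp add: dual_vertices_def)

text \<open>The cardinality of the union equals the sum of upper bounds for the two cardinalities,
  which leaves nothing for the intersection.\<close>

lemma disjoint_of_lengths:
  assumes "strictly_sorted (sorted_elements (xs @ ys))"
    and "length (sorted_elements (xs @ ys)) = length (sorted_elements xs) + length (sorted_elements ys)"
  shows "set xs \<inter> set ys = {}"
proof -
  have "card (set xs \<union> set ys) = length (sorted_elements xs) + length (sorted_elements ys)"
    using assms(2) card_set_eqI(1)[OF refl assms(1)] by simp
  moreover have "card (set xs) \<le> length (sorted_elements xs)" "card (set ys) \<le> length (sorted_elements ys)"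
    using card_length[of "sorted_elements xs"] card_length[of "sorted_elements ys"] by (simp_all add: set_sorted_elements)
  ultimately have "card (set xs \<inter> set ys) = 0" using card_Un_Int[OF finite_set finite_set, of xs ys] by linarith
  then show ?thesis by simp
qed

lemma dual_other_disjoint: "set dual_vertices \<inter> set ` set other_edges = {}"
proof -
  have "set dual_edges \<inter> set other_edges = {}"
    using other_edges_check by (intro disjoint_of_lengths) simp_all
  moreover have "set dual_edges \<union> set other_edges \<subseteq> {xs. strictly_sorted xs}"
    using other_edges_check(5,9) by (auto simp: list_all_iff)
  ultimately have "set ` set dual_edges \<inter> set ` set other_edges = {}"
    using inj_on_image_Int[OF inj_on_set_strictly_sorted, of "set dual_edges" "set other_edges"] by simp
  then show ?thesis by (simp add: dual_vertices_def)
qed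

abbreviation facet_edge :: "nat \<Rightarrow> nat \<Rightarrow> nat \<Rightarrow> nat set" where
  "facet_edge i k c \<equiv> {snd (facet_table ! i) ! c, snd (facet_table ! i) ! (c + 2 ^ k)}"

lemma binary_code_insert: "X \<subseteq> {0, 1, 2} - {k} \<Longrightarrow> binary_code (insert k X) = binary_code X + 2 ^ k"
proof -
  assume X: "X \<subseteq> {0, 1, 2} - {k}"
  then have "finite X" "k \<notin> X" using finite_subset[OF X] by auto
  then show ?thesis by (simp add: binary_code_def)
qed

lemma dset_eq:
  assumes "B \<subseteq> {0, 1, 2}"
  shows "P72.dset i A B k = facet_edge i k ` binary_code ` {X. A \<subseteq> X \<and> X \<subseteq> B - {k}}"
proof -
  have "{facet_corner i X, facet_corner i (insert k X)} = facet_edge i k (binary_code X)" if "X \<in> {X. A \<subseteq> X \<and> X \<subseteq> B - {k}}" for X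
    using that assms by (subst (2) facet_corner_def, subst binary_code_insert) (auto simp: facet_corner_def)
  then show ?thesis unfolding P72.dset_def image_image by (intro image_cong) auto
qed

lemma dset_full: "k \<in> {0, 1, 2} \<Longrightarrow> P72.dset i {} {0, 1, 2} k = facet_edge i k ` set (direction_cycle k)"
proof -
  assume "k \<in> {0, 1, 2}"
  then have k: "k \<in> set [0..<3]" by auto
  have "binary_code ` Pow ({0, 1, 2} - {k}) = set (direction_cycle k)"
    by (rule bspec[OF direction_cycle_set[unfolded list_all_iff] k])
  moreover have "{X. {} \<subseteq> X \<and> X \<subseteq> {0, 1, 2} - {k}} = Pow ({0, 1, 2} - {k})"
    unfolding Pow_def by simp
  ultimately show ?thesis unfolding dset_eq[OF subset_refl] by argo
qed

lemma direction_cells_eq: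
  assumes "k \<in> {0, 1, 2}"
  shows "{binary_code ` {X. A \<subseteq> X \<and> X \<subseteq> B - {k}} | A B. A \<subseteq> B \<and> B \<subseteq> {0, 1, 2} \<and> k \<in> B - A} = quad_cells (direction_cycle k)"
    (is "?R = _")
proof -
  have k: "k \<in> set [0..<3]" using assms by auto
  let ?I = "\<lambda>A B. {S. A \<subseteq> S \<and> S \<subseteq> B - {k}}"
  let ?L = "(\<lambda>(A, B). binary_code ` Set.filter (\<lambda>S. A \<subseteq> S \<and> S \<subseteq> B - {k}) (Pow {0, 1, 2})) `
     Set.filter (\<lambda>(A, B). A \<subseteq> B \<and> k \<in> B - A) (Pow {0, 1, 2} \<times> Pow {0, 1, 2})"
  have filt: "Set.filter (\<lambda>S. A \<subseteq> S \<and> S \<subseteq> B - {k}) (Pow {0, 1, 2}) = ?I A B" if "B \<subseteq> {0, 1, 2::nat}" for A B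
    using that by auto
  have "?L = ?R"
  proof (intro equalityI subsetI)
    fix x assume "x \<in> ?L"
    then obtain A B where *: "A \<subseteq> B" "B \<subseteq> {0, 1, 2}" "k \<in> B - A" "x = binary_code ` Set.filter (\<lambda>S. A \<subseteq> S \<and> S \<subseteq> B - {k}) (Pow {0, 1, 2})"
      by auto
    show "x \<in> ?R" using * unfolding filt[OF *(2)] by blast
  next
    fix x assume "x \<in> ?R"
    then obtain A B where *: "A \<subseteq> B" "B \<subseteq> {0, 1, 2}" "k \<in> B - A" "x = binary_code ` ?I A B" by blast
    then have "A \<subseteq> {0, 1, 2}" by simp
    with * have mem: "(A, B) \<in> Set.filter (\<lambda>(A, B). A \<subseteq> B \<and> k \<in> B - A) (Pow {0, 1, 2} \<times> Pow {0, 1, 2})" by simp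
    show "x \<in> ?L" by (rule image_eqI[OF _ mem]) (simp only: prod.case filt[OF *(2)] *(4))
  qed
  moreover have "?L = quad_cells (direction_cycle k)" using bspec[OF direction_cells[unfolded list_all_iff] k] .
  ultimately show ?thesis by simp
qed

lemma nodes_map: "nodes (map f xs) = map ((`) f) (nodes xs)"
  by (induction xs rule: nodes.induct) auto

lemma quad_cells_map: "q \<noteq> [] \<Longrightarrow> quad_cells (map f q) = (`) f ` quad_cells q"
proof -
  assume "q \<noteq> []"
  then have "map f q @ [hd (map f q)] = map f (q @ [hd q])" by (simp add: hd_map)
  then show ?thesis by (simp only: quad_cells_def nodes_map) auto
qed

lemma direction_cycle_ne: "k \<in> {0, 1, 2} \<Longrightarrow> direction_cycle k \<noteq> []"
  by (auto simp: direction_cycle_def)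

text \<open>A nonempty entry lists the four edges of the class by position, in the order of
  \<open>direction_cycle\<close>; an empty one places them in \<open>other_edges\<close>, away from
  \<open>dual_vertices\<close>.\<close>

lemma trace:
  assumes i: "i < 62" and k: "k \<in> {0, 1, 2}" and q: "q = trace_table ! i ! k"
  shows "q = [] \<Longrightarrow> P72.dset i {} {0, 1, 2} k \<inter> set dual_vertices = {}"
    and "q \<noteq> [] \<Longrightarrow> set q \<subseteq> {..<80} \<and> map ((!) dual_vertices) q = map (facet_edge i k) (direction_cycle k)"
    and "q \<noteq> [] \<Longrightarrow> q \<in> set trace_quads"
proof -
  let ?a = "fst (facet_table ! i)" and ?vs = "snd (facet_table ! i)" and ?r = "trace_table ! i"
  have z: "((?a, ?vs), ?r) \<in> set (zip facet_table trace_table)"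
    using i table_bounds(2) other_edges_check(1) by (auto simp: in_set_zip)
  have c: "length ?r = 3 \<and> list_all (\<lambda>(k, q). q = [] \<or>
     list_all (\<lambda>j. j < 80) q \<and> map ((!) dual_edges) q = edge_quad ?vs k) (List.enumerate 0 ?r)"
    using bspec[OF trace_check[unfolded trace_check_def list_all_iff[of _ "zip _ _"]] z] by (simp only: prod.case)
  have "k < length ?r" using c k by auto
  then have e: "(k, q) \<in> set (List.enumerate 0 ?r)" "q \<in> set ?r" using q by (simp_all add: in_set_enumerate_eq)
  have edge: "map set (edge_quad ?vs k) = map (facet_edge i k) (direction_cycle k)"
    by (simp add: edge_quad_def set_sorted_pair del: sorted_pair.simps)
  show "q \<in> set trace_quads" if "q \<noteq> []"
    using e(2) nth_mem[of i trace_table] i other_edges_check(1) that by (auto simp: trace_quads_def)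
  show "P72.dset i {} {0, 1, 2} k \<inter> set dual_vertices = {}" if "q = []"
  proof -
    have "set (edge_quad ?vs k) \<subseteq> set other_edges"
    proof
      fix x assume "x \<in> set (edge_quad ?vs k)"
      then have "x \<in> set (concat (map (\<lambda>(k, q). if q = [] then edge_quad ?vs k else []) (List.enumerate 0 ?r)))"
        using e(1) \<open>q = []\<close> by (auto intro!: bexI[of _ "(k, q)"])
      then show "x \<in> set other_edges"
        unfolding other_edges_def set_concat set_map by (intro UnionI[OF imageI[OF imageI[OF z]]]) (simp only: prod.case set_concat set_map)
    qed
    then have "set ` set (edge_quad ?vs k) \<subseteq> set ` set other_edges" by (rule image_mono)
    moreover have "set ` set (edge_quad ?vs k) = P72.dset i {} {0, 1, 2} k"
      using arg_cong[OF edge, of set] dset_full[OF k, of i] by simp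
    ultimately have "P72.dset i {} {0, 1, 2} k \<subseteq> set ` set other_edges" by (simp only:)
    then have "P72.dset i {} {0, 1, 2} k \<inter> set dual_vertices \<subseteq> set ` set other_edges \<inter> set dual_vertices" by (rule Int_mono) (rule subset_refl)
    then show ?thesis unfolding Int_commute[of _ "set dual_vertices"] dual_other_disjoint by (simp only: subset_empty)
  qed
  show "set q \<subseteq> {..<80} \<and> map ((!) dual_vertices) q = map (facet_edge i k) (direction_cycle k)" if "q \<noteq> []"
  proof -
    have "list_all (\<lambda>j. j < 80) q \<and> map ((!) dual_edges) q = edge_quad ?vs k"
      using bspec[OF conjunct2[OF c, unfolded list_all_iff[of _ "List.enumerate _ _"]] e(1)] that
      by (simp only: prod.case simp_thms)
    then have q80: "set q \<subseteq> {..<80}" and "map set (map ((!) dual_edges) q) = map (facet_edge i k) (direction_cycle k)"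
      using edge by (auto simp: list_all_iff)
    moreover have "map set (map ((!) dual_edges) q) = map ((!) dual_vertices) q"
      using q80 other_edges_check(2) by (auto simp: dual_vertices_def)
    ultimately show ?thesis by simp
  qed
qed

lemma dset_cells:
  assumes i: "i < 62" and k: "k \<in> {0, 1, 2}" and q: "trace_table ! i ! k \<noteq> []"
  shows "{P72.dset i A B k | A B. A \<subseteq> B \<and> B \<subseteq> {0, 1, 2} \<and> k \<in> B - A} =
    (`) ((!) dual_vertices) ` quad_cells (trace_table ! i ! k)"
proof -
  have "{P72.dset i A B k | A B. A \<subseteq> B \<and> B \<subseteq> {0, 1, 2} \<and> k \<in> B - A} =
    {facet_edge i k ` binary_code ` {X. A \<subseteq> X \<and> X \<subseteq> B - {k}} | A B. A \<subseteq> B \<and> B \<subseteq> {0, 1, 2} \<and> k \<in> B - A}"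
    by (rule Collect_cong, rule ex_cong1, rule ex_cong1, rule rev_conj_cong, rule refl) (simp only: dset_eq)
  also have "\<dots> = (`) (facet_edge i k) ` {binary_code ` {X. A \<subseteq> X \<and> X \<subseteq> B - {k}} | A B. A \<subseteq> B \<and> B \<subseteq> {0, 1, 2} \<and> k \<in> B - A}"
    by blast
  also have "\<dots> = quad_cells (map ((!) dual_vertices) (trace_table ! i ! k))"
    unfolding direction_cells_eq[OF k] quad_cells_map[OF direction_cycle_ne[OF k], symmetric]
    using trace(2)[OF i k refl q] by simp
  finally show ?thesis by (simp only: quad_cells_map[OF q])
qed

lemma ids_image:
  assumes "distinct hs" "J \<subseteq> {..<length hs}" shows "P72.ids hs ((!) hs ` J) = J"
  using assms by (auto simp: P72.ids_def nth_eq_iff_index_eq)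

lemma trace_quadE:
  assumes "q \<in> set trace_quads"
  obtains i k where "i < 62" "k \<in> {0, 1, 2}" "q = trace_table ! i ! k" "q \<noteq> []"
proof -
  obtain r where r: "r \<in> set trace_table" "q \<in> set r" "q \<noteq> []" using assms by (auto simp: trace_quads_def)
  then obtain i where i: "i < 62" "r = trace_table ! i" using other_edges_check(1) unfolding in_set_conv_nth[of r] by auto
  have "((fst (facet_table ! i), snd (facet_table ! i)), r) \<in> set (zip facet_table trace_table)"
    using i table_bounds(2) other_edges_check(1) by (auto simp: in_set_zip)
  then have "length r = 3" using bspec[OF trace_check[unfolded trace_check_def list_all_iff[of _ "zip _ _"]]] by fastforce
  then obtain k where "k < 3" "q = r ! k" using r(2) unfolding in_set_conv_nth by auto
  moreover from \<open>k < 3\<close> have "k \<in> {0, 1, 2}" by auto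
  ultimately show thesis using that i r(3) by blast
qed

lemma dset_trace: "q \<in> set trace_quads \<Longrightarrow> \<exists>i<62. \<exists>k\<in>{0, 1, 2}. P72.dset i {} {0, 1, 2} k = (!) dual_vertices ` set q \<and> set q \<subseteq> {..<80}"
proof -
  assume "q \<in> set trace_quads"
  then obtain i k where *: "i < 62" "k \<in> {0, 1, 2}" "q = trace_table ! i ! k" "q \<noteq> []" by (rule trace_quadE)
  have t: "set q \<subseteq> {..<80}" "map ((!) dual_vertices) q = map (facet_edge i k) (direction_cycle k)" using trace(2)[OF *] by simp_all
  have "P72.dset i {} {0, 1, 2} k = (!) dual_vertices ` set q"
    unfolding dset_full[OF *(2)] using arg_cong[OF t(2), of set] by simp
  then show ?thesis using * t(1) by blast
qed

definition klein_component where "klein_component = P72.edge_component (set dual_vertices)"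

lemma klein_component_dual_manifold: "klein_component \<in> dual_manifolds P72.P"
  unfolding klein_component_def
proof (rule P72.edge_component_dual_manifold)
  fix i k :: nat assume ik: "i < 62" "k \<in> {0, 1, 2}"
  show "P72.dset i {} {0, 1, 2} k \<subseteq> set dual_vertices \<or> P72.dset i {} {0, 1, 2} k \<inter> set dual_vertices = {}"
  proof (cases "trace_table ! i ! k = []")
    case True then show ?thesis using trace(1)[OF ik refl] by blast
  next
    case False
    have t: "set (trace_table ! i ! k) \<subseteq> {..<80}" "map ((!) dual_vertices) (trace_table ! i ! k) = map (facet_edge i k) (direction_cycle k)"
      using trace(2)[OF ik refl False] by simp_all
    have "P72.dset i {} {0, 1, 2} k = (!) dual_vertices ` set (trace_table ! i ! k)"
      unfolding dset_full[OF ik(2)] using arg_cong[OF t(2), of set] by simp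
    also have "\<dots> \<subseteq> set dual_vertices" using t(1) length_dual_vertices by (auto simp: subset_iff)
    finally show ?thesis ..
  qed
next
  show "0 < length dual_vertices" using length_dual_vertices by simp
  obtain q where "q \<in> set trace_quads" "0 \<in> set q" using linked_check(2) by (auto simp: list_ex_iff)
  then show "\<exists>i<62. \<exists>k\<in>{0, 1, 2}. dual_vertices ! 0 \<in> P72.dset i {} {0, 1, 2} k" using dset_trace[of q] by (metis imageI)
next
  fix n assume "0 < n" "n < length dual_vertices"
  then have "n \<in> set [1..<80]" using length_dual_vertices by simp
  then obtain q j where "q \<in> set trace_quads" "n \<in> set q" "j \<in> set q" "j < n"
    using bspec[OF linked_check(1)[unfolded list_all_iff]] unfolding list_ex_iff List.member_iff by blast
  then show "\<exists>n'<n. \<exists>i<62. \<exists>k\<in>{0, 1, 2}. dual_vertices ! n \<in> P72.dset i {} {0, 1, 2} k \<and> dual_vertices ! n' \<in> P72.dset i {} {0, 1, 2} k"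
    using dset_trace[of q] by (metis imageI)
qed

text \<open>A cell of the component lies in a facet class that meets \<open>dual_vertices\<close>,
  so the entry of that class is not empty and the cells of the class are those of the listed square.
  Conversely each listed square comes from a facet class.\<close>

lemma klein_component_cells:
  "(\<lambda>c. P72.ids dual_vertices (P72.edge_code c)) ` klein_component = \<Union> (quad_cells ` set trace_quads)" (is "?f ` _ = _")
proof (intro equalityI subsetI)
  have sub: "J \<subseteq> set q" if "J \<in> quad_cells q" "q \<noteq> []" for J and q :: "nat list"
  proof -
    have "c \<subseteq> set vs" if "c \<in> set (nodes vs)" for c and vs :: "nat list"
      using that by (rule in_nodesE) auto
    then show ?thesis using that by (fastforce simp: quad_cells_def)
  qed
  have J: "?f c = J" if "P72.edge_code c = (!) dual_vertices ` J" "J \<in> quad_cells q" "q \<noteq> []" "set q \<subseteq> {..<80}" for c J q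
    unfolding that(1) using sub[OF that(2,3)] that(4) length_dual_vertices by (intro ids_image) (use distinct_dual_vertices in auto)
  {
    fix x assume "x \<in> ?f ` klein_component"
    then obtain c where c: "c \<in> derivative_complex P72.P" "P72.edge_code c \<subseteq> set dual_vertices" "x = ?f c"
      by (auto simp: klein_component_def P72.edge_component_def)
    obtain i A B k where d: "i < 62" "A \<subseteq> B" "B \<subseteq> {0, 1, 2}" "k \<in> B - A" "c = (P72.face i A B, P72.par i A B k)"
      using c(1) by (rule P72.derivative_cellE)
    have k: "k \<in> {0, 1, 2}" using d(3,4) by blast
    have code: "P72.edge_code c = P72.dset i A B k" unfolding d(5) by (rule P72.edge_code_cell[OF d(1-4)])
    have "{X. A \<subseteq> X \<and> X \<subseteq> B - {k}} \<subseteq> {X. {} \<subseteq> X \<and> X \<subseteq> {0, 1, 2} - {k}}" using d(3) by blast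
    then have "P72.dset i A B k \<subseteq> P72.dset i {} {0, 1, 2} k" unfolding P72.dset_def by (rule image_mono)
    moreover have "P72.dset i A B k \<noteq> {}" using d(2,4) by (auto simp: P72.dset_def)
    ultimately have "P72.dset i {} {0, 1, 2} k \<inter> set dual_vertices \<noteq> {}" using c(2) code by blast
    then have ne: "trace_table ! i ! k \<noteq> []" using trace(1)[OF d(1) k refl] by blast
    have "P72.dset i A B k \<in> {P72.dset i A B k | A B. A \<subseteq> B \<and> B \<subseteq> {0, 1, 2} \<and> k \<in> B - A}" using d(2-4) by blast
    then obtain J where "P72.dset i A B k = (!) dual_vertices ` J" "J \<in> quad_cells (trace_table ! i ! k)"
      unfolding dset_cells[OF d(1) k ne] by blast
    then show "x \<in> \<Union> (quad_cells ` set trace_quads)"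
      using J[of c J] code c(3) trace(2,3)[OF d(1) k refl ne] ne by auto
  }
  fix J assume "J \<in> \<Union> (quad_cells ` set trace_quads)"
  then obtain q where q: "q \<in> set trace_quads" "J \<in> quad_cells q" by blast
  obtain i k where *: "i < 62" "k \<in> {0, 1, 2}" "q = trace_table ! i ! k" "q \<noteq> []" using q(1) by (rule trace_quadE)
  have q80: "set q \<subseteq> {..<80}" using trace(2)[OF *] by simp
  have "(!) dual_vertices ` J \<in> {P72.dset i A B k | A B. A \<subseteq> B \<and> B \<subseteq> {0, 1, 2} \<and> k \<in> B - A}"
    unfolding dset_cells[OF *(1,2) *(4)[unfolded *(3)]] using q(2) *(3) by blast
  then obtain A B where AB: "(!) dual_vertices ` J = P72.dset i A B k" "A \<subseteq> B" "B \<subseteq> {0, 1, 2}" "k \<in> B - A" by blast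
  let ?c = "(P72.face i A B, P72.par i A B k)"
  have code: "P72.edge_code ?c = (!) dual_vertices ` J" unfolding AB(1) by (rule P72.edge_code_cell[OF *(1) AB(2-4)])
  have "?c \<in> derivative_complex P72.P" unfolding P72.derivative_complex_eq using *(1) AB(2-4) by blast
  moreover have "P72.edge_code ?c \<subseteq> set dual_vertices"
    unfolding code using sub[OF q(2) *(4)] q80 length_dual_vertices by (auto simp: subset_iff)
  ultimately have "?c \<in> klein_component" by (simp add: klein_component_def P72.edge_component_def)
  then show "J \<in> ?f ` klein_component" using J[OF code q(2) *(4) q80] by (intro image_eqI[of _ _ ?c]) simp_all
qed

section \<open>The surface is a Klein bottle\<close>

lemma sorted_complex_cells: "sorted_elements (complex_cells squares) = complex_cells squares" by code_simp
lemma word_ends: "hd word = last word" "27 \<le> length word" by code_simp+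

lemma length_four: "length q = 4 \<Longrightarrow> \<exists>a b c d. q = [a, b, c, d]"
  by (auto simp: length_Suc_conv numeral_eq_Suc)

lemma set_quad_cell_list: "length q = 4 \<Longrightarrow> set ` set (quad_cell_list q) = quad_cells q"
proof -
  assume "length q = 4"
  then obtain a b c d where q: "q = [a, b, c, d]" using length_four by blast
  have "set ` set (quad_cell_list q) = insert (set q) ((\<lambda>x. {x}) ` set q \<union> set ` set (quad_edges q))"
    by (simp add: quad_cell_list_def image_Un image_image)
  moreover have "set ` set (quad_edges q) = {{a, b}, {b, c}, {c, d}, {d, a}}"
    by (simp add: q set_sorted_pair del: sorted_pair.simps)
  moreover have "(\<lambda>x. {x}) ` set q = {{a}, {b}, {c}, {d}}" by (simp add: q)
  moreover have "set (nodes (q @ [hd q])) = {{a}, {b}, {c}, {d}} \<union> {{a, b}, {b, c}, {c, d}, {d, a}}"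
    unfolding q append.simps list.sel nodes.simps list.set Un_insert_left Un_empty_left
    by (simp only: insert_commute insert_absorb2)
  ultimately show ?thesis by (simp only: quad_cells_def)
qed

lemma set_complex_cells:
  assumes "\<And>q. q \<in> set qs \<Longrightarrow> length q = 4"
  shows "set ` set (complex_cells qs) = \<Union> (quad_cells ` set qs)"
proof -
  have "set ` set (complex_cells qs) = (\<Union>q\<in>set qs. set ` set (quad_cell_list q))"
    unfolding complex_cells_def set_sorted_elements by (simp add: image_UN)
  also have "\<dots> = (\<Union>q\<in>set qs. quad_cells q)" using assms by (intro SUP_cong refl set_quad_cell_list)
  finally show ?thesis .
qed

lemma squares_quads: "q \<in> set squares \<Longrightarrow> length q = 4 \<and> distinct q"
proof -
  assume "q \<in> set squares"
  then have "length q = 4 \<and> strictly_sorted (sort q)"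
    by (rule bspec[OF squares_check(5)[unfolded list_all_iff]])
  then show ?thesis using strictly_sorted_sorted[of "sort q"] by simp
qed

lemma cells_squares: "\<Union> (quad_cells ` set squares) = set ` set (complex_cells squares)"
  using set_complex_cells[of squares] squares_quads by simp

lemma cells_trace_quads: "\<Union> (quad_cells ` set trace_quads) = set ` set (complex_cells squares)"
  unfolding squares_check(1) using set_complex_cells[of trace_quads] squares_check(6) by (simp add: list_all_iff)

text \<open>A proper subset of a square is not itself a square with four vertices, so such a cell is
  a vertex or a pair. A pair of vertices of a square is a side or a diagonal of it, and diagonals
  are excluded by the check.\<close>

lemma squares_no_diagonal:
  assumes q: "q \<in> set squares" and c: "c \<in> \<Union> (quad_cells ` set squares)" "c \<subset> set q"
  shows "c \<in> set (nodes (q @ [hd q]))"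
proof -
  obtain x y z w where xyzw: "q = [x, y, z, w]" using squares_quads[OF q] length_four by blast
  have nd: "nodes (q @ [hd q]) = [{x}, {x, y}, {y}, {y, z}, {z}, {z, w}, {w}, {w, x}, {x}]" by (simp add: xyzw)
  have distinct_q: "distinct [x, y, z, w]" using squares_quads[OF q] xyzw by simp
  have diag: "sorted_pair a b \<notin> set (complex_cells squares)" if "sorted_pair a b \<in> set (quad_diagonals q)" for a b
  proof -
    have "sorted_pair a b \<in> set (concat (map quad_diagonals squares))"
      using q that by (auto simp del: sorted_pair.simps)
    moreover have "set (concat (map quad_diagonals squares)) \<inter> set (complex_cells squares) = {}"
      by (rule disjoint_of_lengths[OF diagonals_check(2)]) (simp only: diagonals_check(1) sorted_complex_cells)
    ultimately show ?thesis by (rule disjoint_iff[THEN iffD1, rule_format, rotated])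
  qed
  obtain l where l: "l \<in> set (complex_cells squares)" "c = set l" using c(1) unfolding cells_squares by blast
  have ls: "strictly_sorted l" using bspec[OF squares_check(3)[unfolded list_all_iff] l(1)] .
  have pair: "l = sorted_pair a b" if "c = {a, b}" "a \<noteq> b" for a b
    using ls l(2) that strictly_sorted_sorted[of l] by (intro sorted_distinct_set_unique) auto
  have nd_diag: "c \<noteq> {x, z}" "c \<noteq> {y, w}"
    using pair[of x z] pair[of y w] diag[of x z] diag[of y w] l(1) distinct_q unfolding xyzw by (auto simp del: sorted_pair.simps)
  obtain q' where q': "q' \<in> set squares" "c \<in> quad_cells q'" using c(1) by blast
  have q'4: "length q' = 4" "distinct q'" using squares_quads[OF q'(1)] by simp_all
  have "c \<noteq> set q'"
  proof
    assume "c = set q'"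
    then have "card c = card (set q)" using q'4 squares_quads[OF q] by (simp add: distinct_card)
    then show False using c(2) psubset_card_mono[of "set q" c] by simp
  qed
  then have "c \<in> set (nodes (q' @ [hd q']))" using q'(2) by (simp add: quad_cells_def)
  then obtain a b where ab: "c = {a, b}" by (rule in_nodesE) blast+
  then have "a \<in> {x, y, z, w}" "b \<in> {x, y, z, w}" using c(2) xyzw by auto
  then show ?thesis unfolding nd using ab nd_diag by (elim insertE emptyE) (simp_all add: insert_commute)
qed

interpretation K: nat_quad_complex "set squares"
  by unfold_locales (use squares_quads squares_no_diagonal in auto)

lemma K_cells: "K.cells = set ` set (complex_cells squares)"
  unfolding K.cells_def by (rule cells_squares)

lemma partition:
  "distinct (map set cell_partition)" "set ` set cell_partition = K.cells"
proof -
  have eq: "set cell_partition = set (complex_cells squares)"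
    using set_sorted_elements[of cell_partition] cell_partition_check(1) by simp
  have "distinct cell_partition"
    using cell_partition_check squares_check(2) by (intro distinct_of_sorted_elements) simp_all
  moreover have "list_all strictly_sorted cell_partition" using squares_check(3) unfolding list_all_iff eq .
  ultimately show "distinct (map set cell_partition)" by (rule distinct_map_set)
  show "set ` set cell_partition = K.cells" unfolding eq K_cells ..
qed

lemma loops:
  "hd loop_a = 0" "last loop_a = 0" "hd loop_b = 0" "last loop_b = 0" "length loop_a = 10" "length loop_b = 5"
  "distinct_adj loop_a" "distinct_adj loop_b"
  by (simp_all add: loop_a_def loop_b_def)

lemma nodes_inner: "2 \<le> length vs \<Longrightarrow> set (nodes vs) = insert {hd vs} (insert {last vs} (inner_nodes vs))"
proof -
  assume vs: "2 \<le> length vs"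
  have *: "set xs = insert (hd xs) (insert (last xs) (set (butlast (tl xs))))" if "2 \<le> length xs" for xs :: "'b list"
  proof -
    have e: "xs = hd xs # butlast (tl xs) @ [last xs]"
      using that by (cases xs) (auto simp: append_butlast_last_id split: if_splits)
    have "set xs = set (hd xs # butlast (tl xs) @ [last xs])" by (rule arg_cong[OF e])
    also have "\<dots> = insert (hd xs) (insert (last xs) (set (butlast (tl xs))))" by auto
    finally show ?thesis .
  qed
  have "vs \<noteq> []" "2 \<le> length (nodes vs)" using vs by (auto simp: length_nodes)
  with *[of "nodes vs"] show ?thesis by (simp add: inner_nodes_def hd_nodes last_nodes)
qed

text \<open>The gluing run provides the disc and its boundary word. Disjointness and covering follow
  from the one partition of the cells into swept cells, base point and inner cells of the
  loops.\<close>

lemma klein_word: "top_of_set K.X homeomorphic_space klein_bottle"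
proof -
  have run: "glue_all gluing_steps (first_square @ [hd first_square], [first_square], [sort first_square]) = (word, squares, swept)"
    unfolding shelled_def[symmetric] word_def squares_def swept_def by simp
  have first: "first_square \<in> set squares" using squares_check(7) by simp
  have dswept: "distinct (map set swept)" using partition(1) by (simp add: cell_partition_def)
  have "\<exists>f. disc_map f (K.region (set ` set [sort first_square])) (unif (nodes (first_square @ [hd first_square])))"
    using K.disc_quad[OF first] by simp
  then have "\<exists>f. disc_map f (K.region (set ` set swept)) (unif (nodes word))"
    by (rule K.glue_all_disc[OF _ _ _ glue_ok run dswept subset_refl]) (simp_all add: first_square_def)
  moreover have "hd word = last word" "25 + 2 \<le> length word"
    using word_ends by simp_all
  ultimately obtain f where f: "disc_map f (K.region (set ` set swept)) (unif (nodes ((loop_b @ tl loop_a) @ tl (loop_b @ tl (rev loop_a)))))"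
    using K.disc_rotate_word[of _ _ word 25] unfolding word by blast
  let ?na = "set (nodes loop_a)" and ?nb = "set (nodes loop_b)" and ?S = "set ` set swept"
  have len: "2 \<le> length loop_a" "2 \<le> length loop_b" using loops by simp_all
  have na: "?na = insert {0} (inner_nodes loop_a)" and nb: "?nb = insert {0} (inner_nodes loop_b)"
    using nodes_inner[OF len(1)] nodes_inner[OF len(2)] loops by simp_all
  have part: "K.cells = ?S \<union> insert {0} (inner_nodes loop_a \<union> inner_nodes loop_b)"
    unfolding partition(2)[symmetric] cell_partition_def
    by (simp add: image_Un set_inner_cells[OF len(1)] set_inner_cells[OF len(2)] Un_assoc)
  have disj: "?S \<inter> inner_nodes loop_a = {}" "?S \<inter> inner_nodes loop_b = {}" "{0} \<notin> ?S" "{0} \<notin> inner_nodes loop_a"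
    "{0} \<notin> inner_nodes loop_b" "inner_nodes loop_a \<inter> inner_nodes loop_b = {}"
    using partition(1) unfolding cell_partition_def map_append distinct_append set_map set_append
      set_inner_cells[OF len(1), symmetric] set_inner_cells[OF len(2), symmetric] by auto
  have path: "K.edge_path loop_a" "K.edge_path loop_b"
    unfolding K.edge_path_iff using len part na nb loops(7,8) by (auto simp: distinct_adj_conv_nth)
  show ?thesis
    by (rule K.klein_of_word[OF f path])
      (use loops loops_distinct disj part na nb in auto)
qed

lemma klein_component_surface:
  "geometric_realization klein_component homeomorphic_space klein_bottle" "surface_f_vector klein_component = [80, 160, 80]"
proof -
  have C: "K.cells = (\<lambda>c. P72.ids dual_vertices (P72.edge_code c)) ` P72.edge_component (set dual_vertices)"
    unfolding klein_component_cells[unfolded klein_component_def] K_cells cells_trace_quads ..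
  note real = P72.edge_component_realization[OF distinct_dual_vertices C, folded klein_component_def]
  show "geometric_realization klein_component homeomorphic_space klein_bottle"
    by (rule homeomorphic_space_trans[OF real(1)]) (rule klein_word[unfolded K.X_def])
  have "card {x \<in> K.cells. card x = 2 ^ j} = length (filter (\<lambda>c. length c = 2 ^ j) (complex_cells squares))" for j :: nat
  proof -
    let ?L = "complex_cells squares"
    have ss: "set ?L \<subseteq> {xs. strictly_sorted xs}" using squares_check(3) by (auto simp: list_all_iff)
    have card: "card (set l) = length l" if "l \<in> set ?L" for l
      using ss that strictly_sorted_sorted[of l] distinct_card by blast
    have "{x \<in> K.cells. card x = 2 ^ j} = set ` set (filter (\<lambda>c. length c = 2 ^ j) ?L)"
      unfolding K_cells using card by auto
    also have "card \<dots> = card (set (filter (\<lambda>c. length c = 2 ^ j) ?L))"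
      by (rule card_image[OF inj_on_subset[OF inj_on_set_strictly_sorted]]) (use ss in auto)
    also have "\<dots> = length (filter (\<lambda>c. length c = 2 ^ j) ?L)"
      by (rule distinct_card) (use strictly_sorted_sorted[OF squares_check(2)] in simp)
    finally show ?thesis .
  qed
  then show "surface_f_vector klein_component = [80, 160, 80]"
    unfolding surface_f_vector_def real(2) using squares_check(4) by simp
qed

theorem theorem5p1:
  shows "\<exists>P72 :: (real ^ 4) set.
           cubical_polytope P72 \<and> aff_dim P72 = 4 \<and>
           polytope_f_vector P72 = [72, 196, 186, 62] \<and>
           (\<exists>K \<in> dual_manifolds P72.
              immersed_klein_bottle P72 K \<and> surface_f_vector K = [80, 160, 80])"
proof (intro exI[of _ P72.P] conjI bexI[of _ klein_component])
  show "cubical_polytope P72.P" by (rule P72.cubical_P)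
  show "aff_dim P72.P = 4" using P72.aff_dim_P by simp
  have "klein_component \<subseteq> derivative_complex P72.P" by (auto simp: klein_component_def P72.edge_component_def)
  moreover from this have "finite klein_component" using P72.finite_derivative_complex by (rule finite_subset)
  ultimately show "immersed_klein_bottle P72.P klein_component"
    unfolding immersed_klein_bottle_def using klein_component_surface(1) P72.canonical_immersion by blast
qed (fact P72_f_vector klein_component_surface(2) klein_component_dual_manifold)+

end
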